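(* Let $P_0,P_1,\ldots,P_i,\ldots$ give an iterative operadic theory of $n$-categories, with a resulting category $\mathcal V_n$ of $n$-categories for each $n\ge0$. Then for each $n\ge0$ there is a monad $Q^{(n)}$ on $n\text{-}\mathbf{GSet}$ whose category of algebras is $\mathcal V_n$.
   Context: **Operads and $(\mathcal V,P)$-categories.** "Operad" in a category $\mathcal V$ with finite products means a classical non-symmetric operad: objects $P(k)$ ($k\ge 0$), a unit $1\to P(1)$ and composition maps $P(m)\times P(k_1)\times\cdots\times P(k_m)\to P(k_1+\cdots+k_m)$, associative and unital. A $\mathcal V$-graph $A$ is a set $A_0$ of objects with an object $A(a,a')\in\mathcal V$ for all $a,a'\in A_0$; a morphism $F:A\to B$ is a function $A_0\to B_0$ with morphisms $A(a,a')\to B(Fa,Fa')$ in $\mathcal V$. A $(\mathcal V,P)$-category is a $\mathcal V$-graph $A$ with, for all $k\ge0$ and $a_0,\dots,a_k\in A_0$, a morphism $\gamma: P(k)\times A(a_{k-1},a_k)\times\cdots\times A(a_0,a_1)\to A(a_0,a_k)$ (for $k=0$: $P(0)\to A(a,a)$), compatible with the operad structure: the unit of $P$ acts as the identity, and, for a composable string cut into $m$ consecutive blocks, applying $p_i\in P(k_i)$ to the $i$-th block along the string and then $p\in P(m)$ to the results agrees with applying the operadic composite $p(p_1,\dots,p_m)$ to the whole string. Morphisms are $\mathcal V$-graph morphisms commuting with all $\gamma$; the category is $(\mathcal V,P)\text{-}\mathbf{Cat}$; it has finite products when $\mathcal V$ does. **Iterative operadic theory of $n$-categories.** For all $n\ge0$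 a category $\mathcal V_n$ and a contractible operad $P_n$ in $\mathcal V_n$ such that $\mathcal V_0=\mathbf{Set}$ and $\mathcal V_{n+1}=(\mathcal V_n,P_n)\text{-}\mathbf{Cat}$. Contractibility: a set is contractible iff it has exactly one element; an operad is contractible if each $P(k)$ is; a $\mathcal V$-graph $A$ is contractible if $A_0\ne\emptyset$ and every $A(a,a')$ is contractible in $\mathcal V$; a $(\mathcal V,P)$-category is contractible if its underlying $\mathcal V$-graph is. **Globular sets.** $n\text{-}\mathbf{GSet}$ is the category of $n$-globular sets (sets $A_0,\dots,A_n$ with $s,t:A_m\to A_{m-1}$, $ss=st$, $ts=tt$). It is equivalent to $n\text{-}\mathbf{Gph}$, where $0\text{-}\mathbf{Gph}=\mathbf{Set}$, $n\text{-}\mathbf{Gph}=((n-1)\text{-}\mathbf{Gph})\text{-}\mathbf{Gph}$, and the two are identified: the 0-cells are the objects, the $m$-cells ($m\ge1$) are the $(m-1)$-cells of the hom-objects. "The category of algebras is $\mathcal V_n$" is meant up to equivalence of categories. *)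

theory Defs
  imports Main "HOL-Library.FuncSet"
begin

section \<open>Categories, functors, monads\<close>

record ('o, 'm) cat =
  Obj :: "'o set"
  Arr :: "'m set"
  Dom :: "'m \<Rightarrow> 'o"
  Cod :: "'m \<Rightarrow> 'o"
  Ident :: "'o \<Rightarrow> 'm"
  Comp :: "'m \<Rightarrow> 'm \<Rightarrow> 'm"  \<comment> \<open>\<open>Comp C g f\<close> is \<open>g\<close> after \<open>f\<close>\<close>

definition hom :: "('o, 'm) cat \<Rightarrow> 'o \<Rightarrow> 'o \<Rightarrow> 'm set" where
  "hom C X Y = {f \<in> Arr C. Dom C f = X \<and> Cod C f = Y}"

definition category :: "('o, 'm) cat \<Rightarrow> bool" where
  "category C \<longleftrightarrow>
     (\<forall>f\<in>Arr C. Dom C f \<in> Obj C \<and> Cod C f \<in> Obj C) \<and>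
     (\<forall>X\<in>Obj C. Ident C X \<in> hom C X X) \<and>
     (\<forall>X Y Z f g. f \<in> hom C X Y \<and> g \<in> hom C Y Z \<longrightarrow> Comp C g f \<in> hom C X Z) \<and>
     (\<forall>X Y f. f \<in> hom C X Y \<longrightarrow> Comp C f (Ident C X) = f \<and> Comp C (Ident C Y) f = f) \<and>
     (\<forall>W X Y Z f g h. f \<in> hom C W X \<and> g \<in> hom C X Y \<and> h \<in> hom C Y Z \<longrightarrow>
        Comp C h (Comp C g f) = Comp C (Comp C h g) f)"

record ('o, 'm, 'p, 'q) ftor =
  Fobj :: "'o \<Rightarrow> 'p"
  Farr :: "'m \<Rightarrow> 'q"

definition "functor" :: "('o, 'm) cat \<Rightarrow> ('p, 'q) cat \<Rightarrow> ('o, 'm, 'p, 'q) ftor \<Rightarrow> bool" where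
  "functor C D F \<longleftrightarrow>
     category C \<and> category D \<and>
     (\<forall>X\<in>Obj C. Fobj F X \<in> Obj D) \<and>
     (\<forall>X Y f. f \<in> hom C X Y \<longrightarrow> Farr F f \<in> hom D (Fobj F X) (Fobj F Y)) \<and>
     (\<forall>X\<in>Obj C. Farr F (Ident C X) = Ident D (Fobj F X)) \<and>
     (\<forall>X Y Z f g. f \<in> hom C X Y \<and> g \<in> hom C Y Z \<longrightarrow>
        Farr F (Comp C g f) = Comp D (Farr F g) (Farr F f))"

definition id_ftor :: "('o, 'm, 'o, 'm) ftor" where
  "id_ftor = \<lparr>Fobj = (\<lambda>X. X), Farr = (\<lambda>f. f)\<rparr>"

definition comp_ftor ::
  "('p, 'q, 'r, 's) ftor \<Rightarrow> ('o, 'm, 'p, 'q) ftor \<Rightarrow> ('o, 'm, 'r, 's) ftor" where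
  "comp_ftor G F = \<lparr>Fobj = Fobj G \<circ> Fobj F, Farr = Farr G \<circ> Farr F\<rparr>"

definition nat_trans :: "('o, 'm) cat \<Rightarrow> ('p, 'q) cat \<Rightarrow> ('o, 'm, 'p, 'q) ftor \<Rightarrow>
    ('o, 'm, 'p, 'q) ftor \<Rightarrow> ('o \<Rightarrow> 'q) \<Rightarrow> bool" where
  "nat_trans C D F G \<tau> \<longleftrightarrow>
     functor C D F \<and> functor C D G \<and>
     (\<forall>X\<in>Obj C. \<tau> X \<in> hom D (Fobj F X) (Fobj G X)) \<and>
     (\<forall>X Y f. f \<in> hom C X Y \<longrightarrow> Comp D (\<tau> Y) (Farr F f) = Comp D (Farr G f) (\<tau> X))"

definition iso_arr :: "('o, 'm) cat \<Rightarrow> 'm \<Rightarrow> bool" where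
  "iso_arr C f \<longleftrightarrow> (\<exists>X\<in>Obj C. \<exists>Y\<in>Obj C. f \<in> hom C X Y \<and>
     (\<exists>g\<in>hom C Y X. Comp C g f = Ident C X \<and> Comp C f g = Ident C Y))"

definition nat_iso :: "('o, 'm) cat \<Rightarrow> ('p, 'q) cat \<Rightarrow> ('o, 'm, 'p, 'q) ftor \<Rightarrow>
    ('o, 'm, 'p, 'q) ftor \<Rightarrow> ('o \<Rightarrow> 'q) \<Rightarrow> bool" where
  "nat_iso C D F G \<tau> \<longleftrightarrow> nat_trans C D F G \<tau> \<and> (\<forall>X\<in>Obj C. iso_arr D (\<tau> X))"

definition equivalent_cats :: "('o, 'm) cat \<Rightarrow> ('p, 'q) cat \<Rightarrow> bool" where
  "equivalent_cats C D \<longleftrightarrow> (\<exists>F G. functor C D F \<and> functor D C G \<and>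
     (\<exists>\<eta>. nat_iso C C id_ftor (comp_ftor G F) \<eta>) \<and>
     (\<exists>\<epsilon>. nat_iso D D (comp_ftor F G) id_ftor \<epsilon>))"

record ('o, 'm) mnd =
  endo :: "('o, 'm, 'o, 'm) ftor"
  munit :: "'o \<Rightarrow> 'm"
  mmult :: "'o \<Rightarrow> 'm"

definition monad :: "('o, 'm) cat \<Rightarrow> ('o, 'm) mnd \<Rightarrow> bool" where
  "monad C Q \<longleftrightarrow>
     functor C C (endo Q) \<and>
     nat_trans C C id_ftor (endo Q) (munit Q) \<and>
     nat_trans C C (comp_ftor (endo Q) (endo Q)) (endo Q) (mmult Q) \<and>
     (\<forall>X\<in>Obj C.
        Comp C (mmult Q X) (munit Q (Fobj (endo Q) X)) = Ident C (Fobj (endo Q) X) \<and>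
        Comp C (mmult Q X) (Farr (endo Q) (munit Q X)) = Ident C (Fobj (endo Q) X) \<and>
        Comp C (mmult Q X) (mmult Q (Fobj (endo Q) X)) =
          Comp C (mmult Q X) (Farr (endo Q) (mmult Q X)))"

definition is_algebra :: "('o, 'm) cat \<Rightarrow> ('o, 'm) mnd \<Rightarrow> 'o \<times> 'm \<Rightarrow> bool" where
  "is_algebra C Q A \<longleftrightarrow> (case A of (X, h) \<Rightarrow>
     X \<in> Obj C \<and> h \<in> hom C (Fobj (endo Q) X) X \<and>
     Comp C h (munit Q X) = Ident C X \<and>
     Comp C h (mmult Q X) = Comp C h (Farr (endo Q) h))"

text \<open>The Eilenberg--Moore category; an arrow is a triple (domain, underlying arrow, codomain).\<close>

definition algebras ::
  "('o, 'm) cat \<Rightarrow> ('o, 'm) mnd \<Rightarrow> ('o \<times> 'm, ('o \<times> 'm) \<times> 'm \<times> ('o \<times> 'm)) cat" where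
  "algebras C Q = \<lparr>
     Obj = {A. is_algebra C Q A},
     Arr = {(A, f, B). is_algebra C Q A \<and> is_algebra C Q B \<and> f \<in> hom C (fst A) (fst B) \<and>
              Comp C f (snd A) = Comp C (snd B) (Farr (endo Q) f)},
     Dom = (\<lambda>(A, f, B). A),
     Cod = (\<lambda>(A, f, B). B),
     Ident = (\<lambda>A. (A, Ident C (fst A), A)),
     Comp = (\<lambda>(B', g, D) (A, f, B). (A, Comp C g f, D))\<rparr>"


section \<open>Finite products\<close>

definition is_product :: "('o, 'm) cat \<Rightarrow> 'o list \<Rightarrow> 'o \<times> 'm list \<Rightarrow> bool" where
  "is_product C Xs L \<longleftrightarrow> (case L of (X, prs) \<Rightarrow>
     X \<in> Obj C \<and> list_all2 (\<lambda>pr Z. pr \<in> hom C X Z) prs Xs \<and>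
     (\<forall>Y\<in>Obj C. \<forall>fs. list_all2 (\<lambda>f Z. f \<in> hom C Y Z) fs Xs \<longrightarrow>
        (\<exists>!h. h \<in> hom C Y X \<and> map (\<lambda>pr. Comp C pr h) prs = fs)))"

text \<open>
  A chosen product of each finite list of objects; it is meaningful in categories having
  finite products. The product of the empty list is a terminal object.
\<close>

definition product_cone :: "('o, 'm) cat \<Rightarrow> 'o list \<Rightarrow> 'o \<times> 'm list" where
  "product_cone C Xs = (SOME L. is_product C Xs L)"

definition Prod :: "('o, 'm) cat \<Rightarrow> 'o list \<Rightarrow> 'o" where
  "Prod C Xs = fst (product_cone C Xs)"

definition projs :: "('o, 'm) cat \<Rightarrow> 'o list \<Rightarrow> 'm list" where
  "projs C Xs = snd (product_cone C Xs)"

text \<open>\<open>tuple C Y fs\<close> is the arrow from \<open>Y\<close> into the product of the codomains of \<open>fs\<close>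
  with components \<open>fs\<close>.\<close>

definition tuple :: "('o, 'm) cat \<Rightarrow> 'o \<Rightarrow> 'm list \<Rightarrow> 'm" where
  "tuple C Y fs = (THE h. h \<in> hom C Y (Prod C (map (Cod C) fs)) \<and>
     map (\<lambda>pr. Comp C pr h) (projs C (map (Cod C) fs)) = fs)"


section \<open>Non-symmetric operads\<close>

text \<open>
  The field \<open>ocomp\<close> takes the list \<open>[k\<^sub>1, \<dots>, k\<^sub>m]\<close> to the composition map
  \<open>P(m) \<times> P(k\<^sub>1) \<times> \<cdots> \<times> P(k\<^sub>m) \<rightarrow> P(k\<^sub>1 + \<cdots> + k\<^sub>m)\<close>.
  Commutativity of diagrams of arrows out of products is expressed by
  generalized elements, that is, arrows from an arbitrary object \<open>Y\<close>.
\<close>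

record ('o, 'm) operad =
  ops :: "nat \<Rightarrow> 'o"
  ounit :: 'm
  ocomp :: "nat list \<Rightarrow> 'm"

definition unit_at :: "('o, 'm) cat \<Rightarrow> ('o, 'm) operad \<Rightarrow> 'o \<Rightarrow> 'm" where
  "unit_at V P Y = Comp V (ounit P) (tuple V Y [])"

definition ocomp_at ::
  "('o, 'm) cat \<Rightarrow> ('o, 'm) operad \<Rightarrow> 'o \<Rightarrow> nat list \<Rightarrow> 'm \<Rightarrow> 'm list \<Rightarrow> 'm" where
  "ocomp_at V P Y ks p ps = Comp V (ocomp P ks) (tuple V Y (p # ps))"

definition is_operad :: "('o, 'm) cat \<Rightarrow> ('o, 'm) operad \<Rightarrow> bool" where
  "is_operad V P \<longleftrightarrow>
     (\<forall>k. ops P k \<in> Obj V) \<and>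
     ounit P \<in> hom V (Prod V []) (ops P 1) \<and>
     (\<forall>ks. ocomp P ks \<in>
        hom V (Prod V (ops P (length ks) # map (ops P) ks)) (ops P (sum_list ks))) \<and>
     (\<forall>Y\<in>Obj V. \<forall>k. \<forall>p\<in>hom V Y (ops P k).
        ocomp_at V P Y [k] (unit_at V P Y) [p] = p \<and>
        ocomp_at V P Y (replicate k 1) p (replicate k (unit_at V P Y)) = p) \<and>
     (\<forall>Y\<in>Obj V. \<forall>kss p ps qss.
        p \<in> hom V Y (ops P (length kss)) \<and>
        list_all2 (\<lambda>q ks. q \<in> hom V Y (ops P (length ks))) ps kss \<and>
        list_all2 (list_all2 (\<lambda>q k. q \<in> hom V Y (ops P k))) qss kss \<longrightarrow>
        ocomp_at V P Y (concat kss) (ocomp_at V P Y (map length kss) p ps) (concat qss) =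
        ocomp_at V P Y (map sum_list kss) p
          (map (\<lambda>i. ocomp_at V P Y (kss ! i) (ps ! i) (qss ! i)) [0..<length kss]))"


section \<open>Categories enriched in \<open>V\<close> and weakened by an operad \<open>P\<close>\<close>

text \<open>
  Small sets are the subsets of a type \<open>'u\<close>; they are closed under finite products, up to
  bijection, when \<open>'u\<close> is infinite. All functions that are part of an object or arrow
  are \<open>undefined\<close> outside their domain, so that equality of the data is equality of the
  functions on their domain.
\<close>

datatype ('u, 'o) vgraph = VGraph (gobjs: "'u set") (ghom: "'u \<Rightarrow> 'u \<Rightarrow> 'o")

definition is_vgraph :: "('o, 'm) cat \<Rightarrow> ('u, 'o) vgraph \<Rightarrow> bool" where
  "is_vgraph V A \<longleftrightarrow>
     (\<forall>a b. if a \<in> gobjs A \<and> b \<in> gobjs A then ghom A a b \<in> Obj V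
            else ghom A a b = undefined)"

definition is_vgraph_map ::
  "('o, 'm) cat \<Rightarrow> ('u, 'o) vgraph \<Rightarrow> ('u, 'o) vgraph \<Rightarrow> ('u \<Rightarrow> 'u) \<Rightarrow> ('u \<Rightarrow> 'u \<Rightarrow> 'm) \<Rightarrow> bool"
where
  "is_vgraph_map V A B F H \<longleftrightarrow>
     F \<in> gobjs A \<rightarrow>\<^sub>E gobjs B \<and>
     (\<forall>a b. if a \<in> gobjs A \<and> b \<in> gobjs A then H a b \<in> hom V (ghom A a b) (ghom B (F a) (F b))
            else H a b = undefined)"

text \<open>
  The field \<open>vact\<close> takes a nonempty string \<open>[a\<^sub>0, \<dots>, a\<^sub>k]\<close> of objects to
  \<open>\<gamma> : P(k) \<times> A(a\<^sub>k\<^sub>-\<^sub>1, a\<^sub>k) \<times> \<cdots> \<times> A(a\<^sub>0, a\<^sub>1) \<rightarrow> A(a\<^sub>0, a\<^sub>k)\<close>.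
\<close>

datatype ('u, 'o, 'm) vpcat =
  VPCat (ugraph: "('u, 'o) vgraph") (vact: "'u list \<Rightarrow> 'm")

definition strings :: "('u, 'o) vgraph \<Rightarrow> 'u list set" where
  "strings A = {as. as \<noteq> [] \<and> set as \<subseteq> gobjs A}"

definition steps :: "('u, 'o) vgraph \<Rightarrow> 'u list \<Rightarrow> 'o list" where
  "steps A as = map (\<lambda>i. ghom A (as ! i) (as ! Suc i)) [0..<length as - 1]"

text \<open>
  The list \<open>fs\<close> of generalized elements is given along the string, i.e. starting with the
  element of \<open>A(a\<^sub>0, a\<^sub>1)\<close>, whereas the product in the domain of \<open>\<gamma>\<close> is in reverse order.
\<close>

definition vact_at ::
  "('o, 'm) cat \<Rightarrow> ('u, 'o, 'm) vpcat \<Rightarrow> 'o \<Rightarrow> 'u list \<Rightarrow> 'm \<Rightarrow> 'm list \<Rightarrow> 'm" where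
  "vact_at V A Y as p fs = Comp V (vact A as) (tuple V Y (p # rev fs))"

text \<open>
  Cutting a list into consecutive blocks of \<open>k\<^sub>1, \<dots>, k\<^sub>m\<close> steps (here \<open>ks = [k\<^sub>1, \<dots>, k\<^sub>m]\<close>,
  blocks numbered from \<open>0\<close>); consecutive blocks of objects share their common end point.
\<close>

definition offset :: "nat list \<Rightarrow> nat \<Rightarrow> nat" where
  "offset ks i = sum_list (take i ks)"

definition obj_block :: "nat list \<Rightarrow> 'a list \<Rightarrow> nat \<Rightarrow> 'a list" where
  "obj_block ks as i = take (Suc (ks ! i)) (drop (offset ks i) as)"

definition step_block :: "nat list \<Rightarrow> 'a list \<Rightarrow> nat \<Rightarrow> 'a list" where
  "step_block ks fs i = take (ks ! i) (drop (offset ks i) fs)"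

definition cut_points :: "nat list \<Rightarrow> 'a list \<Rightarrow> 'a list" where
  "cut_points ks as = map (\<lambda>i. as ! offset ks i) [0..<Suc (length ks)]"

definition is_vpcat :: "('o, 'm) cat \<Rightarrow> ('o, 'm) operad \<Rightarrow> ('u, 'o, 'm) vpcat \<Rightarrow> bool" where
  "is_vpcat V P A \<longleftrightarrow>
     is_vgraph V (ugraph A) \<and>
     (\<forall>as. if as \<in> strings (ugraph A)
           then vact A as \<in> hom V (Prod V (ops P (length as - 1) # rev (steps (ugraph A) as)))
                               (ghom (ugraph A) (hd as) (last as))
           else vact A as = undefined) \<and>
     (\<forall>Y\<in>Obj V. \<forall>a\<in>gobjs (ugraph A). \<forall>b\<in>gobjs (ugraph A).
        \<forall>f\<in>hom V Y (ghom (ugraph A) a b). vact_at V A Y [a, b] (unit_at V P Y) [f] = f) \<and>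
     (\<forall>Y\<in>Obj V. \<forall>as\<in>strings (ugraph A). \<forall>ks p ps fs.
        sum_list ks = length as - 1 \<and>
        p \<in> hom V Y (ops P (length ks)) \<and>
        list_all2 (\<lambda>q k. q \<in> hom V Y (ops P k)) ps ks \<and>
        list_all2 (\<lambda>f Z. f \<in> hom V Y Z) fs (steps (ugraph A) as) \<longrightarrow>
        vact_at V A Y (cut_points ks as) p
          (map (\<lambda>i. vact_at V A Y (obj_block ks as i) (ps ! i) (step_block ks fs i))
             [0..<length ks]) =
        vact_at V A Y as (ocomp_at V P Y ks p ps) fs)"

datatype ('u, 'o, 'm) vpmap =
  VPMap (vdom: "('u, 'o, 'm) vpcat") (vcod: "('u, 'o, 'm) vpcat")
        (vfun: "'u \<Rightarrow> 'u") (vhom: "'u \<Rightarrow> 'u \<Rightarrow> 'm")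

definition is_vpmap :: "('o, 'm) cat \<Rightarrow> ('o, 'm) operad \<Rightarrow> ('u, 'o, 'm) vpmap \<Rightarrow> bool" where
  "is_vpmap V P F \<longleftrightarrow>
     is_vpcat V P (vdom F) \<and> is_vpcat V P (vcod F) \<and>
     is_vgraph_map V (ugraph (vdom F)) (ugraph (vcod F)) (vfun F) (vhom F) \<and>
     (\<forall>Y\<in>Obj V. \<forall>as\<in>strings (ugraph (vdom F)). \<forall>p fs.
        p \<in> hom V Y (ops P (length as - 1)) \<and>
        list_all2 (\<lambda>f Z. f \<in> hom V Y Z) fs (steps (ugraph (vdom F)) as) \<longrightarrow>
        Comp V (vhom F (hd as) (last as)) (vact_at V (vdom F) Y as p fs) =
        vact_at V (vcod F) Y (map (vfun F) as) p
          (map (\<lambda>i. Comp V (vhom F (as ! i) (as ! Suc i)) (fs ! i)) [0..<length fs]))"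

definition vp_cat ::
  "('o, 'm) cat \<Rightarrow> ('o, 'm) operad \<Rightarrow> (('u, 'o, 'm) vpcat, ('u, 'o, 'm) vpmap) cat" where
  "vp_cat V P = \<lparr>
     Obj = {A. is_vpcat V P A},
     Arr = {F. is_vpmap V P F},
     Dom = vdom,
     Cod = vcod,
     Ident = (\<lambda>A. VPMap A A (\<lambda>a\<in>gobjs (ugraph A). a)
        (\<lambda>a b. if a \<in> gobjs (ugraph A) \<and> b \<in> gobjs (ugraph A)
               then Ident V (ghom (ugraph A) a b) else undefined)),
     Comp = (\<lambda>G F. VPMap (vdom F) (vcod G)
        (\<lambda>a\<in>gobjs (ugraph (vdom F)). vfun G (vfun F a))
        (\<lambda>a b. if a \<in> gobjs (ugraph (vdom F)) \<and> b \<in> gobjs (ugraph (vdom F))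
               then Comp V (vhom G (vfun F a) (vfun F b)) (vhom F a b) else undefined))\<rparr>"


section \<open>Sets and globular sets\<close>

datatype 'u setmap = SetMap (sdom: "'u set") (scod: "'u set") (sfun: "'u \<Rightarrow> 'u")

definition set_cat :: "('u set, 'u setmap) cat" where
  "set_cat = \<lparr>
     Obj = UNIV,
     Arr = {f. sfun f \<in> sdom f \<rightarrow>\<^sub>E scod f},
     Dom = sdom,
     Cod = scod,
     Ident = (\<lambda>A. SetMap A A (\<lambda>x\<in>A. x)),
     Comp = (\<lambda>g f. SetMap (sdom f) (scod g) (\<lambda>x\<in>sdom f. sfun g (sfun f x)))\<rparr>"

text \<open>
  The maps \<open>gsrc A m\<close> and \<open>gtgt A m\<close> go from \<open>(m + 1)\<close>-cells to \<open>m\<close>-cells. An \<open>n\<close>-globular set has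
  no cells in dimensions above \<open>n\<close>.
\<close>

datatype 'u gset =
  GSet (cells: "nat \<Rightarrow> 'u set") (gsrc: "nat \<Rightarrow> 'u \<Rightarrow> 'u") (gtgt: "nat \<Rightarrow> 'u \<Rightarrow> 'u")

definition is_gset :: "nat \<Rightarrow> 'u gset \<Rightarrow> bool" where
  "is_gset n A \<longleftrightarrow>
     (\<forall>m>n. cells A m = {}) \<and>
     (\<forall>m. gsrc A m \<in> cells A (Suc m) \<rightarrow>\<^sub>E cells A m \<and>
          gtgt A m \<in> cells A (Suc m) \<rightarrow>\<^sub>E cells A m) \<and>
     (\<forall>m. \<forall>x\<in>cells A (Suc (Suc m)).
        gsrc A m (gsrc A (Suc m) x) = gsrc A m (gtgt A (Suc m) x) \<and>
        gtgt A m (gsrc A (Suc m) x) = gtgt A m (gtgt A (Suc m) x))"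

datatype 'u gmap = GMap (gdom: "'u gset") (gcod: "'u gset") (gfun: "nat \<Rightarrow> 'u \<Rightarrow> 'u")

definition is_gmap :: "nat \<Rightarrow> 'u gmap \<Rightarrow> bool" where
  "is_gmap n f \<longleftrightarrow>
     is_gset n (gdom f) \<and> is_gset n (gcod f) \<and>
     (\<forall>m. gfun f m \<in> cells (gdom f) m \<rightarrow>\<^sub>E cells (gcod f) m) \<and>
     (\<forall>m. \<forall>x\<in>cells (gdom f) (Suc m).
        gsrc (gcod f) m (gfun f (Suc m) x) = gfun f m (gsrc (gdom f) m x) \<and>
        gtgt (gcod f) m (gfun f (Suc m) x) = gfun f m (gtgt (gdom f) m x))"

definition gset_cat :: "nat \<Rightarrow> ('u gset, 'u gmap) cat" where
  "gset_cat n = \<lparr>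
     Obj = {A. is_gset n A},
     Arr = {f. is_gmap n f},
     Dom = gdom,
     Cod = gcod,
     Ident = (\<lambda>A. GMap A A (\<lambda>m. \<lambda>x\<in>cells A m. x)),
     Comp = (\<lambda>g f. GMap (gdom f) (gcod g)
        (\<lambda>m. \<lambda>x\<in>cells (gdom f) m. gfun g m (gfun f m x)))\<rparr>"


section \<open>Iterative operadic theories of \<open>n\<close>-categories\<close>

text \<open>
  The objects and arrows of all the categories \<open>V\<^sub>n\<close> live in one pair of types, since the types of
  an iterated construction cannot depend on \<open>n\<close>. The injective constructors only tag the data, and
  \<open>copy_cat\<close> transports a category along them.
\<close>

datatype 'u nobj = SetObj "'u set" | CatObj "('u, 'u nobj, 'u narr) vpcat"
     and 'u narr = SetArr "'u setmap" | CatArr "('u, 'u nobj, 'u narr) vpmap"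

definition copy_cat :: "('o \<Rightarrow> 'p) \<Rightarrow> ('m \<Rightarrow> 'q) \<Rightarrow> ('o, 'm) cat \<Rightarrow> ('p, 'q) cat" where
  "copy_cat i j C = \<lparr>
     Obj = i ` Obj C,
     Arr = j ` Arr C,
     Dom = (\<lambda>f. i (Dom C (inv j f))),
     Cod = (\<lambda>f. i (Cod C (inv j f))),
     Ident = (\<lambda>X. j (Ident C (inv i X))),
     Comp = (\<lambda>g f. j (Comp C (inv j g) (inv j f)))\<rparr>"

fun ncat :: "(nat \<Rightarrow> ('u nobj, 'u narr) operad) \<Rightarrow> nat \<Rightarrow> ('u nobj, 'u narr) cat" where
  "ncat P 0 = copy_cat SetObj SetArr set_cat"
| "ncat P (Suc n) = copy_cat CatObj CatArr (vp_cat (ncat P n) (P n))"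

definition contractible_vgraph :: "('o \<Rightarrow> bool) \<Rightarrow> ('u, 'o) vgraph \<Rightarrow> bool" where
  "contractible_vgraph contr A \<longleftrightarrow>
     gobjs A \<noteq> {} \<and> (\<forall>a\<in>gobjs A. \<forall>b\<in>gobjs A. contr (ghom A a b))"

fun contractible_nobj :: "nat \<Rightarrow> 'u nobj \<Rightarrow> bool" where
  "contractible_nobj 0 X \<longleftrightarrow> (\<exists>x. X = SetObj {x})"
| "contractible_nobj (Suc n) X \<longleftrightarrow>
     (\<exists>A. X = CatObj A \<and> contractible_vgraph (contractible_nobj n) (ugraph A))"

definition iterative_operadic_theory :: "(nat \<Rightarrow> ('u nobj, 'u narr) operad) \<Rightarrow> bool" where
  "iterative_operadic_theory P \<longleftrightarrow>
     (\<forall>n. is_operad (ncat P n) (P n) \<and> (\<forall>k. contractible_nobj n (ops (P n) k)))"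

end

theory Submission
  imports Defs
begin

text \<open>
  Call a globular set with partial operations, whose domains depend on the globular set only,
  a structure. The category \<open>V\<^sub>n\<close> embeds fully faithfully into structures on \<open>n\<close>-globular sets:
  an \<open>(n+1)\<close>-category has the operations of its homs, and for each cell \<open>p\<close> of \<open>P\<^sub>n(k)\<close> an operation
  that composes strings of \<open>k\<close> cells. By induction on \<open>n\<close>, the image is closed, up to
  isomorphism, under two constructions: structures whose cells are separated by homomorphisms
  into the image, and quotients of structures in the image by homomorphisms that have a section of
  globular sets. The first closure gives finite products, and also free objects: inside the
  (large) product over all maps from a globular set \<open>A\<close> to objects of \<open>V\<^sub>n\<close>, take the substructure
  generated by \<open>A\<close>, which is small because the operations are finitary. The second one turns every
  algebra \<open>h : Q A \<rightarrow> A\<close> of the resulting monad, which is split by the unit, into an object of \<open>V\<^sub>n\<close>.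
\<close>


section \<open>Equivalences and monads from universal arrows\<close>

text \<open>The operations are partial: a string can be composed only if its cells match end to end.
  For this reason closure under all surjective quotients cannot be expected: matching cells of a
  quotient need not lift to matching cells upstairs. A section of globular sets lifts whole strings
  at once, and for an algebra the unit of the monad is such a section. In the other direction an
  equation may be tested under a separating family of homomorphisms, which preserve both of its
  sides. So the induction on \<open>n\<close> can carry two closure properties in place of a list of
  equations. The definitions speak of arrows out of products, the closure arguments of cells. The
  two meet because finite products turn out to be formed dimensionwise, so that every tuple of cells
  is the value of the projections at one cell of a product. All cells have to be elements of the one
  type \<open>'u\<close>. Being infinite, it contains codes for its own lists, and these serve as
  tuples in products, as cells of homs tagged by their two objects, and as terms over generators.
  The index class of the product used for free objects may be too large to be coded; only the
  generated part is.\<close>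

lemma functor_cat: "functor C D F \<Longrightarrow> category C" "functor C D F \<Longrightarrow> category D"
  by (auto simp: functor_def)

lemma hom_Obj: "category C \<Longrightarrow> f \<in> hom C X Y \<Longrightarrow> X \<in> Obj C \<and> Y \<in> Obj C"
  by (auto simp: category_def hom_def)

lemma ident_hom: "category C \<Longrightarrow> X \<in> Obj C \<Longrightarrow> Ident C X \<in> hom C X X"
  by (auto simp: category_def)

lemma comp_hom: "category C \<Longrightarrow> f \<in> hom C X Y \<Longrightarrow> g \<in> hom C Y Z \<Longrightarrow> Comp C g f \<in> hom C X Z"
  unfolding category_def by blast

lemma comp_ident: "category C \<Longrightarrow> f \<in> hom C X Y \<Longrightarrow> Comp C f (Ident C X) = f"
  "category C \<Longrightarrow> f \<in> hom C X Y \<Longrightarrow> Comp C (Ident C Y) f = f"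
  unfolding category_def by blast+

lemma comp_assoc: "category C \<Longrightarrow> f \<in> hom C W X \<Longrightarrow> g \<in> hom C X Y \<Longrightarrow> h \<in> hom C Y Z \<Longrightarrow>
    Comp C (Comp C h g) f = Comp C h (Comp C g f)"
  unfolding category_def by metis

lemma functor_Obj: "functor C D F \<Longrightarrow> X \<in> Obj C \<Longrightarrow> Fobj F X \<in> Obj D"
  by (auto simp: functor_def)

lemma functor_hom: "functor C D F \<Longrightarrow> f \<in> hom C X Y \<Longrightarrow> Farr F f \<in> hom D (Fobj F X) (Fobj F Y)"
  unfolding functor_def by blast

lemma functor_ident: "functor C D F \<Longrightarrow> X \<in> Obj C \<Longrightarrow> Farr F (Ident C X) = Ident D (Fobj F X)"
  by (auto simp: functor_def)

lemma functor_comp: "functor C D F \<Longrightarrow> f \<in> hom C X Y \<Longrightarrow> g \<in> hom C Y Z \<Longrightarrow>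
    Farr F (Comp C g f) = Comp D (Farr F g) (Farr F f)"
  unfolding functor_def by blast

lemma hom_Dom: "f \<in> hom C X Y \<Longrightarrow> Dom C f = X" and hom_Cod: "f \<in> hom C X Y \<Longrightarrow> Cod C f = Y"
  by (auto simp: hom_def)

lemma iso_arrI: "category C \<Longrightarrow> f \<in> hom C X Y \<Longrightarrow> g \<in> hom C Y X \<Longrightarrow> Comp C g f = Ident C X \<Longrightarrow>
    Comp C f g = Ident C Y \<Longrightarrow> iso_arr C f"
  unfolding iso_arr_def by (metis hom_Obj)

lemma iso_arrE:
  assumes "iso_arr C f" "f \<in> hom C X Y"
  obtains g where "g \<in> hom C Y X" "Comp C g f = Ident C X" "Comp C f g = Ident C Y"
proof -
  obtain X' Y' g where "f \<in> hom C X' Y'" "g \<in> hom C Y' X'" "Comp C g f = Ident C X'" "Comp C f g = Ident C Y'"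
    using assms(1) unfolding iso_arr_def by blast
  moreover have "X' = X" "Y' = Y" using calculation(1) assms(2) by (auto simp: hom_def)
  ultimately show ?thesis using that by blast
qed

lemma functor_id: "category C \<Longrightarrow> functor C C id_ftor"
  by (auto simp: functor_def id_ftor_def)

lemma functor_compose: "functor C D F \<Longrightarrow> functor D E G \<Longrightarrow> functor C E (comp_ftor G F)"
  by (auto simp: functor_def comp_ftor_def; metis)

text \<open>The inverse functor \<open>G\<close> conjugates an arrow by the chosen isomorphisms
  \<open>i\<close> and \<open>j\<close> and lifts the result along \<open>K\<close>. Equations
  between arrows of \<open>D\<close> are proved after applying \<open>K\<close>, where adjacent
  \<open>j\<close> and \<open>i\<close> cancel.\<close>

lemma equivalent_catsI:
  assumes K: "functor D C K"
    and faithful: "\<And>X Y f g. f \<in> hom D X Y \<Longrightarrow> g \<in> hom D X Y \<Longrightarrow> Farr K f = Farr K g \<Longrightarrow> f = g"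
    and full: "\<And>X Y g. X \<in> Obj D \<Longrightarrow> Y \<in> Obj D \<Longrightarrow> g \<in> hom C (Fobj K X) (Fobj K Y) \<Longrightarrow>
      \<exists>f\<in>hom D X Y. Farr K f = g"
    and surj: "\<And>c. c \<in> Obj C \<Longrightarrow> \<exists>X\<in>Obj D. \<exists>i\<in>hom C c (Fobj K X). iso_arr C i"
  shows "equivalent_cats C D"
proof -
  note C = functor_cat(2)[OF K] and D = functor_cat(1)[OF K]
  have "\<forall>c\<in>Obj C. \<exists>X i j. X \<in> Obj D \<and> i \<in> hom C c (Fobj K X) \<and> j \<in> hom C (Fobj K X) c \<and>
      Comp C j i = Ident C c \<and> Comp C i j = Ident C (Fobj K X)"
    by (metis surj iso_arrE)
  then obtain F i j where F: "\<And>c. c \<in> Obj C \<Longrightarrow> F c \<in> Obj D"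
    and i: "\<And>c. c \<in> Obj C \<Longrightarrow> i c \<in> hom C c (Fobj K (F c))"
    and j: "\<And>c. c \<in> Obj C \<Longrightarrow> j c \<in> hom C (Fobj K (F c)) c"
    and ji: "\<And>c. c \<in> Obj C \<Longrightarrow> Comp C (j c) (i c) = Ident C c"
    and ij: "\<And>c. c \<in> Obj C \<Longrightarrow> Comp C (i c) (j c) = Ident C (Fobj K (F c))"
    by metis
  define L where "L X Y g = (SOME f. f \<in> hom D X Y \<and> Farr K f = g)" for X Y g
  have L: "L X Y g \<in> hom D X Y" "Farr K (L X Y g) = g"
    if "X \<in> Obj D" "Y \<in> Obj D" "g \<in> hom C (Fobj K X) (Fobj K Y)" for X Y g
    using someI_ex[of "\<lambda>f. f \<in> hom D X Y \<and> Farr K f = g"] full[OF that] unfolding L_def by blast+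
  note [simp] = functor_Obj[OF K] F
  note ch = comp_hom[OF C] and ca = comp_assoc[OF C]
  define G where "G = \<lparr>Fobj = F, Farr = (\<lambda>f. L (F (Dom C f)) (F (Cod C f))
     (Comp C (i (Cod C f)) (Comp C f (j (Dom C f)))))\<rparr>"
  have Gh: "Farr G f \<in> hom D (F X) (F Y)" and KG: "Farr K (Farr G f) = Comp C (i Y) (Comp C f (j X))"
    if f: "f \<in> hom C X Y" for f X Y
  proof -
    have o: "X \<in> Obj C" "Y \<in> Obj C" using hom_Obj[OF C f] by auto
    have "Comp C (i Y) (Comp C f (j X)) \<in> hom C (Fobj K (F X)) (Fobj K (F Y))"
      using i j o f by (blast intro: ch)
    with L[of "F X" "F Y"] o show "Farr G f \<in> hom D (F X) (F Y)" "Farr K (Farr G f) = Comp C (i Y) (Comp C f (j X))"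
      by (auto simp: G_def hom_Dom[OF f] hom_Cod[OF f])
  qed
  have FG[simp]: "Fobj G = F" by (simp add: G_def)
  have G: "functor C D G"
    unfolding functor_def
  proof (intro conjI ballI allI impI)
    fix X assume X: "X \<in> Obj C"
    show "Farr G (Ident C X) = Ident D (Fobj G X)"
      using X j ij by (intro faithful[of _ "F X" "F X"])
        (auto simp: KG[OF ident_hom[OF C X]] functor_ident[OF K] comp_ident(2)[OF C j[OF X]]
          intro: ident_hom[OF D] Gh[OF ident_hom[OF C X]])
  next
    fix X Y Z f g assume a: "f \<in> hom C X Y \<and> g \<in> hom C Y Z"
    then have f: "f \<in> hom C X Y" and g: "g \<in> hom C Y Z" by auto
    have o: "X \<in> Obj C" "Y \<in> Obj C" "Z \<in> Obj C" using hom_Obj[OF C f] hom_Obj[OF C g] by auto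
    have gf: "Comp C g f \<in> hom C X Z" using f g by (rule ch)
    have fj: "Comp C f (j X) \<in> hom C (Fobj K (F X)) Y" using ch[OF j[OF o(1)] f] .
    have gj: "Comp C g (j Y) \<in> hom C (Fobj K (F Y)) Z" using ch[OF j[OF o(2)] g] .
    have "Comp C (Comp C (i Z) (Comp C g (j Y))) (Comp C (i Y) (Comp C f (j X)))
      = Comp C (i Z) (Comp C (Comp C g (j Y)) (Comp C (i Y) (Comp C f (j X))))"
      using ca[OF ch[OF fj i[OF o(2)]] gj i[OF o(3)]] .
    also have "Comp C (Comp C g (j Y)) (Comp C (i Y) (Comp C f (j X))) = Comp C g (Comp C f (j X))"
      using ca[OF ch[OF fj i[OF o(2)]] j[OF o(2)] g] ca[OF fj i[OF o(2)] j[OF o(2)]] ji[OF o(2)]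
        comp_ident(2)[OF C fj] by simp
    also have "\<dots> = Comp C (Comp C g f) (j X)" using ca[OF j[OF o(1)] f g] by simp
    finally show "Farr G (Comp C g f) = Comp D (Farr G g) (Farr G f)"
      by (intro faithful[OF Gh[OF gf] comp_hom[OF D Gh[OF f] Gh[OF g]]])
        (simp add: KG[OF gf] functor_comp[OF K Gh[OF f] Gh[OF g]] KG[OF f] KG[OF g])
  qed (use C D Gh in auto)
  have eta: "nat_iso C C id_ftor (comp_ftor K G) i"
    unfolding nat_iso_def nat_trans_def
  proof (intro conjI ballI allI impI)
    fix X Y f assume f: "f \<in> hom C X Y"
    then have o: "X \<in> Obj C" "Y \<in> Obj C" using hom_Obj[OF C] by auto
    have "Comp C (Comp C (i Y) (Comp C f (j X))) (i X) = Comp C (i Y) (Comp C (Comp C f (j X)) (i X))"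
      using ca[OF i[OF o(1)] ch[OF j[OF o(1)] f] i[OF o(2)]] .
    also have "Comp C (Comp C f (j X)) (i X) = f"
      using ca[OF i[OF o(1)] j[OF o(1)] f] ji[OF o(1)] comp_ident(1)[OF C f] by simp
    finally show "Comp C (i Y) (Farr id_ftor f) = Comp C (Farr (comp_ftor K G) f) (i X)"
      by (simp add: id_ftor_def comp_ftor_def KG[OF f])
  next
    fix X assume X: "X \<in> Obj C"
    show "iso_arr C (i X)" by (rule iso_arrI[OF C i[OF X] j[OF X] ji[OF X] ij[OF X]])
  qed (rule functor_id[OF C] functor_compose[OF G K] | simp add: i id_ftor_def comp_ftor_def)+
  \<comment> \<open>The object chosen for \<open>K X\<close> is related to \<open>X\<close> only
    inside \<open>C\<close>. Fullness of \<open>K\<close> lifts \<open>j\<close> to the counit at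
    \<open>X\<close>, and further below it lifts \<open>i\<close> to the inverse
    \<open>u\<close>.\<close>
  define e where "e X = L (F (Fobj K X)) X (j (Fobj K X))" for X
  have e: "e X \<in> hom D (F (Fobj K X)) X" "Farr K (e X) = j (Fobj K X)" if X: "X \<in> Obj D" for X
    using L[of "F (Fobj K X)" X "j (Fobj K X)"] X j by (auto simp: e_def)
  have eps: "nat_iso D D (comp_ftor G K) id_ftor e"
    unfolding nat_iso_def nat_trans_def
  proof (intro conjI ballI allI impI)
    fix X Y f assume f: "f \<in> hom D X Y"
    then have o: "X \<in> Obj D" "Y \<in> Obj D" using hom_Obj[OF D] by auto
    let ?KX = "Fobj K X" and ?KY = "Fobj K Y" and ?f = "Farr K f"
    have Kf: "?f \<in> hom C ?KX ?KY" using functor_hom[OF K f] .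
    have fj: "Comp C ?f (j ?KX) \<in> hom C (Fobj K (F ?KX)) ?KY" using ch[OF j Kf] o by auto
    have "Comp C (j ?KY) (Comp C (i ?KY) (Comp C ?f (j ?KX))) = Comp C ?f (j ?KX)"
      using ca[OF fj i j] ji[of ?KY] comp_ident(2)[OF C fj] o by simp
    then show "Comp D (e Y) (Farr (comp_ftor G K) f) = Comp D (Farr id_ftor f) (e X)"
      unfolding comp_ftor_def id_ftor_def
      by (intro faithful[of _ "F ?KX" Y])
        (auto intro: comp_hom[OF D] e o f Gh[OF Kf] simp: functor_comp[OF K Gh[OF Kf] e(1)[OF o(2)]]
          functor_comp[OF K e(1)[OF o(1)] f] KG[OF Kf] e o)
  next
    fix X assume X: "X \<in> Obj D"
    let ?KX = "Fobj K X"
    have KX: "?KX \<in> Obj C" using X by simp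
    obtain u where u: "u \<in> hom D X (F ?KX)" "Farr K u = i ?KX"
      using full[of X "F ?KX" "i ?KX"] X i[OF KX] by auto
    show "iso_arr D (e X)"
      by (rule iso_arrI[OF D e(1)[OF X] u(1)])
        (rule faithful, use X KX u e[OF X] ij[OF KX] ji[OF KX] in
          \<open>auto intro!: comp_hom[OF D] ident_hom[OF D] simp: functor_ident[OF K] functor_comp[OF K]\<close>)+
  qed (rule functor_id[OF D] functor_compose[OF K G] | simp add: e id_ftor_def comp_ftor_def)+
  show ?thesis unfolding equivalent_cats_def using G K eta eps by blast
qed

section \<open>The monad of a family of universal arrows\<close>

locale univ_arrows =
  fixes C :: "('o, 'm) cat" and V :: "('p, 'q) cat" and U :: "('p, 'q, 'o, 'm) ftor"
    and F :: "'o \<Rightarrow> 'p" and \<eta> :: "'o \<Rightarrow> 'm"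
  assumes U: "functor V C U"
    and F: "\<And>A. A \<in> Obj C \<Longrightarrow> F A \<in> Obj V"
    and eta: "\<And>A. A \<in> Obj C \<Longrightarrow> \<eta> A \<in> hom C A (Fobj U (F A))"
    and univ: "\<And>A X f. A \<in> Obj C \<Longrightarrow> X \<in> Obj V \<Longrightarrow> f \<in> hom C A (Fobj U X) \<Longrightarrow>
      \<exists>!g. g \<in> hom V (F A) X \<and> Comp C (Farr U g) (\<eta> A) = f"
begin

lemmas C = functor_cat(2)[OF U] and V = functor_cat(1)[OF U]

definition ext :: "'o \<Rightarrow> 'p \<Rightarrow> 'm \<Rightarrow> 'q" where
  "ext A X f = (THE g. g \<in> hom V (F A) X \<and> Comp C (Farr U g) (\<eta> A) = f)"

lemma ext:
  assumes "A \<in> Obj C" "X \<in> Obj V" "f \<in> hom C A (Fobj U X)"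
  shows "ext A X f \<in> hom V (F A) X" "Comp C (Farr U (ext A X f)) (\<eta> A) = f"
  using theI'[OF univ[OF assms]] unfolding ext_def by auto

text \<open>Equations between arrows out of a free object are checked on the generators.
  Functoriality of \<open>free_arr\<close>, naturality of the counit and the triangle identity
  inside \<open>monad_T\<close> all rest on this.\<close>

lemma ext_unique:
  assumes "A \<in> Obj C" "g \<in> hom V (F A) X" "h \<in> hom V (F A) X"
    "Comp C (Farr U g) (\<eta> A) = Comp C (Farr U h) (\<eta> A)"
  shows "g = h"
  using univ[of A X "Comp C (Farr U g) (\<eta> A)"] assms hom_Obj[OF V assms(2)]
    comp_hom[OF C eta functor_hom[OF U assms(2)]] by metis

definition free_arr :: "'m \<Rightarrow> 'q" where
  "free_arr f = ext (Dom C f) (F (Cod C f)) (Comp C (\<eta> (Cod C f)) f)"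

definition counit :: "'p \<Rightarrow> 'q" where
  "counit X = ext (Fobj U X) X (Ident C (Fobj U X))"

lemma free_arr:
  assumes f: "f \<in> hom C A B"
  shows "free_arr f \<in> hom V (F A) (F B)" "Comp C (Farr U (free_arr f)) (\<eta> A) = Comp C (\<eta> B) f"
proof -
  have o: "A \<in> Obj C" "B \<in> Obj C" using hom_Obj[OF C f] by auto
  have "Comp C (\<eta> B) f \<in> hom C A (Fobj U (F B))" using comp_hom[OF C f eta] o by auto
  from ext[OF o(1) F[OF o(2)] this]
  show "free_arr f \<in> hom V (F A) (F B)" "Comp C (Farr U (free_arr f)) (\<eta> A) = Comp C (\<eta> B) f"
    by (auto simp: free_arr_def hom_Dom[OF f] hom_Cod[OF f])
qed

lemma counit:
  assumes "X \<in> Obj V"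
  shows "counit X \<in> hom V (F (Fobj U X)) X" "Comp C (Farr U (counit X)) (\<eta> (Fobj U X)) = Ident C (Fobj U X)"
  using ext[of "Fobj U X" X "Ident C (Fobj U X)"] assms functor_Obj[OF U] ident_hom[OF C]
  by (auto simp: counit_def)

definition "T = \<lparr>endo = \<lparr>Fobj = (\<lambda>A. Fobj U (F A)), Farr = (\<lambda>f. Farr U (free_arr f))\<rparr>,
   munit = \<eta>, mmult = (\<lambda>A. Farr U (counit (F A)))\<rparr>"

lemma T_simps [simp]: "Fobj (endo T) A = Fobj U (F A)" "Farr (endo T) f = Farr U (free_arr f)"
  "munit T = \<eta>" "mmult T A = Farr U (counit (F A))"
  by (simp_all add: T_def)

lemma free_arr_ident: "A \<in> Obj C \<Longrightarrow> free_arr (Ident C A) = Ident V (F A)"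
  using free_arr[OF ident_hom[OF C, of A]] F[of A] ident_hom[OF V, of "F A"]
  by (intro ext_unique[of A _ "F A"])
    (auto simp: functor_ident[OF U] comp_ident[OF C eta])

lemma free_arr_comp:
  assumes f: "f \<in> hom C A B" and g: "g \<in> hom C B D"
  shows "free_arr (Comp C g f) = Comp V (free_arr g) (free_arr f)"
proof -
  have o: "A \<in> Obj C" "B \<in> Obj C" "D \<in> Obj C" using hom_Obj[OF C f] hom_Obj[OF C g] by auto
  note gf = comp_hom[OF C f g] and h = functor_hom[OF U free_arr(1)[OF f]] functor_hom[OF U free_arr(1)[OF g]]
  show ?thesis
    using comp_hom[OF V free_arr(1)[OF f] free_arr(1)[OF g]] free_arr[OF gf] o
    by (intro ext_unique[of A _ "F D"])
      (auto simp: functor_comp[OF U free_arr(1)[OF f] free_arr(1)[OF g]] comp_assoc[OF C eta h]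
        free_arr[OF f] comp_assoc[OF C f eta h(2), symmetric] free_arr[OF g] comp_assoc[OF C f g eta])
qed

lemma T_functor: "functor C C (endo T)"
  unfolding functor_def
  using C F functor_Obj[OF U] functor_hom[OF U free_arr(1)]
  by (auto simp: free_arr_ident functor_ident[OF U] free_arr_comp functor_comp[OF U free_arr(1) free_arr(1)])

text \<open>The instance \<open>f = counit (F A)\<close> is the associativity of the monad, and
  \<open>f = counit X\<close> is the associativity law of the algebra carried by
  \<open>U X\<close>.\<close>

lemma counit_natural:
  assumes f: "f \<in> hom V X Y"
  shows "Comp V (counit Y) (free_arr (Farr U f)) = Comp V f (counit X)"
proof -
  have o: "X \<in> Obj V" "Y \<in> Obj V" using hom_Obj[OF V f] by auto
  note uf = functor_hom[OF U f] and uo = functor_Obj[OF U o(1)] functor_Obj[OF U o(2)]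
  note ff = free_arr[OF uf] and c = counit[OF o(1)] counit[OF o(2)]
  show ?thesis
    by (rule ext_unique[OF uo(1) comp_hom[OF V ff(1) c(3)] comp_hom[OF V c(1) f]])
      (simp add: functor_comp[OF U ff(1) c(3)] functor_comp[OF U c(1) f]
        comp_assoc[OF C eta[OF uo(1)] functor_hom[OF U ff(1)] functor_hom[OF U c(3)]] ff(2)
        comp_assoc[OF C eta[OF uo(1)] functor_hom[OF U c(1)] uf] c
        comp_assoc[OF C uf eta[OF uo(2)] functor_hom[OF U c(3)], symmetric]
        comp_ident[OF C uf])
qed

lemma monad_T: "monad C T"
  unfolding monad_def nat_trans_def
proof (intro conjI ballI allI impI)
  fix A assume A: "A \<in> Obj C"
  note FA = F[OF A] and UFA = functor_Obj[OF U F[OF A]] and e = eta[OF A]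
  note c = counit[OF FA] and fa = free_arr[OF e]
  show "mmult T A \<in> hom C (Fobj (comp_ftor (endo T) (endo T)) A) (Fobj (endo T) A)"
    using functor_hom[OF U c(1)] by (simp add: comp_ftor_def)
  show "Comp C (mmult T A) (munit T (Fobj (endo T) A)) = Ident C (Fobj (endo T) A)"
    using c(2) by simp
  have "Comp V (counit (F A)) (free_arr (\<eta> A)) = Ident V (F A)"
    by (rule ext_unique[OF A comp_hom[OF V fa(1) c(1)] ident_hom[OF V FA]])
      (simp add: functor_comp[OF U fa(1) c(1)] functor_ident[OF U FA]
        comp_assoc[OF C e functor_hom[OF U fa(1)] functor_hom[OF U c(1)]] fa(2)
        comp_assoc[OF C e eta[OF UFA] functor_hom[OF U c(1)], symmetric] c(2))
  then show "Comp C (mmult T A) (Farr (endo T) (munit T A)) = Ident C (Fobj (endo T) A)"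
    using functor_comp[OF U fa(1) c(1)] functor_ident[OF U FA] by simp
  have m: "Comp V (counit (F A)) (free_arr (Farr U (counit (F A)))) =
      Comp V (counit (F A)) (counit (F (Fobj U (F A))))"
    by (rule counit_natural[OF c(1)])
  show "Comp C (mmult T A) (mmult T (Fobj (endo T) A)) = Comp C (mmult T A) (Farr (endo T) (mmult T A))"
    using functor_comp[OF U counit(1)[OF F[OF UFA]] c(1)] functor_comp[OF U free_arr(1)[OF functor_hom[OF U c(1)]] c(1)] m
    by simp
next
  fix A B f assume f: "f \<in> hom C A B"
  show "Comp C (munit T B) (Farr id_ftor f) = Comp C (Farr (endo T) f) (munit T A)"
    using free_arr[OF f] by (simp add: id_ftor_def)
  have o: "F A \<in> Obj V" "F B \<in> Obj V" using hom_Obj[OF C f] F by auto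
  note ff = free_arr(1)[OF f]
  show "Comp C (mmult T B) (Farr (comp_ftor (endo T) (endo T)) f) = Comp C (Farr (endo T) f) (mmult T A)"
    using counit_natural[OF ff] functor_comp[OF U counit(1)[OF o(1)] ff]
      functor_comp[OF U free_arr(1)[OF functor_hom[OF U ff]] counit(1)[OF o(2)]]
    by (simp add: comp_ftor_def)
qed (rule T_functor functor_id[OF C] functor_compose[OF T_functor T_functor] | simp add: eta id_ftor_def)+

section \<open>The comparison functor from \<open>V\<close> to the algebras\<close>

definition "compar = \<lparr>Fobj = (\<lambda>X. (Fobj U X, Farr U (counit X))),
  Farr = (\<lambda>f. ((Fobj U (Dom V f), Farr U (counit (Dom V f))), Farr U f,
     (Fobj U (Cod V f), Farr U (counit (Cod V f)))))\<rparr>"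

lemma hom_algebras: "x \<in> hom (algebras C Q) A B \<longleftrightarrow> (\<exists>f. x = (A, f, B) \<and> is_algebra C Q A \<and> is_algebra C Q B \<and>
   f \<in> hom C (fst A) (fst B) \<and> Comp C f (snd A) = Comp C (snd B) (Farr (endo Q) f))"
  by (cases x) (auto simp: hom_def algebras_def)

lemma category_algebras: "category (algebras C T)"
proof -
  have e: "functor C C (endo T)" by (rule T_functor)
  have 1: "Comp C (Comp C g f) a = Comp C d (Farr (endo T) (Comp C g f))"
    if f: "f \<in> hom C A B" and g: "g \<in> hom C B D"
      and a: "a \<in> hom C (Fobj (endo T) A) A" and b: "b \<in> hom C (Fobj (endo T) B) B" and d: "d \<in> hom C (Fobj (endo T) D) D"
      and fa: "Comp C f a = Comp C b (Farr (endo T) f)" and gb: "Comp C g b = Comp C d (Farr (endo T) g)" for f g A B D a b d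
  proof -
    note Tf = functor_hom[OF e f] and Tg = functor_hom[OF e g]
    have "Comp C (Comp C g f) a = Comp C g (Comp C b (Farr (endo T) f))"
      using comp_assoc[OF C a f g] fa by simp
    also have "\<dots> = Comp C d (Comp C (Farr (endo T) g) (Farr (endo T) f))"
      using comp_assoc[OF C Tf b g] gb comp_assoc[OF C Tf Tg d] by simp
    finally show ?thesis using functor_comp[OF e f g] by simp
  qed
  have hI: "(A, f, B) \<in> hom (algebras C T) A B"
    if "is_algebra C T A" "is_algebra C T B" "f \<in> hom C (fst A) (fst B)"
      "Comp C f (snd A) = Comp C (snd B) (Farr (endo T) f)" for A B f
    using that by (simp add: hom_algebras)
  show ?thesis
    unfolding category_def
  proof (intro conjI ballI allI impI)
    fix A assume "A \<in> Obj (algebras C T)"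
    then have A: "is_algebra C T A" "fst A \<in> Obj C" "snd A \<in> hom C (Fobj (endo T) (fst A)) (fst A)"
      by (auto simp: algebras_def is_algebra_def)
    show "Ident (algebras C T) A \<in> hom (algebras C T) A A"
      using hI[OF A(1) A(1) ident_hom[OF C A(2)]] A
      by (simp add: algebras_def functor_ident[OF e, simplified] comp_ident[OF C, simplified])
  next
    fix X Y Z f g
    assume "f \<in> hom (algebras C T) X Y \<and> g \<in> hom (algebras C T) Y Z"
    then obtain f' g' where f: "f = (X, f', Y)" "g = (Y, g', Z)" "is_algebra C T X" "is_algebra C T Y" "is_algebra C T Z"
       "f' \<in> hom C (fst X) (fst Y)" "Comp C f' (snd X) = Comp C (snd Y) (Farr (endo T) f')"
       "g' \<in> hom C (fst Y) (fst Z)" "Comp C g' (snd Y) = Comp C (snd Z) (Farr (endo T) g')"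
      by (auto simp: hom_algebras)
    then show "Comp (algebras C T) g f \<in> hom (algebras C T) X Z"
      using hI[OF f(3,5) comp_hom[OF C f(6,8)] 1[OF f(6,8) _ _ _ f(7,9)]]
      by (simp add: algebras_def is_algebra_def split_beta)
  next
    fix X Y f assume "f \<in> hom (algebras C T) X Y"
    then obtain f' where f: "f = (X, f', Y)" "f' \<in> hom C (fst X) (fst Y)"
      by (auto simp: hom_algebras)
    show "Comp (algebras C T) f (Ident (algebras C T) X) = f" "Comp (algebras C T) (Ident (algebras C T) Y) f = f"
      using f by (auto simp: algebras_def comp_ident[OF C])
  next
    fix W X Y Z f g h
    assume "f \<in> hom (algebras C T) W X \<and> g \<in> hom (algebras C T) X Y \<and> h \<in> hom (algebras C T) Y Z"
    then obtain f' g' h' where f: "f = (W, f', X)" "g = (X, g', Y)" "h = (Y, h', Z)" "f' \<in> hom C (fst W) (fst X)"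
      "g' \<in> hom C (fst X) (fst Y)" "h' \<in> hom C (fst Y) (fst Z)"
      by (auto simp: hom_algebras)
    show "Comp (algebras C T) h (Comp (algebras C T) g f) = Comp (algebras C T) (Comp (algebras C T) h g) f"
      using f by (simp add: algebras_def comp_assoc[OF C f(4-6)])
  qed (auto simp: algebras_def)
qed

lemma is_algebra_compar: assumes X: "X \<in> Obj V" shows "is_algebra C T (Fobj U X, Farr U (counit X))"
proof -
  note c = counit[OF X] and UX = functor_Obj[OF U X]
  show ?thesis unfolding is_algebra_def
    using UX c functor_hom[OF U c(1)] counit_natural[OF c(1)]
      functor_comp[OF U counit(1)[OF F[OF UX]] c(1)] functor_comp[OF U free_arr(1)[OF functor_hom[OF U c(1)]] c(1)]
    by simp
qed

lemma compar_functor: "functor V (algebras C T) compar"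
  unfolding functor_def
proof (intro conjI ballI allI impI)
  fix X Y f assume f: "f \<in> hom V X Y"
  then have o: "X \<in> Obj V" "Y \<in> Obj V" using hom_Obj[OF V] by auto
  show "Farr compar f \<in> hom (algebras C T) (Fobj compar X) (Fobj compar Y)"
    using is_algebra_compar o functor_hom[OF U f] counit_natural[OF f]
      functor_comp[OF U counit(1)[OF o(1)] f] functor_comp[OF U free_arr(1)[OF functor_hom[OF U f]] counit(1)[OF o(2)]]
    by (simp add: hom_algebras compar_def hom_Dom[OF f] hom_Cod[OF f])
next
  fix X assume X: "X \<in> Obj V"
  show "Farr compar (Ident V X) = Ident (algebras C T) (Fobj compar X)"
    using hom_Dom[OF ident_hom[OF V X]] hom_Cod[OF ident_hom[OF V X]]
    by (simp add: compar_def algebras_def functor_ident[OF U X])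
next
  fix X Y Z f g assume "f \<in> hom V X Y \<and> g \<in> hom V Y Z"
  then have f: "f \<in> hom V X Y" and g: "g \<in> hom V Y Z" by auto
  show "Farr compar (Comp V g f) = Comp (algebras C T) (Farr compar g) (Farr compar f)"
    using comp_hom[OF V f g] f g by (simp add: compar_def algebras_def functor_comp[OF U f g] hom_Dom hom_Cod)
qed (use V category_algebras is_algebra_compar in \<open>auto simp: compar_def algebras_def\<close>)

text \<open>Monadicity without coequalizers. For essential surjectivity it is enough that a
  structure map \<open>h\<close>, followed by an isomorphism \<open>\<theta>\<close> of its carrier
  with some \<open>U X\<close>, lifts to \<open>V\<close>: the lift is then the extension of
  \<open>\<theta>\<close> given by the universal property, and this makes \<open>\<theta>\<close> a
  map of algebras.\<close>

lemma monadic: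
  assumes faithful: "\<And>X Y f g. f \<in> hom V X Y \<Longrightarrow> g \<in> hom V X Y \<Longrightarrow> Farr U f = Farr U g \<Longrightarrow> f = g"
    and full: "\<And>X Y g. X \<in> Obj V \<Longrightarrow> Y \<in> Obj V \<Longrightarrow> g \<in> hom C (Fobj U X) (Fobj U Y) \<Longrightarrow>
      Comp C g (Farr U (counit X)) = Comp C (Farr U (counit Y)) (Farr U (free_arr g)) \<Longrightarrow>
      \<exists>f\<in>hom V X Y. Farr U f = g"
    and surj: "\<And>A h. is_algebra C T (A, h) \<Longrightarrow>
      \<exists>X\<in>Obj V. \<exists>\<theta>\<in>hom C A (Fobj U X). iso_arr C \<theta> \<and> (\<exists>g\<in>hom V (F A) X. Farr U g = Comp C \<theta> h)"
  shows "\<exists>Q. monad C Q \<and> equivalent_cats (algebras C Q) V"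
proof -
  note A = category_algebras
  have "equivalent_cats (algebras C T) V"
  proof (rule equivalent_catsI[OF compar_functor])
    fix X Y f g assume "f \<in> hom V X Y" "g \<in> hom V X Y" "Farr compar f = Farr compar g"
    then show "f = g" using faithful by (auto simp: compar_def)
  next
    fix X Y g assume o: "X \<in> Obj V" "Y \<in> Obj V" and g: "g \<in> hom (algebras C T) (Fobj compar X) (Fobj compar Y)"
    then obtain g' where g': "g = (Fobj compar X, g', Fobj compar Y)" "g' \<in> hom C (Fobj U X) (Fobj U Y)"
      "Comp C g' (Farr U (counit X)) = Comp C (Farr U (counit Y)) (Farr U (free_arr g'))"
      by (auto simp: hom_algebras compar_def)
    with full[OF o] obtain f where f: "f \<in> hom V X Y" "Farr U f = g'" by blast
    then show "\<exists>f\<in>hom V X Y. Farr compar f = g"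
      using g' by (intro bexI[OF _ f(1)]) (auto simp: compar_def hom_Dom hom_Cod)
  next
    fix c assume "c \<in> Obj (algebras C T)"
    then have "is_algebra C T c" by (simp add: algebras_def)
    then obtain B h where c: "c = (B, h)" "is_algebra C T (B, h)" by (cases c) auto
    then have B: "B \<in> Obj C" and h: "h \<in> hom C (Fobj U (F B)) B" and h1: "Comp C h (\<eta> B) = Ident C B"
      by (auto simp: is_algebra_def)
    from surj[OF c(2)] obtain X \<theta> g where X: "X \<in> Obj V" and t: "\<theta> \<in> hom C B (Fobj U X)" "iso_arr C \<theta>"
      and g: "g \<in> hom V (F B) X" "Farr U g = Comp C \<theta> h" by blast
    obtain t' where t': "t' \<in> hom C (Fobj U X) B" "Comp C t' \<theta> = Ident C B" "Comp C \<theta> t' = Ident C (Fobj U X)"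
      using iso_arrE[OF t(2,1)] .
    note ft = free_arr[OF t(1)] and cX = counit[OF X] and UX = functor_Obj[OF U X]
    \<comment> \<open>Both sides extend \<open>\<theta>\<close> along \<open>\<eta> B\<close>: the
      left one by naturality of the unit and a triangle identity, the right one by the unit law of
      the algebra.\<close>
    have "Comp V (counit X) (free_arr \<theta>) = g"
    proof (rule ext_unique[OF B comp_hom[OF V ft(1) cX(1)] g(1)])
      have "Comp C (Farr U (Comp V (counit X) (free_arr \<theta>))) (\<eta> B) = \<theta>"
        by (simp add: functor_comp[OF U ft(1) cX(1)] comp_assoc[OF C eta[OF B] functor_hom[OF U ft(1)] functor_hom[OF U cX(1)]]
          ft(2) comp_assoc[OF C t(1) eta[OF UX] functor_hom[OF U cX(1)], symmetric] cX(2) comp_ident[OF C t(1)])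
      also have "\<theta> = Comp C (Farr U g) (\<eta> B)"
        by (simp add: g(2) comp_assoc[OF C eta[OF B] h t(1)] h1 comp_ident[OF C t(1)])
      finally show "Comp C (Farr U (Comp V (counit X) (free_arr \<theta>))) (\<eta> B) = Comp C (Farr U g) (\<eta> B)" .
    qed
    then have eq: "Comp C \<theta> h = Comp C (Farr U (counit X)) (Farr U (free_arr \<theta>))"
      using g(2) functor_comp[OF U ft(1) cX(1)] by simp
    note ft' = free_arr[OF t'(1)]
    have tt: "Comp V (free_arr \<theta>) (free_arr t') = Ident V (F (Fobj U X))"
      using free_arr_comp[OF t'(1) t(1)] t'(3) free_arr_ident[OF UX] by simp
    have tt': "Comp C (Farr U (free_arr \<theta>)) (Farr U (free_arr t')) = Ident C (Fobj U (F (Fobj U X)))"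
      using functor_comp[OF U ft'(1) ft(1)] tt functor_ident[OF U F[OF UX]] by simp
    note Uc = functor_hom[OF U cX(1)] and Ut = functor_hom[OF U ft(1)] and Ut' = functor_hom[OF U ft'(1)]
    \<comment> \<open>The inverse \<open>t'\<close> is a map of algebras too: the free construction
      keeps it inverse to \<open>\<theta>\<close>, so \<open>eq\<close> can be conjugated.\<close>
    have "Comp C t' (Farr U (counit X)) = Comp C t' (Comp C (Farr U (counit X)) (Comp C (Farr U (free_arr \<theta>)) (Farr U (free_arr t'))))"
      by (simp add: tt' comp_ident[OF C Uc])
    also have "\<dots> = Comp C (Comp C t' (Comp C \<theta> h)) (Farr U (free_arr t'))"
      using comp_assoc[OF C Ut' Ut Uc] comp_assoc[OF C Ut' comp_hom[OF C h t(1)] t'(1)] eq by simp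
    also have "Comp C t' (Comp C \<theta> h) = h"
      using comp_assoc[OF C h t(1) t'(1)] t'(2) comp_ident[OF C h] by simp
    finally have eq': "Comp C t' (Farr U (counit X)) = Comp C h (Farr U (free_arr t'))" .
    let ?K = "Fobj compar X"
    have a1: "(c, \<theta>, ?K) \<in> hom (algebras C T) c ?K"
      using c t eq is_algebra_compar[OF X] by (simp add: hom_algebras compar_def)
    have a2: "(?K, t', c) \<in> hom (algebras C T) ?K c"
      using c t' eq' is_algebra_compar[OF X] by (simp add: hom_algebras compar_def)
    have "iso_arr (algebras C T) (c, \<theta>, ?K)"
      by (rule iso_arrI[OF A a1 a2]) (use t' c in \<open>simp_all add: algebras_def compar_def\<close>)
    with X a1 show "\<exists>X\<in>Obj V. \<exists>i\<in>hom (algebras C T) c (Fobj compar X). iso_arr (algebras C T) i" by blast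
  qed
  with monad_T show ?thesis by blast
qed

end

section \<open>Globular sets\<close>

definition app :: "'u gmap \<Rightarrow> nat \<times> 'u \<Rightarrow> nat \<times> 'u" where
  "app f = (\<lambda>(d, x). (d, gfun f d x))"

definition mk_gmap :: "'u gset \<Rightarrow> 'u gset \<Rightarrow> (nat \<Rightarrow> 'u \<Rightarrow> 'u) \<Rightarrow> 'u gmap" where
  "mk_gmap X Y h = GMap X Y (\<lambda>m. \<lambda>x\<in>cells X m. h m x)"

lemma app_simp [simp]: "app f (d, x) = (d, gfun f d x)"
  by (simp add: app_def)

lemma gset_hom_iff: "f \<in> hom (gset_cat n) X Y \<longleftrightarrow> is_gmap n f \<and> gdom f = X \<and> gcod f = Y"
  by (auto simp: hom_def gset_cat_def)

lemma Obj_gset_cat [simp]: "X \<in> Obj (gset_cat n) \<longleftrightarrow> is_gset n X"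
  by (simp add: gset_cat_def)

lemma gset_in: "is_gset n A \<Longrightarrow> x \<in> cells A (Suc m) \<Longrightarrow> gsrc A m x \<in> cells A m"
  "is_gset n A \<Longrightarrow> x \<in> cells A (Suc m) \<Longrightarrow> gtgt A m x \<in> cells A m"
  unfolding is_gset_def by blast+

lemma gset_globular:
  "is_gset n A \<Longrightarrow> x \<in> cells A (Suc (Suc m)) \<Longrightarrow> gsrc A m (gtgt A (Suc m) x) = gsrc A m (gsrc A (Suc m) x)"
  "is_gset n A \<Longrightarrow> x \<in> cells A (Suc (Suc m)) \<Longrightarrow> gtgt A m (gsrc A (Suc m) x) = gtgt A m (gtgt A (Suc m) x)"
  unfolding is_gset_def by auto

lemma gset_dim: "is_gset n A \<Longrightarrow> x \<in> cells A m \<Longrightarrow> m \<le> n"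
  unfolding is_gset_def by (metis empty_iff not_le)

lemma is_gsetI:
  assumes "\<And>m x. x \<in> cells A m \<Longrightarrow> m \<le> n"
    and "\<And>m. gsrc A m \<in> extensional (cells A (Suc m))" "\<And>m. gtgt A m \<in> extensional (cells A (Suc m))"
    and "\<And>m x. x \<in> cells A (Suc m) \<Longrightarrow> gsrc A m x \<in> cells A m"
    and "\<And>m x. x \<in> cells A (Suc m) \<Longrightarrow> gtgt A m x \<in> cells A m"
    and "\<And>m x. x \<in> cells A (Suc (Suc m)) \<Longrightarrow> gsrc A m (gsrc A (Suc m) x) = gsrc A m (gtgt A (Suc m) x)"
    and "\<And>m x. x \<in> cells A (Suc (Suc m)) \<Longrightarrow> gtgt A m (gsrc A (Suc m) x) = gtgt A m (gtgt A (Suc m) x)"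
  shows "is_gset n A"
  unfolding is_gset_def PiE_def Pi_def
proof (intro conjI allI impI ballI)
  fix m assume "n < m"
  then show "cells A m = {}" using assms(1)[of _ m] by fastforce
qed (use assms(2-) in auto)

lemma gset_homD:
  assumes "f \<in> hom (gset_cat n) X Y"
  shows "is_gset n X" "is_gset n Y" "gdom f = X" "gcod f = Y"
  using assms by (auto simp: gset_hom_iff is_gmap_def)

lemma gfun_in: "f \<in> hom (gset_cat n) X Y \<Longrightarrow> x \<in> cells X m \<Longrightarrow> gfun f m x \<in> cells Y m"
  unfolding gset_hom_iff is_gmap_def by blast

lemma gfun_src: "f \<in> hom (gset_cat n) X Y \<Longrightarrow> x \<in> cells X (Suc m) \<Longrightarrow>
    gsrc Y m (gfun f (Suc m) x) = gfun f m (gsrc X m x)"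
  and gfun_tgt: "f \<in> hom (gset_cat n) X Y \<Longrightarrow> x \<in> cells X (Suc m) \<Longrightarrow>
    gtgt Y m (gfun f (Suc m) x) = gfun f m (gtgt X m x)"
  unfolding gset_hom_iff is_gmap_def by blast+

lemma mk_gmap:
  assumes "is_gset n X" "is_gset n Y" "\<And>m x. x \<in> cells X m \<Longrightarrow> h m x \<in> cells Y m"
    and "\<And>m x. x \<in> cells X (Suc m) \<Longrightarrow> gsrc Y m (h (Suc m) x) = h m (gsrc X m x)"
    and "\<And>m x. x \<in> cells X (Suc m) \<Longrightarrow> gtgt Y m (h (Suc m) x) = h m (gtgt X m x)"
  shows "mk_gmap X Y h \<in> hom (gset_cat n) X Y"
  using assms gset_in[OF assms(1)] by (auto simp: gset_hom_iff is_gmap_def mk_gmap_def)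

lemma gfun_mk_gmap [simp]: "x \<in> cells X m \<Longrightarrow> gfun (mk_gmap X Y h) m x = h m x"
  by (simp add: mk_gmap_def)

lemma gmap_eqI:
  assumes f: "f \<in> hom (gset_cat n) X Y" and g: "g \<in> hom (gset_cat n) X Y"
    and eq: "\<And>m x. x \<in> cells X m \<Longrightarrow> gfun f m x = gfun g m x"
  shows "f = g"
proof (rule gmap.expand, intro conjI)
  show "gfun f = gfun g"
  proof
    fix m
    have "gfun f m \<in> extensional (cells X m)" "gfun g m \<in> extensional (cells X m)"
      using f g unfolding gset_hom_iff is_gmap_def PiE_def by auto
    then show "gfun f m = gfun g m" using eq extensionalityI by blast
  qed
qed (use gset_homD[OF f] gset_homD[OF g] in auto)

lemma gfun_comp: "f \<in> hom (gset_cat n) X Y \<Longrightarrow> x \<in> cells X m \<Longrightarrow>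
    gfun (Comp (gset_cat n) g f) m x = gfun g m (gfun f m x)"
  by (auto simp: gset_cat_def hom_def)

lemma gfun_ident [simp]: "x \<in> cells X m \<Longrightarrow> gfun (Ident (gset_cat n) X) m x = x"
  by (simp add: gset_cat_def)

lemma category_gset_cat: "category (gset_cat n :: ('u gset, 'u gmap) cat)"
proof -
  let ?C = "gset_cat n :: ('u gset, 'u gmap) cat"
  have id: "Ident ?C X \<in> hom ?C X X" if "is_gset n X" for X
  proof -
    have "Ident ?C X = mk_gmap X X (\<lambda>m x. x)" by (simp add: gset_cat_def mk_gmap_def)
    then show ?thesis using mk_gmap[of n X X "\<lambda>m x. x"] that by simp
  qed
  have comp: "Comp ?C g f \<in> hom ?C X Z" if "f \<in> hom ?C X Y" "g \<in> hom ?C Y Z" for f g X Y Z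
  proof -
    have "Comp ?C g f = mk_gmap X Z (\<lambda>m x. gfun g m (gfun f m x))"
      using gset_homD[OF that(1)] gset_homD[OF that(2)] by (simp add: gset_cat_def mk_gmap_def)
    then show ?thesis
      using mk_gmap[of n X Z "\<lambda>m x. gfun g m (gfun f m x)"] that gset_homD[OF that(1)] gset_homD[OF that(2)]
      by (simp add: gfun_in gfun_src gfun_tgt)
  qed
  show ?thesis
    unfolding category_def
  proof (intro conjI ballI allI impI)
    fix X Y f assume f: "f \<in> hom ?C X Y"
    note iX = id[OF gset_homD(1)[OF f]] and iY = id[OF gset_homD(2)[OF f]]
    show "Comp ?C f (Ident ?C X) = f"
      by (rule gmap_eqI[OF comp[OF iX f] f]) (simp add: gfun_comp[OF iX])
    show "Comp ?C (Ident ?C Y) f = f"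
      by (rule gmap_eqI[OF comp[OF f iY] f]) (simp add: gfun_comp[OF f] gfun_in[OF f])
  next
    fix W X Y Z f g h assume a: "f \<in> hom ?C W X \<and> g \<in> hom ?C X Y \<and> h \<in> hom ?C Y Z"
    then have f: "f \<in> hom ?C W X" and g: "g \<in> hom ?C X Y" and h: "h \<in> hom ?C Y Z" by auto
    show "Comp ?C h (Comp ?C g f) = Comp ?C (Comp ?C h g) f"
      by (rule gmap_eqI[OF comp[OF comp[OF f g] h] comp[OF f comp[OF g h]]])
        (simp add: gfun_comp[OF f] gfun_comp[OF g] gfun_comp[OF comp[OF f g]] gfun_in[OF f])
  next
    fix f assume "f \<in> Arr ?C"
    then show "Dom ?C f \<in> Obj ?C" "Cod ?C f \<in> Obj ?C" by (simp_all add: gset_cat_def is_gmap_def)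
  qed (use id comp in auto)
qed

lemmas gset_comp_hom = comp_hom[OF category_gset_cat]
  and gset_ident_hom = ident_hom[OF category_gset_cat, simplified]

lemma gset_inverse:
  assumes t: "\<theta> \<in> hom (gset_cat n) X Y" and bij: "\<And>m. bij_betw (gfun \<theta> m) (cells X m) (cells Y m)"
  obtains \<theta>' where "\<theta>' \<in> hom (gset_cat n) Y X"
    "\<And>m x. x \<in> cells X m \<Longrightarrow> gfun \<theta>' m (gfun \<theta> m x) = x"
    "\<And>m y. y \<in> cells Y m \<Longrightarrow> gfun \<theta> m (gfun \<theta>' m y) = y"
proof -
  let ?h = "\<lambda>m. inv_into (cells X m) (gfun \<theta> m)"
  note o = gset_homD[OF t]
  have h: "?h m y \<in> cells X m" "gfun \<theta> m (?h m y) = y" if "y \<in> cells Y m" for m y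
    using bij[of m] that by (metis bij_betw_def inv_into_into, metis bij_betw_def f_inv_into_f)
  have h': "?h m (gfun \<theta> m x) = x" if "x \<in> cells X m" for m x
    using bij[of m] that by (simp add: bij_betw_def)
  have "mk_gmap Y X ?h \<in> hom (gset_cat n) Y X"
  proof (rule mk_gmap)
    fix m y assume y: "y \<in> cells Y (Suc m)"
    show "gsrc X m (?h (Suc m) y) = ?h m (gsrc Y m y)"
      using h'[of "gsrc X m (?h (Suc m) y)" m] gfun_src[OF t h(1)[OF y]] h[OF y] gset_in[OF o(1)] by simp
    show "gtgt X m (?h (Suc m) y) = ?h m (gtgt Y m y)"
      using h'[of "gtgt X m (?h (Suc m) y)" m] gfun_tgt[OF t h(1)[OF y]] h[OF y] gset_in[OF o(1)] by simp
  qed (use o h in auto)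
  then show ?thesis by (rule that) (use h h' gfun_in[OF t] in auto)
qed

lemma gset_iso_arr:
  assumes t: "\<theta> \<in> hom (gset_cat n) X Y" and bij: "\<And>m. bij_betw (gfun \<theta> m) (cells X m) (cells Y m)"
  shows "iso_arr (gset_cat n) \<theta>"
proof -
  obtain \<theta>' where t': "\<theta>' \<in> hom (gset_cat n) Y X"
    "\<And>m x. x \<in> cells X m \<Longrightarrow> gfun \<theta>' m (gfun \<theta> m x) = x"
    "\<And>m y. y \<in> cells Y m \<Longrightarrow> gfun \<theta> m (gfun \<theta>' m y) = y"
    using gset_inverse[OF assms] by blast
  note o = gset_homD[OF t]
  show ?thesis
  proof (rule iso_arrI[OF category_gset_cat t t'(1)])
    show "Comp (gset_cat n) \<theta>' \<theta> = Ident (gset_cat n) X"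
      by (rule gmap_eqI[OF gset_comp_hom[OF t t'(1)] gset_ident_hom[OF o(1)]]) (simp add: gfun_comp[OF t] t'(2))
    show "Comp (gset_cat n) \<theta> \<theta>' = Ident (gset_cat n) Y"
      by (rule gmap_eqI[OF gset_comp_hom[OF t'(1) t] gset_ident_hom[OF o(2)]]) (simp add: gfun_comp[OF t'(1)] t'(3))
  qed
qed

section \<open>Categories of globular sets with partial operations\<close>

text \<open>
  Operations are named by symbols \<open>\<sigma>\<close>. Their arguments are lists of cells tagged with their dimension;
  \<open>Dm A \<sigma> xs\<close> means that \<open>xs\<close> is in the domain of \<open>\<sigma>\<close>, and \<open>rd \<sigma>\<close> is the dimension of the result.
\<close>

definition phom :: "nat \<Rightarrow> ('u gset \<Rightarrow> 's \<Rightarrow> (nat \<times> 'u) list \<Rightarrow> bool) \<Rightarrow> ('s \<Rightarrow> nat) \<Rightarrow>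
    'u gset \<Rightarrow> ('s \<Rightarrow> (nat \<times> 'u) list \<Rightarrow> 'u) \<Rightarrow> 'u gset \<Rightarrow> ('s \<Rightarrow> (nat \<times> 'u) list \<Rightarrow> 'u) \<Rightarrow> 'u gmap \<Rightarrow> bool"
where
  "phom n Dm rd A e B e' f \<longleftrightarrow> f \<in> hom (gset_cat n) A B \<and>
     (\<forall>\<sigma> xs. Dm A \<sigma> xs \<longrightarrow> gfun f (rd \<sigma>) (e \<sigma> xs) = e' \<sigma> (map (app f) xs))"

text \<open>Isomorphism with a structure that comes from \<open>V\<close>. A dimensionwise bijective
  homomorphism suffices, since by \<open>phom_inverse\<close> its inverse preserves the operations
  as well.\<close>

definition rep :: "nat \<Rightarrow> ('o, 'm) cat \<Rightarrow> ('o, 'm, 'u gset, 'u gmap) ftor \<Rightarrow>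
    ('u gset \<Rightarrow> 's \<Rightarrow> (nat \<times> 'u) list \<Rightarrow> bool) \<Rightarrow> ('s \<Rightarrow> nat) \<Rightarrow> ('o \<Rightarrow> 's \<Rightarrow> (nat \<times> 'u) list \<Rightarrow> 'u) \<Rightarrow>
    'u gset \<Rightarrow> ('s \<Rightarrow> (nat \<times> 'u) list \<Rightarrow> 'u) \<Rightarrow> bool"
where
  "rep n V U Dm rd ev T e \<longleftrightarrow> (\<exists>N\<in>Obj V. \<exists>\<theta>. phom n Dm rd T e (Fobj U N) (ev N) \<theta> \<and>
     (\<forall>m. bij_betw (gfun \<theta> m) (cells T m) (cells (Fobj U N) m)))"

text \<open>What the induction on \<open>n\<close> carries: through \<open>U\<close>, the category
  \<open>V\<close> is a full subcategory of structures (\<open>phom_arr\<close>,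
  \<open>lift_arr\<close>, \<open>faithful\<close>) with the closure properties
  \<open>rep_sub\<close> and \<open>rep_quot\<close>. By \<open>Dm_reflect\<close> a jointly
  injective family detects domains, so that argument lists in a free object can be tested
  componentwise; the empty family detects nothing and is excluded. \<open>Dm_rd\<close> keeps
  results in the dimensions where products have tuples. In \<open>rep_sub\<close> only distinct
  cells are to be separated, so a structure with at most one cell in each dimension qualifies; this
  gives the terminal object.\<close>

locale opcat =
  fixes n :: nat and V :: "('o, 'm) cat" and U :: "('o, 'm, 'u gset, 'u gmap) ftor"
    and Dm :: "'u gset \<Rightarrow> 's \<Rightarrow> (nat \<times> 'u) list \<Rightarrow> bool" and rd :: "'s \<Rightarrow> nat"
    and ev :: "'o \<Rightarrow> 's \<Rightarrow> (nat \<times> 'u) list \<Rightarrow> 'u"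
  assumes U: "functor V (gset_cat n) U"
    and Dm_map: "\<And>A B f \<sigma> xs. f \<in> hom (gset_cat n) A B \<Longrightarrow> Dm A \<sigma> xs \<Longrightarrow> Dm B \<sigma> (map (app f) xs)"
    and Dm_cells: "\<And>A \<sigma> xs d x. is_gset n A \<Longrightarrow> Dm A \<sigma> xs \<Longrightarrow> (d, x) \<in> set xs \<Longrightarrow> x \<in> cells A d"
    and Dm_reflect: "\<And>T S \<sigma> xs. is_gset n T \<Longrightarrow> S \<noteq> {} \<Longrightarrow>
      (\<And>f. f \<in> S \<Longrightarrow> f \<in> hom (gset_cat n) T (gcod f)) \<Longrightarrow>
      (\<And>f. f \<in> S \<Longrightarrow> Dm (gcod f) \<sigma> (map (app f) xs)) \<Longrightarrow>
      (\<And>d x y. x \<in> cells T d \<Longrightarrow> y \<in> cells T d \<Longrightarrow> (\<And>f. f \<in> S \<Longrightarrow> gfun f d x = gfun f d y) \<Longrightarrow> x = y) \<Longrightarrow>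
      (\<And>d x. (d, x) \<in> set xs \<Longrightarrow> x \<in> cells T d) \<Longrightarrow> Dm T \<sigma> xs"
    and Dm_rd: "\<And>A \<sigma> xs. is_gset n A \<Longrightarrow> Dm A \<sigma> xs \<Longrightarrow> rd \<sigma> \<le> n"
    and ev_cells: "\<And>X \<sigma> xs. X \<in> Obj V \<Longrightarrow> Dm (Fobj U X) \<sigma> xs \<Longrightarrow> ev X \<sigma> xs \<in> cells (Fobj U X) (rd \<sigma>)"
    and faithful: "\<And>X Y f g. f \<in> hom V X Y \<Longrightarrow> g \<in> hom V X Y \<Longrightarrow> Farr U f = Farr U g \<Longrightarrow> f = g"
    and phom_arr: "\<And>X Y f. f \<in> hom V X Y \<Longrightarrow> phom n Dm rd (Fobj U X) (ev X) (Fobj U Y) (ev Y) (Farr U f)"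
    and lift_arr: "\<And>X Y f. X \<in> Obj V \<Longrightarrow> Y \<in> Obj V \<Longrightarrow>
      phom n Dm rd (Fobj U X) (ev X) (Fobj U Y) (ev Y) f \<Longrightarrow> \<exists>g\<in>hom V X Y. Farr U g = f"
    and rep_sub: "\<And>T e. is_gset n T \<Longrightarrow> (\<And>\<sigma> xs. Dm T \<sigma> xs \<Longrightarrow> e \<sigma> xs \<in> cells T (rd \<sigma>)) \<Longrightarrow>
      (\<And>m x y. x \<in> cells T m \<Longrightarrow> y \<in> cells T m \<Longrightarrow> x \<noteq> y \<Longrightarrow>
         \<exists>M\<in>Obj V. \<exists>f. phom n Dm rd T e (Fobj U M) (ev M) f \<and> gfun f m x \<noteq> gfun f m y) \<Longrightarrow>
      rep n V U Dm rd ev T e"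
    and rep_quot: "\<And>M T e q s. M \<in> Obj V \<Longrightarrow> phom n Dm rd (Fobj U M) (ev M) T e q \<Longrightarrow>
      s \<in> hom (gset_cat n) T (Fobj U M) \<Longrightarrow> (\<And>m x. x \<in> cells T m \<Longrightarrow> gfun q m (gfun s m x) = x) \<Longrightarrow>
      rep n V U Dm rd ev T e"
begin

lemmas V = functor_cat(1)[OF U]

lemma gset_U: "X \<in> Obj V \<Longrightarrow> is_gset n (Fobj U X)"
  using functor_Obj[OF U] by auto

lemma U_hom: "f \<in> hom V X Y \<Longrightarrow> Farr U f \<in> hom (gset_cat n) (Fobj U X) (Fobj U Y)"
  using functor_hom[OF U] .

lemma act_ev: "f \<in> hom V X Y \<Longrightarrow> Dm (Fobj U X) \<sigma> xs \<Longrightarrow>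
    gfun (Farr U f) (rd \<sigma>) (ev X \<sigma> xs) = ev Y \<sigma> (map (app (Farr U f)) xs)"
  using phom_arr unfolding phom_def by blast

lemma act_comp: "f \<in> hom V X Y \<Longrightarrow> g \<in> hom V Y Z \<Longrightarrow> x \<in> cells (Fobj U X) m \<Longrightarrow>
    gfun (Farr U (Comp V g f)) m x = gfun (Farr U g) m (gfun (Farr U f) m x)"
  by (simp add: functor_comp[OF U] gfun_comp[OF U_hom])

lemma act_in: "f \<in> hom V X Y \<Longrightarrow> x \<in> cells (Fobj U X) m \<Longrightarrow> gfun (Farr U f) m x \<in> cells (Fobj U Y) m"
  by (rule gfun_in[OF U_hom])

lemma arr_eqI: "f \<in> hom V X Y \<Longrightarrow> g \<in> hom V X Y \<Longrightarrow>
    (\<And>m x. x \<in> cells (Fobj U X) m \<Longrightarrow> gfun (Farr U f) m x = gfun (Farr U g) m x) \<Longrightarrow> f = g"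
  by (rule faithful, assumption, assumption, rule gmap_eqI[OF U_hom U_hom])

lemma map_app_comp:
  assumes "is_gset n A" "Dm A \<sigma> xs" "\<And>d x. x \<in> cells A d \<Longrightarrow> gfun h d x = gfun g d (gfun f d x)"
  shows "map (app h) xs = map (app g) (map (app f) xs)"
  using assms Dm_cells[OF assms(1,2)] by auto

lemma map_app_ident:
  assumes "is_gset n A" "Dm A \<sigma> xs" "\<And>d x. x \<in> cells A d \<Longrightarrow> gfun h d x = x"
  shows "map (app h) xs = xs"
  using assms Dm_cells[OF assms(1,2)] by (auto intro: map_idI)

lemma phom_comp:
  assumes f: "phom n Dm rd A e B e' f" and g: "phom n Dm rd B e' D e'' g"
    and e: "\<And>\<sigma> xs. Dm A \<sigma> xs \<Longrightarrow> e \<sigma> xs \<in> cells A (rd \<sigma>)"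
  shows "phom n Dm rd A e D e'' (Comp (gset_cat n) g f)"
proof -
  have fh: "f \<in> hom (gset_cat n) A B" and gh: "g \<in> hom (gset_cat n) B D" using f g by (auto simp: phom_def)
  have "gfun (Comp (gset_cat n) g f) (rd \<sigma>) (e \<sigma> xs) = e'' \<sigma> (map (app (Comp (gset_cat n) g f)) xs)" if "Dm A \<sigma> xs" for \<sigma> xs
  proof -
    have "map (app (Comp (gset_cat n) g f)) xs = map (app g) (map (app f) xs)"
      by (rule map_app_comp[OF gset_homD(1)[OF fh] that]) (rule gfun_comp[OF fh])
    then show ?thesis
      using that f g Dm_map[OF fh that] by (simp add: phom_def gfun_comp[OF fh e[OF that]] del: map_map)
  qed
  then show ?thesis using gset_comp_hom[OF fh gh] by (simp add: phom_def)
qed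

lemma phom_inverse:
  assumes t: "phom n Dm rd A e B e' \<theta>" and t': "\<theta>' \<in> hom (gset_cat n) B A"
    and i: "\<And>m x. x \<in> cells A m \<Longrightarrow> gfun \<theta>' m (gfun \<theta> m x) = x"
    and i': "\<And>m y. y \<in> cells B m \<Longrightarrow> gfun \<theta> m (gfun \<theta>' m y) = y"
    and e: "\<And>\<sigma> xs. Dm A \<sigma> xs \<Longrightarrow> e \<sigma> xs \<in> cells A (rd \<sigma>)"
  shows "phom n Dm rd B e' A e \<theta>'"
  unfolding phom_def
proof (intro conjI allI impI t')
  fix \<sigma> xs assume D: "Dm B \<sigma> xs"
  have D': "Dm A \<sigma> (map (app \<theta>') xs)" by (rule Dm_map[OF t' D])
  have "map (app \<theta>) (map (app \<theta>') xs) = xs"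
    using Dm_cells[OF gset_homD(1)[OF t'] D] i' by (auto intro: map_idI)
  then have "e' \<sigma> xs = gfun \<theta> (rd \<sigma>) (e \<sigma> (map (app \<theta>') xs))" using t D' by (simp add: phom_def)
  then show "gfun \<theta>' (rd \<sigma>) (e' \<sigma> xs) = e \<sigma> (map (app \<theta>') xs)" using i[OF e[OF D']] by simp
qed

lemma rep_iso:
  assumes "rep n V U Dm rd ev T e" and e: "\<And>\<sigma> xs. Dm T \<sigma> xs \<Longrightarrow> e \<sigma> xs \<in> cells T (rd \<sigma>)"
  obtains N \<theta> \<theta>' where "N \<in> Obj V" "phom n Dm rd T e (Fobj U N) (ev N) \<theta>" "phom n Dm rd (Fobj U N) (ev N) T e \<theta>'"
    "\<And>m x. x \<in> cells T m \<Longrightarrow> gfun \<theta>' m (gfun \<theta> m x) = x"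
    "\<And>m y. y \<in> cells (Fobj U N) m \<Longrightarrow> gfun \<theta> m (gfun \<theta>' m y) = y"
proof -
  obtain N \<theta> where N: "N \<in> Obj V" and t: "phom n Dm rd T e (Fobj U N) (ev N) \<theta>"
    and b: "\<And>m. bij_betw (gfun \<theta> m) (cells T m) (cells (Fobj U N) m)"
    using assms(1) unfolding rep_def by blast
  obtain \<theta>' where "\<theta>' \<in> hom (gset_cat n) (Fobj U N) T" "\<And>m x. x \<in> cells T m \<Longrightarrow> gfun \<theta>' m (gfun \<theta> m x) = x"
    "\<And>m y. y \<in> cells (Fobj U N) m \<Longrightarrow> gfun \<theta> m (gfun \<theta>' m y) = y"
    using gset_inverse[of \<theta> n T "Fobj U N"] b t unfolding phom_def by blast
  with that[OF N t phom_inverse[OF t _ _ _ e]] show ?thesis by blast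
qed

end

text \<open>Products, enriched homs and free objects have tuples or terms as cells. The codes
  \<open>enl\<close> and \<open>es\<close> bring these back into \<open>'u\<close>, where the cells
  of an object of \<open>V\<close> must lie.\<close>

locale coded_opcat = opcat n V U Dm rd ev
  for n :: nat and V :: "('o, 'm) cat" and U :: "('o, 'm, 'u gset, 'u gmap) ftor"
    and Dm :: "'u gset \<Rightarrow> 's \<Rightarrow> (nat \<times> 'u) list \<Rightarrow> bool" and rd :: "'s \<Rightarrow> nat"
    and ev :: "'o \<Rightarrow> 's \<Rightarrow> (nat \<times> 'u) list \<Rightarrow> 'u" +
  fixes enl :: "'u list \<Rightarrow> 'u" and es :: "'s \<Rightarrow> 'u"
  assumes inj_enl: "inj enl" and inj_es: "inj es"
begin

lemma enl_eq [simp]: "enl xs = enl ys \<longleftrightarrow> xs = ys"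
  using inj_enl by (auto dest: injD)

lemma es_eq [simp]: "es s = es t \<longleftrightarrow> s = t"
  using inj_es by (auto dest: injD)

text \<open>Numerals inside \<open>'u\<close>, used as tags; they differ because lists of different
  lengths have different codes.\<close>

definition nt :: "nat \<Rightarrow> 'u" where "nt k = enl (replicate k undefined)"

lemma nt_eq [simp]: "nt j = nt k \<longleftrightarrow> j = k"
  unfolding nt_def enl_eq by (metis length_replicate)

lemma inv_enl [simp]: "inv enl (enl xs) = xs"
  by (rule inv_f_f[OF inj_enl])

abbreviation cel :: "'o \<Rightarrow> nat \<Rightarrow> 'u set" where "cel X d \<equiv> cells (Fobj U X) d"
abbreviation act :: "'m \<Rightarrow> nat \<Rightarrow> 'u \<Rightarrow> 'u" where "act f \<equiv> gfun (Farr U f)"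

subsection \<open>Finite products\<close>

text \<open>A cone that is a product in each dimension separately. The bound
  \<open>d \<le> n\<close> matters when \<open>Xs\<close> is empty: otherwise the empty tuple would
  have to come from a cell in every dimension.\<close>

definition ccone :: "'o list \<Rightarrow> 'o \<Rightarrow> 'm list \<Rightarrow> bool" where
  "ccone Xs N prs \<longleftrightarrow> N \<in> Obj V \<and> list_all2 (\<lambda>pr X. pr \<in> hom V N X) prs Xs \<and>
     (\<forall>d ys. d \<le> n \<and> list_all2 (\<lambda>y X. y \<in> cel X d) ys Xs \<longrightarrow>
        (\<exists>x\<in>cel N d. map (\<lambda>pr. act pr d x) prs = ys)) \<and>
     (\<forall>d. \<forall>x\<in>cel N d. \<forall>x'\<in>cel N d. map (\<lambda>pr. act pr d x) prs = map (\<lambda>pr. act pr d x') prs \<longrightarrow> x = x')"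

text \<open>The product of the underlying globular sets, with componentwise operations, is separated
  by its projections, and these are homomorphisms to objects of \<open>V\<close>. So
  \<open>rep_sub\<close> applies, and fullness lifts the projections.\<close>

lemma ccone_exists:
  assumes Xs: "set Xs \<subseteq> Obj V"
  shows "\<exists>N prs. ccone Xs N prs"
proof -
  define k where "k = length Xs"
  have X: "Xs ! i \<in> Obj V" "is_gset n (Fobj U (Xs ! i))" if "i < k" for i
    using Xs that by (auto simp: k_def intro!: gset_U)
  define C where "C d = {enl ys | ys. d \<le> n \<and> length ys = k \<and> (\<forall>i<k. ys ! i \<in> cel (Xs ! i) d)}" for d
  define sr where "sr d z = enl (map (\<lambda>i. gsrc (Fobj U (Xs ! i)) d (inv enl z ! i)) [0..<k])" for d z
  define tg where "tg d z = enl (map (\<lambda>i. gtgt (Fobj U (Xs ! i)) d (inv enl z ! i)) [0..<k])" for d z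
  define T where "T = GSet C (\<lambda>d. \<lambda>z\<in>C (Suc d). sr d z) (\<lambda>d. \<lambda>z\<in>C (Suc d). tg d z)"
  have C_I: "enl ys \<in> C d" if "d \<le> n" "length ys = k" "\<And>i. i < k \<Longrightarrow> ys ! i \<in> cel (Xs ! i) d" for ys d
    using that unfolding C_def by blast
  have C_E: "\<exists>ys. z = enl ys \<and> d \<le> n \<and> length ys = k \<and> (\<forall>i<k. ys ! i \<in> cel (Xs ! i) d)" if "z \<in> C d" for z d
    using that unfolding C_def by blast
  have st: "sr d z \<in> C d" "tg d z \<in> C d" if z: "z \<in> C (Suc d)" for d z
  proof -
    obtain ys where "z = enl ys" "Suc d \<le> n" "length ys = k" "\<forall>i<k. ys ! i \<in> cel (Xs ! i) (Suc d)"
      using C_E[OF z] by blast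
    then show "sr d z \<in> C d" "tg d z \<in> C d"
      unfolding sr_def tg_def by (auto intro!: C_I simp: gset_in[OF X(2)])
  qed
  have gT: "is_gset n T"
  proof (rule is_gsetI)
    fix d z assume z: "z \<in> cells T (Suc (Suc d))"
    then have zC: "z \<in> C (Suc (Suc d))" by (simp add: T_def)
    obtain ys where ys: "z = enl ys" "length ys = k" "\<forall>i<k. ys ! i \<in> cel (Xs ! i) (Suc (Suc d))"
      using C_E[OF zC] by blast
    then show "gsrc T d (gsrc T (Suc d) z) = gsrc T d (gtgt T (Suc d) z)"
      "gtgt T d (gsrc T (Suc d) z) = gtgt T d (gtgt T (Suc d) z)"
      using st[OF zC] zC X(2)
      by (auto simp: T_def sr_def[of _ "sr _ _"] tg_def[of _ "sr _ _"] sr_def[of _ "tg _ _"] tg_def[of _ "tg _ _"])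
         (auto simp: sr_def tg_def gset_globular[OF X(2)])
  qed (use C_E st in \<open>auto simp: T_def\<close>)
  define p where "p i = mk_gmap T (Fobj U (Xs ! i)) (\<lambda>d z. inv enl z ! i)" for i
  have p: "p i \<in> hom (gset_cat n) T (Fobj U (Xs ! i))" if i: "i < k" for i
    unfolding p_def
  proof (rule mk_gmap[OF gT X(2)[OF i]])
    fix m x assume "x \<in> cells T m"
    then have "x \<in> C m" by (simp add: T_def)
    then show "inv enl x ! i \<in> cel (Xs ! i) m" using i by (auto simp: C_def)
  qed (use i in \<open>auto simp: T_def sr_def tg_def\<close>)
  have pz: "gfun (p i) d (enl ys) = ys ! i" if "enl ys \<in> C d" for i d ys
    using that by (simp add: p_def T_def)
  define e where "e \<sigma> xs = enl (map (\<lambda>i. ev (Xs ! i) \<sigma> (map (app (p i)) xs)) [0..<k])" for \<sigma> xs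
  have e: "e \<sigma> xs \<in> C (rd \<sigma>)" if "Dm T \<sigma> xs" for \<sigma> xs
    unfolding e_def
    using that Dm_rd[OF gT that] by (intro C_I) (auto intro!: ev_cells X Dm_map[OF p])
  have pp: "phom n Dm rd T e (Fobj U (Xs ! i)) (ev (Xs ! i)) (p i)" if "i < k" for i
    unfolding phom_def
  proof (intro conjI allI impI p[OF that])
    fix \<sigma> xs assume "Dm T \<sigma> xs"
    then have "enl (map (\<lambda>i. ev (Xs ! i) \<sigma> (map (app (p i)) xs)) [0..<k]) \<in> C (rd \<sigma>)"
      using e by (simp add: e_def)
    from pz[OF this] show "gfun (p i) (rd \<sigma>) (e \<sigma> xs) = ev (Xs ! i) \<sigma> (map (app (p i)) xs)"
      using that by (simp add: e_def)
  qed
  have "rep n V U Dm rd ev T e"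
  proof (rule rep_sub[OF gT])
    fix d x y assume xy: "x \<in> cells T d" "y \<in> cells T d" "x \<noteq> y"
    then have "x \<in> C d" "y \<in> C d" by (simp_all add: T_def)
    then obtain xs ys where *: "x = enl xs" "y = enl ys" "length xs = k" "length ys = k"
      "enl xs \<in> C d" "enl ys \<in> C d"
      using C_E by metis
    with xy obtain i where i: "i < k" "xs ! i \<noteq> ys ! i" by (metis nth_equalityI)
    then have "gfun (p i) d x \<noteq> gfun (p i) d y" using * pz by simp
    with pp[OF i(1)] X(1)[OF i(1)]
    show "\<exists>M\<in>Obj V. \<exists>f. phom n Dm rd T e (Fobj U M) (ev M) f \<and> gfun f d x \<noteq> gfun f d y" by blast
  qed (simp add: e T_def)
  from rep_iso[OF this] e obtain N \<theta> \<theta>' where N: "N \<in> Obj V"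
    and t: "phom n Dm rd T e (Fobj U N) (ev N) \<theta>" and t': "phom n Dm rd (Fobj U N) (ev N) T e \<theta>'"
    and i: "\<And>m x. x \<in> cells T m \<Longrightarrow> gfun \<theta>' m (gfun \<theta> m x) = x"
    and i': "\<And>m y. y \<in> cel N m \<Longrightarrow> gfun \<theta> m (gfun \<theta>' m y) = y"
    by (auto simp: T_def)
  have th: "\<theta> \<in> hom (gset_cat n) T (Fobj U N)" "\<theta>' \<in> hom (gset_cat n) (Fobj U N) T"
    using t t' by (auto simp: phom_def)
  have "\<exists>g\<in>hom V N (Xs ! i). Farr U g = Comp (gset_cat n) (p i) \<theta>'" if "i < k" for i
    using lift_arr[OF N X(1)[OF that] phom_comp[OF t' pp[OF that]]] ev_cells[OF N] by blast
  then obtain pr where pr: "\<And>i. i < k \<Longrightarrow> pr i \<in> hom V N (Xs ! i)"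
    "\<And>i. i < k \<Longrightarrow> Farr U (pr i) = Comp (gset_cat n) (p i) \<theta>'" by metis
  have pa: "act (pr i) d x = gfun (p i) d (gfun \<theta>' d x)" if "i < k" "x \<in> cel N d" for i d x
    using that by (simp add: pr(2) gfun_comp[OF th(2)])
  have "ccone Xs N (map pr [0..<k])"
    unfolding ccone_def
  proof (intro conjI allI impI ballI N)
    show "list_all2 (\<lambda>pr X. pr \<in> hom V N X) (map pr [0..<k]) Xs"
      using pr(1) by (auto simp: list_all2_conv_all_nth k_def)
  next
    fix d ys assume a: "d \<le> n \<and> list_all2 (\<lambda>y X. y \<in> cel X d) ys Xs"
    then have y: "enl ys \<in> C d" "length ys = k" by (auto intro!: C_I simp: list_all2_conv_all_nth k_def)
    then have "gfun \<theta> d (enl ys) \<in> cel N d" using gfun_in[OF th(1)] by (simp add: T_def)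
    moreover have "map (\<lambda>pr. act pr d (gfun \<theta> d (enl ys))) (map pr [0..<k]) = ys"
    proof (rule nth_equalityI)
      fix j assume "j < length (map (\<lambda>pr. act pr d (gfun \<theta> d (enl ys))) (map pr [0..<k]))"
      then have j: "j < k" by simp
      have "gfun \<theta>' d (gfun \<theta> d (enl ys)) = enl ys" using i y by (simp add: T_def)
      then show "map (\<lambda>pr. act pr d (gfun \<theta> d (enl ys))) (map pr [0..<k]) ! j = ys ! j"
        using pa[OF j calculation] pz[OF y(1)] j by simp
    qed (simp add: y)
    ultimately show "\<exists>x\<in>cel N d. map (\<lambda>pr. act pr d x) (map pr [0..<k]) = ys" by blast
  next
    fix d x x' assume x: "x \<in> cel N d" "x' \<in> cel N d"
      and eq: "map (\<lambda>pr. act pr d x) (map pr [0..<k]) = map (\<lambda>pr. act pr d x') (map pr [0..<k])"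
    have "gfun \<theta>' d x \<in> C d" "gfun \<theta>' d x' \<in> C d" using gfun_in[OF th(2)] x by (auto simp: T_def)
    then obtain xs xs' where *: "gfun \<theta>' d x = enl xs" "gfun \<theta>' d x' = enl xs'" "length xs = k" "length xs' = k"
      "enl xs \<in> C d" "enl xs' \<in> C d" using C_E by metis
    have "xs = xs'"
    proof (rule nth_equalityI)
      fix j assume "j < length xs"
      then have j: "j < k" using *(3) by simp
      show "xs ! j = xs' ! j"
        using arg_cong[OF eq, of "\<lambda>l. l ! j"] pa[OF j x(1)] pa[OF j x(2)] pz[OF *(5)] pz[OF *(6)] *(1,2) j
        by simp
    qed (simp add: *)
    then show "x = x'" using i' x * by metis
  qed
  then show ?thesis by blast
qed

lemma ccone_pr:
  assumes c: "ccone Xs N prs" and i: "i < length Xs"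
  shows "prs ! i \<in> hom V N (Xs ! i)" "Xs ! i \<in> Obj V"
proof -
  show *: "prs ! i \<in> hom V N (Xs ! i)" using c i by (auto simp: ccone_def list_all2_conv_all_nth)
  show "Xs ! i \<in> Obj V" using hom_Obj[OF V *] by simp
qed

lemma ccone_len: "ccone Xs N prs \<Longrightarrow> length prs = length Xs"
  by (auto simp: ccone_def list_all2_conv_all_nth)

lemma ccone_Obj: "ccone Xs N prs \<Longrightarrow> N \<in> Obj V"
  by (auto simp: ccone_def)

lemma ccone_eq:
  assumes "ccone Xs N prs" "x \<in> cel N d" "x' \<in> cel N d"
    "\<And>i. i < length Xs \<Longrightarrow> act (prs ! i) d x = act (prs ! i) d x'"
  shows "x = x'"
proof -
  have "map (\<lambda>pr. act pr d x) prs = map (\<lambda>pr. act pr d x') prs"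
    using assms(4) ccone_len[OF assms(1)] by (simp add: list_eq_iff_nth_eq)
  with assms(1-3) show ?thesis unfolding ccone_def by blast
qed

text \<open>The tupling map is chosen cell by cell. It commutes with sources and targets because the
  projections do and are jointly injective.\<close>

lemma ccone_tuple:
  assumes c: "ccone Xs N prs" and Z: "is_gset n Z"
    and fs: "list_all2 (\<lambda>f X. f \<in> hom (gset_cat n) Z (Fobj U X)) fs Xs"
  obtains h where "h \<in> hom (gset_cat n) Z (Fobj U N)"
    "\<And>d z i. z \<in> cells Z d \<Longrightarrow> i < length Xs \<Longrightarrow> act (prs ! i) d (gfun h d z) = gfun (fs ! i) d z"
proof -
  have f: "fs ! i \<in> hom (gset_cat n) Z (Fobj U (Xs ! i))" if "i < length Xs" for i
    using fs that by (auto simp: list_all2_conv_all_nth)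
  have "\<exists>x\<in>cel N d. map (\<lambda>pr. act pr d x) prs = map (\<lambda>f. gfun f d z) fs" if z: "z \<in> cells Z d" for d z
  proof -
    have "list_all2 (\<lambda>y X. y \<in> cel X d) (map (\<lambda>f. gfun f d z) fs) Xs"
      using fs z gfun_in[OF f z] by (auto simp: list_all2_conv_all_nth)
    then show ?thesis using c gset_dim[OF Z z] unfolding ccone_def by blast
  qed
  note ex = this
  define h where "h d z = (SOME x. x \<in> cel N d \<and> map (\<lambda>pr. act pr d x) prs = map (\<lambda>f. gfun f d z) fs)" for d z
  have h: "h d z \<in> cel N d" and hm: "map (\<lambda>pr. act pr d (h d z)) prs = map (\<lambda>f. gfun f d z) fs"
    if "z \<in> cells Z d" for d z
    using someI_ex[of "\<lambda>x. x \<in> cel N d \<and> map (\<lambda>pr. act pr d x) prs = map (\<lambda>f. gfun f d z) fs"] ex[OF that]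
    unfolding h_def by blast+
  have hp: "act (prs ! i) d (h d z) = gfun (fs ! i) d z" if "z \<in> cells Z d" "i < length Xs" for i d z
    using arg_cong[OF hm[OF that(1)], of "\<lambda>l. l ! i"] that(2) ccone_len[OF c] fs
    by (simp add: list_all2_conv_all_nth)
  note NO = ccone_Obj[OF c]
  have hh: "mk_gmap Z (Fobj U N) h \<in> hom (gset_cat n) Z (Fobj U N)"
  proof (rule mk_gmap[OF Z gset_U[OF NO] h])
    fix m z assume z: "z \<in> cells Z (Suc m)"
    note s = gset_in[OF gset_U[OF NO] h[OF z]] and s' = gset_in[OF Z z]
    show "gsrc (Fobj U N) m (h (Suc m) z) = h m (gsrc Z m z)"
      by (rule ccone_eq[OF c s(1) h[OF s'(1)]])
        (simp add: gfun_src[OF U_hom[OF ccone_pr(1)[OF c]] h[OF z], symmetric] hp[OF z] hp[OF s'(1)] gfun_src[OF f z])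
    show "gtgt (Fobj U N) m (h (Suc m) z) = h m (gtgt Z m z)"
      by (rule ccone_eq[OF c s(2) h[OF s'(2)]])
        (simp add: gfun_tgt[OF U_hom[OF ccone_pr(1)[OF c]] h[OF z], symmetric] hp[OF z] hp[OF s'(2)] gfun_tgt[OF f z])
  qed
  then show ?thesis by (rule that) (simp add: hp)
qed

text \<open>The globular tupling map preserves the operations, as can be checked after the jointly
  injective projections; fullness of \<open>U\<close> then makes it an arrow of
  \<open>V\<close>.\<close>

lemma ccone_product:
  assumes c: "ccone Xs N prs"
  shows "is_product V Xs (N, prs)"
  unfolding is_product_def prod.case
proof (intro conjI ballI allI impI)
  show "N \<in> Obj V" "list_all2 (\<lambda>pr Z. pr \<in> hom V N Z) prs Xs" using c by (auto simp: ccone_def)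
  fix Y fs assume Y: "Y \<in> Obj V" and fs: "list_all2 (\<lambda>f Z. f \<in> hom V Y Z) fs Xs"
  have f: "fs ! i \<in> hom V Y (Xs ! i)" if "i < length Xs" for i
    using fs that by (auto simp: list_all2_conv_all_nth)
  have len: "length fs = length Xs" "length prs = length Xs"
    using fs ccone_len[OF c] by (auto simp: list_all2_conv_all_nth)
  have N: "N \<in> Obj V" by (rule ccone_Obj[OF c])
  have "list_all2 (\<lambda>f X. f \<in> hom (gset_cat n) (Fobj U Y) (Fobj U X)) (map (Farr U) fs) Xs"
    using fs U_hom by (auto simp: list_all2_conv_all_nth)
  from ccone_tuple[OF c gset_U[OF Y] this] obtain h where h: "h \<in> hom (gset_cat n) (Fobj U Y) (Fobj U N)"
    and hp: "\<And>d z i. z \<in> cel Y d \<Longrightarrow> i < length Xs \<Longrightarrow> act (prs ! i) d (gfun h d z) = act (fs ! i) d z"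
    using len by (metis nth_map)
  have "phom n Dm rd (Fobj U Y) (ev Y) (Fobj U N) (ev N) h"
    unfolding phom_def
  proof (intro conjI allI impI h)
    fix \<sigma> xs assume D: "Dm (Fobj U Y) \<sigma> xs"
    note D' = Dm_map[OF h D]
    show "gfun h (rd \<sigma>) (ev Y \<sigma> xs) = ev N \<sigma> (map (app h) xs)"
    proof (rule ccone_eq[OF c gfun_in[OF h ev_cells[OF Y D]] ev_cells[OF N D']])
      fix i assume i: "i < length Xs"
      have "map (app (Farr U (fs ! i))) xs = map (app (Farr U (prs ! i))) (map (app h) xs)"
        by (rule map_app_comp[OF gset_U[OF Y] D]) (simp add: hp i)
      then show "act (prs ! i) (rd \<sigma>) (gfun h (rd \<sigma>) (ev Y \<sigma> xs)) = act (prs ! i) (rd \<sigma>) (ev N \<sigma> (map (app h) xs))"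
        using hp[OF ev_cells[OF Y D] i] act_ev[OF f[OF i] D] act_ev[OF ccone_pr(1)[OF c i] D'] by (simp del: map_map)
    qed
  qed
  from lift_arr[OF Y N this] obtain g where g: "g \<in> hom V Y N" "Farr U g = h" by blast
  have gm: "map (\<lambda>pr. Comp V pr g) prs = fs"
  proof (rule nth_equalityI)
    fix i assume "i < length (map (\<lambda>pr. Comp V pr g) prs)"
    then have i: "i < length Xs" "i < length prs" using len by auto
    show "map (\<lambda>pr. Comp V pr g) prs ! i = fs ! i"
      unfolding nth_map[OF i(2)]
      by (rule arr_eqI[OF comp_hom[OF V g(1) ccone_pr(1)[OF c i(1)]] f[OF i(1)]])
        (simp add: act_comp[OF g(1) ccone_pr(1)[OF c i(1)]] g(2) hp i)
  qed (use len in simp)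
  show "\<exists>!h. h \<in> hom V Y N \<and> map (\<lambda>pr. Comp V pr h) prs = fs"
  proof (rule ex1I[of _ g])
    fix g' assume g': "g' \<in> hom V Y N \<and> map (\<lambda>pr. Comp V pr g') prs = fs"
    then have g'h: "g' \<in> hom V Y N" by simp
    show "g' = g"
    proof (rule arr_eqI[OF g'h g(1)])
      fix d z assume z: "z \<in> cel Y d"
      show "act g' d z = act g d z"
      proof (rule ccone_eq[OF c act_in[OF g'h z] act_in[OF g(1) z]])
        fix i assume i: "i < length Xs"
        have "Comp V (prs ! i) g' = Comp V (prs ! i) g" using g' gm i len by (metis nth_map)
        then show "act (prs ! i) d (act g' d z) = act (prs ! i) d (act g d z)"
          using act_comp[OF g'h ccone_pr(1)[OF c i] z] act_comp[OF g(1) ccone_pr(1)[OF c i] z] by simp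
      qed
    qed
  qed (use g gm in auto)
qed

text \<open>\<open>Prod\<close> and \<open>projs\<close> come from an arbitrary choice of product.
  Any product is isomorphic to the dimensionwise one constructed above, so its cells are tuples as
  well.\<close>

lemma is_product_ccone:
  assumes P: "is_product V Xs (X, prs)"
  shows "ccone Xs X prs"
proof -
  have X: "X \<in> Obj V" and prs: "list_all2 (\<lambda>pr Z. pr \<in> hom V X Z) prs Xs"
    and uP: "\<And>Y fs. Y \<in> Obj V \<Longrightarrow> list_all2 (\<lambda>f Z. f \<in> hom V Y Z) fs Xs \<Longrightarrow>
        \<exists>!h. h \<in> hom V Y X \<and> map (\<lambda>pr. Comp V pr h) prs = fs"
    using P unfolding is_product_def by auto
  have "set Xs \<subseteq> Obj V"
    using prs hom_Obj[OF V] by (fastforce simp: list_all2_conv_all_nth in_set_conv_nth)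
  then obtain N qs where c: "ccone Xs N qs" using ccone_exists by blast
  have qs: "list_all2 (\<lambda>pr Z. pr \<in> hom V N Z) qs Xs" and N: "N \<in> Obj V" using c by (auto simp: ccone_def)
  obtain u where u: "u \<in> hom V X N" "map (\<lambda>pr. Comp V pr u) qs = prs"
    using ccone_product[OF c] X prs unfolding is_product_def by (auto dest!: ex1_implies_ex)
  obtain v where v: "v \<in> hom V N X" "map (\<lambda>pr. Comp V pr v) prs = qs"
    using uP[OF N qs] by blast
  have len: "length prs = length Xs" "length qs = length Xs" using prs qs by (auto simp: list_all2_conv_all_nth)
  have prh: "prs ! i \<in> hom V X (Xs ! i)" "qs ! i \<in> hom V N (Xs ! i)" if "i < length Xs" for i
    using prs qs that by (auto simp: list_all2_conv_all_nth)
  have ui: "Comp V (qs ! i) u = prs ! i" and vi: "Comp V (prs ! i) v = qs ! i" if "i < length Xs" for i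
    using u(2) v(2) that len by (metis nth_map)+
  \<comment> \<open>This composite makes \<open>u\<close> injective on cells; cells with prescribed
    components will be supplied by \<open>v\<close>.\<close>
  have vu: "Comp V v u = Ident V X"
  proof -
    have "map (\<lambda>pr. Comp V pr (Comp V v u)) prs = prs" "map (\<lambda>pr. Comp V pr (Ident V X)) prs = prs"
      using len by (simp_all add: list_eq_iff_nth_eq comp_assoc[OF V u(1) v(1) prh(1), symmetric] ui vi comp_ident(1)[OF V prh(1)])
    then show ?thesis using uP[OF X prs] comp_hom[OF V u(1) v(1)] ident_hom[OF V X] by blast
  qed
  have ua: "act (qs ! i) d (act u d x) = act (prs ! i) d x" if "x \<in> cel X d" "i < length Xs" for i d x
    using act_comp[OF u(1) prh(2) that(1)] ui that by simp
  have va: "act (prs ! i) d (act v d x) = act (qs ! i) d x" if "x \<in> cel N d" "i < length Xs" for i d x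
    using act_comp[OF v(1) prh(1) that(1)] vi that by simp
  show ?thesis
    unfolding ccone_def
  proof (intro conjI allI impI ballI X prs)
    fix d ys assume a: "d \<le> n \<and> list_all2 (\<lambda>y X. y \<in> cel X d) ys Xs"
    then obtain x where x: "x \<in> cel N d" "map (\<lambda>pr. act pr d x) qs = ys"
      using c unfolding ccone_def by blast
    have "map (\<lambda>pr. act pr d (act v d x)) prs = ys"
      using va[OF x(1)] x(2)[symmetric] len by (simp add: list_eq_iff_nth_eq)
    then show "\<exists>x\<in>cel X d. map (\<lambda>pr. act pr d x) prs = ys" using act_in[OF v(1) x(1)] by blast
  next
    fix d x x' assume x: "x \<in> cel X d" "x' \<in> cel X d"
      and eq: "map (\<lambda>pr. act pr d x) prs = map (\<lambda>pr. act pr d x') prs"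
    have "act u d x = act u d x'"
      using ccone_eq[OF c act_in[OF u(1) x(1)] act_in[OF u(1) x(2)]] ua[OF x(1)] ua[OF x(2)] eq len
      by (simp add: list_eq_iff_nth_eq)
    then have "act (Comp V v u) d x = act (Comp V v u) d x'" using act_comp[OF u(1) v(1)] x by simp
    then show "x = x'" using x by (simp add: vu functor_ident[OF U X])
  qed
qed

lemma Prod_ccone: "set Xs \<subseteq> Obj V \<Longrightarrow> ccone Xs (Prod V Xs) (projs V Xs)"
proof -
  assume "set Xs \<subseteq> Obj V"
  then obtain N prs where "ccone Xs N prs" using ccone_exists by blast
  then have "is_product V Xs (product_cone V Xs)"
    unfolding product_cone_def by (metis someI ccone_product)
  then show ?thesis using is_product_ccone by (simp add: Prod_def projs_def)
qed

lemma Prod_Obj: "set Xs \<subseteq> Obj V \<Longrightarrow> Prod V Xs \<in> Obj V"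
  by (rule ccone_Obj[OF Prod_ccone])

definition tup :: "'o list \<Rightarrow> nat \<Rightarrow> 'u list \<Rightarrow> 'u" where
  "tup Xs d ys = (THE x. x \<in> cel (Prod V Xs) d \<and> map (\<lambda>pr. act pr d x) (projs V Xs) = ys)"

lemma tup_eqI:
  assumes "set Xs \<subseteq> Obj V" "x \<in> cel (Prod V Xs) d" "map (\<lambda>pr. act pr d x) (projs V Xs) = ys"
  shows "tup Xs d ys = x"
  unfolding tup_def using assms Prod_ccone[OF assms(1)] unfolding ccone_def by (intro the_equality) auto

lemma tup:
  assumes "set Xs \<subseteq> Obj V" "d \<le> n" "list_all2 (\<lambda>y X. y \<in> cel X d) ys Xs"
  shows "tup Xs d ys \<in> cel (Prod V Xs) d" "map (\<lambda>pr. act pr d (tup Xs d ys)) (projs V Xs) = ys"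
proof -
  obtain x where "x \<in> cel (Prod V Xs) d" "map (\<lambda>pr. act pr d x) (projs V Xs) = ys"
    using Prod_ccone[OF assms(1)] assms(2,3) unfolding ccone_def by blast
  with tup_eqI[OF assms(1) this] show "tup Xs d ys \<in> cel (Prod V Xs) d" "map (\<lambda>pr. act pr d (tup Xs d ys)) (projs V Xs) = ys"
    by auto
qed

lemma tuple:
  assumes Y: "Y \<in> Obj V" and fs: "list_all2 (\<lambda>f X. f \<in> hom V Y X) fs Xs"
  shows "tuple V Y fs \<in> hom V Y (Prod V Xs)"
    "y \<in> cel Y d \<Longrightarrow> act (tuple V Y fs) d y = tup Xs d (map (\<lambda>f. act f d y) fs)"
proof -
  have XO: "set Xs \<subseteq> Obj V"
    using fs hom_Obj[OF V] by (fastforce simp: list_all2_conv_all_nth in_set_conv_nth)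
  have cod: "map (Cod V) fs = Xs"
    using fs by (auto simp: list_all2_conv_all_nth list_eq_iff_nth_eq hom_Cod)
  note c = Prod_ccone[OF XO]
  have "\<exists>!h. h \<in> hom V Y (Prod V Xs) \<and> map (\<lambda>pr. Comp V pr h) (projs V Xs) = fs"
    using ccone_product[OF c] Y fs unfolding is_product_def by blast
  from theI'[OF this] have t: "tuple V Y fs \<in> hom V Y (Prod V Xs)"
    "map (\<lambda>pr. Comp V pr (tuple V Y fs)) (projs V Xs) = fs"
    by (simp_all add: tuple_def cod)
  show "tuple V Y fs \<in> hom V Y (Prod V Xs)" by (rule t)
  assume y: "y \<in> cel Y d"
  have "map (\<lambda>pr. act pr d (act (tuple V Y fs) d y)) (projs V Xs) = map (\<lambda>f. act f d y) fs"
  proof (rule nth_equalityI)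
    fix i assume "i < length (map (\<lambda>pr. act pr d (act (tuple V Y fs) d y)) (projs V Xs))"
    then have i: "i < length Xs" using ccone_len[OF c] by simp
    have "Comp V (projs V Xs ! i) (tuple V Y fs) = fs ! i"
      using arg_cong[OF t(2), of "\<lambda>l. l ! i"] i ccone_len[OF c] by simp
    then show "map (\<lambda>pr. act pr d (act (tuple V Y fs) d y)) (projs V Xs) ! i = map (\<lambda>f. act f d y) fs ! i"
      using act_comp[OF t(1) ccone_pr(1)[OF c i] y] i ccone_len[OF c] fs by (simp add: list_all2_conv_all_nth)
  qed (use t(2) in \<open>metis length_map\<close>)
  then show "act (tuple V Y fs) d y = tup Xs d (map (\<lambda>f. act f d y) fs)"
    using tup_eqI[OF XO act_in[OF t(1) y]] by simp
qed

text \<open>Take for \<open>Y\<close> the product and for \<open>fs\<close> its projections. In this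
  way axioms stated for all generalized elements yield equations for all tuples of cells.\<close>

lemma generic_element:
  assumes XO: "set Xs \<subseteq> Obj V" and d: "d \<le> n" and xs: "list_all2 (\<lambda>x X. x \<in> cel X d) xs Xs"
  obtains Y y fs where "Y \<in> Obj V" "y \<in> cel Y d" "list_all2 (\<lambda>f X. f \<in> hom V Y X) fs Xs"
    "map (\<lambda>f. act f d y) fs = xs"
  using that[OF Prod_Obj[OF XO] tup(1)[OF assms] _ tup(2)[OF assms]] Prod_ccone[OF XO] by (auto simp: ccone_def)

end

context coded_opcat begin

subsection \<open>Free objects\<close>

text \<open>
  The free object on \<open>A\<close> is generated by \<open>A\<close> in the product over the class \<open>idx A\<close> of all maps from \<open>A\<close> to
  objects of \<open>V\<close>; thus its cells are functions on \<open>idx A\<close>. In \<open>coded A m u t\<close>, the element \<open>u\<close> of \<open>'u\<close> records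
  how the \<open>m\<close>-cell \<open>t\<close> was generated, which shows that there are few enough of them.
\<close>

definition idx :: "'u gset \<Rightarrow> ('o \<times> 'u gmap) set" where
  "idx A = {i. fst i \<in> Obj V \<and> snd i \<in> hom (gset_cat n) A (Fobj U (fst i))}"

inductive coded :: "'u gset \<Rightarrow> nat \<Rightarrow> 'u \<Rightarrow> ('o \<times> 'u gmap \<Rightarrow> 'u) \<Rightarrow> bool" for A where
  gen: "x \<in> cells A m \<Longrightarrow> coded A m (enl [nt 0, x]) (\<lambda>i\<in>idx A. gfun (snd i) m x)"
| src: "coded A (Suc m) u t \<Longrightarrow> coded A m (enl [nt 1, u]) (\<lambda>i\<in>idx A. gsrc (Fobj U (fst i)) m (t i))"
| tgt: "coded A (Suc m) u t \<Longrightarrow> coded A m (enl [nt 2, u]) (\<lambda>i\<in>idx A. gtgt (Fobj U (fst i)) m (t i))"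
| op: "list_all2 (\<lambda>u t. fst t = fst u \<and> coded A (fst u) (snd u) (snd t)) us ts \<Longrightarrow>
    (\<And>i. i \<in> idx A \<Longrightarrow> Dm (Fobj U (fst i)) \<sigma> (map (\<lambda>t. (fst t, snd t i)) ts)) \<Longrightarrow>
    coded A (rd \<sigma>) (enl (nt 3 # es \<sigma> # map (\<lambda>u. enl [nt (fst u), snd u]) us))
      (\<lambda>i\<in>idx A. ev (fst i) \<sigma> (map (\<lambda>t. (fst t, snd t i)) ts))"

lemma coded_in: "coded A m u t \<Longrightarrow> i \<in> idx A \<Longrightarrow> t i \<in> cel (fst i) m"
  by (induction rule: coded.induct)
    (auto simp: idx_def gfun_in gset_in[OF gset_U] ev_cells)

lemma coded_extensional: "coded A m u t \<Longrightarrow> t \<in> extensional (idx A)"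
  by (induction rule: coded.induct) (rule restrict_extensional)+

text \<open>The leading tag of a code tells which rule was used last, and the codes of arguments
  carry their dimensions, so a derivation can be read back from its code. A cell may have several
  codes, but no code serves two cells of the same dimension.\<close>

lemma coded_functional: "coded A m u t \<Longrightarrow> coded A m u t' \<Longrightarrow> t = t'"
proof (induction arbitrary: t' rule: coded.induct)
  case (gen x m)
  from gen(2) show ?case by (cases rule: coded.cases) auto
next
  case (src m u t)
  from src(3) show ?case by (cases rule: coded.cases) (auto dest!: src(2))
next
  case (tgt m u t)
  from tgt(3) show ?case by (cases rule: coded.cases) (auto dest!: tgt(2))
next
  case (op us ts \<sigma>)
  from op(3) show ?case
  proof (cases rule: coded.cases)
    case inner: (op us' ts' \<sigma>')
    then have s: "\<sigma>' = \<sigma>" by simp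
    have "map (\<lambda>u. enl [nt (fst u), snd u]) us = map (\<lambda>u. enl [nt (fst u), snd u]) us'"
      using inner by simp
    then have "us = us'"
      by (rule map_injective) (auto intro!: injI simp: prod_eq_iff)
    have "ts = ts'"
    proof (rule nth_equalityI)
      show l: "length ts = length ts'"
        using inner op.IH \<open>us = us'\<close> by (simp add: list_all2_conv_all_nth)
      fix j assume "j < length ts"
      then show "ts ! j = ts' ! j"
        using inner(4) op.IH \<open>us = us'\<close> l by (auto simp: list_all2_conv_all_nth prod_eq_iff)
    qed
    then show ?thesis using inner s by simp
  qed auto
qed

text \<open>The empty product receives a map from \<open>A\<close>. This bounds the dimensions of
  \<open>fgset A\<close> and provides the nonempty family that \<open>Dm_reflect\<close> asks
  for.\<close>

lemma idx_nonempty: "is_gset n A \<Longrightarrow> idx A \<noteq> {}"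
proof -
  assume A: "is_gset n A"
  obtain N prs where c: "ccone [] N prs" using ccone_exists[of "[]"] by auto
  obtain h where "h \<in> hom (gset_cat n) A (Fobj U N)" using ccone_tuple[OF c A, of "[]"] by auto
  then have "(N, h) \<in> idx A" using ccone_Obj[OF c] by (simp add: idx_def)
  then show ?thesis by blast
qed

section \<open>The generated substructure, coded as a globular set\<close>

definition fcells :: "'u gset \<Rightarrow> nat \<Rightarrow> ('o \<times> 'u gmap \<Rightarrow> 'u) set" where
  "fcells A m = {t. \<exists>u. coded A m u t}"

definition code :: "'u gset \<Rightarrow> nat \<Rightarrow> ('o \<times> 'u gmap \<Rightarrow> 'u) \<Rightarrow> 'u" where
  "code A m t = (SOME u. coded A m u t)"

definition fgen :: "'u gset \<Rightarrow> nat \<Rightarrow> 'u \<Rightarrow> 'o \<times> 'u gmap \<Rightarrow> 'u" where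
  "fgen A m x = (\<lambda>i\<in>idx A. gfun (snd i) m x)"

definition fsrc :: "'u gset \<Rightarrow> nat \<Rightarrow> ('o \<times> 'u gmap \<Rightarrow> 'u) \<Rightarrow> 'o \<times> 'u gmap \<Rightarrow> 'u" where
  "fsrc A m t = (\<lambda>i\<in>idx A. gsrc (Fobj U (fst i)) m (t i))"

definition ftgt :: "'u gset \<Rightarrow> nat \<Rightarrow> ('o \<times> 'u gmap \<Rightarrow> 'u) \<Rightarrow> 'o \<times> 'u gmap \<Rightarrow> 'u" where
  "ftgt A m t = (\<lambda>i\<in>idx A. gtgt (Fobj U (fst i)) m (t i))"

definition fop :: "'u gset \<Rightarrow> 's \<Rightarrow> (nat \<times> ('o \<times> 'u gmap \<Rightarrow> 'u)) list \<Rightarrow> 'o \<times> 'u gmap \<Rightarrow> 'u" where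
  "fop A \<sigma> ts = (\<lambda>i\<in>idx A. ev (fst i) \<sigma> (map (\<lambda>t. (fst t, snd t i)) ts))"

lemma code: "t \<in> fcells A m \<Longrightarrow> coded A m (code A m t) t"
  unfolding code_def fcells_def by (auto intro: someI)

lemma code_inj: "t \<in> fcells A m \<Longrightarrow> t' \<in> fcells A m \<Longrightarrow> code A m t = code A m t' \<Longrightarrow> t = t'"
  by (metis code coded_functional)

lemma fcells_closed:
  "x \<in> cells A m \<Longrightarrow> fgen A m x \<in> fcells A m"
  "t \<in> fcells A (Suc m) \<Longrightarrow> fsrc A m t \<in> fcells A m"
  "t \<in> fcells A (Suc m) \<Longrightarrow> ftgt A m t \<in> fcells A m"
  unfolding fcells_def fgen_def fsrc_def ftgt_def by (blast intro: coded.intros)+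

lemma fcells_op:
  assumes "\<And>d t. (d, t) \<in> set ts \<Longrightarrow> t \<in> fcells A d"
    and "\<And>i. i \<in> idx A \<Longrightarrow> Dm (Fobj U (fst i)) \<sigma> (map (\<lambda>t. (fst t, snd t i)) ts)"
  shows "fop A \<sigma> ts \<in> fcells A (rd \<sigma>)"
proof -
  have "list_all2 (\<lambda>u t. fst t = fst u \<and> coded A (fst u) (snd u) (snd t))
      (map (\<lambda>t. (fst t, code A (fst t) (snd t))) ts) ts"
    using assms(1) by (auto simp: list_all2_conv_all_nth in_set_conv_nth intro!: code) (metis prod.collapse)
  from coded.op[OF this assms(2)] show ?thesis by (auto simp: fcells_def fop_def)
qed

text \<open>Induction on generation with the codes hidden; the uniqueness half of the universal
  property is proved by it.\<close>

lemma fcells_induct [consumes 1, case_names gen src tgt op]: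
  assumes "t \<in> fcells A m"
    and "\<And>m x. x \<in> cells A m \<Longrightarrow> Q m (fgen A m x)"
    and "\<And>m t. t \<in> fcells A (Suc m) \<Longrightarrow> Q (Suc m) t \<Longrightarrow> Q m (fsrc A m t)"
    and "\<And>m t. t \<in> fcells A (Suc m) \<Longrightarrow> Q (Suc m) t \<Longrightarrow> Q m (ftgt A m t)"
    and "\<And>\<sigma> ts. (\<And>d t. (d, t) \<in> set ts \<Longrightarrow> t \<in> fcells A d \<and> Q d t) \<Longrightarrow>
      (\<And>i. i \<in> idx A \<Longrightarrow> Dm (Fobj U (fst i)) \<sigma> (map (\<lambda>t. (fst t, snd t i)) ts)) \<Longrightarrow> Q (rd \<sigma>) (fop A \<sigma> ts)"
  shows "Q m t"
proof -
  obtain u where "coded A m u t" using assms(1) by (auto simp: fcells_def)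
  then show ?thesis
  proof (induction rule: coded.induct)
    case (op us ts \<sigma>)
    have "t \<in> fcells A d \<and> Q d t" if "(d, t) \<in> set ts" for d t
    proof -
      obtain j where j: "j < length ts" "ts ! j = (d, t)" using \<open>(d, t) \<in> set ts\<close> by (auto simp: in_set_conv_nth)
      then show ?thesis using list_all2_nthD2[OF op(1) j(1)] by (auto simp: fcells_def)
    qed
    from assms(5)[OF this op(2)] show ?case by (simp only: fop_def)
  next
    case (src m u t)
    then show ?case using assms(3)[of t m] unfolding fsrc_def fcells_def by blast
  next
    case (tgt m u t)
    then show ?case using assms(4)[of t m] unfolding ftgt_def fcells_def by blast
  qed (simp only: assms(2) fgen_def[symmetric])
qed

lemma fcells_in: "t \<in> fcells A m \<Longrightarrow> i \<in> idx A \<Longrightarrow> t i \<in> cel (fst i) m"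
  by (auto simp: fcells_def coded_in)

lemma fcells_eqI:
  assumes "t \<in> fcells A m" "t' \<in> fcells A m'" and eq: "\<And>i. i \<in> idx A \<Longrightarrow> t i = t' i"
  shows "t = t'"
proof -
  have "t \<in> extensional (idx A)" "t' \<in> extensional (idx A)"
    using assms(1,2) coded_extensional unfolding fcells_def by blast+
  then show ?thesis by (rule extensionalityI) (rule eq)
qed

definition decode :: "'u gset \<Rightarrow> nat \<Rightarrow> 'u \<Rightarrow> 'o \<times> 'u gmap \<Rightarrow> 'u" where
  "decode A m = inv_into (fcells A m) (code A m)"

lemma decode_code [simp]: "t \<in> fcells A m \<Longrightarrow> decode A m (code A m t) = t"
  unfolding decode_def by (rule inv_into_f_f) (auto intro: inj_onI code_inj)

text \<open>A generated cell is a function on the class \<open>idx A\<close>; it is replaced by one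
  chosen code, so that the result is a globular set with cells in \<open>'u\<close>.\<close>

definition fgset :: "'u gset \<Rightarrow> 'u gset" where
  "fgset A = GSet (\<lambda>m. code A m ` fcells A m)
     (\<lambda>m. \<lambda>u\<in>code A (Suc m) ` fcells A (Suc m). code A m (fsrc A m (decode A (Suc m) u)))
     (\<lambda>m. \<lambda>u\<in>code A (Suc m) ` fcells A (Suc m). code A m (ftgt A m (decode A (Suc m) u)))"

definition feval :: "'u gset \<Rightarrow> 's \<Rightarrow> (nat \<times> 'u) list \<Rightarrow> 'u" where
  "feval A \<sigma> xs = code A (rd \<sigma>) (fop A \<sigma> (map (\<lambda>(d, u). (d, decode A d u)) xs))"

definition fproj :: "'u gset \<Rightarrow> 'o \<times> 'u gmap \<Rightarrow> 'u gmap" where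
  "fproj A i = mk_gmap (fgset A) (Fobj U (fst i)) (\<lambda>m u. decode A m u i)"

lemma fgset_cells: "cells (fgset A) m = code A m ` fcells A m"
  by (simp add: fgset_def)

lemma fgset_st [simp]:
  "t \<in> fcells A (Suc m) \<Longrightarrow> gsrc (fgset A) m (code A (Suc m) t) = code A m (fsrc A m t)"
  "t \<in> fcells A (Suc m) \<Longrightarrow> gtgt (fgset A) m (code A (Suc m) t) = code A m (ftgt A m t)"
  by (simp_all add: fgset_def)

lemma idxD: "i \<in> idx A \<Longrightarrow> fst i \<in> Obj V" "i \<in> idx A \<Longrightarrow> snd i \<in> hom (gset_cat n) A (Fobj U (fst i))"
  by (auto simp: idx_def)

lemma is_gset_fgset: assumes A: "is_gset n A" shows "is_gset n (fgset A)"
proof (rule is_gsetI)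
  fix m x assume x: "x \<in> cells (fgset A) m"
  then obtain t where "t \<in> fcells A m" by (auto simp: fgset_cells)
  moreover obtain i where "i \<in> idx A" using idx_nonempty[OF A] by blast
  ultimately show "m \<le> n" using fcells_in gset_dim[OF gset_U[OF idxD(1)]] by blast
next
  fix m x assume "x \<in> cells (fgset A) (Suc (Suc m))"
  then obtain t where t: "t \<in> fcells A (Suc (Suc m))" "x = code A (Suc (Suc m)) t" by (auto simp: fgset_cells)
  have "fsrc A m (fsrc A (Suc m) t) = fsrc A m (ftgt A (Suc m) t)"
    "ftgt A m (fsrc A (Suc m) t) = ftgt A m (ftgt A (Suc m) t)"
    unfolding fsrc_def ftgt_def
    by (rule restrict_ext, simp add: gset_globular[OF gset_U[OF idxD(1)[of _ A]] fcells_in[OF t(1)]])+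
  with t show "gsrc (fgset A) m (gsrc (fgset A) (Suc m) x) = gsrc (fgset A) m (gtgt (fgset A) (Suc m) x)"
    "gtgt (fgset A) m (gsrc (fgset A) (Suc m) x) = gtgt (fgset A) m (gtgt (fgset A) (Suc m) x)"
    by (simp_all add: fcells_closed)
qed (auto simp: fgset_cells fcells_closed, auto simp: fgset_def)

lemma fproj_code: "t \<in> fcells A m \<Longrightarrow> gfun (fproj A i) m (code A m t) = t i"
  by (simp add: fproj_def fgset_cells)

lemma fproj_hom: assumes A: "is_gset n A" and i: "i \<in> idx A"
  shows "fproj A i \<in> hom (gset_cat n) (fgset A) (Fobj U (fst i))"
  unfolding fproj_def
  by (rule mk_gmap[OF is_gset_fgset[OF A] gset_U[OF idxD(1)[OF i]]])
    (use i in \<open>auto simp: fgset_cells fcells_in fcells_closed fsrc_def ftgt_def\<close>, 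
      (subst decode_code, use i fcells_closed in \<open>auto simp: fsrc_def ftgt_def\<close>)+)

lemma fgset_args:
  assumes A: "is_gset n A" and D: "Dm (fgset A) \<sigma> xs"
  obtains ts where "xs = map (\<lambda>(d, t). (d, code A d t)) ts" "\<And>d t. (d, t) \<in> set ts \<Longrightarrow> t \<in> fcells A d"
    "\<And>i. i \<in> idx A \<Longrightarrow> map (app (fproj A i)) xs = map (\<lambda>t. (fst t, snd t i)) ts"
    "\<And>i. i \<in> idx A \<Longrightarrow> Dm (Fobj U (fst i)) \<sigma> (map (\<lambda>t. (fst t, snd t i)) ts)"
    "feval A \<sigma> xs = code A (rd \<sigma>) (fop A \<sigma> ts)"
proof -
  define ts where "ts = map (\<lambda>(d, u). (d, decode A d u)) xs"
  have c: "u \<in> code A d ` fcells A d" if "(d, u) \<in> set xs" for d u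
    using Dm_cells[OF is_gset_fgset[OF A] D that] by (simp add: fgset_cells)
  have 1: "xs = map (\<lambda>(d, t). (d, code A d t)) ts"
    unfolding ts_def
  proof -
    have "code A d (decode A d u) = u" if "(d, u) \<in> set xs" for d u using c[OF that] by auto
    then show "xs = map (\<lambda>(d, t). (d, code A d t)) (map (\<lambda>(d, u). (d, decode A d u)) xs)"
      by (auto intro!: map_idI[symmetric])
  qed
  have 2: "t \<in> fcells A d" if "(d, t) \<in> set ts" for d t
    using that c unfolding ts_def by force
  have 3: "map (app (fproj A i)) xs = map (\<lambda>t. (fst t, snd t i)) ts" if "i \<in> idx A" for i
    unfolding 1 using 2 by (auto simp: fproj_code)
  show ?thesis
    using that[OF 1 2 3] Dm_map[OF fproj_hom[OF A] D] 3 by (simp add: feval_def ts_def)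
qed

lemma feval_in: assumes A: "is_gset n A" and D: "Dm (fgset A) \<sigma> xs"
  shows "feval A \<sigma> xs \<in> cells (fgset A) (rd \<sigma>)"
proof -
  obtain ts where ts: "\<And>d t. (d, t) \<in> set ts \<Longrightarrow> t \<in> fcells A d"
    "\<And>i. i \<in> idx A \<Longrightarrow> Dm (Fobj U (fst i)) \<sigma> (map (\<lambda>t. (fst t, snd t i)) ts)"
    "feval A \<sigma> xs = code A (rd \<sigma>) (fop A \<sigma> ts)"
    by (rule fgset_args[OF A D]) (rule that; assumption)
  show ?thesis using fcells_op[OF ts(1,2)] by (auto simp: ts(3) fgset_cells)
qed

lemma fproj_phom: assumes A: "is_gset n A" and i: "i \<in> idx A"
  shows "phom n Dm rd (fgset A) (feval A) (Fobj U (fst i)) (ev (fst i)) (fproj A i)"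
  unfolding phom_def
proof (intro conjI allI impI fproj_hom[OF A i])
  fix \<sigma> xs assume D: "Dm (fgset A) \<sigma> xs"
  obtain ts where ts: "\<And>d t. (d, t) \<in> set ts \<Longrightarrow> t \<in> fcells A d"
    "\<And>i. i \<in> idx A \<Longrightarrow> Dm (Fobj U (fst i)) \<sigma> (map (\<lambda>t. (fst t, snd t i)) ts)"
    "feval A \<sigma> xs = code A (rd \<sigma>) (fop A \<sigma> ts)"
    "\<And>i. i \<in> idx A \<Longrightarrow> map (app (fproj A i)) xs = map (\<lambda>t. (fst t, snd t i)) ts"
    by (rule fgset_args[OF A D]) (rule that; assumption)
  show "gfun (fproj A i) (rd \<sigma>) (feval A \<sigma> xs) = ev (fst i) \<sigma> (map (app (fproj A i)) xs)"
  proof -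
    have "fop A \<sigma> ts \<in> fcells A (rd \<sigma>)" by (rule fcells_op[OF ts(1,2)])
    from fproj_code[OF this] show ?thesis unfolding ts(3) ts(4)[OF i] using i by (simp add: fop_def)
  qed
qed

lemma fproj_sep:
  assumes xy: "x \<in> cells (fgset A) m" "y \<in> cells (fgset A) m"
    and eq: "\<And>i. i \<in> idx A \<Longrightarrow> gfun (fproj A i) m x = gfun (fproj A i) m y"
  shows "x = y"
proof -
  obtain t t' where t: "t \<in> fcells A m" "x = code A m t" "t' \<in> fcells A m" "y = code A m t'"
    using xy by (auto simp: fgset_cells)
  have "t = t'" by (rule fcells_eqI[OF t(1,3)]) (use eq t in \<open>simp add: fproj_code\<close>)
  then show ?thesis using t by simp
qed

text \<open>The projections are jointly injective by \<open>fproj_sep\<close>, so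
  \<open>Dm_reflect\<close> turns the componentwise condition into membership in the domain.\<close>

lemma Dm_fgset:
  assumes A: "is_gset n A" and ts: "\<And>d t. (d, t) \<in> set ts \<Longrightarrow> t \<in> fcells A d"
    and D: "\<And>i. i \<in> idx A \<Longrightarrow> Dm (Fobj U (fst i)) \<sigma> (map (\<lambda>t. (fst t, snd t i)) ts)"
  shows "Dm (fgset A) \<sigma> (map (\<lambda>(d, t). (d, code A d t)) ts)"
    "feval A \<sigma> (map (\<lambda>(d, t). (d, code A d t)) ts) = code A (rd \<sigma>) (fop A \<sigma> ts)"
proof -
  show "Dm (fgset A) \<sigma> (map (\<lambda>(d, t). (d, code A d t)) ts)"
  proof (rule Dm_reflect[OF is_gset_fgset[OF A], of "fproj A ` idx A"])
    show "fproj A ` idx A \<noteq> {}" using idx_nonempty[OF A] by simp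
    fix f assume "f \<in> fproj A ` idx A"
    then obtain i where i: "i \<in> idx A" "f = fproj A i" by blast
    note h = fproj_hom[OF A i(1)]
    show "f \<in> hom (gset_cat n) (fgset A) (gcod f)" using h gset_homD(4)[OF h] i by simp
    have eq: "map (app f) (map (\<lambda>(d, t). (d, code A d t)) ts) = map (\<lambda>t. (fst t, snd t i)) ts"
      using ts by (auto simp: i(2) fproj_code)
    then show "Dm (gcod f) \<sigma> (map (app f) (map (\<lambda>(d, t). (d, code A d t)) ts))"
      unfolding eq using D[OF i(1)] gset_homD(4)[OF h] i by simp
  next
    fix d x assume "(d, x) \<in> set (map (\<lambda>(d, t). (d, code A d t)) ts)"
    then show "x \<in> cells (fgset A) d" using ts by (auto simp: fgset_cells)
  qed (auto intro: fproj_sep)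
  have "map ((\<lambda>(d, u). (d, decode A d u)) \<circ> (\<lambda>(d, t). (d, code A d t))) ts = ts"
    using ts by (auto intro!: map_idI)
  then show "feval A \<sigma> (map (\<lambda>(d, t). (d, code A d t)) ts) = code A (rd \<sigma>) (fop A \<sigma> ts)"
    by (simp add: feval_def)
qed

text \<open>The projections separate the cells, so \<open>rep_sub\<close> provides an object of
  \<open>V\<close>. Existence of extensions: a map \<open>f\<close> from \<open>A\<close> to
  \<open>U X\<close> is itself an index, and the projection at this index extends it. Uniqueness:
  two extensions agree on the generators, hence on all that sources, targets and operations generate
  from them.\<close>

lemma free_object:
  assumes A: "is_gset n A"
  shows "\<exists>N\<in>Obj V. \<exists>\<eta>\<in>hom (gset_cat n) A (Fobj U N). \<forall>X\<in>Obj V. \<forall>f\<in>hom (gset_cat n) A (Fobj U X).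
    \<exists>!g. g \<in> hom V N X \<and> Comp (gset_cat n) (Farr U g) \<eta> = f"
proof -
  note gF = is_gset_fgset[OF A]
  have "rep n V U Dm rd ev (fgset A) (feval A)"
  proof (rule rep_sub[OF gF feval_in[OF A]])
    fix m x y assume "x \<in> cells (fgset A) m" "y \<in> cells (fgset A) m" "x \<noteq> y"
    then obtain i where "i \<in> idx A" "gfun (fproj A i) m x \<noteq> gfun (fproj A i) m y" using fproj_sep by blast
    then show "\<exists>M\<in>Obj V. \<exists>f. phom n Dm rd (fgset A) (feval A) (Fobj U M) (ev M) f \<and> gfun f m x \<noteq> gfun f m y"
      using fproj_phom[OF A] idxD(1) by blast
  qed
  from rep_iso[OF this feval_in[OF A]] obtain N \<theta> \<theta>' where N: "N \<in> Obj V"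
    and t: "phom n Dm rd (fgset A) (feval A) (Fobj U N) (ev N) \<theta>"
    and t': "phom n Dm rd (Fobj U N) (ev N) (fgset A) (feval A) \<theta>'"
    and i: "\<And>m x. x \<in> cells (fgset A) m \<Longrightarrow> gfun \<theta>' m (gfun \<theta> m x) = x"
    and i': "\<And>m y. y \<in> cel N m \<Longrightarrow> gfun \<theta> m (gfun \<theta>' m y) = y" by blast
  have th: "\<theta> \<in> hom (gset_cat n) (fgset A) (Fobj U N)" "\<theta>' \<in> hom (gset_cat n) (Fobj U N) (fgset A)"
    using t t' by (auto simp: phom_def)
  define u where "u = mk_gmap A (fgset A) (\<lambda>m x. code A m (fgen A m x))"
  have u: "u \<in> hom (gset_cat n) A (fgset A)"
    unfolding u_def
  proof (rule mk_gmap[OF A gF])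
    fix m x assume x: "x \<in> cells A (Suc m)"
    have "fsrc A m (fgen A (Suc m) x) = fgen A m (gsrc A m x)" "ftgt A m (fgen A (Suc m) x) = fgen A m (gtgt A m x)"
      unfolding fsrc_def ftgt_def fgen_def
      by (rule restrict_ext, simp add: gfun_src[OF idxD(2)[of _ A] x] gfun_tgt[OF idxD(2)[of _ A] x])+
    then show "gsrc (fgset A) m (code A (Suc m) (fgen A (Suc m) x)) = code A m (fgen A m (gsrc A m x))"
      "gtgt (fgset A) m (code A (Suc m) (fgen A (Suc m) x)) = code A m (fgen A m (gtgt A m x))"
      using x by (simp_all add: fcells_closed)
  qed (simp add: fgset_cells fcells_closed)
  have ux: "gfun u m x = code A m (fgen A m x)" if "x \<in> cells A m" for m x using that by (simp add: u_def)
  let ?eta = "Comp (gset_cat n) \<theta> u"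
  have eta: "?eta \<in> hom (gset_cat n) A (Fobj U N)" by (rule gset_comp_hom[OF u th(1)])
  have "\<exists>!g. g \<in> hom V N X \<and> Comp (gset_cat n) (Farr U g) ?eta = f"
    if X: "X \<in> Obj V" and f: "f \<in> hom (gset_cat n) A (Fobj U X)" for X f
  proof -
    have ii: "(X, f) \<in> idx A" using X f by (simp add: idx_def)
    note p = fproj_phom[OF A ii, simplified] and ph = fproj_hom[OF A ii, simplified]
    obtain g where g: "g \<in> hom V N X" "Farr U g = Comp (gset_cat n) (fproj A (X, f)) \<theta>'"
      using lift_arr[OF N X phom_comp[OF t' p ev_cells[OF N]]] by blast
    have gf: "Comp (gset_cat n) (Farr U g) ?eta = f"
    proof (rule gmap_eqI[OF gset_comp_hom[OF eta U_hom[OF g(1)]] f])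
      fix m x assume x: "x \<in> cells A m"
      note c = fcells_closed(1)[OF x]
      have uc: "gfun u m x \<in> cells (fgset A) m" using gfun_in[OF u x] .
      then show "gfun (Comp (gset_cat n) (Farr U g) ?eta) m x = gfun f m x"
        using gfun_in[OF th(1) uc] x ii c
        by (simp add: gfun_comp[OF eta] gfun_comp[OF u] gfun_comp[OF th(2)] g(2) i) 
          (simp add: ux fproj_code fgen_def)
    qed
    show ?thesis
    proof (rule ex1I[of _ g])
      show "g \<in> hom V N X \<and> Comp (gset_cat n) (Farr U g) ?eta = f" using g gf by simp
      fix g' assume g': "g' \<in> hom V N X \<and> Comp (gset_cat n) (Farr U g') ?eta = f"
      then have g'h: "g' \<in> hom V N X" by simp
      have *: "act g' m (gfun \<theta> m (code A m t)) = act g m (gfun \<theta> m (code A m t))" if "t \<in> fcells A m" for m t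
        using that
      proof (induction rule: fcells_induct)
        case (gen m x)
        have "gfun (Comp (gset_cat n) (Farr U g') ?eta) m x = gfun (Comp (gset_cat n) (Farr U g) ?eta) m x"
          using g' gf by simp
        then show ?case using gen by (simp add: gfun_comp[OF eta] gfun_comp[OF u] ux)
      next
        case (src m t)
        have c: "code A (Suc m) t \<in> cells (fgset A) (Suc m)" using src(1) by (simp add: fgset_cells)
        note tc = gfun_in[OF th(1) c]
        show ?case
          using gfun_src[OF th(1) c, symmetric] gfun_src[OF U_hom[OF g(1)] tc, symmetric]
            gfun_src[OF U_hom[OF g'h] tc, symmetric] src by simp
      next
        case (tgt m t)
        have c: "code A (Suc m) t \<in> cells (fgset A) (Suc m)" using tgt(1) by (simp add: fgset_cells)
        note tc = gfun_in[OF th(1) c]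
        show ?case
          using gfun_tgt[OF th(1) c, symmetric] gfun_tgt[OF U_hom[OF g(1)] tc, symmetric]
            gfun_tgt[OF U_hom[OF g'h] tc, symmetric] tgt by simp
      next
        case (op \<sigma> ts)
        let ?xs = "map (\<lambda>(d, t). (d, code A d t)) ts"
        have D: "Dm (fgset A) \<sigma> ?xs" and fe: "feval A \<sigma> ?xs = code A (rd \<sigma>) (fop A \<sigma> ts)"
          using Dm_fgset[OF A, of ts \<sigma>] op by auto
        note D' = Dm_map[OF th(1) D]
        have te: "gfun \<theta> (rd \<sigma>) (code A (rd \<sigma>) (fop A \<sigma> ts)) = ev N \<sigma> (map (app \<theta>) ?xs)"
          using t D unfolding phom_def fe[symmetric] by blast
        have eq: "map (app (Farr U g')) (map (app \<theta>) ?xs) = map (app (Farr U g)) (map (app \<theta>) ?xs)"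
          using op(1) by auto
        show ?case unfolding te act_ev[OF g(1) D'] act_ev[OF g'h D'] eq ..
      qed
      show "g' = g"
      proof (rule arr_eqI[OF g'h g(1)])
        fix m x assume x: "x \<in> cel N m"
        obtain t where t: "t \<in> fcells A m" "gfun \<theta>' m x = code A m t"
          using gfun_in[OF th(2) x] by (auto simp: fgset_cells)
        then show "act g' m x = act g m x" using *[OF t(1)] i'[OF x] by metis
      qed
    qed
  qed
  with N eta show ?thesis by blast
qed

text \<open>For an algebra \<open>(A, h)\<close> the multiplication law makes \<open>h\<close> a
  homomorphism from the free object, for operations on \<open>A\<close> that are computed in the
  free object. The unit law makes \<open>\<eta> A\<close> a section of \<open>h\<close>. These are
  the hypotheses of \<open>rep_quot\<close>.\<close>

theorem monadic_gset: "\<exists>Q. monad (gset_cat n :: ('u gset, 'u gmap) cat) Q \<and> equivalent_cats (algebras (gset_cat n) Q) V"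
proof -
  have "\<forall>A. \<exists>N \<eta>. is_gset n A \<longrightarrow> N \<in> Obj V \<and> \<eta> \<in> hom (gset_cat n) A (Fobj U N) \<and>
    (\<forall>X\<in>Obj V. \<forall>f\<in>hom (gset_cat n) A (Fobj U X). \<exists>!g. g \<in> hom V N X \<and> Comp (gset_cat n) (Farr U g) \<eta> = f)"
    using free_object by meson
  then obtain F \<eta> where free: "\<And>A. is_gset n A \<Longrightarrow> F A \<in> Obj V"
    "\<And>A. is_gset n A \<Longrightarrow> \<eta> A \<in> hom (gset_cat n) A (Fobj U (F A))"
    "\<And>A X f. is_gset n A \<Longrightarrow> X \<in> Obj V \<Longrightarrow> f \<in> hom (gset_cat n) A (Fobj U X) \<Longrightarrow>
      \<exists>!g. g \<in> hom V (F A) X \<and> Comp (gset_cat n) (Farr U g) (\<eta> A) = f"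
    by metis
  interpret univ_arrows "gset_cat n" V U F \<eta>
    by unfold_locales (use U free in auto)
  \<comment> \<open>Every operation of \<open>X\<close> factors through the free object on the
    underlying globular set of \<open>X\<close>. Hence a map that respects the counits respects the
    operations.\<close>
  have ev_free: "ev X \<sigma> xs = act (counit X) (rd \<sigma>) (ev (F (Fobj U X)) \<sigma> (map (app (\<eta> (Fobj U X))) xs))"
    if X: "X \<in> Obj V" and D: "Dm (Fobj U X) \<sigma> xs" for X \<sigma> xs
  proof -
    note e = free(2)[OF gset_U[OF X]] and c = counit[OF X]
    note D' = Dm_map[OF e D]
    have "map (app (Farr U (counit X))) (map (app (\<eta> (Fobj U X))) xs) = map (app (Ident (gset_cat n) (Fobj U X))) xs"
      by (rule map_app_comp[symmetric, OF gset_U[OF X] D]) (simp add: c(2)[symmetric] gfun_comp[OF e] del: gfun_ident)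
    also have "\<dots> = xs" by (rule map_app_ident[OF gset_U[OF X] D]) simp
    finally show ?thesis using act_ev[OF c(1) D'] by simp
  qed
  show ?thesis
  proof (rule monadic)
    fix X Y f g assume "f \<in> hom V X Y" "g \<in> hom V X Y" "Farr U f = Farr U g"
    then show "f = g" by (rule faithful)
  next
    fix X Y g assume X: "X \<in> Obj V" and Y: "Y \<in> Obj V" and g: "g \<in> hom (gset_cat n) (Fobj U X) (Fobj U Y)"
      and eq: "Comp (gset_cat n) g (Farr U (counit X)) = Comp (gset_cat n) (Farr U (counit Y)) (Farr U (free_arr g))"
    note eX = free(2)[OF gset_U[OF X]] and eY = free(2)[OF gset_U[OF Y]] and cX = counit[OF X] and cY = counit[OF Y]
    note fg = free_arr[OF g]
    have "phom n Dm rd (Fobj U X) (ev X) (Fobj U Y) (ev Y) g"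
      unfolding phom_def
    proof (intro conjI allI impI g)
      fix \<sigma> xs assume D: "Dm (Fobj U X) \<sigma> xs"
      note DX = Dm_map[OF eX D] and DY = Dm_map[OF g D]
      let ?z = "ev (F (Fobj U X)) \<sigma> (map (app (\<eta> (Fobj U X))) xs)"
      have z: "?z \<in> cel (F (Fobj U X)) (rd \<sigma>)" by (rule ev_cells[OF free(1)[OF gset_U[OF X]] DX])
      have "gfun g (rd \<sigma>) (ev X \<sigma> xs) = gfun (Comp (gset_cat n) g (Farr U (counit X))) (rd \<sigma>) ?z"
        by (simp add: ev_free[OF X D] gfun_comp[OF U_hom[OF cX(1)] z])
      also have "\<dots> = act (counit Y) (rd \<sigma>) (act (free_arr g) (rd \<sigma>) ?z)"
        by (simp add: eq gfun_comp[OF U_hom[OF fg(1)] z])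
      also have "act (free_arr g) (rd \<sigma>) ?z = ev (F (Fobj U Y)) \<sigma> (map (app (Farr U (free_arr g))) (map (app (\<eta> (Fobj U X))) xs))"
        by (rule act_ev[OF fg(1) DX])
      also have "map (app (Farr U (free_arr g))) (map (app (\<eta> (Fobj U X))) xs) = map (app (Comp (gset_cat n) (\<eta> (Fobj U Y)) g)) xs"
        by (rule map_app_comp[symmetric, OF gset_U[OF X] D]) (simp add: fg(2)[symmetric] gfun_comp[OF eX])
      also have "\<dots> = map (app (\<eta> (Fobj U Y))) (map (app g) xs)"
        by (rule map_app_comp[OF gset_U[OF X] D]) (simp add: gfun_comp[OF g])
      finally show "gfun g (rd \<sigma>) (ev X \<sigma> xs) = ev Y \<sigma> (map (app g) xs)"
        by (simp add: ev_free[OF Y DY])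
    qed
    then show "\<exists>f\<in>hom V X Y. Farr U f = g" by (rule lift_arr[OF X Y])
  next
    fix A h assume "is_algebra (gset_cat n) T (A, h)"
    then have A: "is_gset n A" and h: "h \<in> hom (gset_cat n) (Fobj U (F A)) A"
      and unit: "Comp (gset_cat n) h (\<eta> A) = Ident (gset_cat n) A"
      and mult: "Comp (gset_cat n) h (Farr U (counit (F A))) = Comp (gset_cat n) h (Farr U (free_arr h))"
      by (auto simp: is_algebra_def)
    note e = free(2)[OF A] and FA = free(1)[OF A]
    let ?FA = "Fobj U (F A)"
    note UFA = gset_U[OF FA] and fh = free_arr[OF h] and c = counit[OF FA]
    note eF = free(2)[OF UFA]
    have he: "gfun h m (gfun (\<eta> A) m x) = x" if "x \<in> cells A m" for m x
      using that by (simp add: gfun_comp[OF e that, symmetric] unit)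
    \<comment> \<open>\<open>\<eta> A\<close> makes the arguments into generators, where the
      operations of the free object are available, and \<open>h\<close> brings the result back to
      \<open>A\<close>.\<close>
    define ea where "ea \<sigma> xs = gfun h (rd \<sigma>) (ev (F A) \<sigma> (map (app (\<eta> A)) xs))" for \<sigma> xs
    have ph: "phom n Dm rd ?FA (ev (F A)) A ea h"
      unfolding phom_def
    proof (intro conjI allI impI h)
      fix \<sigma> xs assume D: "Dm ?FA \<sigma> xs"
      note D' = Dm_map[OF eF D]
      let ?z = "ev (F ?FA) \<sigma> (map (app (\<eta> ?FA)) xs)"
      have z: "?z \<in> cel (F ?FA) (rd \<sigma>)" by (rule ev_cells[OF free(1)[OF UFA] D'])
      have "gfun h (rd \<sigma>) (ev (F A) \<sigma> xs) = gfun (Comp (gset_cat n) h (Farr U (counit (F A)))) (rd \<sigma>) ?z"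
        by (simp add: ev_free[OF FA D] gfun_comp[OF U_hom[OF c(1)] z])
      also have "\<dots> = gfun h (rd \<sigma>) (act (free_arr h) (rd \<sigma>) ?z)"
        by (simp add: mult gfun_comp[OF U_hom[OF fh(1)] z])
      also have "act (free_arr h) (rd \<sigma>) ?z = ev (F A) \<sigma> (map (app (Farr U (free_arr h))) (map (app (\<eta> ?FA)) xs))"
        by (rule act_ev[OF fh(1) D'])
      also have "map (app (Farr U (free_arr h))) (map (app (\<eta> ?FA)) xs) = map (app (Comp (gset_cat n) (\<eta> A) h)) xs"
        by (rule map_app_comp[symmetric, OF UFA D]) (simp add: fh(2)[symmetric] gfun_comp[OF eF])
      also have "\<dots> = map (app (\<eta> A)) (map (app h) xs)"
        by (rule map_app_comp[OF UFA D]) (simp add: gfun_comp[OF h])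
      finally show "gfun h (rd \<sigma>) (ev (F A) \<sigma> xs) = ea \<sigma> (map (app h) xs)"
        by (simp add: ea_def)
    qed
    have eac: "ea \<sigma> xs \<in> cells A (rd \<sigma>)" if "Dm A \<sigma> xs" for \<sigma> xs
      unfolding ea_def by (rule gfun_in[OF h ev_cells[OF FA Dm_map[OF e that]]])
    have "rep n V U Dm rd ev A ea" by (rule rep_quot[OF FA ph e he])
    then obtain N \<theta> where N: "N \<in> Obj V" and t: "phom n Dm rd A ea (Fobj U N) (ev N) \<theta>"
      and b: "\<And>m. bij_betw (gfun \<theta> m) (cells A m) (cel N m)" unfolding rep_def by blast
    have th: "\<theta> \<in> hom (gset_cat n) A (Fobj U N)" using t by (simp add: phom_def)
    obtain g where "g \<in> hom V (F A) N" "Farr U g = Comp (gset_cat n) \<theta> h"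
      using lift_arr[OF FA N phom_comp[OF ph t ev_cells[OF FA]]] by blast
    then show "\<exists>X\<in>Obj V. \<exists>\<theta>\<in>hom (gset_cat n) A (Fobj U X). iso_arr (gset_cat n) \<theta> \<and>
        (\<exists>g\<in>hom V (F A) X. Farr U g = Comp (gset_cat n) \<theta> h)"
      using N th gset_iso_arr[OF th b] by blast
  qed
qed

end

section \<open>Strings cut into blocks\<close>

text \<open>A string of \<open>k\<close> edges has \<open>k + 1\<close> vertices, so an empty string
  still has a vertex. The entries of \<open>ys\<close> will be cells, arrows of \<open>V\<close> or
  globular maps.\<close>

definition along :: "('a \<Rightarrow> 'a \<Rightarrow> 'b \<Rightarrow> bool) \<Rightarrow> 'a list \<Rightarrow> 'b list \<Rightarrow> bool" where
  "along R as ys \<longleftrightarrow> length as = Suc (length ys) \<and> (\<forall>i<length ys. R (as ! i) (as ! Suc i) (ys ! i))"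

definition medge :: "('a \<Rightarrow> 'a \<Rightarrow> 'b \<Rightarrow> 'c) \<Rightarrow> 'a list \<Rightarrow> 'b list \<Rightarrow> 'c list" where
  "medge \<phi> as ys = map (\<lambda>i. \<phi> (as ! i) (as ! Suc i) (ys ! i)) [0..<length ys]"

lemma length_medge [simp]: "length (medge \<phi> as ys) = length ys"
  by (simp add: medge_def)

lemma nth_medge [simp]: "i < length ys \<Longrightarrow> medge \<phi> as ys ! i = \<phi> (as ! i) (as ! Suc i) (ys ! i)"
  by (simp add: medge_def)

lemma alongD: "along R as ys \<Longrightarrow> length as = Suc (length ys)" "along R as ys \<Longrightarrow> as \<noteq> []"
  "along R as ys \<Longrightarrow> i < length ys \<Longrightarrow> R (as ! i) (as ! Suc i) (ys ! i)"
  by (auto simp: along_def)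

lemma along_nth_in: "along R as ys \<Longrightarrow> i < length ys \<Longrightarrow> as ! i \<in> set as \<and> as ! Suc i \<in> set as"
  by (auto simp: along_def)

lemma along_ends: "along R as ys \<Longrightarrow> hd as \<in> set as \<and> last as \<in> set as"
  by (auto dest: alongD(2))

lemma along_medge:
  assumes "along R as ys"
    "\<And>a b y. a \<in> set as \<Longrightarrow> b \<in> set as \<Longrightarrow> y \<in> set ys \<Longrightarrow> R a b y \<Longrightarrow> S (F a) (F b) (\<phi> a b y)"
  shows "along S (map F as) (medge \<phi> as ys)"
  using assms by (auto simp: along_def)

lemma along_medge_id:
  assumes "along R as ys"
    "\<And>a b y. a \<in> set as \<Longrightarrow> b \<in> set as \<Longrightarrow> y \<in> set ys \<Longrightarrow> R a b y \<Longrightarrow> S a b (\<phi> a b y)"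
  shows "along S as (medge \<phi> as ys)"
  using assms by (auto simp: along_def)

lemma along_map:
  assumes "along R as ys" "\<And>a b y. a \<in> set as \<Longrightarrow> b \<in> set as \<Longrightarrow> R a b y \<Longrightarrow> S a b (\<phi> y)"
  shows "along S as (map \<phi> ys)"
  using assms by (auto simp: along_def)

lemma medge_cong:
  assumes "along R as ys"
    "\<And>a b y. a \<in> set as \<Longrightarrow> b \<in> set as \<Longrightarrow> y \<in> set ys \<Longrightarrow> R a b y \<Longrightarrow> \<phi> a b y = \<psi> a b y"
  shows "medge \<phi> as ys = medge \<psi> as ys"
  using assms by (auto simp: along_def medge_def)

lemma medge_ident:
  assumes "along R as ys" "\<And>a b y. a \<in> set as \<Longrightarrow> b \<in> set as \<Longrightarrow> R a b y \<Longrightarrow> \<phi> a b y = y"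
  shows "medge \<phi> as ys = ys"
  using assms by (auto simp: along_def intro: nth_equalityI)

lemma medge_map_medge:
  assumes "length as = Suc (length ys)"
  shows "medge \<psi> (map F as) (medge \<phi> as ys) = medge (\<lambda>a b y. \<psi> (F a) (F b) (\<phi> a b y)) as ys"
  using assms by (auto simp: medge_def)

lemma medge_medge_same: "medge \<psi> as (medge \<phi> as ys) = medge (\<lambda>a b y. \<psi> a b (\<phi> a b y)) as ys"
  by (auto simp: medge_def)

lemma map_medge: "map f (medge \<phi> as ys) = medge (\<lambda>a b y. f (\<phi> a b y)) as ys"
  by (simp add: medge_def)

lemma medge_map: "medge \<phi> as (map f ys) = medge (\<lambda>a b y. \<phi> a b (f y)) as ys"
  by (simp add: medge_def)

lemma map_upt_cong: "(\<And>i. i < m \<Longrightarrow> f i = g i) \<Longrightarrow> map f [0..<m] = map g [0..<m]"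
  by simp

section \<open>Blocks of a cut string\<close>

lemma offset_Suc: "i < length ks \<Longrightarrow> offset ks (Suc i) = offset ks i + ks ! i"
  by (simp add: offset_def take_Suc_conv_app_nth)

lemma offset_le: "offset ks i \<le> sum_list ks"
proof -
  have "sum_list ks = offset ks i + sum_list (drop i ks)"
    unfolding offset_def by (metis append_take_drop_id sum_list_append)
  then show ?thesis by simp
qed

lemma offset_0 [simp]: "offset ks 0 = 0" and offset_all [simp]: "offset ks (length ks) = sum_list ks"
  by (simp_all add: offset_def)

lemma obj_block:
  assumes "length as = Suc (sum_list ks)" "i < length ks"
  shows "length (obj_block ks as i) = Suc (ks ! i)"
    "j \<le> ks ! i \<Longrightarrow> obj_block ks as i ! j = as ! (offset ks i + j)"
    "hd (obj_block ks as i) = as ! offset ks i" "last (obj_block ks as i) = as ! offset ks (Suc i)"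
    "set (obj_block ks as i) \<subseteq> set as"
proof -
  have le: "offset ks i + ks ! i \<le> sum_list ks" using offset_le[of ks "Suc i"] offset_Suc[OF assms(2)] by simp
  show l: "length (obj_block ks as i) = Suc (ks ! i)" using le assms by (simp add: obj_block_def)
  show nth: "obj_block ks as i ! j = as ! (offset ks i + j)" if "j \<le> ks ! i" for j
    using that le assms by (simp add: obj_block_def)
  show "hd (obj_block ks as i) = as ! offset ks i" using nth[of 0] l by (simp add: hd_conv_nth flip: length_greater_0_conv)
  show "last (obj_block ks as i) = as ! offset ks (Suc i)"
    using nth[of "ks ! i"] l offset_Suc[OF assms(2)] by (simp add: last_conv_nth flip: length_greater_0_conv)
  show "set (obj_block ks as i) \<subseteq> set as" unfolding obj_block_def by (meson set_drop_subset set_take_subset subset_trans)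
qed

lemma step_block:
  assumes "length ys = sum_list ks" "i < length ks"
  shows "length (step_block ks ys i) = ks ! i" "j < ks ! i \<Longrightarrow> step_block ks ys i ! j = ys ! (offset ks i + j)"
proof -
  have le: "offset ks i + ks ! i \<le> sum_list ks" using offset_le[of ks "Suc i"] offset_Suc[OF assms(2)] by simp
  show l: "length (step_block ks ys i) = ks ! i" using le assms by (simp add: step_block_def)
  show nth: "step_block ks ys i ! j = ys ! (offset ks i + j)" if "j < ks ! i" for j
    using that le assms by (simp add: step_block_def)
qed

lemma cut_points:
  "length (cut_points ks as) = Suc (length ks)"
  "i \<le> length ks \<Longrightarrow> cut_points ks as ! i = as ! offset ks i"
  by (simp_all add: cut_points_def del: upt_Suc)

lemma cut_points_ends:
  assumes "length as = Suc (sum_list ks)"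
  shows "hd (cut_points ks as) = hd as" "last (cut_points ks as) = last as" "set (cut_points ks as) \<subseteq> set as"
proof -
  have ne: "cut_points ks as \<noteq> []" "as \<noteq> []" using cut_points(1)[of ks as] assms by auto
  show "hd (cut_points ks as) = hd as" "last (cut_points ks as) = last as"
    using ne assms by (simp_all add: hd_conv_nth last_conv_nth cut_points)
  show "set (cut_points ks as) \<subseteq> set as"
    using assms offset_le[of ks] by (auto simp: cut_points_def le_imp_less_Suc simp del: upt_Suc)
qed

lemma obj_block_map: "obj_block ks (map F as) i = map F (obj_block ks as i)"
  by (simp add: obj_block_def take_map drop_map)

lemma step_block_map: "step_block ks (map F ys) i = map F (step_block ks ys i)"
  by (simp add: step_block_def take_map drop_map)

lemma cut_points_map:
  "length as = Suc (sum_list ks) \<Longrightarrow> cut_points ks (map F as) = map F (cut_points ks as)"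
  using offset_le[of ks] by (auto simp: cut_points_def le_imp_less_Suc simp del: upt_Suc)

lemma along_block:
  assumes al: "along R as ys" and k: "sum_list ks = length ys" and i: "i < length ks"
  shows "along R (obj_block ks as i) (step_block ks ys i)"
proof -
  have l: "length as = Suc (sum_list ks)" "length ys = sum_list ks" using al k by (auto simp: along_def)
  have le: "offset ks i + ks ! i \<le> sum_list ks" using offset_le[of ks "Suc i"] offset_Suc[OF i] by simp
  show ?thesis unfolding along_def
    using obj_block(1,2)[OF l(1) i] step_block[OF l(2) i] alongD(3)[OF al] le l by auto
qed

lemma along_cut:
  assumes al: "along R as ys" and k: "sum_list ks = length ys"
    and z: "\<And>i. i < length ks \<Longrightarrow> S (hd (obj_block ks as i)) (last (obj_block ks as i)) (z i)"
  shows "along S (cut_points ks as) (map z [0..<length ks])"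
proof -
  have l: "length as = Suc (sum_list ks)" using al k by (auto simp: along_def)
  show ?thesis unfolding along_def using z obj_block(3,4)[OF l] by (auto simp: cut_points)
qed

lemma medge_block:
  assumes "length as = Suc (length ys)" "sum_list ks = length ys" "i < length ks"
  shows "step_block ks (medge \<phi> as ys) i = medge \<phi> (obj_block ks as i) (step_block ks ys i)"
proof -
  have l: "length as = Suc (sum_list ks)" "length ys = sum_list ks" using assms by auto
  have le: "offset ks i + ks ! i \<le> sum_list ks" using offset_le[of ks "Suc i"] offset_Suc[OF assms(3)] by simp
  have m: "length (medge \<phi> as ys) = sum_list ks" using l by simp
  show ?thesis
    by (rule nth_equalityI) (use obj_block(1,2)[OF l(1) assms(3)] step_block[OF l(2) assms(3)] 
      step_block[OF m assms(3)] le l in auto)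
qed

text \<open>An edge of the coarse string runs from the first to the last object of its block, which
  is where the composite of the block lives.\<close>

lemma medge_cut:
  assumes "length as = Suc (sum_list ks)"
  shows "medge \<phi> (cut_points ks as) (map z [0..<length ks]) =
    map (\<lambda>i. \<phi> (hd (obj_block ks as i)) (last (obj_block ks as i)) (z i)) [0..<length ks]"
  using obj_block(3,4)[OF assms] by (auto simp: medge_def cut_points)

section \<open>Enriched categories in terms of elements\<close>

text \<open>The type of operation symbols is now a fixed one, chosen so that the enriched categories
  over \<open>V\<close> again have symbols of this type; otherwise the induction on \<open>n\<close>
  could not be iterated.\<close>

locale enriched = coded_opcat n V U Dm rd ev enl es
  for n :: nat and V :: "('o, 'm) cat" and U :: "('o, 'm, 'u gset, 'u gmap) ftor"
    and Dm :: "'u gset \<Rightarrow> nat \<times> nat \<times> nat \<times> 'u \<Rightarrow> (nat \<times> 'u) list \<Rightarrow> bool"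
    and rd :: "nat \<times> nat \<times> nat \<times> 'u \<Rightarrow> nat"
    and ev :: "'o \<Rightarrow> nat \<times> nat \<times> nat \<times> 'u \<Rightarrow> (nat \<times> 'u) list \<Rightarrow> 'u" and enl es +
  fixes P :: "('o, 'm) operad"
  assumes operad: "is_operad V P"
begin

abbreviation PU :: "nat \<Rightarrow> 'u gset" where "PU k \<equiv> Fobj U (ops P k)"

lemma P_Obj: "ops P k \<in> Obj V"
  using operad by (simp add: is_operad_def)

lemma P_gset: "is_gset n (PU k)"
  by (rule gset_U[OF P_Obj])

section \<open>The operad and the composition maps on cells\<close>

definition ou :: "nat \<Rightarrow> 'u" where
  "ou d = act (ounit P) d (tup [] d [])"

definition oc :: "nat list \<Rightarrow> nat \<Rightarrow> 'u \<Rightarrow> 'u list \<Rightarrow> 'u" where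
  "oc ks d p ps = act (ocomp P ks) d (tup (ops P (length ks) # map (ops P) ks) d (p # ps))"

lemma unit_at:
  assumes Y: "Y \<in> Obj V"
  shows "unit_at V P Y \<in> hom V Y (ops P 1)" "y \<in> cel Y d \<Longrightarrow> act (unit_at V P Y) d y = ou d"
proof -
  have u: "ounit P \<in> hom V (Prod V []) (ops P 1)" using operad by (simp add: is_operad_def)
  note t = tuple[OF Y, of "[]" "[]", simplified]
  show "unit_at V P Y \<in> hom V Y (ops P 1)" unfolding unit_at_def by (rule comp_hom[OF V t(1) u])
  show "act (unit_at V P Y) d y = ou d" if "y \<in> cel Y d"
    using that t by (simp add: unit_at_def ou_def act_comp[OF t(1) u])
qed

lemma ou_in: "d \<le> n \<Longrightarrow> ou d \<in> cells (PU 1) d"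
  using operad tup(1)[of "[]" d "[]"] unfolding ou_def by (intro act_in[of _ "Prod V []"]) (auto simp: is_operad_def)

lemma ocomp_hom: "ocomp P ks \<in> hom V (Prod V (ops P (length ks) # map (ops P) ks)) (ops P (sum_list ks))"
  using operad by (simp add: is_operad_def)

lemma ocomp_at:
  assumes Y: "Y \<in> Obj V" and p: "p \<in> hom V Y (ops P (length ks))"
    and ps: "list_all2 (\<lambda>q k. q \<in> hom V Y (ops P k)) ps ks"
  shows "ocomp_at V P Y ks p ps \<in> hom V Y (ops P (sum_list ks))"
    "y \<in> cel Y d \<Longrightarrow> act (ocomp_at V P Y ks p ps) d y = oc ks d (act p d y) (map (\<lambda>q. act q d y) ps)"
proof -
  have "list_all2 (\<lambda>f X. f \<in> hom V Y X) (p # ps) (ops P (length ks) # map (ops P) ks)"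
    using p ps by (simp add: list.rel_map)
  note t = tuple[OF Y this]
  show "ocomp_at V P Y ks p ps \<in> hom V Y (ops P (sum_list ks))"
    unfolding ocomp_at_def by (rule comp_hom[OF V t(1) ocomp_hom])
  show "act (ocomp_at V P Y ks p ps) d y = oc ks d (act p d y) (map (\<lambda>q. act q d y) ps)" if "y \<in> cel Y d"
    using t(2)[OF that] that by (simp add: ocomp_at_def oc_def act_comp[OF t(1) ocomp_hom])
qed

lemma oc_in:
  assumes p: "p \<in> cells (PU (length ks)) d" and ps: "list_all2 (\<lambda>q k. q \<in> cells (PU k) d) ps ks"
  shows "oc ks d p ps \<in> cells (PU (sum_list ks)) d"
  unfolding oc_def
  by (rule act_in[OF ocomp_hom], rule tup(1))
    (use P_Obj gset_dim[OF P_gset p] p ps in \<open>auto simp: list.rel_map\<close>)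

text \<open>The action as an operation on \<open>d\<close>-cells. Cells are given along the string,
  whereas the domain of the action lists the homs backwards; hence \<open>rev\<close>.\<close>

definition gam :: "('u, 'o, 'm) vpcat \<Rightarrow> 'u list \<Rightarrow> nat \<Rightarrow> 'u \<Rightarrow> 'u list \<Rightarrow> 'u" where
  "gam A as d p ys = act (vact A as) d (tup (ops P (length as - 1) # rev (steps (ugraph A) as)) d (p # rev ys))"

abbreviation gH :: "('u, 'o, 'm) vpcat \<Rightarrow> 'u \<Rightarrow> 'u \<Rightarrow> 'u gset" where
  "gH A a b \<equiv> Fobj U (ghom (ugraph A) a b)"

abbreviation fits :: "('u \<Rightarrow> 'u \<Rightarrow> 'u gset) \<Rightarrow> nat \<Rightarrow> 'u list \<Rightarrow> 'u list \<Rightarrow> bool" where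
  "fits H d \<equiv> along (\<lambda>a b y. y \<in> cells (H a b) d)"

abbreviation arrs :: "('u, 'o, 'm) vpcat \<Rightarrow> 'o \<Rightarrow> 'u list \<Rightarrow> 'm list \<Rightarrow> bool" where
  "arrs A Y \<equiv> along (\<lambda>a b f. f \<in> hom V Y (ghom (ugraph A) a b))"

text \<open>The typing half of \<open>is_vpcat\<close>, enough to compute with \<open>gam\<close>;
  the equations join it in \<open>is_vpcat_iff\<close>.\<close>

definition pre :: "('u, 'o, 'm) vpcat \<Rightarrow> bool" where
  "pre A \<longleftrightarrow> is_vgraph V (ugraph A) \<and>
     (\<forall>as. if as \<in> strings (ugraph A)
           then vact A as \<in> hom V (Prod V (ops P (length as - 1) # rev (steps (ugraph A) as)))
                               (ghom (ugraph A) (hd as) (last as))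
           else vact A as = undefined)"

lemma list_all2_steps: "as \<noteq> [] \<Longrightarrow> list_all2 (\<lambda>y X. Q y X) ys (steps B as) \<longleftrightarrow>
    along (\<lambda>a b y. Q y (ghom B a b)) as ys"
  by (cases as) (auto simp: list_all2_conv_all_nth steps_def along_def)

lemma length_steps [simp]: "length (steps B as) = length as - 1"
  by (simp add: steps_def)

lemma ghom_Obj: "pre A \<Longrightarrow> a \<in> gobjs (ugraph A) \<Longrightarrow> b \<in> gobjs (ugraph A) \<Longrightarrow> ghom (ugraph A) a b \<in> Obj V"
  unfolding pre_def is_vgraph_def by meson

lemma steps_Obj:
  assumes "pre A" "set as \<subseteq> gobjs (ugraph A)"
  shows "set (ops P k # rev (steps (ugraph A) as)) \<subseteq> Obj V"
proof -
  have "ghom (ugraph A) (as ! i) (as ! Suc i) \<in> Obj V" if "i < length as - 1" for i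
    using that assms(2) by (intro ghom_Obj[OF assms(1)]) auto
  then show ?thesis using P_Obj by (auto simp: steps_def)
qed

lemma vact_hom: "pre A \<Longrightarrow> as \<noteq> [] \<Longrightarrow> set as \<subseteq> gobjs (ugraph A) \<Longrightarrow>
    vact A as \<in> hom V (Prod V (ops P (length as - 1) # rev (steps (ugraph A) as))) (ghom (ugraph A) (hd as) (last as))"
  unfolding pre_def strings_def by (metis (mono_tags, lifting) mem_Collect_eq)

lemma gam_args:
  assumes "fits (gH A) d as ys" "p \<in> cells (PU (length ys)) d"
  shows "list_all2 (\<lambda>y X. y \<in> cel X d) (p # rev ys) (ops P (length as - 1) # rev (steps (ugraph A) as))"
  using assms list_all2_steps[of as "\<lambda>y X. y \<in> cel X d" ys "ugraph A"] alongD(1,2)[OF assms(1)]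
  by simp

lemma gam_in:
  assumes A: "pre A" and as: "set as \<subseteq> gobjs (ugraph A)" and ys: "fits (gH A) d as ys"
    and p: "p \<in> cells (PU (length ys)) d"
  shows "gam A as d p ys \<in> cells (gH A (hd as) (last as)) d"
  unfolding gam_def
  by (rule act_in[OF vact_hom[OF A alongD(2)[OF ys] as]], rule tup(1)[OF steps_Obj[OF A as] gset_dim[OF P_gset p] gam_args[OF ys p]])

lemma vact_at:
  assumes A: "pre A" and Y: "Y \<in> Obj V" and as: "set as \<subseteq> gobjs (ugraph A)"
    and fs: "arrs A Y as fs" and p: "p \<in> hom V Y (ops P (length fs))"
  shows "vact_at V A Y as p fs \<in> hom V Y (ghom (ugraph A) (hd as) (last as))"
    "y \<in> cel Y d \<Longrightarrow> act (vact_at V A Y as p fs) d y = gam A as d (act p d y) (map (\<lambda>f. act f d y) fs)"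
proof -
  have "list_all2 (\<lambda>f X. f \<in> hom V Y X) (p # rev fs) (ops P (length as - 1) # rev (steps (ugraph A) as))"
    using p list_all2_steps[of as "\<lambda>f X. f \<in> hom V Y X" fs "ugraph A"] alongD(1,2)[OF fs] fs by simp
  note t = tuple[OF Y this] and v = vact_hom[OF A alongD(2)[OF fs] as]
  show "vact_at V A Y as p fs \<in> hom V Y (ghom (ugraph A) (hd as) (last as))"
    unfolding vact_at_def by (rule comp_hom[OF V t(1) v])
  show "act (vact_at V A Y as p fs) d y = gam A as d (act p d y) (map (\<lambda>f. act f d y) fs)" if "y \<in> cel Y d"
    using t(2)[OF that] that by (simp add: vact_at_def gam_def act_comp[OF t(1) v] rev_map)
qed

text \<open>This law and the next are stated for abstract data \<open>Ob\<close>, \<open>H\<close>,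
  \<open>g\<close>, because they will also be considered for structures not yet known to come from
  an enriched category.\<close>

definition unit_law :: "'u set \<Rightarrow> ('u \<Rightarrow> 'u \<Rightarrow> 'u gset) \<Rightarrow> ('u list \<Rightarrow> nat \<Rightarrow> 'u \<Rightarrow> 'u list \<Rightarrow> 'u) \<Rightarrow> bool" where
  "unit_law Ob H g \<longleftrightarrow> (\<forall>d. \<forall>a\<in>Ob. \<forall>b\<in>Ob. \<forall>y\<in>cells (H a b) d. g [a, b] d (ou d) [y] = y)"

definition assoc_law :: "'u set \<Rightarrow> ('u \<Rightarrow> 'u \<Rightarrow> 'u gset) \<Rightarrow> ('u list \<Rightarrow> nat \<Rightarrow> 'u \<Rightarrow> 'u list \<Rightarrow> 'u) \<Rightarrow> bool" where
  "assoc_law Ob H g \<longleftrightarrow> (\<forall>d as ks p ps ys. set as \<subseteq> Ob \<and> fits H d as ys \<and> sum_list ks = length ys \<and>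
     p \<in> cells (PU (length ks)) d \<and> list_all2 (\<lambda>q k. q \<in> cells (PU k) d) ps ks \<longrightarrow>
     g (cut_points ks as) d p (map (\<lambda>i. g (obj_block ks as i) d (ps ! i) (step_block ks ys i)) [0..<length ks]) =
     g as d (oc ks d p ps) ys)"

text \<open>Both sides of the associativity axiom are typed and evaluated on cells here, once for
  the two directions of \<open>is_vpcat_iff\<close>.\<close>

lemma vact_blocks:
  assumes A: "pre A" and Y: "Y \<in> Obj V" and as: "set as \<subseteq> gobjs (ugraph A)" and fs: "arrs A Y as fs"
    and k: "sum_list ks = length fs" and p: "p \<in> hom V Y (ops P (length ks))"
    and ps: "list_all2 (\<lambda>q k. q \<in> hom V Y (ops P k)) ps ks"
  defines "L \<equiv> vact_at V A Y (cut_points ks as) p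
          (map (\<lambda>i. vact_at V A Y (obj_block ks as i) (ps ! i) (step_block ks fs i)) [0..<length ks])"
  shows "L \<in> hom V Y (ghom (ugraph A) (hd as) (last as))"
    "y \<in> cel Y d \<Longrightarrow> act L d y = gam A (cut_points ks as) d (act p d y)
       (map (\<lambda>i. gam A (obj_block ks as i) d (act (ps ! i) d y) (step_block ks (map (\<lambda>f. act f d y) fs) i)) [0..<length ks])"
    "vact_at V A Y as (ocomp_at V P Y ks p ps) fs \<in> hom V Y (ghom (ugraph A) (hd as) (last as))"
    "y \<in> cel Y d \<Longrightarrow> act (vact_at V A Y as (ocomp_at V P Y ks p ps) fs) d y =
       gam A as d (oc ks d (act p d y) (map (\<lambda>q. act q d y) ps)) (map (\<lambda>f. act f d y) fs)"
proof -
  have l: "length as = Suc (sum_list ks)" "length fs = sum_list ks" using fs k by (auto simp: along_def)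
  note cs = cut_points_ends[OF l(1)]
  have B: "arrs A Y (obj_block ks as i) (step_block ks fs i)" "set (obj_block ks as i) \<subseteq> gobjs (ugraph A)"
    "ps ! i \<in> hom V Y (ops P (length (step_block ks fs i)))" if "i < length ks" for i
    using along_block[OF fs k that] obj_block(5)[OF l(1) that] as step_block(1)[OF l(2) that] ps that
    by (auto simp: list_all2_conv_all_nth)
  note v = vact_at[OF A Y B(2,1,3)]
  have C: "arrs A Y (cut_points ks as) (map (\<lambda>i. vact_at V A Y (obj_block ks as i) (ps ! i) (step_block ks fs i)) [0..<length ks])"
    by (rule along_cut[OF fs k]) (rule v(1))
  have cs': "set (cut_points ks as) \<subseteq> gobjs (ugraph A)" using cs(3) as by blast
  note vc = vact_at[OF A Y cs' C, of p]
  show "L \<in> hom V Y (ghom (ugraph A) (hd as) (last as))" using vc(1) p cs by (simp add: L_def)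
  show "act L d y = gam A (cut_points ks as) d (act p d y)
       (map (\<lambda>i. gam A (obj_block ks as i) d (act (ps ! i) d y) (step_block ks (map (\<lambda>f. act f d y) fs) i)) [0..<length ks])"
    if y: "y \<in> cel Y d"
  proof -
    have eq: "map (\<lambda>i. act (vact_at V A Y (obj_block ks as i) (ps ! i) (step_block ks fs i)) d y) [0..<length ks] =
      map (\<lambda>i. gam A (obj_block ks as i) d (act (ps ! i) d y) (step_block ks (map (\<lambda>f. act f d y) fs) i)) [0..<length ks]"
      by (rule map_upt_cong) (simp add: v(2)[OF _ _ _ y] step_block_map)
    show ?thesis unfolding L_def eq[symmetric] using vc(2)[OF _ y] p by (simp add: o_def)
  qed
  note o = ocomp_at[OF Y p ps]
  have o': "ocomp_at V P Y ks p ps \<in> hom V Y (ops P (length fs))" using o(1) k by simp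
  note w = vact_at[OF A Y as fs o']
  show "vact_at V A Y as (ocomp_at V P Y ks p ps) fs \<in> hom V Y (ghom (ugraph A) (hd as) (last as))" by (rule w(1))
  show "act (vact_at V A Y as (ocomp_at V P Y ks p ps) fs) d y =
       gam A as d (oc ks d (act p d y) (map (\<lambda>q. act q d y) ps)) (map (\<lambda>f. act f d y) fs)" if "y \<in> cel Y d"
    using w(2)[OF that] o(2)[OF that] by simp
qed

lemma along_args:
  assumes "as \<in> strings (ugraph A)" "list_all2 (\<lambda>f Z. f \<in> hom V Y Z) fs (steps (ugraph A) as)"
  shows "arrs A Y as fs" "set as \<subseteq> gobjs (ugraph A)" "length fs = length as - 1"
  using assms list_all2_steps[of as "\<lambda>f Z. f \<in> hom V Y Z" fs "ugraph A"] list_all2_lengthD[OF assms(2)]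
  by (auto simp: strings_def)

text \<open>From arrows to cells, the axioms are applied to well chosen generalized elements: the
  identity of a hom for the unit law, a generic element of a product for associativity. From cells
  to arrows, parallel arrows of \<open>V\<close> are equal once they agree on all cells.\<close>

lemma is_vpcat_iff:
  "is_vpcat V P A \<longleftrightarrow> pre A \<and> unit_law (gobjs (ugraph A)) (gH A) (gam A) \<and> assoc_law (gobjs (ugraph A)) (gH A) (gam A)"
proof
  assume A: "is_vpcat V P A"
  then have pre: "pre A" unfolding is_vpcat_def pre_def by blast
  have "unit_law (gobjs (ugraph A)) (gH A) (gam A)"
    unfolding unit_law_def
  proof (intro allI ballI)
    fix d a b y assume a: "a \<in> gobjs (ugraph A)" "b \<in> gobjs (ugraph A)" and y: "y \<in> cells (gH A a b) d"
    let ?Y = "ghom (ugraph A) a b"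
    have Y: "?Y \<in> Obj V" using ghom_Obj[OF pre a] .
    note id = ident_hom[OF V Y]
    have eq: "vact_at V A ?Y [a, b] (unit_at V P ?Y) [Ident V ?Y] = Ident V ?Y"
      using A Y a id unfolding is_vpcat_def by blast
    have "arrs A ?Y [a, b] [Ident V ?Y]" using id by (simp add: along_def)
    from vact_at(2)[OF pre Y _ this _ y, of "unit_at V P ?Y"] a unit_at[OF Y] y
    have "act (vact_at V A ?Y [a, b] (unit_at V P ?Y) [Ident V ?Y]) d y = gam A [a, b] d (ou d) [act (Ident V ?Y) d y]"
      by simp
    then show "gam A [a, b] d (ou d) [y] = y" unfolding eq using y by (simp add: functor_ident[OF U Y])
  qed
  moreover have "assoc_law (gobjs (ugraph A)) (gH A) (gam A)"
    unfolding assoc_law_def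
  proof (intro allI impI, elim conjE)
    fix d as ks p ps ys
    assume as: "set as \<subseteq> gobjs (ugraph A)" and ys: "fits (gH A) d as ys" and k: "sum_list ks = length ys"
      and p: "p \<in> cells (PU (length ks)) d" and ps: "list_all2 (\<lambda>q k. q \<in> cells (PU k) d) ps ks"
    \<comment> \<open>One product for everything that occurs: \<open>P(m)\<close>, the
      \<open>P(k\<^sub>i)\<close> and the homs of the string. The given cells are then the values of
      generalized elements at a common cell \<open>y\<close>.\<close>
    have XO: "set (ops P (length ks) # (map (ops P) ks @ steps (ugraph A) as)) \<subseteq> Obj V"
      using P_Obj steps_Obj[OF pre as] by auto
    have "list_all2 (\<lambda>x X. x \<in> cel X d) (p # (ps @ ys)) (ops P (length ks) # (map (ops P) ks @ steps (ugraph A) as))"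
      using p ps ys list_all2_steps[of as "\<lambda>x X. x \<in> cel X d" ys "ugraph A"] alongD(2)[OF ys]
      by (auto simp: list.rel_map intro!: list_all2_appendI)
    from generic_element[OF XO gset_dim[OF P_gset p] this] obtain Y y gs where Y: "Y \<in> Obj V" and y: "y \<in> cel Y d"
      and gs: "list_all2 (\<lambda>f X. f \<in> hom V Y X) gs (ops P (length ks) # (map (ops P) ks @ steps (ugraph A) as))"
      and gy: "map (\<lambda>f. act f d y) gs = p # (ps @ ys)" by blast
    obtain p' gs' where g1: "gs = p' # gs'" "p' \<in> hom V Y (ops P (length ks))"
      "list_all2 (\<lambda>f X. f \<in> hom V Y X) gs' (map (ops P) ks @ steps (ugraph A) as)"
      using gs by (auto simp: list_all2_Cons2)
    obtain ps' fs where g2: "gs' = ps' @ fs" "list_all2 (\<lambda>f X. f \<in> hom V Y X) ps' (map (ops P) ks)"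
      "list_all2 (\<lambda>f X. f \<in> hom V Y X) fs (steps (ugraph A) as)"
      using g1(3) by (auto simp: list_all2_append2)
    have ps': "list_all2 (\<lambda>q k. q \<in> hom V Y (ops P k)) ps' ks" using g2(2) by (simp add: list.rel_map)
    have str: "as \<in> strings (ugraph A)" using as alongD(2)[OF ys] by (simp add: strings_def)
    note ar = along_args[OF str g2(3)]
    have lf: "length fs = length ys" using ar(3) alongD(1)[OF ys] by simp
    have lp: "length ps' = length ps" using ps ps' by (simp add: list_all2_lengthD)
    have vals: "act p' d y = p" "map (\<lambda>f. act f d y) ps' = ps" "map (\<lambda>f. act f d y) fs = ys"
      using gy g1(1) g2(1) lf lp by auto
    have pi: "act (ps' ! i) d y = ps ! i" if "i < length ks" for i
      using vals(2) that list_all2_lengthD[OF ps'] by (metis nth_map)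
    have kl: "sum_list ks = length as - 1" using k alongD(1)[OF ys] by simp
    have "vact_at V A Y (cut_points ks as) p'
          (map (\<lambda>i. vact_at V A Y (obj_block ks as i) (ps' ! i) (step_block ks fs i)) [0..<length ks]) =
        vact_at V A Y as (ocomp_at V P Y ks p' ps') fs"
      using A Y str kl g1(2) ps' g2(3) unfolding is_vpcat_def by blast
    then show "gam A (cut_points ks as) d p (map (\<lambda>i. gam A (obj_block ks as i) d (ps ! i) (step_block ks ys i)) [0..<length ks]) =
     gam A as d (oc ks d p ps) ys"
      using vact_blocks(2,4)[OF pre Y ar(2,1) _ g1(2) ps' y] k lf
        map_upt_cong[of "length ks" "\<lambda>i. gam A (obj_block ks as i) d (act (ps' ! i) d y) (step_block ks ys i)"
          "\<lambda>i. gam A (obj_block ks as i) d (ps ! i) (step_block ks ys i)"]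
      by (simp add: vals pi)
  qed
  ultimately show "pre A \<and> unit_law (gobjs (ugraph A)) (gH A) (gam A) \<and> assoc_law (gobjs (ugraph A)) (gH A) (gam A)"
    using pre by blast
next
  assume "pre A \<and> unit_law (gobjs (ugraph A)) (gH A) (gam A) \<and> assoc_law (gobjs (ugraph A)) (gH A) (gam A)"
  then have pre: "pre A" and ul: "unit_law (gobjs (ugraph A)) (gH A) (gam A)"
    and al: "assoc_law (gobjs (ugraph A)) (gH A) (gam A)" by auto
  show "is_vpcat V P A"
    unfolding is_vpcat_def
  proof (intro conjI ballI allI impI)
    fix Y a b f assume Y: "Y \<in> Obj V" and a: "a \<in> gobjs (ugraph A)" "b \<in> gobjs (ugraph A)"
      and f: "f \<in> hom V Y (ghom (ugraph A) a b)"
    have ar: "arrs A Y [a, b] [f]" using f by (simp add: along_def)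
    have u: "unit_at V P Y \<in> hom V Y (ops P (length [f]))" using unit_at(1)[OF Y] by simp
    have as: "set [a, b] \<subseteq> gobjs (ugraph A)" using a by simp
    note v = vact_at[OF pre Y as ar u]
    show "vact_at V A Y [a, b] (unit_at V P Y) [f] = f"
    proof (rule arr_eqI[OF _ f])
      show "vact_at V A Y [a, b] (unit_at V P Y) [f] \<in> hom V Y (ghom (ugraph A) a b)" using v(1) by simp
      fix m y assume y: "y \<in> cel Y m"
      show "act (vact_at V A Y [a, b] (unit_at V P Y) [f]) m y = act f m y"
        using v(2)[OF y] ul a act_in[OF f y] unit_at(2)[OF Y y] unfolding unit_law_def by simp
    qed
  next
    fix Y as ks p ps fs
    assume Y: "Y \<in> Obj V" and str: "as \<in> strings (ugraph A)"
      and asm: "sum_list ks = length as - 1 \<and> p \<in> hom V Y (ops P (length ks)) \<and>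
        list_all2 (\<lambda>q k. q \<in> hom V Y (ops P k)) ps ks \<and> list_all2 (\<lambda>f Z. f \<in> hom V Y Z) fs (steps (ugraph A) as)"
    then have p: "p \<in> hom V Y (ops P (length ks))" and ps: "list_all2 (\<lambda>q k. q \<in> hom V Y (ops P k)) ps ks"
      and fs: "list_all2 (\<lambda>f Z. f \<in> hom V Y Z) fs (steps (ugraph A) as)" by auto
    note ar = along_args[OF str fs]
    have k: "sum_list ks = length fs" using asm ar(3) by simp
    note v = vact_blocks[OF pre Y ar(2,1) k p ps]
    show "vact_at V A Y (cut_points ks as) p
          (map (\<lambda>i. vact_at V A Y (obj_block ks as i) (ps ! i) (step_block ks fs i)) [0..<length ks]) =
        vact_at V A Y as (ocomp_at V P Y ks p ps) fs"
    proof (rule arr_eqI[OF v(1,3)])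
      fix m y assume y: "y \<in> cel Y m"
      have 1: "fits (gH A) m as (map (\<lambda>f. act f m y) fs)"
        by (rule along_map[OF ar(1)]) (rule act_in[OF _ y])
      have 2: "list_all2 (\<lambda>q k. q \<in> cells (PU k) m) (map (\<lambda>q. act q m y) ps) ks"
        using ps by (auto simp: list_all2_conv_all_nth intro: act_in[OF _ y])
      have lp: "length ps = length ks" using ps by (simp add: list_all2_lengthD)
      have "gam A (cut_points ks as) m (act p m y) (map (\<lambda>i. gam A (obj_block ks as i) m (map (\<lambda>q. act q m y) ps ! i)
         (step_block ks (map (\<lambda>f. act f m y) fs) i)) [0..<length ks]) =
        gam A as m (oc ks m (act p m y) (map (\<lambda>q. act q m y) ps)) (map (\<lambda>f. act f m y) fs)"
        using al 1 2 ar(2) k act_in[OF p y] unfolding assoc_law_def by simp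
      then show "act (vact_at V A Y (cut_points ks as) p
          (map (\<lambda>i. vact_at V A Y (obj_block ks as i) (ps ! i) (step_block ks fs i)) [0..<length ks])) m y =
        act (vact_at V A Y as (ocomp_at V P Y ks p ps) fs) m y"
        unfolding v(2)[OF y] v(4)[OF y] using lp
          map_upt_cong[of "length ks" "\<lambda>i. gam A (obj_block ks as i) m (map (\<lambda>q. act q m y) ps ! i)
            (step_block ks (map (\<lambda>f. act f m y) fs) i)" "\<lambda>i. gam A (obj_block ks as i) m (act (ps ! i) m y)
            (step_block ks (map (\<lambda>f. act f m y) fs) i)"] by simp
    qed
  qed (insert pre, unfold pre_def, blast+)
qed


section \<open>Enriched functors on cells\<close>

definition hom_law :: "('u, 'o, 'm) vpmap \<Rightarrow> bool" where
  "hom_law F \<longleftrightarrow> (\<forall>d as p ys. set as \<subseteq> gobjs (ugraph (vdom F)) \<and> fits (gH (vdom F)) d as ys \<and>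
     p \<in> cells (PU (length ys)) d \<longrightarrow>
     act (vhom F (hd as) (last as)) d (gam (vdom F) as d p ys) =
     gam (vcod F) (map (vfun F) as) d p (medge (\<lambda>a b. act (vhom F a b) d) as ys))"

lemma vpcat_pre: "is_vpcat V P A \<Longrightarrow> pre A"
  by (simp add: is_vpcat_iff)

lemma vgraph_mapD:
  assumes "is_vgraph_map V A B F H"
  shows "a \<in> gobjs A \<Longrightarrow> F a \<in> gobjs B"
    "a \<in> gobjs A \<Longrightarrow> b \<in> gobjs A \<Longrightarrow> H a b \<in> hom V (ghom A a b) (ghom B (F a) (F b))"
    "F \<in> extensional (gobjs A)" "a \<notin> gobjs A \<or> b \<notin> gobjs A \<Longrightarrow> H a b = undefined"
  using assms unfolding is_vgraph_map_def PiE_def Pi_def by (auto split: if_splits)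

text \<open>As for \<open>is_vpcat_iff\<close>: a generic element of the domain of the action in one
  direction, comparison of arrows on cells in the other.\<close>

lemma is_vpmap_iff:
  "is_vpmap V P F \<longleftrightarrow> is_vpcat V P (vdom F) \<and> is_vpcat V P (vcod F) \<and>
     is_vgraph_map V (ugraph (vdom F)) (ugraph (vcod F)) (vfun F) (vhom F) \<and> hom_law F"
proof -
  let ?A = "vdom F" and ?B = "vcod F"
  have main: "(\<forall>Y\<in>Obj V. \<forall>as\<in>strings (ugraph ?A). \<forall>p fs.
        p \<in> hom V Y (ops P (length as - 1)) \<and>
        list_all2 (\<lambda>f Z. f \<in> hom V Y Z) fs (steps (ugraph ?A) as) \<longrightarrow>
        Comp V (vhom F (hd as) (last as)) (vact_at V ?A Y as p fs) =
        vact_at V ?B Y (map (vfun F) as) p (map (\<lambda>i. Comp V (vhom F (as ! i) (as ! Suc i)) (fs ! i)) [0..<length fs]))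
    \<longleftrightarrow> hom_law F" (is "?L \<longleftrightarrow> _")
    if A: "pre ?A" and B: "pre ?B" and m: "is_vgraph_map V (ugraph ?A) (ugraph ?B) (vfun F) (vhom F)"
  proof -
    have el: "Comp V (vhom F (hd as) (last as)) (vact_at V ?A Y as p fs) \<in> hom V Y (ghom (ugraph ?B) (vfun F (hd as)) (vfun F (last as)))"
      "vact_at V ?B Y (map (vfun F) as) p (medge (\<lambda>a b f. Comp V (vhom F a b) f) as fs) \<in>
         hom V Y (ghom (ugraph ?B) (vfun F (hd as)) (vfun F (last as)))"
      "y \<in> cel Y d \<Longrightarrow> act (Comp V (vhom F (hd as) (last as)) (vact_at V ?A Y as p fs)) d y =
        act (vhom F (hd as) (last as)) d (gam ?A as d (act p d y) (map (\<lambda>f. act f d y) fs))"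
      "y \<in> cel Y d \<Longrightarrow> act (vact_at V ?B Y (map (vfun F) as) p (medge (\<lambda>a b f. Comp V (vhom F a b) f) as fs)) d y =
        gam ?B (map (vfun F) as) d (act p d y) (medge (\<lambda>a b. act (vhom F a b) d) as (map (\<lambda>f. act f d y) fs))"
      if Y: "Y \<in> Obj V" and as: "set as \<subseteq> gobjs (ugraph ?A)" and fs: "arrs ?A Y as fs"
        and p: "p \<in> hom V Y (ops P (length fs))" for Y as fs p y d
    proof -
      note v = vact_at[OF A Y as fs p]
      have e: "hd as \<in> gobjs (ugraph ?A)" "last as \<in> gobjs (ugraph ?A)" using along_ends[OF fs] as by auto
      note h = vgraph_mapD(2)[OF m e]
      show "Comp V (vhom F (hd as) (last as)) (vact_at V ?A Y as p fs) \<in> hom V Y (ghom (ugraph ?B) (vfun F (hd as)) (vfun F (last as)))"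
        by (rule comp_hom[OF V v(1) h])
      have fs': "arrs ?B Y (map (vfun F) as) (medge (\<lambda>a b f. Comp V (vhom F a b) f) as fs)"
        by (rule along_medge[OF fs]) (use as in \<open>blast intro: comp_hom[OF V] vgraph_mapD(2)[OF m]\<close>)
      have as': "set (map (vfun F) as) \<subseteq> gobjs (ugraph ?B)" using as vgraph_mapD(1)[OF m] by auto
      have p': "p \<in> hom V Y (ops P (length (medge (\<lambda>a b f. Comp V (vhom F a b) f) as fs)))" using p by simp
      note v' = vact_at[OF B Y as' fs' p']
      have hl: "hd (map (vfun F) as) = vfun F (hd as)" "last (map (vfun F) as) = vfun F (last as)"
        using alongD(2)[OF fs] by (simp_all add: hd_map last_map)
      show "vact_at V ?B Y (map (vfun F) as) p (medge (\<lambda>a b f. Comp V (vhom F a b) f) as fs) \<in>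
         hom V Y (ghom (ugraph ?B) (vfun F (hd as)) (vfun F (last as)))" using v'(1) hl by simp
      assume y: "y \<in> cel Y d"
      show "act (Comp V (vhom F (hd as) (last as)) (vact_at V ?A Y as p fs)) d y =
        act (vhom F (hd as) (last as)) d (gam ?A as d (act p d y) (map (\<lambda>f. act f d y) fs))"
        using act_comp[OF v(1) h y] v(2)[OF y] by simp
      have "medge (\<lambda>a b f. act (Comp V (vhom F a b) f) d y) as fs = medge (\<lambda>a b f. act (vhom F a b) d (act f d y)) as fs"
        by (rule medge_cong[OF fs]) (use as in \<open>blast intro: act_comp[OF _ vgraph_mapD(2)[OF m] y]\<close>)
      then show "act (vact_at V ?B Y (map (vfun F) as) p (medge (\<lambda>a b f. Comp V (vhom F a b) f) as fs)) d y =
        gam ?B (map (vfun F) as) d (act p d y) (medge (\<lambda>a b. act (vhom F a b) d) as (map (\<lambda>f. act f d y) fs))"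
        using v'(2)[OF y] by (simp add: map_medge medge_map)
    qed
    show ?thesis
    proof
      assume L: ?L
      show "hom_law F"
        unfolding hom_law_def
      proof (intro allI impI, elim conjE)
        fix d as p ys assume as: "set as \<subseteq> gobjs (ugraph ?A)" and ys: "fits (gH ?A) d as ys"
          and p: "p \<in> cells (PU (length ys)) d"
        note ga = gam_args[OF ys p]
        from generic_element[OF steps_Obj[OF A as] gset_dim[OF P_gset p] ga] obtain Y y gs where Y: "Y \<in> Obj V" and y: "y \<in> cel Y d"
          and gs: "list_all2 (\<lambda>f X. f \<in> hom V Y X) gs (ops P (length as - 1) # rev (steps (ugraph ?A) as))"
          and gy: "map (\<lambda>f. act f d y) gs = p # rev ys" by blast
        obtain p' fs where g1: "gs = p' # rev fs" "p' \<in> hom V Y (ops P (length as - 1))"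
          "list_all2 (\<lambda>f X. f \<in> hom V Y X) fs (steps (ugraph ?A) as)"
          using gs by (auto simp: list_all2_Cons2) (metis list_all2_rev rev_rev_ident)
        have vals: "act p' d y = p" "map (\<lambda>f. act f d y) fs = ys"
          using gy g1(1) by (auto simp: rev_map[symmetric])
        have str: "as \<in> strings (ugraph ?A)" using as alongD(2)[OF ys] by (simp add: strings_def)
        note ar = along_args[OF str g1(3)]
        have p': "p' \<in> hom V Y (ops P (length fs))" using g1(2) ar(3) by simp
        have "Comp V (vhom F (hd as) (last as)) (vact_at V ?A Y as p' fs) =
          vact_at V ?B Y (map (vfun F) as) p' (medge (\<lambda>a b f. Comp V (vhom F a b) f) as fs)"
          using L Y str g1 unfolding medge_def by blast
        then show "act (vhom F (hd as) (last as)) d (gam ?A as d p ys) =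
          gam ?B (map (vfun F) as) d p (medge (\<lambda>a b. act (vhom F a b) d) as ys)"
          using el(3,4)[OF Y as ar(1) p' y] vals by simp
      qed
    next
      assume hl: "hom_law F"
      show ?L
      proof (intro ballI allI impI, elim conjE)
        fix Y as p fs assume Y: "Y \<in> Obj V" and str: "as \<in> strings (ugraph ?A)"
          and p: "p \<in> hom V Y (ops P (length as - 1))" and fs: "list_all2 (\<lambda>f Z. f \<in> hom V Y Z) fs (steps (ugraph ?A) as)"
        note ar = along_args[OF str fs]
        have p': "p \<in> hom V Y (ops P (length fs))" using p ar(3) by simp
        note e = el[OF Y ar(2,1) p']
        have "Comp V (vhom F (hd as) (last as)) (vact_at V ?A Y as p fs) =
          vact_at V ?B Y (map (vfun F) as) p (medge (\<lambda>a b f. Comp V (vhom F a b) f) as fs)"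
        proof (rule arr_eqI[OF e(1,2)])
          fix d y assume y: "y \<in> cel Y d"
          have 1: "fits (gH ?A) d as (map (\<lambda>f. act f d y) fs)"
            by (rule along_map[OF ar(1)]) (rule act_in[OF _ y])
          show "act (Comp V (vhom F (hd as) (last as)) (vact_at V ?A Y as p fs)) d y =
            act (vact_at V ?B Y (map (vfun F) as) p (medge (\<lambda>a b f. Comp V (vhom F a b) f) as fs)) d y"
            unfolding e(3)[OF y] e(4)[OF y] using hl 1 ar(2) act_in[OF p' y] unfolding hom_law_def by simp
        qed
        then show "Comp V (vhom F (hd as) (last as)) (vact_at V ?A Y as p fs) =
          vact_at V ?B Y (map (vfun F) as) p (map (\<lambda>i. Comp V (vhom F (as ! i) (as ! Suc i)) (fs ! i)) [0..<length fs])"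
          by (simp add: medge_def)
      qed
    qed
  qed
  show ?thesis unfolding is_vpmap_def using main vpcat_pre by blast
qed

lemma vpmap_eqI:
  assumes F: "is_vpmap V P F" and G: "is_vpmap V P G" and "vdom F = vdom G" "vcod F = vcod G"
    and "\<And>a. a \<in> gobjs (ugraph (vdom F)) \<Longrightarrow> vfun F a = vfun G a"
    and "\<And>a b. a \<in> gobjs (ugraph (vdom F)) \<Longrightarrow> b \<in> gobjs (ugraph (vdom F)) \<Longrightarrow> vhom F a b = vhom G a b"
  shows "F = G"
proof (rule vpmap.expand, intro conjI assms(3,4))
  have m: "is_vgraph_map V (ugraph (vdom F)) (ugraph (vcod F)) (vfun F) (vhom F)"
    "is_vgraph_map V (ugraph (vdom F)) (ugraph (vcod F)) (vfun G) (vhom G)"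
    using F G assms(3,4) by (auto simp: is_vpmap_def)
  show "vfun F = vfun G"
    by (rule extensionalityI[OF vgraph_mapD(3)[OF m(1)] vgraph_mapD(3)[OF m(2)]]) (rule assms(5))
  show "vhom F = vhom G"
    by (intro ext) (metis assms(6) vgraph_mapD(4)[OF m(1)] vgraph_mapD(4)[OF m(2)])
qed

lemma hom_vp_cat: "F \<in> hom (vp_cat V P) A B \<longleftrightarrow> is_vpmap V P F \<and> vdom F = A \<and> vcod F = B"
  by (auto simp: hom_def vp_cat_def)

lemma category_vp_cat: "category (vp_cat V P :: (('u, 'o, 'm) vpcat, ('u, 'o, 'm) vpmap) cat)"
proof -
  let ?C = "vp_cat V P :: (('u, 'o, 'm) vpcat, ('u, 'o, 'm) vpmap) cat"
  have id: "Ident ?C A \<in> hom ?C A A" if A: "is_vpcat V P A" for A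
  proof -
    let ?I = "Ident ?C A"
    note pre = vpcat_pre[OF A]
    have s: "vdom ?I = A" "vcod ?I = A" by (simp_all add: vp_cat_def)
    have f: "vfun ?I a = a" if "a \<in> gobjs (ugraph A)" for a using that by (simp add: vp_cat_def)
    have h: "vhom ?I a b = Ident V (ghom (ugraph A) a b)" if "a \<in> gobjs (ugraph A)" "b \<in> gobjs (ugraph A)" for a b
      using that by (simp add: vp_cat_def)
    have ha: "act (vhom ?I a b) d x = x" if "a \<in> gobjs (ugraph A)" "b \<in> gobjs (ugraph A)" "x \<in> cells (gH A a b) d" for a b d x
      using that by (simp add: h functor_ident[OF U ghom_Obj[OF pre]])
    have gm: "is_vgraph_map V (ugraph A) (ugraph A) (vfun ?I) (vhom ?I)"
      unfolding is_vgraph_map_def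
      using f ident_hom[OF V ghom_Obj[OF pre]] by (auto simp: vp_cat_def)
    have "hom_law ?I"
      unfolding hom_law_def s
    proof (intro allI impI, elim conjE)
      fix d as p ys assume as: "set as \<subseteq> gobjs (ugraph A)" and ys: "fits (gH A) d as ys"
        and p: "p \<in> cells (PU (length ys)) d"
      have 1: "map (vfun ?I) as = as" using f as by (auto intro: map_idI)
      have 2: "medge (\<lambda>a b. act (vhom ?I a b) d) as ys = ys"
        by (rule medge_ident[OF ys]) (use as ha in blast)
      have "hd as \<in> gobjs (ugraph A)" "last as \<in> gobjs (ugraph A)" using along_ends[OF ys] as by auto
      then show "act (vhom ?I (hd as) (last as)) d (gam A as d p ys) =
        gam A (map (vfun ?I) as) d p (medge (\<lambda>a b. act (vhom ?I a b) d) as ys)"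
        unfolding 1 2 by (rule ha) (rule gam_in[OF pre as ys p])
    qed
    then show ?thesis unfolding hom_vp_cat is_vpmap_iff using A gm s by simp
  qed
  have comp: "Comp ?C G F \<in> hom ?C A D" if "F \<in> hom ?C A B" "G \<in> hom ?C B D" for F G A B D
  proof -
    have F: "is_vpmap V P F" "vdom F = A" "vcod F = B" and G: "is_vpmap V P G" "vdom G = B" "vcod G = D"
      using that by (auto simp: hom_vp_cat)
    let ?I = "Comp ?C G F"
    have AB: "is_vpcat V P A" "is_vpcat V P B" "is_vpcat V P D" using F G by (auto simp: is_vpmap_def)
    have mF: "is_vgraph_map V (ugraph A) (ugraph B) (vfun F) (vhom F)" and hF: "hom_law F"
      and mG: "is_vgraph_map V (ugraph B) (ugraph D) (vfun G) (vhom G)" and hG: "hom_law G"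
      using F G by (auto simp: is_vpmap_iff)
    have s: "vdom ?I = A" "vcod ?I = D" using F G by (simp_all add: vp_cat_def)
    have f: "vfun ?I a = vfun G (vfun F a)" if "a \<in> gobjs (ugraph A)" for a using that F by (simp add: vp_cat_def)
    have h: "vhom ?I a b = Comp V (vhom G (vfun F a) (vfun F b)) (vhom F a b)"
      if "a \<in> gobjs (ugraph A)" "b \<in> gobjs (ugraph A)" for a b using that F by (simp add: vp_cat_def)
    have ha: "act (vhom ?I a b) d x = act (vhom G (vfun F a) (vfun F b)) d (act (vhom F a b) d x)"
      if "a \<in> gobjs (ugraph A)" "b \<in> gobjs (ugraph A)" "x \<in> cells (gH A a b) d" for a b d x
      using that by (simp add: h act_comp[OF vgraph_mapD(2)[OF mF] vgraph_mapD(2)[OF mG]] vgraph_mapD(1)[OF mF])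
    have gm: "is_vgraph_map V (ugraph A) (ugraph D) (vfun ?I) (vhom ?I)"
      unfolding is_vgraph_map_def
    proof (intro conjI allI)
      show "vfun ?I \<in> gobjs (ugraph A) \<rightarrow>\<^sub>E gobjs (ugraph D)"
        using F vgraph_mapD(1)[OF mF] vgraph_mapD(1)[OF mG] by (auto simp: vp_cat_def)
      fix a b
      show "if a \<in> gobjs (ugraph A) \<and> b \<in> gobjs (ugraph A) then vhom ?I a b \<in> hom V (ghom (ugraph A) a b) (ghom (ugraph D) (vfun ?I a) (vfun ?I b))
        else vhom ?I a b = undefined"
      proof (cases "a \<in> gobjs (ugraph A) \<and> b \<in> gobjs (ugraph A)")
        case True
        then show ?thesis
          using comp_hom[OF V vgraph_mapD(2)[OF mF] vgraph_mapD(2)[OF mG]] vgraph_mapD(1)[OF mF] f h by simp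
      next
        case False
        have "vhom ?I a b = undefined" unfolding vp_cat_def using False F by auto
        then show ?thesis using False by auto
      qed
    qed
    have "hom_law ?I"
      unfolding hom_law_def s
    proof (intro allI impI, elim conjE)
      fix d as p ys assume as: "set as \<subseteq> gobjs (ugraph A)" and ys: "fits (gH A) d as ys"
        and p: "p \<in> cells (PU (length ys)) d"
      let ?ys = "medge (\<lambda>a b. act (vhom F a b) d) as ys"
      have ys': "fits (gH B) d (map (vfun F) as) ?ys"
        by (rule along_medge[OF ys]) (use as vgraph_mapD(2)[OF mF] act_in in blast)
      have as': "set (map (vfun F) as) \<subseteq> gobjs (ugraph B)" using as vgraph_mapD(1)[OF mF] by auto
      have ne: "as \<noteq> []" using alongD(2)[OF ys] .
      have "hd as \<in> gobjs (ugraph A)" "last as \<in> gobjs (ugraph A)" using along_ends[OF ys] as by auto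
      then have "act (vhom ?I (hd as) (last as)) d (gam A as d p ys) =
        act (vhom G (vfun F (hd as)) (vfun F (last as))) d (act (vhom F (hd as) (last as)) d (gam A as d p ys))"
        by (rule ha) (rule gam_in[OF vpcat_pre[OF AB(1)] as ys p])
      also have "act (vhom F (hd as) (last as)) d (gam A as d p ys) = gam B (map (vfun F) as) d p ?ys"
        using hF as ys p unfolding hom_law_def F by blast
      also have "act (vhom G (vfun F (hd as)) (vfun F (last as))) d (gam B (map (vfun F) as) d p ?ys) =
        gam D (map (vfun G) (map (vfun F) as)) d p (medge (\<lambda>a b. act (vhom G a b) d) (map (vfun F) as) ?ys)"
        using hG[unfolded hom_law_def G, rule_format, of "map (vfun F) as" d ?ys p] as' ys' p ne
        by (simp add: hd_map last_map)
      also have "map (vfun G) (map (vfun F) as) = map (vfun ?I) as" using f as by auto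
      also have "medge (\<lambda>a b. act (vhom G a b) d) (map (vfun F) as) ?ys = medge (\<lambda>a b. act (vhom ?I a b) d) as ys"
        unfolding medge_map_medge[OF alongD(1)[OF ys]]
        by (rule medge_cong[OF ys]) (use as ha in \<open>force\<close>)
      finally show "act (vhom ?I (hd as) (last as)) d (gam A as d p ys) =
        gam D (map (vfun ?I) as) d p (medge (\<lambda>a b. act (vhom ?I a b) d) as ys)" .
    qed
    then show ?thesis unfolding hom_vp_cat is_vpmap_iff using AB gm s by simp
  qed
  have Comp_simps: "vdom (Comp ?C G F) = vdom F" "vcod (Comp ?C G F) = vcod G"
    "a \<in> gobjs (ugraph (vdom F)) \<Longrightarrow> vfun (Comp ?C G F) a = vfun G (vfun F a)"
    "a \<in> gobjs (ugraph (vdom F)) \<Longrightarrow> b \<in> gobjs (ugraph (vdom F)) \<Longrightarrow>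
      vhom (Comp ?C G F) a b = Comp V (vhom G (vfun F a) (vfun F b)) (vhom F a b)" for F G a b
    by (simp_all add: vp_cat_def)
  have Id_simps: "vdom (Ident ?C A) = A" "vcod (Ident ?C A) = A" "a \<in> gobjs (ugraph A) \<Longrightarrow> vfun (Ident ?C A) a = a"
    "a \<in> gobjs (ugraph A) \<Longrightarrow> b \<in> gobjs (ugraph A) \<Longrightarrow> vhom (Ident ?C A) a b = Ident V (ghom (ugraph A) a b)" for A a b
    by (simp_all add: vp_cat_def)
  have vm: "F a \<in> gobjs B" if "is_vgraph_map V A B F H" "a \<in> gobjs A" for A B F H a using vgraph_mapD(1)[OF that] .
  have mp: "is_vgraph_map V (ugraph A) (ugraph B) (vfun F) (vhom F)" if "F \<in> hom ?C A B" for F A B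
    using that by (auto simp: hom_vp_cat is_vpmap_def)
  have iso: "is_vpmap V P F" "vdom F = A" "vcod F = B" "is_vpcat V P A" "is_vpcat V P B" if "F \<in> hom ?C A B" for F A B
    using that by (auto simp: hom_vp_cat is_vpmap_def)
  show ?thesis
    unfolding category_def
  proof (intro conjI ballI allI impI)
    fix F assume "F \<in> Arr ?C"
    then show "Dom ?C F \<in> Obj ?C" "Cod ?C F \<in> Obj ?C" by (auto simp: vp_cat_def is_vpmap_def)
  next
    fix A assume "A \<in> Obj ?C" then show "Ident ?C A \<in> hom ?C A A" using id by (simp add: vp_cat_def)
  next
    fix A B D F G assume "F \<in> hom ?C A B \<and> G \<in> hom ?C B D"
    then show "Comp ?C G F \<in> hom ?C A D" using comp by blast
  next
    fix A B F assume F: "F \<in> hom ?C A B"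
    note i = iso[OF F] and iA = id[OF iso(4)[OF F]] and iB = id[OF iso(5)[OF F]] and m = mp[OF F]
    show "Comp ?C F (Ident ?C A) = F"
      by (rule vpmap_eqI[OF iso(1)[OF comp[OF iA F]] i(1)])
        (use i in \<open>simp_all add: Comp_simps Id_simps comp_ident(1)[OF V vgraph_mapD(2)[OF m]]\<close>)
    show "Comp ?C (Ident ?C B) F = F"
      by (rule vpmap_eqI[OF iso(1)[OF comp[OF F iB]] i(1)])
        (use i in \<open>simp_all add: Comp_simps Id_simps vm[OF m] comp_ident(2)[OF V vgraph_mapD(2)[OF m]]\<close>)
  next
    fix A B D E F G H assume "F \<in> hom ?C A B \<and> G \<in> hom ?C B D \<and> H \<in> hom ?C D E"
    then have F: "F \<in> hom ?C A B" and G: "G \<in> hom ?C B D" and H: "H \<in> hom ?C D E" by auto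
    note mF = mp[OF F] and mG = mp[OF G] and mH = mp[OF H]
    show "Comp ?C H (Comp ?C G F) = Comp ?C (Comp ?C H G) F"
      by (rule vpmap_eqI[OF iso(1)[OF comp[OF comp[OF F G] H]] iso(1)[OF comp[OF F comp[OF G H]]]])
        (use iso(2,3)[OF F] iso(2,3)[OF G] iso(2,3)[OF H] in
          \<open>simp_all add: Comp_simps vm[OF mF] vm[OF mG]
            comp_assoc[OF V vgraph_mapD(2)[OF mF] vgraph_mapD(2)[OF mG] vgraph_mapD(2)[OF mH]]\<close>)
  qed
qed

end

section \<open>Laws of enriched categories over globular sets\<close>

context enriched begin

text \<open>
  The laws concern a set \<open>Ob\<close>, globular sets \<open>H a b\<close> with operations \<open>h a b\<close>, and compositions \<open>g as d p ys\<close> of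
  strings \<open>ys\<close> of \<open>d\<close>-cells over objects \<open>as\<close> by a \<open>d\<close>-cell \<open>p\<close> of the operad.
\<close>

definition typed_law where
  "typed_law Ob H h g \<longleftrightarrow>
     (\<forall>a\<in>Ob. \<forall>b\<in>Ob. is_gset n (H a b) \<and> (\<forall>\<sigma> zs. Dm (H a b) \<sigma> zs \<longrightarrow> h a b \<sigma> zs \<in> cells (H a b) (rd \<sigma>))) \<and>
     (\<forall>d as p ys. set as \<subseteq> Ob \<and> fits H d as ys \<and> p \<in> cells (PU (length ys)) d \<longrightarrow>
        g as d p ys \<in> cells (H (hd as) (last as)) d)"

definition st_law where
  "st_law Ob H g \<longleftrightarrow> (\<forall>d as p ys. set as \<subseteq> Ob \<and> fits H (Suc d) as ys \<and> p \<in> cells (PU (length ys)) (Suc d) \<longrightarrow>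
     gsrc (H (hd as) (last as)) d (g as (Suc d) p ys) =
       g as d (gsrc (PU (length ys)) d p) (medge (\<lambda>a b. gsrc (H a b) d) as ys) \<and>
     gtgt (H (hd as) (last as)) d (g as (Suc d) p ys) =
       g as d (gtgt (PU (length ys)) d p) (medge (\<lambda>a b. gtgt (H a b) d) as ys))"

text \<open>The interchange law says that the composition maps preserve the operations of the homs. It is stated
  for a family of arguments parametrised by an arbitrary globular set \<open>Z\<close>, since the domain of an operation
  need not be expressible in terms of the components of its arguments.\<close>

definition inter_law where
  "inter_law Ob H h g \<longleftrightarrow> (\<forall>as \<chi>s Z \<pi> \<sigma> zs. set as \<subseteq> Ob \<and> along (\<lambda>a b \<chi>. \<chi> \<in> hom (gset_cat n) Z (H a b)) as \<chi>s \<and>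
     is_gset n Z \<and> \<pi> \<in> hom (gset_cat n) Z (PU (length \<chi>s)) \<and> Dm Z \<sigma> zs \<longrightarrow>
     h (hd as) (last as) \<sigma> (map (\<lambda>(d, z). (d, g as d (gfun \<pi> d z) (map (\<lambda>\<chi>. gfun \<chi> d z) \<chi>s))) zs) =
     g as (rd \<sigma>) (ev (ops P (length \<chi>s)) \<sigma> (map (app \<pi>) zs)) (medge (\<lambda>a b \<chi>. h a b \<sigma> (map (app \<chi>) zs)) as \<chi>s))"

definition laws where
  "laws Ob H h g \<longleftrightarrow> typed_law Ob H h g \<and> st_law Ob H g \<and> unit_law Ob H g \<and> assoc_law Ob H g \<and> inter_law Ob H h g"

text \<open>Neither end is assumed to satisfy the laws. This allows them to be transferred both
  ways: from target to source by \<open>laws_sub\<close>, from source to target by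
  \<open>laws_quot\<close>.\<close>

definition ihom where
  "ihom Ob H h g Ob' H' h' g' F \<phi> \<longleftrightarrow> F ` Ob \<subseteq> Ob' \<and>
     (\<forall>a\<in>Ob. \<forall>b\<in>Ob. phom n Dm rd (H a b) (h a b) (H' (F a) (F b)) (h' (F a) (F b)) (\<phi> a b)) \<and>
     (\<forall>d as p ys. set as \<subseteq> Ob \<and> fits H d as ys \<and> p \<in> cells (PU (length ys)) d \<longrightarrow>
        gfun (\<phi> (hd as) (last as)) d (g as d p ys) =
        g' (map F as) d p (medge (\<lambda>a b. gfun (\<phi> a b) d) as ys))"

lemma typed_lawD:
  assumes "typed_law Ob H h g"
  shows "a \<in> Ob \<Longrightarrow> b \<in> Ob \<Longrightarrow> is_gset n (H a b)"
    "a \<in> Ob \<Longrightarrow> b \<in> Ob \<Longrightarrow> Dm (H a b) \<sigma> zs \<Longrightarrow> h a b \<sigma> zs \<in> cells (H a b) (rd \<sigma>)"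
    "set as \<subseteq> Ob \<Longrightarrow> fits H d as ys \<Longrightarrow> p \<in> cells (PU (length ys)) d \<Longrightarrow>
      g as d p ys \<in> cells (H (hd as) (last as)) d"
  using assms unfolding typed_law_def by blast+

lemma st_lawD:
  assumes "st_law Ob H g" "set as \<subseteq> Ob" "fits H (Suc d) as ys" "p \<in> cells (PU (length ys)) (Suc d)"
  shows "gsrc (H (hd as) (last as)) d (g as (Suc d) p ys) =
       g as d (gsrc (PU (length ys)) d p) (medge (\<lambda>a b. gsrc (H a b) d) as ys)"
    "gtgt (H (hd as) (last as)) d (g as (Suc d) p ys) =
       g as d (gtgt (PU (length ys)) d p) (medge (\<lambda>a b. gtgt (H a b) d) as ys)"
  using assms unfolding st_law_def by blast+

lemma unit_lawD: "unit_law Ob H g \<Longrightarrow> a \<in> Ob \<Longrightarrow> b \<in> Ob \<Longrightarrow> y \<in> cells (H a b) d \<Longrightarrow> g [a, b] d (ou d) [y] = y"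
  unfolding unit_law_def by blast

lemma assoc_lawD: "assoc_law Ob H g \<Longrightarrow> set as \<subseteq> Ob \<Longrightarrow> fits H d as ys \<Longrightarrow> sum_list ks = length ys \<Longrightarrow>
    p \<in> cells (PU (length ks)) d \<Longrightarrow> list_all2 (\<lambda>q k. q \<in> cells (PU k) d) ps ks \<Longrightarrow>
    g (cut_points ks as) d p (map (\<lambda>i. g (obj_block ks as i) d (ps ! i) (step_block ks ys i)) [0..<length ks]) =
     g as d (oc ks d p ps) ys"
  unfolding assoc_law_def by blast

lemma inter_lawD: "inter_law Ob H h g \<Longrightarrow> set as \<subseteq> Ob \<Longrightarrow> along (\<lambda>a b \<chi>. \<chi> \<in> hom (gset_cat n) Z (H a b)) as \<chi>s \<Longrightarrow>
    is_gset n Z \<Longrightarrow> \<pi> \<in> hom (gset_cat n) Z (PU (length \<chi>s)) \<Longrightarrow> Dm Z \<sigma> zs \<Longrightarrow>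
     h (hd as) (last as) \<sigma> (map (\<lambda>(d, z). (d, g as d (gfun \<pi> d z) (map (\<lambda>\<chi>. gfun \<chi> d z) \<chi>s))) zs) =
     g as (rd \<sigma>) (ev (ops P (length \<chi>s)) \<sigma> (map (app \<pi>) zs)) (medge (\<lambda>a b \<chi>. h a b \<sigma> (map (app \<chi>) zs)) as \<chi>s)"
  unfolding inter_law_def by blast

lemma ihomD:
  assumes "ihom Ob H h g Ob' H' h' g' F \<phi>"
  shows "a \<in> Ob \<Longrightarrow> F a \<in> Ob'"
    "a \<in> Ob \<Longrightarrow> b \<in> Ob \<Longrightarrow> phom n Dm rd (H a b) (h a b) (H' (F a) (F b)) (h' (F a) (F b)) (\<phi> a b)"
    "a \<in> Ob \<Longrightarrow> b \<in> Ob \<Longrightarrow> \<phi> a b \<in> hom (gset_cat n) (H a b) (H' (F a) (F b))"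
    "a \<in> Ob \<Longrightarrow> b \<in> Ob \<Longrightarrow> Dm (H a b) \<sigma> zs \<Longrightarrow>
       gfun (\<phi> a b) (rd \<sigma>) (h a b \<sigma> zs) = h' (F a) (F b) \<sigma> (map (app (\<phi> a b)) zs)"
    "set as \<subseteq> Ob \<Longrightarrow> fits H d as ys \<Longrightarrow> p \<in> cells (PU (length ys)) d \<Longrightarrow>
        gfun (\<phi> (hd as) (last as)) d (g as d p ys) = g' (map F as) d p (medge (\<lambda>a b. gfun (\<phi> a b) d) as ys)"
  using assms unfolding ihom_def phom_def by blast+

lemma map_app_Comp:
  assumes "f \<in> hom (gset_cat n) A B" "Dm A \<sigma> zs"
  shows "map (app (Comp (gset_cat n) g f)) zs = map (app g) (map (app f) zs)"
  by (rule map_app_comp[OF gset_homD(1)[OF assms(1)] assms(2)]) (rule gfun_comp[OF assms(1)])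

lemma fits_along:
  assumes "along (\<lambda>a b \<chi>. \<chi> \<in> hom (gset_cat n) Z (H a b)) as \<chi>s" "z \<in> cells Z d"
  shows "fits H d as (map (\<lambda>\<chi>. gfun \<chi> d z) \<chi>s)"
  by (rule along_map[OF assms(1)]) (rule gfun_in[OF _ assms(2)])

lemma fits_st:
  assumes t: "typed_law Ob H h g" and as: "set as \<subseteq> Ob" and ys: "fits H (Suc d) as ys"
  shows "fits H d as (medge (\<lambda>a b. gsrc (H a b) d) as ys)" "fits H d as (medge (\<lambda>a b. gtgt (H a b) d) as ys)"
  by (rule along_medge_id[OF ys], rule gset_in[OF typed_lawD(1)[OF t subsetD[OF as] subsetD[OF as]]], assumption+)+

lemma fits_map:
  assumes f: "\<And>a b. a \<in> Ob \<Longrightarrow> b \<in> Ob \<Longrightarrow> \<phi> a b \<in> hom (gset_cat n) (H a b) (H' (F a) (F b))"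
    and as: "set as \<subseteq> Ob" and ys: "fits H d as ys"
  shows "fits H' d (map F as) (medge (\<lambda>a b. gfun (\<phi> a b) d) as ys)"
  by (rule along_medge[OF ys], rule gfun_in[OF f[OF subsetD[OF as] subsetD[OF as]]], assumption+)

lemma medge_st:
  assumes f: "\<And>a b. a \<in> Ob \<Longrightarrow> b \<in> Ob \<Longrightarrow> \<phi> a b \<in> hom (gset_cat n) (H a b) (H' (F a) (F b))"
    and as: "set as \<subseteq> Ob" and ys: "fits H (Suc d) as ys"
  shows "medge (\<lambda>a b. gsrc (H' a b) d) (map F as) (medge (\<lambda>a b. gfun (\<phi> a b) (Suc d)) as ys) =
      medge (\<lambda>a b. gfun (\<phi> a b) d) as (medge (\<lambda>a b. gsrc (H a b) d) as ys)"
    "medge (\<lambda>a b. gtgt (H' a b) d) (map F as) (medge (\<lambda>a b. gfun (\<phi> a b) (Suc d)) as ys) =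
      medge (\<lambda>a b. gfun (\<phi> a b) d) as (medge (\<lambda>a b. gtgt (H a b) d) as ys)"
proof -
  note l = alongD(1)[OF ys]
  have st: "gsrc (H' (F a) (F b)) d (gfun (\<phi> a b) (Suc d) y) = gfun (\<phi> a b) d (gsrc (H a b) d y)"
    "gtgt (H' (F a) (F b)) d (gfun (\<phi> a b) (Suc d) y) = gfun (\<phi> a b) d (gtgt (H a b) d y)"
    if "a \<in> set as" "b \<in> set as" "y \<in> cells (H a b) (Suc d)" for a b y
    using gfun_src[OF f that(3)] gfun_tgt[OF f that(3)] that as by auto
  show "medge (\<lambda>a b. gsrc (H' a b) d) (map F as) (medge (\<lambda>a b. gfun (\<phi> a b) (Suc d)) as ys) =
      medge (\<lambda>a b. gfun (\<phi> a b) d) as (medge (\<lambda>a b. gsrc (H a b) d) as ys)"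
    unfolding medge_map_medge[OF l] medge_medge_same by (rule medge_cong[OF ys]) (rule st)
  show "medge (\<lambda>a b. gtgt (H' a b) d) (map F as) (medge (\<lambda>a b. gfun (\<phi> a b) (Suc d)) as ys) =
      medge (\<lambda>a b. gfun (\<phi> a b) d) as (medge (\<lambda>a b. gtgt (H a b) d) as ys)"
    unfolding medge_map_medge[OF l] medge_medge_same by (rule medge_cong[OF ys]) (rule st)
qed

lemma along_Comp:
  assumes f: "\<And>a b. a \<in> Ob \<Longrightarrow> b \<in> Ob \<Longrightarrow> \<phi> a b \<in> hom (gset_cat n) (H a b) (H' (F a) (F b))"
    and as: "set as \<subseteq> Ob" and al: "along (\<lambda>a b \<chi>. \<chi> \<in> hom (gset_cat n) Z (H a b)) as \<chi>s"
  shows "along (\<lambda>a b \<chi>. \<chi> \<in> hom (gset_cat n) Z (H' a b)) (map F as) (medge (\<lambda>a b \<chi>. Comp (gset_cat n) (\<phi> a b) \<chi>) as \<chi>s)"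
  by (rule along_medge[OF al], rule gset_comp_hom[OF _ f[OF subsetD[OF as] subsetD[OF as]]], assumption+)

lemma fits_ops:
  assumes t: "typed_law Ob H h g" and as: "set as \<subseteq> Ob"
    and al: "along (\<lambda>a b \<chi>. \<chi> \<in> hom (gset_cat n) Z (H a b)) as \<chi>s" and D: "Dm Z \<sigma> zs"
  shows "fits H (rd \<sigma>) as (medge (\<lambda>a b \<chi>. h a b \<sigma> (map (app \<chi>) zs)) as \<chi>s)"
  by (rule along_medge_id[OF al], rule typed_lawD(2)[OF t subsetD[OF as] subsetD[OF as] Dm_map[OF _ D]], assumption+)

text \<open>By compatibility with sources and targets, composing a family of arguments over
  \<open>Z\<close> is a globular map on \<open>Z\<close>. It therefore preserves domains, which
  gives meaning to the left side of the interchange law (\<open>comp_Dm\<close>).\<close>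

lemma comp_gmap:
  assumes t: "typed_law Ob H h g" and st: "st_law Ob H g" and as: "set as \<subseteq> Ob"
    and al: "along (\<lambda>a b \<chi>. \<chi> \<in> hom (gset_cat n) Z (H a b)) as \<chi>s" and Z: "is_gset n Z"
    and p: "\<pi> \<in> hom (gset_cat n) Z (PU (length \<chi>s))"
  shows "mk_gmap Z (H (hd as) (last as)) (\<lambda>d z. g as d (gfun \<pi> d z) (map (\<lambda>\<chi>. gfun \<chi> d z) \<chi>s)) \<in>
    hom (gset_cat n) Z (H (hd as) (last as))"
proof -
  have e: "hd as \<in> Ob" "last as \<in> Ob" using along_ends[OF al] as by auto
  show ?thesis
  proof (rule mk_gmap[OF Z typed_lawD(1)[OF t e]])
    show "g as d (gfun \<pi> d z) (map (\<lambda>\<chi>. gfun \<chi> d z) \<chi>s) \<in> cells (H (hd as) (last as)) d" if z: "z \<in> cells Z d" for d z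
      using typed_lawD(3)[OF t as fits_along[OF al z]] gfun_in[OF p z] by simp
    fix d z assume z: "z \<in> cells Z (Suc d)"
    have 1: "medge (\<lambda>a b. gsrc (H a b) d) as (map (\<lambda>\<chi>. gfun \<chi> (Suc d) z) \<chi>s) = map (\<lambda>\<chi>. gfun \<chi> d (gsrc Z d z)) \<chi>s"
      "medge (\<lambda>a b. gtgt (H a b) d) as (map (\<lambda>\<chi>. gfun \<chi> (Suc d) z) \<chi>s) = map (\<lambda>\<chi>. gfun \<chi> d (gtgt Z d z)) \<chi>s"
      using z by (auto intro!: nth_equalityI simp: gfun_src[OF alongD(3)[OF al]] gfun_tgt[OF alongD(3)[OF al]])
    show "gsrc (H (hd as) (last as)) d (g as (Suc d) (gfun \<pi> (Suc d) z) (map (\<lambda>\<chi>. gfun \<chi> (Suc d) z) \<chi>s)) =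
      g as d (gfun \<pi> d (gsrc Z d z)) (map (\<lambda>\<chi>. gfun \<chi> d (gsrc Z d z)) \<chi>s)"
      "gtgt (H (hd as) (last as)) d (g as (Suc d) (gfun \<pi> (Suc d) z) (map (\<lambda>\<chi>. gfun \<chi> (Suc d) z) \<chi>s)) =
      g as d (gfun \<pi> d (gtgt Z d z)) (map (\<lambda>\<chi>. gfun \<chi> d (gtgt Z d z)) \<chi>s)"
      using st_lawD[OF st as fits_along[OF al z]] gfun_in[OF p z] gfun_src[OF p z] gfun_tgt[OF p z]
      unfolding 1 by simp_all
  qed
qed

lemma comp_Dm:
  assumes "typed_law Ob H h g" "st_law Ob H g" "set as \<subseteq> Ob"
    "along (\<lambda>a b \<chi>. \<chi> \<in> hom (gset_cat n) Z (H a b)) as \<chi>s" "is_gset n Z"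
    "\<pi> \<in> hom (gset_cat n) Z (PU (length \<chi>s))" and D: "Dm Z \<sigma> zs"
  shows "Dm (H (hd as) (last as)) \<sigma> (map (\<lambda>(d, z). (d, g as d (gfun \<pi> d z) (map (\<lambda>\<chi>. gfun \<chi> d z) \<chi>s))) zs)"
proof -
  have eq: "map (app (mk_gmap Z (H (hd as) (last as)) (\<lambda>d z. g as d (gfun \<pi> d z) (map (\<lambda>\<chi>. gfun \<chi> d z) \<chi>s)))) zs =
    map (\<lambda>(d, z). (d, g as d (gfun \<pi> d z) (map (\<lambda>\<chi>. gfun \<chi> d z) \<chi>s))) zs"
    using Dm_cells[OF assms(5) D] by auto
  show ?thesis using Dm_map[OF comp_gmap[OF assms(1-6)] D] unfolding eq .
qed

lemma medge_Comp:
  assumes "along (\<lambda>a b \<chi>. \<chi> \<in> hom (gset_cat n) Z (H a b)) as \<chi>s" "z \<in> cells Z d"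
  shows "map (\<lambda>\<chi>. gfun \<chi> d z) (medge (\<lambda>a b \<chi>. Comp (gset_cat n) (\<phi> a b) \<chi>) as \<chi>s) =
    medge (\<lambda>a b. gfun (\<phi> a b) d) as (map (\<lambda>\<chi>. gfun \<chi> d z) \<chi>s)"
  unfolding map_medge medge_map by (rule medge_cong[OF assms(1)]) (rule gfun_comp[OF _ assms(2)])

lemma block_args:
  assumes as: "set as \<subseteq> Ob" and ys: "fits H d as ys" and k: "sum_list ks = length ys"
    and p: "p \<in> cells (PU (length ks)) d" and ps: "list_all2 (\<lambda>q k. q \<in> cells (PU k) d) ps ks"
  shows "length as = Suc (sum_list ks)"
    "i < length ks \<Longrightarrow> set (obj_block ks as i) \<subseteq> Ob"
    "i < length ks \<Longrightarrow> fits H d (obj_block ks as i) (step_block ks ys i)"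
    "i < length ks \<Longrightarrow> ps ! i \<in> cells (PU (length (step_block ks ys i))) d"
    "set (cut_points ks as) \<subseteq> Ob"
    "oc ks d p ps \<in> cells (PU (length ys)) d"
proof -
  show l: "length as = Suc (sum_list ks)" using alongD(1)[OF ys] k by simp
  show "set (obj_block ks as i) \<subseteq> Ob" "fits H d (obj_block ks as i) (step_block ks ys i)"
    "ps ! i \<in> cells (PU (length (step_block ks ys i))) d" if "i < length ks"
    using obj_block(5)[OF l that] as along_block[OF ys k that] step_block(1)[OF k[symmetric] that] ps that
    by (auto simp: list_all2_conv_all_nth)
  show "set (cut_points ks as) \<subseteq> Ob" using cut_points_ends(3)[OF l] as by blast
  show "oc ks d p ps \<in> cells (PU (length ys)) d" using oc_in[OF p ps] k by simp
qed

lemma assoc_args: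
  assumes t: "typed_law Ob H h g"
    and as: "set as \<subseteq> Ob" and ys: "fits H d as ys" and k: "sum_list ks = length ys"
    and p: "p \<in> cells (PU (length ks)) d" and ps: "list_all2 (\<lambda>q k. q \<in> cells (PU k) d) ps ks"
  shows "fits H d (cut_points ks as) (map (\<lambda>i. g (obj_block ks as i) d (ps ! i) (step_block ks ys i)) [0..<length ks])"
  by (rule along_cut[OF ys k]) (rule typed_lawD(3)[OF t block_args(2,3,4)[OF as ys k p ps]])

text \<open>The homomorphism property is used twice: for the coarse string and then inside each
  block.\<close>

lemma ihom_assoc:
  assumes f: "ihom Ob H h g Ob' H' h' g' F \<phi>" and t: "typed_law Ob H h g"
    and as: "set as \<subseteq> Ob" and ys: "fits H d as ys" and k: "sum_list ks = length ys"
    and p: "p \<in> cells (PU (length ks)) d" and ps: "list_all2 (\<lambda>q k. q \<in> cells (PU k) d) ps ks"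
  shows "gfun (\<phi> (hd as) (last as)) d (g (cut_points ks as) d p
      (map (\<lambda>i. g (obj_block ks as i) d (ps ! i) (step_block ks ys i)) [0..<length ks])) =
    g' (cut_points ks (map F as)) d p (map (\<lambda>i. g' (obj_block ks (map F as) i) d (ps ! i)
      (step_block ks (medge (\<lambda>a b. gfun (\<phi> a b) d) as ys) i)) [0..<length ks])"
proof -
  note B = block_args[OF as ys k p ps] and A = assoc_args[OF t as ys k p ps]
  have "gfun (\<phi> (hd as) (last as)) d (g (cut_points ks as) d p
      (map (\<lambda>i. g (obj_block ks as i) d (ps ! i) (step_block ks ys i)) [0..<length ks])) =
    g' (map F (cut_points ks as)) d p (medge (\<lambda>a b. gfun (\<phi> a b) d) (cut_points ks as)
      (map (\<lambda>i. g (obj_block ks as i) d (ps ! i) (step_block ks ys i)) [0..<length ks]))"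
    using ihomD(5)[OF f B(5) A] p cut_points_ends(1,2)[OF B(1)] by simp
  also have "medge (\<lambda>a b. gfun (\<phi> a b) d) (cut_points ks as)
      (map (\<lambda>i. g (obj_block ks as i) d (ps ! i) (step_block ks ys i)) [0..<length ks]) =
    map (\<lambda>i. g' (obj_block ks (map F as) i) d (ps ! i)
      (step_block ks (medge (\<lambda>a b. gfun (\<phi> a b) d) as ys) i)) [0..<length ks]"
    unfolding medge_cut[OF B(1)]
    by (rule map_upt_cong) (simp add: ihomD(5)[OF f B(2,3,4)] obj_block_map medge_block[OF alongD(1)[OF ys] k])
  finally show ?thesis by (simp add: cut_points_map[OF B(1)])
qed

text \<open>Each law equates two cells of one hom. A homomorphism into data satisfying the laws
  carries them to the two sides of the same law over there, so the two cells cannot be separated.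
  The typing is a hypothesis, as it is what makes both sides cells of that hom.\<close>

lemma laws_sub:
  assumes t: "typed_law Ob H h g"
    and sep: "\<And>a b d x y. a \<in> Ob \<Longrightarrow> b \<in> Ob \<Longrightarrow> x \<in> cells (H a b) d \<Longrightarrow> y \<in> cells (H a b) d \<Longrightarrow>
      (\<And>Ob' H' h' g' F \<phi>. laws Ob' H' h' g' \<Longrightarrow> ihom Ob H h g Ob' H' h' g' F \<phi> \<Longrightarrow>
         gfun (\<phi> a b) d x = gfun (\<phi> a b) d y) \<Longrightarrow> x = y"
  shows "laws Ob H h g"
proof -
  \<comment> \<open>This law comes first, since the interchange law relies on it to know that its
    left side is defined.\<close>
  have st: "st_law Ob H g"
    unfolding st_law_def
  proof (intro allI impI, elim conjE)
    fix d as p ys assume as: "set as \<subseteq> Ob" and ys: "fits H (Suc d) as ys" and p: "p \<in> cells (PU (length ys)) (Suc d)"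
    have e: "hd as \<in> Ob" "last as \<in> Ob" using along_ends[OF ys] as by auto
    note l = alongD(1)[OF ys] and G = typed_lawD(3)[OF t as ys p] and Hg = typed_lawD(1)[OF t e]
    have m: "fits H d as (medge (\<lambda>a b. gsrc (H a b) d) as ys)" "fits H d as (medge (\<lambda>a b. gtgt (H a b) d) as ys)"
      by (rule fits_st[OF t as ys])+
    have ps: "gsrc (PU (length ys)) d p \<in> cells (PU (length ys)) d" "gtgt (PU (length ys)) d p \<in> cells (PU (length ys)) d"
      using gset_in[OF P_gset p] by auto
    show "gsrc (H (hd as) (last as)) d (g as (Suc d) p ys) =
       g as d (gsrc (PU (length ys)) d p) (medge (\<lambda>a b. gsrc (H a b) d) as ys) \<and>
     gtgt (H (hd as) (last as)) d (g as (Suc d) p ys) =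
       g as d (gtgt (PU (length ys)) d p) (medge (\<lambda>a b. gtgt (H a b) d) as ys)"
    proof (intro conjI; rule sep[OF e])
      fix Ob' H' h' g' F \<phi> assume L: "laws Ob' H' h' g'" and f: "ihom Ob H h g Ob' H' h' g' F \<phi>"
      have st': "st_law Ob' H' g'" using L by (simp add: laws_def)
      have as': "set (map F as) \<subseteq> Ob'" using as ihomD(1)[OF f] by auto
      have ys': "fits H' (Suc d) (map F as) (medge (\<lambda>a b. gfun (\<phi> a b) (Suc d)) as ys)"
        by (rule fits_map[where Ob=Ob and H=H, OF _ as ys]) (rule ihomD(3)[OF f])
      have hl: "hd (map F as) = F (hd as)" "last (map F as) = F (last as)"
        using alongD(2)[OF ys] by (simp_all add: hd_map last_map)
      note S = st_lawD[OF st' as' ys', unfolded length_medge hl, OF p]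
      have "medge (\<lambda>a b. gsrc (H' a b) d) (map F as) (medge (\<lambda>a b. gfun (\<phi> a b) (Suc d)) as ys) =
          medge (\<lambda>a b. gfun (\<phi> a b) d) as (medge (\<lambda>a b. gsrc (H a b) d) as ys)"
        by (rule medge_st(1)[where Ob=Ob and H=H, OF _ as ys]) (rule ihomD(3)[OF f])
      then show "gfun (\<phi> (hd as) (last as)) d (gsrc (H (hd as) (last as)) d (g as (Suc d) p ys)) =
        gfun (\<phi> (hd as) (last as)) d (g as d (gsrc (PU (length ys)) d p) (medge (\<lambda>a b. gsrc (H a b) d) as ys))"
        using gfun_src[OF ihomD(3)[OF f e] G] ihomD(5)[OF f as ys p] S(1) ihomD(5)[OF f as m(1)] ps(1) by simp
      have "medge (\<lambda>a b. gtgt (H' a b) d) (map F as) (medge (\<lambda>a b. gfun (\<phi> a b) (Suc d)) as ys) =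
          medge (\<lambda>a b. gfun (\<phi> a b) d) as (medge (\<lambda>a b. gtgt (H a b) d) as ys)"
        by (rule medge_st(2)[where Ob=Ob and H=H, OF _ as ys]) (rule ihomD(3)[OF f])
      then show "gfun (\<phi> (hd as) (last as)) d (gtgt (H (hd as) (last as)) d (g as (Suc d) p ys)) =
        gfun (\<phi> (hd as) (last as)) d (g as d (gtgt (PU (length ys)) d p) (medge (\<lambda>a b. gtgt (H a b) d) as ys))"
        using gfun_tgt[OF ihomD(3)[OF f e] G] ihomD(5)[OF f as ys p] S(2) ihomD(5)[OF f as m(2)] ps(2) by simp
    qed (use gset_in[OF Hg G] typed_lawD(3)[OF t as m(1)] typed_lawD(3)[OF t as m(2)] ps in auto)
  qed
  have un: "unit_law Ob H g"
    unfolding unit_law_def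
  proof (intro allI ballI)
    fix d a b y assume ab: "a \<in> Ob" "b \<in> Ob" and y: "y \<in> cells (H a b) d"
    have as: "set [a, b] \<subseteq> Ob" and ys: "fits H d [a, b] [y]" using ab y by (auto simp: along_def)
    have o: "ou d \<in> cells (PU (length [y])) d" using ou_in gset_dim[OF typed_lawD(1)[OF t ab] y] by simp
    show "g [a, b] d (ou d) [y] = y"
    proof (rule sep[OF ab _ y])
      show "g [a, b] d (ou d) [y] \<in> cells (H a b) d" using typed_lawD(3)[OF t as ys o] by simp
      fix Ob' H' h' g' F \<phi> assume L: "laws Ob' H' h' g'" and f: "ihom Ob H h g Ob' H' h' g' F \<phi>"
      then have "unit_law Ob' H' g'" by (simp add: laws_def)
      from unit_lawD[OF this ihomD(1)[OF f ab(1)] ihomD(1)[OF f ab(2)] gfun_in[OF ihomD(3)[OF f ab] y]]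
      show "gfun (\<phi> a b) d (g [a, b] d (ou d) [y]) = gfun (\<phi> a b) d y"
        using ihomD(5)[OF f as ys o] by (simp add: medge_def)
    qed
  qed
  have "assoc_law Ob H g"
    unfolding assoc_law_def
  proof (intro allI impI, elim conjE)
    fix d as ks p ps ys assume as: "set as \<subseteq> Ob" and ys: "fits H d as ys" and k: "sum_list ks = length ys"
      and p: "p \<in> cells (PU (length ks)) d" and ps: "list_all2 (\<lambda>q k. q \<in> cells (PU k) d) ps ks"
    note B = block_args[OF as ys k p ps] and A = assoc_args[OF t as ys k p ps]
    have e: "hd as \<in> Ob" "last as \<in> Ob" using along_ends[OF ys] as by auto
    show "g (cut_points ks as) d p (map (\<lambda>i. g (obj_block ks as i) d (ps ! i) (step_block ks ys i)) [0..<length ks]) =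
     g as d (oc ks d p ps) ys"
    proof (rule sep[OF e])
      fix Ob' H' h' g' F \<phi> assume L: "laws Ob' H' h' g'" and f: "ihom Ob H h g Ob' H' h' g' F \<phi>"
      have al: "assoc_law Ob' H' g'" using L by (simp add: laws_def)
      have as': "set (map F as) \<subseteq> Ob'" using as ihomD(1)[OF f] by auto
      have ys': "fits H' d (map F as) (medge (\<lambda>a b. gfun (\<phi> a b) d) as ys)"
        by (rule fits_map[where Ob=Ob and H=H, OF _ as ys]) (rule ihomD(3)[OF f])
      show "gfun (\<phi> (hd as) (last as)) d (g (cut_points ks as) d p
          (map (\<lambda>i. g (obj_block ks as i) d (ps ! i) (step_block ks ys i)) [0..<length ks])) =
        gfun (\<phi> (hd as) (last as)) d (g as d (oc ks d p ps) ys)"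
        unfolding ihom_assoc[OF f t as ys k p ps] ihomD(5)[OF f as ys B(6)]
        by (rule assoc_lawD[OF al as' ys' _ p ps]) (simp add: k)
    qed (use typed_lawD(3)[OF t B(5) A] p cut_points_ends(1,2)[OF B(1)] typed_lawD(3)[OF t as ys B(6)] in auto)
  qed
  moreover have "inter_law Ob H h g"
    unfolding inter_law_def
  proof (intro allI impI, elim conjE)
    fix as \<chi>s Z \<pi> \<sigma> zs assume as: "set as \<subseteq> Ob" and al: "along (\<lambda>a b \<chi>. \<chi> \<in> hom (gset_cat n) Z (H a b)) as \<chi>s"
      and Z: "is_gset n Z" and pi: "\<pi> \<in> hom (gset_cat n) Z (PU (length \<chi>s))" and D: "Dm Z \<sigma> zs"
    note D' = comp_Dm[OF t st as al Z pi D]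
    have e: "hd as \<in> Ob" "last as \<in> Ob" using along_ends[OF al] as by auto
    have ep: "ev (ops P (length \<chi>s)) \<sigma> (map (app \<pi>) zs) \<in> cells (PU (length \<chi>s)) (rd \<sigma>)"
      by (rule ev_cells[OF P_Obj Dm_map[OF pi D]])
    have eh: "fits H (rd \<sigma>) as (medge (\<lambda>a b \<chi>. h a b \<sigma> (map (app \<chi>) zs)) as \<chi>s)"
      by (rule fits_ops[OF t as al D])
    show "h (hd as) (last as) \<sigma> (map (\<lambda>(d, z). (d, g as d (gfun \<pi> d z) (map (\<lambda>\<chi>. gfun \<chi> d z) \<chi>s))) zs) =
     g as (rd \<sigma>) (ev (ops P (length \<chi>s)) \<sigma> (map (app \<pi>) zs)) (medge (\<lambda>a b \<chi>. h a b \<sigma> (map (app \<chi>) zs)) as \<chi>s)"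
    proof (rule sep[OF e])
      fix Ob' H' h' g' F \<phi> assume L: "laws Ob' H' h' g'" and f: "ihom Ob H h g Ob' H' h' g' F \<phi>"
      have il: "inter_law Ob' H' h' g'" using L by (simp add: laws_def)
      have as': "set (map F as) \<subseteq> Ob'" using as ihomD(1)[OF f] by auto
      have hl: "hd (map F as) = F (hd as)" "last (map F as) = F (last as)"
        using alongD(2)[OF al] by (simp_all add: hd_map last_map)
      let ?\<chi> = "medge (\<lambda>a b \<chi>. Comp (gset_cat n) (\<phi> a b) \<chi>) as \<chi>s"
      have al': "along (\<lambda>a b \<chi>. \<chi> \<in> hom (gset_cat n) Z (H' a b)) (map F as) ?\<chi>"
        by (rule along_Comp[where Ob=Ob and H=H, OF _ as al]) (rule ihomD(3)[OF f])
      have pi': "\<pi> \<in> hom (gset_cat n) Z (PU (length ?\<chi>))" using pi by simp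
      have 1: "map (app (\<phi> (hd as) (last as))) (map (\<lambda>(d, z). (d, g as d (gfun \<pi> d z) (map (\<lambda>\<chi>. gfun \<chi> d z) \<chi>s))) zs) =
        map (\<lambda>(d, z). (d, g' (map F as) d (gfun \<pi> d z) (map (\<lambda>\<chi>. gfun \<chi> d z) ?\<chi>))) zs"
      proof -
        have "gfun (\<phi> (hd as) (last as)) d (g as d (gfun \<pi> d z) (map (\<lambda>\<chi>. gfun \<chi> d z) \<chi>s)) =
          g' (map F as) d (gfun \<pi> d z) (map (\<lambda>\<chi>. gfun \<chi> d z) ?\<chi>)" if "(d, z) \<in> set zs" for d z
          using ihomD(5)[OF f as fits_along[OF al Dm_cells[OF Z D that]]] gfun_in[OF pi Dm_cells[OF Z D that]]
            medge_Comp[OF al Dm_cells[OF Z D that], of \<phi>] by simp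
        then show ?thesis by auto
      qed
      have 2: "medge (\<lambda>a b. gfun (\<phi> a b) (rd \<sigma>)) as (medge (\<lambda>a b \<chi>. h a b \<sigma> (map (app \<chi>) zs)) as \<chi>s) =
        medge (\<lambda>a b \<chi>. h' a b \<sigma> (map (app \<chi>) zs)) (map F as) ?\<chi>"
        unfolding medge_map_medge[OF alongD(1)[OF al]] medge_medge_same
      proof (rule medge_cong[OF al])
        fix a b \<chi> assume ab: "a \<in> set as" "b \<in> set as" and \<chi>: "\<chi> \<in> hom (gset_cat n) Z (H a b)"
        have o: "a \<in> Ob" "b \<in> Ob" using ab as by auto
        show "gfun (\<phi> a b) (rd \<sigma>) (h a b \<sigma> (map (app \<chi>) zs)) = h' (F a) (F b) \<sigma> (map (app (Comp (gset_cat n) (\<phi> a b) \<chi>)) zs)"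
          unfolding ihomD(4)[OF f o Dm_map[OF \<chi> D]] map_app_Comp[OF \<chi> D] ..
      qed
      have "h' (F (hd as)) (F (last as)) \<sigma> (map (\<lambda>(d, z). (d, g' (map F as) d (gfun \<pi> d z) (map (\<lambda>\<chi>. gfun \<chi> d z) ?\<chi>))) zs) =
        g' (map F as) (rd \<sigma>) (ev (ops P (length \<chi>s)) \<sigma> (map (app \<pi>) zs)) (medge (\<lambda>a b \<chi>. h' a b \<sigma> (map (app \<chi>) zs)) (map F as) ?\<chi>)"
        using inter_lawD[OF il as' al' Z pi' D] unfolding hl length_medge .
      then show "gfun (\<phi> (hd as) (last as)) (rd \<sigma>) (h (hd as) (last as) \<sigma> (map (\<lambda>(d, z). (d, g as d (gfun \<pi> d z) (map (\<lambda>\<chi>. gfun \<chi> d z) \<chi>s))) zs)) =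
        gfun (\<phi> (hd as) (last as)) (rd \<sigma>) (g as (rd \<sigma>) (ev (ops P (length \<chi>s)) \<sigma> (map (app \<pi>) zs)) (medge (\<lambda>a b \<chi>. h a b \<sigma> (map (app \<chi>) zs)) as \<chi>s))"
        unfolding ihomD(4)[OF f e D'] ihomD(5)[OF f as eh, unfolded length_medge, OF ep] 1 2 .
    qed (use typed_lawD(2)[OF t e D'] typed_lawD(3)[OF t as eh] ep in auto)
  qed
  ultimately show ?thesis using t st un by (simp add: laws_def)
qed

text \<open>Downstairs, composites and operations are obtained by lifting the arguments along the
  section, working upstairs and projecting back. Each law is then the image of the corresponding law
  upstairs.\<close>

lemma laws_quot:
  assumes L: "laws ObM HM hM gM" and f: "ihom ObM HM hM gM Ob H h g Q \<psi>"
    and s: "\<And>a. a \<in> Ob \<Longrightarrow> s a \<in> ObM" "\<And>a. a \<in> Ob \<Longrightarrow> Q (s a) = a"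
    and \<tau>: "\<And>a b. a \<in> Ob \<Longrightarrow> b \<in> Ob \<Longrightarrow> \<tau> a b \<in> hom (gset_cat n) (H a b) (HM (s a) (s b))"
    and \<psi>\<tau>: "\<And>a b d x. a \<in> Ob \<Longrightarrow> b \<in> Ob \<Longrightarrow> x \<in> cells (H a b) d \<Longrightarrow> gfun (\<psi> (s a) (s b)) d (gfun (\<tau> a b) d x) = x"
  shows "laws Ob H h g"
proof -
  have tM: "typed_law ObM HM hM gM" and stM: "st_law ObM HM gM" and uM: "unit_law ObM HM gM"
    and aM: "assoc_law ObM HM gM" and iM: "inter_law ObM HM hM gM" using L by (auto simp: laws_def)
  have sas: "set (map s as) \<subseteq> ObM" if "set as \<subseteq> Ob" for as using that s by auto
  have Qs: "map Q (map s as) = as" if "set as \<subseteq> Ob" for as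
    using that by (induction as) (auto simp: s(2))
  have \<psi>h: "\<psi> (s a) (s b) \<in> hom (gset_cat n) (HM (s a) (s b)) (H a b)" if "a \<in> Ob" "b \<in> Ob" for a b
    using ihomD(3)[OF f s(1)[OF that(1)] s(1)[OF that(2)]] s(2) that by simp
  \<comment> \<open>Composable strings lift to composable strings, because the section is a family
    of maps of homs lying over a map \<open>s\<close> of objects.\<close>
  have fit: "fits HM d (map s as) (medge (\<lambda>a b. gfun (\<tau> a b) d) as ys)" if "set as \<subseteq> Ob" "fits H d as ys" for d as ys
    by (rule fits_map[where Ob=Ob and H=H, OF _ that]) (rule \<tau>)
  have g\<psi>: "gfun (\<psi> (s (hd as)) (s (last as))) d (gM (map s as) d p xs) =
      g as d p (medge (\<lambda>a b. gfun (\<psi> (s a) (s b)) d) as xs)"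
    if as: "set as \<subseteq> Ob" and xs: "fits HM d (map s as) xs" and p: "p \<in> cells (PU (length xs)) d" for d as xs p
  proof -
    have "as \<noteq> []" using alongD(2)[OF xs] by simp
    moreover have "medge (\<lambda>a b. gfun (\<psi> a b) d) (map s as) xs = medge (\<lambda>a b. gfun (\<psi> (s a) (s b)) d) as xs"
      using alongD(1)[OF xs] by (simp add: medge_def)
    ultimately show ?thesis using ihomD(5)[OF f sas[OF as] xs p] Qs[OF as] by (simp add: hd_map last_map)
  qed
  have \<psi>\<tau>': "medge (\<lambda>a b. gfun (\<psi> (s a) (s b)) d) as (medge (\<lambda>a b. gfun (\<tau> a b) d) as ys) = ys"
    if as: "set as \<subseteq> Ob" and ys: "fits H d as ys" for d as ys
    unfolding medge_medge_same by (rule medge_ident[OF ys]) (use as \<psi>\<tau> in blast)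
  have g: "g as d p ys = gfun (\<psi> (s (hd as)) (s (last as))) d (gM (map s as) d p (medge (\<lambda>a b. gfun (\<tau> a b) d) as ys))"
    if as: "set as \<subseteq> Ob" and ys: "fits H d as ys" and p: "p \<in> cells (PU (length ys)) d" for d as ys p
    using g\<psi>[OF as fit[OF as ys]] p \<psi>\<tau>'[OF as ys] by simp
  have gMc: "gM (map s as) d p xs \<in> cells (HM (s (hd as)) (s (last as))) d"
    if as: "set as \<subseteq> Ob" and xs: "fits HM d (map s as) xs" and p: "p \<in> cells (PU (length xs)) d" for d as xs p
  proof -
    have "as \<noteq> []" using alongD(2)[OF xs] by simp
    then show ?thesis using typed_lawD(3)[OF tM sas[OF as] xs p] by (simp add: hd_map last_map)
  qed
  have h\<psi>: "gfun (\<psi> (s a) (s b)) (rd \<sigma>) (hM (s a) (s b) \<sigma> zs) = h a b \<sigma> (map (app (\<psi> (s a) (s b))) zs)"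
    if "a \<in> Ob" "b \<in> Ob" "Dm (HM (s a) (s b)) \<sigma> zs" for a b \<sigma> zs
    using ihomD(4)[OF f s(1)[OF that(1)] s(1)[OF that(2)] that(3)] s(2) that by simp
  have h: "h a b \<sigma> zs = gfun (\<psi> (s a) (s b)) (rd \<sigma>) (hM (s a) (s b) \<sigma> (map (app (\<tau> a b)) zs))"
    if ab: "a \<in> Ob" "b \<in> Ob" and D: "Dm (H a b) \<sigma> zs" for a b \<sigma> zs
  proof -
    have "map (app (\<psi> (s a) (s b))) (map (app (\<tau> a b)) zs) = zs"
      using Dm_cells[OF gset_homD(1)[OF \<tau>[OF ab]] D] \<psi>\<tau>[OF ab] by (auto intro: map_idI)
    then show ?thesis using h\<psi>[OF ab Dm_map[OF \<tau>[OF ab] D]] by simp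
  qed
  have t: "typed_law Ob H h g"
    unfolding typed_law_def
  proof (intro conjI ballI allI impI, goal_cases)
    case (1 a b)
    then show ?case using gset_homD(1)[OF \<tau>] by blast
  next
    case (2 a b \<sigma> zs)
    then show ?case unfolding h[OF 2]
      using gfun_in[OF \<psi>h typed_lawD(2)[OF tM s(1) s(1) Dm_map[OF \<tau>]]] by blast
  next
    case (3 d as p ys)
    then have as: "set as \<subseteq> Ob" and ys: "fits H d as ys" and p: "p \<in> cells (PU (length ys)) d" by auto
    have e: "hd as \<in> Ob" "last as \<in> Ob" using along_ends[OF ys] as by auto
    show ?case unfolding g[OF as ys p] using gfun_in[OF \<psi>h[OF e] gMc[OF as fit[OF as ys]]] p by simp
  qed
  have st: "st_law Ob H g"
    unfolding st_law_def
  proof (intro allI impI, elim conjE)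
    fix d as p ys assume as: "set as \<subseteq> Ob" and ys: "fits H (Suc d) as ys" and p: "p \<in> cells (PU (length ys)) (Suc d)"
    have e: "hd as \<in> Ob" "last as \<in> Ob" using along_ends[OF ys] as by auto
    note l = alongD(1)[OF ys]
    let ?xs = "medge (\<lambda>a b. gfun (\<tau> a b) (Suc d)) as ys"
    note F = fit[OF as ys]
    have px: "p \<in> cells (PU (length ?xs)) (Suc d)" using p by simp
    have hl: "hd (map s as) = s (hd as)" "last (map s as) = s (last as)"
      using alongD(2)[OF ys] by (simp_all add: hd_map last_map)
    note S = st_lawD[OF stM sas[OF as] F px, unfolded length_medge hl] and G = gMc[OF as F px]
    have m: "fits H d as (medge (\<lambda>a b. gsrc (H a b) d) as ys)" "fits H d as (medge (\<lambda>a b. gtgt (H a b) d) as ys)"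
      by (rule fits_st[OF t as ys])+
    have ps: "gsrc (PU (length ys)) d p \<in> cells (PU (length ys)) d" "gtgt (PU (length ys)) d p \<in> cells (PU (length ys)) d"
      using gset_in[OF P_gset p] by auto
    have "medge (\<lambda>a b. gsrc (HM a b) d) (map s as) ?xs = medge (\<lambda>a b. gfun (\<tau> a b) d) as (medge (\<lambda>a b. gsrc (H a b) d) as ys)"
      "medge (\<lambda>a b. gtgt (HM a b) d) (map s as) ?xs = medge (\<lambda>a b. gfun (\<tau> a b) d) as (medge (\<lambda>a b. gtgt (H a b) d) as ys)"
      by (rule medge_st[where Ob=Ob and H=H, OF _ as ys], rule \<tau>, assumption+)+
    then show "gsrc (H (hd as) (last as)) d (g as (Suc d) p ys) =
       g as d (gsrc (PU (length ys)) d p) (medge (\<lambda>a b. gsrc (H a b) d) as ys) \<and>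
     gtgt (H (hd as) (last as)) d (g as (Suc d) p ys) =
       g as d (gtgt (PU (length ys)) d p) (medge (\<lambda>a b. gtgt (H a b) d) as ys)"
      using g[OF as ys p] g[OF as m(1)] g[OF as m(2)] ps gfun_src[OF \<psi>h[OF e] G] gfun_tgt[OF \<psi>h[OF e] G] S by simp
  qed
  have un: "unit_law Ob H g"
    unfolding unit_law_def
  proof (intro allI ballI)
    fix d a b y assume ab: "a \<in> Ob" "b \<in> Ob" and y: "y \<in> cells (H a b) d"
    have as: "set [a, b] \<subseteq> Ob" and ys: "fits H d [a, b] [y]" using ab y by (auto simp: along_def)
    have o: "ou d \<in> cells (PU (length [y])) d" using ou_in gset_dim[OF typed_lawD(1)[OF t ab] y] by simp
    show "g [a, b] d (ou d) [y] = y"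
      using g[OF as ys o] unit_lawD[OF uM s(1)[OF ab(1)] s(1)[OF ab(2)] gfun_in[OF \<tau>[OF ab] y]] \<psi>\<tau>[OF ab y]
      by (simp add: medge_def)
  qed
  have "assoc_law Ob H g"
    unfolding assoc_law_def
  proof (intro allI impI, elim conjE)
    fix d as ks p ps ys assume as: "set as \<subseteq> Ob" and ys: "fits H d as ys" and k: "sum_list ks = length ys"
      and p: "p \<in> cells (PU (length ks)) d" and ps: "list_all2 (\<lambda>q k. q \<in> cells (PU k) d) ps ks"
    note B = block_args[OF as ys k p ps]
    let ?xs = "medge (\<lambda>a b. gfun (\<tau> a b) d) as ys"
    note F = fit[OF as ys]
    have k': "sum_list ks = length ?xs" using k by simp
    have ne: "as \<noteq> []" using alongD(2)[OF ys] .
    have "gfun (\<psi> (hd (map s as)) (last (map s as))) d (gM (cut_points ks (map s as)) d p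
      (map (\<lambda>i. gM (obj_block ks (map s as) i) d (ps ! i) (step_block ks ?xs i)) [0..<length ks])) =
      g (cut_points ks (map Q (map s as))) d p (map (\<lambda>i. g (obj_block ks (map Q (map s as)) i) d (ps ! i)
      (step_block ks (medge (\<lambda>a b. gfun (\<psi> a b) d) (map s as) ?xs) i)) [0..<length ks])"
      by (rule ihom_assoc[OF f tM sas[OF as] F k' p ps])
    also have "medge (\<lambda>a b. gfun (\<psi> a b) d) (map s as) ?xs = ys"
      using \<psi>\<tau>'[OF as ys] by (simp add: medge_map_medge[OF alongD(1)[OF ys]] medge_medge_same)
    finally have "g (cut_points ks as) d p (map (\<lambda>i. g (obj_block ks as i) d (ps ! i) (step_block ks ys i)) [0..<length ks]) =
      gfun (\<psi> (hd (map s as)) (last (map s as))) d (gM (cut_points ks (map s as)) d p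
      (map (\<lambda>i. gM (obj_block ks (map s as) i) d (ps ! i) (step_block ks ?xs i)) [0..<length ks]))"
      unfolding Qs[OF as] by simp
    also have "\<dots> = gfun (\<psi> (s (hd as)) (s (last as))) d (gM (map s as) d (oc ks d p ps) ?xs)"
      unfolding assoc_lawD[OF aM sas[OF as] F k' p ps] using ne by (simp add: hd_map last_map)
    also have "\<dots> = g as d (oc ks d p ps) ys" using g[OF as ys B(6)] by simp
    finally show "g (cut_points ks as) d p (map (\<lambda>i. g (obj_block ks as i) d (ps ! i) (step_block ks ys i)) [0..<length ks]) =
     g as d (oc ks d p ps) ys" .
  qed
  moreover have "inter_law Ob H h g"
    unfolding inter_law_def
  proof (intro allI impI, elim conjE)
    fix as \<chi>s Z \<pi> \<sigma> zs assume as: "set as \<subseteq> Ob" and al: "along (\<lambda>a b \<chi>. \<chi> \<in> hom (gset_cat n) Z (H a b)) as \<chi>s"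
      and Z: "is_gset n Z" and pi: "\<pi> \<in> hom (gset_cat n) Z (PU (length \<chi>s))" and D: "Dm Z \<sigma> zs"
    have e: "hd as \<in> Ob" "last as \<in> Ob" using along_ends[OF al] as by auto
    let ?\<chi> = "medge (\<lambda>a b \<chi>. Comp (gset_cat n) (\<tau> a b) \<chi>) as \<chi>s"
    have al': "along (\<lambda>a b \<chi>. \<chi> \<in> hom (gset_cat n) Z (HM a b)) (map s as) ?\<chi>"
      by (rule along_Comp[where Ob=Ob and H=H, OF _ as al]) (rule \<tau>)
    have pi': "\<pi> \<in> hom (gset_cat n) Z (PU (length ?\<chi>))" using pi by simp
    have hl: "hd (map s as) = s (hd as)" "last (map s as) = s (last as)"
      using alongD(2)[OF al] by (simp_all add: hd_map last_map)
    let ?zs = "map (\<lambda>(d, z). (d, gM (map s as) d (gfun \<pi> d z) (map (\<lambda>\<chi>. gfun \<chi> d z) ?\<chi>))) zs"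
    have D': "Dm (HM (s (hd as)) (s (last as))) \<sigma> ?zs"
      using comp_Dm[OF tM stM sas[OF as] al' Z pi' D] unfolding hl .
    have 1: "map (app (\<psi> (s (hd as)) (s (last as)))) ?zs = map (\<lambda>(d, z). (d, g as d (gfun \<pi> d z) (map (\<lambda>\<chi>. gfun \<chi> d z) \<chi>s))) zs"
    proof -
      have "gfun (\<psi> (s (hd as)) (s (last as))) d (gM (map s as) d (gfun \<pi> d z) (map (\<lambda>\<chi>. gfun \<chi> d z) ?\<chi>)) =
        g as d (gfun \<pi> d z) (map (\<lambda>\<chi>. gfun \<chi> d z) \<chi>s)" if "(d, z) \<in> set zs" for d z
      proof -
        note z = Dm_cells[OF Z D that]
        show ?thesis unfolding medge_Comp[OF al z]
          using g[OF as fits_along[OF al z]] gfun_in[OF pi z] by simp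
      qed
      then show ?thesis by auto
    qed
    have ep: "ev (ops P (length \<chi>s)) \<sigma> (map (app \<pi>) zs) \<in> cells (PU (length \<chi>s)) (rd \<sigma>)"
      by (rule ev_cells[OF P_Obj Dm_map[OF pi D]])
    let ?ws = "medge (\<lambda>a b \<chi>. hM a b \<sigma> (map (app \<chi>) zs)) (map s as) ?\<chi>"
    have ws: "fits HM (rd \<sigma>) (map s as) ?ws"
      by (rule fits_ops[OF tM sas[OF as] al' D])
    have 2: "medge (\<lambda>a b. gfun (\<psi> (s a) (s b)) (rd \<sigma>)) as ?ws = medge (\<lambda>a b \<chi>. h a b \<sigma> (map (app \<chi>) zs)) as \<chi>s"
      unfolding medge_map_medge[OF alongD(1)[OF al]] medge_medge_same
    proof (rule medge_cong[OF al])
      fix a b \<chi> assume ab: "a \<in> set as" "b \<in> set as" and \<chi>: "\<chi> \<in> hom (gset_cat n) Z (H a b)"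
      have o: "a \<in> Ob" "b \<in> Ob" using ab as by auto
      show "gfun (\<psi> (s a) (s b)) (rd \<sigma>) (hM (s a) (s b) \<sigma> (map (app (Comp (gset_cat n) (\<tau> a b) \<chi>)) zs)) = h a b \<sigma> (map (app \<chi>) zs)"
        unfolding map_app_Comp[OF \<chi> D] h[OF o Dm_map[OF \<chi> D]] ..
    qed
    have "h (hd as) (last as) \<sigma> (map (app (\<psi> (s (hd as)) (s (last as)))) ?zs) =
      gfun (\<psi> (s (hd as)) (s (last as))) (rd \<sigma>) (hM (s (hd as)) (s (last as)) \<sigma> ?zs)"
      using h\<psi>[OF e D'] by simp
    also have "hM (s (hd as)) (s (last as)) \<sigma> ?zs = gM (map s as) (rd \<sigma>) (ev (ops P (length \<chi>s)) \<sigma> (map (app \<pi>) zs)) ?ws"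
      using inter_lawD[OF iM sas[OF as] al' Z pi' D] unfolding hl length_medge .
    also have "gfun (\<psi> (s (hd as)) (s (last as))) (rd \<sigma>) \<dots> = g as (rd \<sigma>) (ev (ops P (length \<chi>s)) \<sigma> (map (app \<pi>) zs))
        (medge (\<lambda>a b. gfun (\<psi> (s a) (s b)) (rd \<sigma>)) as ?ws)"
      by (rule g\<psi>[OF as ws]) (simp add: ep)
    finally show "h (hd as) (last as) \<sigma> (map (\<lambda>(d, z). (d, g as d (gfun \<pi> d z) (map (\<lambda>\<chi>. gfun \<chi> d z) \<chi>s))) zs) =
     g as (rd \<sigma>) (ev (ops P (length \<chi>s)) \<sigma> (map (app \<pi>) zs)) (medge (\<lambda>a b \<chi>. h a b \<sigma> (map (app \<chi>) zs)) as \<chi>s)"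
      unfolding 1 2 .
  qed
  ultimately show ?thesis using t st un by (simp add: laws_def)
qed


section \<open>Enriched categories satisfy the laws\<close>

lemma ccone_nth: "set Xs \<subseteq> Obj V \<Longrightarrow> i < length Xs \<Longrightarrow> projs V Xs ! i \<in> hom V (Prod V Xs) (Xs ! i)"
  by (rule ccone_pr(1)[OF Prod_ccone])

lemma tup_eqI':
  assumes "set Xs \<subseteq> Obj V" "x \<in> cel (Prod V Xs) d" "length ys = length Xs"
    "\<And>i. i < length Xs \<Longrightarrow> act (projs V Xs ! i) d x = ys ! i"
  shows "tup Xs d ys = x"
  using assms ccone_len[OF Prod_ccone[OF assms(1)]] by (intro tup_eqI) (auto intro: nth_equalityI)

lemma tup_nth:
  assumes "set Xs \<subseteq> Obj V" "d \<le> n" "list_all2 (\<lambda>y X. y \<in> cel X d) ys Xs" "i < length Xs"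
  shows "act (projs V Xs ! i) d (tup Xs d ys) = ys ! i"
  using arg_cong[OF tup(2)[OF assms(1-3)], of "\<lambda>l. l ! i"] ccone_len[OF Prod_ccone[OF assms(1)]] assms(4) by simp

text \<open>The unit and associativity laws come from \<open>is_vpcat_iff\<close>. The other two
  hold because \<open>vact A as\<close> is an arrow of \<open>V\<close>, so that it underlies a
  globular map preserving the operations, and in the product sources, targets and operations are
  componentwise.\<close>

lemma laws_vpcat:
  assumes A: "is_vpcat V P A"
  shows "laws (gobjs (ugraph A)) (gH A) (\<lambda>a b. ev (ghom (ugraph A) a b)) (gam A)"
proof -
  have pre: "pre A" and u: "unit_law (gobjs (ugraph A)) (gH A) (gam A)" and a: "assoc_law (gobjs (ugraph A)) (gH A) (gam A)"
    using A by (auto simp: is_vpcat_iff)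
  note gO = ghom_Obj[OF pre]
  have t: "typed_law (gobjs (ugraph A)) (gH A) (\<lambda>a b. ev (ghom (ugraph A) a b)) (gam A)"
    unfolding typed_law_def using gset_U[OF gO] ev_cells[OF gO] gam_in[OF pre] by blast
  have st: "st_law (gobjs (ugraph A)) (gH A) (gam A)"
    unfolding st_law_def
  proof (intro allI impI, elim conjE)
    fix d as p ys assume as: "set as \<subseteq> gobjs (ugraph A)" and ys: "fits (gH A) (Suc d) as ys"
      and p: "p \<in> cells (PU (length ys)) (Suc d)"
    let ?Xs = "ops P (length as - 1) # rev (steps (ugraph A) as)"
    note XO = steps_Obj[OF pre as, of "length as - 1"] and ga = gam_args[OF ys p] and d = gset_dim[OF P_gset p]
    note tp = tup(1)[OF XO d ga] and v = vact_hom[OF pre alongD(2)[OF ys] as]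
    note l = alongD(1)[OF ys]
    have PO: "is_gset n (Fobj U (Prod V ?Xs))" by (rule gset_U[OF Prod_Obj[OF XO]])
    \<comment> \<open>Position 0 belongs to the operad; position \<open>i > 0\<close> belongs to
      edge \<open>length ys - i\<close>, since the homs stand in reverse order.\<close>
    have nth: "?Xs ! i = (if i = 0 then ops P (length ys) else ghom (ugraph A) (as ! (length ys - i)) (as ! Suc (length ys - i)))"
      "(p # rev ys) ! i = (if i = 0 then p else ys ! (length ys - i))" if "i < length ?Xs" for i
      using that l by (auto simp: nth_Cons' rev_nth steps_def)
    have s: "tup ?Xs d (gsrc (PU (length ys)) d p # rev (medge (\<lambda>a b. gsrc (gH A a b) d) as ys)) =
        gsrc (Fobj U (Prod V ?Xs)) d (tup ?Xs (Suc d) (p # rev ys))"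
    proof (rule tup_eqI'[OF XO gset_in(1)[OF PO tp]])
      fix i assume i: "i < length ?Xs"
      show "act (projs V ?Xs ! i) d (gsrc (Fobj U (Prod V ?Xs)) d (tup ?Xs (Suc d) (p # rev ys))) =
        (gsrc (PU (length ys)) d p # rev (medge (\<lambda>a b. gsrc (gH A a b) d) as ys)) ! i"
        unfolding gfun_src[OF U_hom[OF ccone_nth[OF XO i]] tp, symmetric] tup_nth[OF XO d ga i] nth[OF i]
        using i l by (auto simp: nth_Cons' rev_nth)
    qed (use l in simp)
    have t: "tup ?Xs d (gtgt (PU (length ys)) d p # rev (medge (\<lambda>a b. gtgt (gH A a b) d) as ys)) =
        gtgt (Fobj U (Prod V ?Xs)) d (tup ?Xs (Suc d) (p # rev ys))"
    proof (rule tup_eqI'[OF XO gset_in(2)[OF PO tp]])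
      fix i assume i: "i < length ?Xs"
      show "act (projs V ?Xs ! i) d (gtgt (Fobj U (Prod V ?Xs)) d (tup ?Xs (Suc d) (p # rev ys))) =
        (gtgt (PU (length ys)) d p # rev (medge (\<lambda>a b. gtgt (gH A a b) d) as ys)) ! i"
        unfolding gfun_tgt[OF U_hom[OF ccone_nth[OF XO i]] tp, symmetric] tup_nth[OF XO d ga i] nth[OF i]
        using i l by (auto simp: nth_Cons' rev_nth)
    qed (use l in simp)
    show "gsrc (gH A (hd as) (last as)) d (gam A as (Suc d) p ys) =
        gam A as d (gsrc (PU (length ys)) d p) (medge (\<lambda>a b. gsrc (gH A a b) d) as ys) \<and>
      gtgt (gH A (hd as) (last as)) d (gam A as (Suc d) p ys) =
        gam A as d (gtgt (PU (length ys)) d p) (medge (\<lambda>a b. gtgt (gH A a b) d) as ys)"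
      unfolding gam_def s t using gfun_src[OF U_hom[OF v] tp] gfun_tgt[OF U_hom[OF v] tp] by simp
  qed
  have "inter_law (gobjs (ugraph A)) (gH A) (\<lambda>a b. ev (ghom (ugraph A) a b)) (gam A)"
    unfolding inter_law_def
  proof (intro allI impI, elim conjE)
    fix as \<chi>s Z \<pi> \<sigma> zs assume as: "set as \<subseteq> gobjs (ugraph A)" and al: "along (\<lambda>a b \<chi>. \<chi> \<in> hom (gset_cat n) Z (gH A a b)) as \<chi>s"
      and Z: "is_gset n Z" and pi: "\<pi> \<in> hom (gset_cat n) Z (PU (length \<chi>s))" and D: "Dm Z \<sigma> zs"
    let ?Xs = "ops P (length as - 1) # rev (steps (ugraph A) as)"
    note XO = steps_Obj[OF pre as, of "length as - 1"] and v = vact_hom[OF pre alongD(2)[OF al] as] and l = alongD(1)[OF al]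
    note c = Prod_ccone[OF XO]
    have nth: "?Xs ! i = (if i = 0 then ops P (length \<chi>s) else ghom (ugraph A) (as ! (length \<chi>s - i)) (as ! Suc (length \<chi>s - i)))"
      "(\<pi> # rev \<chi>s) ! i = (if i = 0 then \<pi> else \<chi>s ! (length \<chi>s - i))" if "i < length ?Xs" for i
      using that l by (auto simp: nth_Cons' rev_nth steps_def)
    have la: "list_all2 (\<lambda>f X. f \<in> hom (gset_cat n) Z (Fobj U X)) (\<pi> # rev \<chi>s) ?Xs"
      using list_all2_steps[of as "\<lambda>\<chi> X. \<chi> \<in> hom (gset_cat n) Z (Fobj U X)" \<chi>s "ugraph A"] alongD(2)[OF al] al pi l by simp
    \<comment> \<open>The whole family of arguments over \<open>Z\<close> becomes a single globular
      map into the product.\<close>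
    obtain h where h: "h \<in> hom (gset_cat n) Z (Fobj U (Prod V ?Xs))"
      and hp: "\<And>d z i. z \<in> cells Z d \<Longrightarrow> i < length ?Xs \<Longrightarrow> act (projs V ?Xs ! i) d (gfun h d z) = gfun ((\<pi> # rev \<chi>s) ! i) d z"
      using ccone_tuple[OF c Z la] by blast
    have ht: "tup ?Xs d (gfun \<pi> d z # rev (map (\<lambda>\<chi>. gfun \<chi> d z) \<chi>s)) = gfun h d z" if z: "z \<in> cells Z d" for d z
    proof (rule tup_eqI'[OF XO gfun_in[OF h z]])
      fix i assume i: "i < length ?Xs"
      have "map (\<lambda>\<chi>. gfun \<chi> d z) (\<pi> # rev \<chi>s) ! i = gfun ((\<pi> # rev \<chi>s) ! i) d z"
        using i l by (intro nth_map) simp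
      then show "act (projs V ?Xs ! i) d (gfun h d z) = (gfun \<pi> d z # rev (map (\<lambda>\<chi>. gfun \<chi> d z) \<chi>s)) ! i"
        using hp[OF z i] by (simp add: rev_map)
    qed (use l in simp)
    have eqz: "map (\<lambda>(d, z). (d, gam A as d (gfun \<pi> d z) (map (\<lambda>\<chi>. gfun \<chi> d z) \<chi>s))) zs = map (app (Farr U (vact A as))) (map (app h) zs)"
    proof -
      have "gam A as d (gfun \<pi> d z) (map (\<lambda>\<chi>. gfun \<chi> d z) \<chi>s) = act (vact A as) d (gfun h d z)" if "(d, z) \<in> set zs" for d z
        unfolding gam_def ht[OF Dm_cells[OF Z D that]] ..
      then show ?thesis by auto
    qed
    note Dh = Dm_map[OF h D]
    have PO: "Prod V ?Xs \<in> Obj V" by (rule Prod_Obj[OF XO])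
    have "tup ?Xs (rd \<sigma>) (ev (ops P (length \<chi>s)) \<sigma> (map (app \<pi>) zs) #
        rev (medge (\<lambda>a b \<chi>. ev (ghom (ugraph A) a b) \<sigma> (map (app \<chi>) zs)) as \<chi>s)) = ev (Prod V ?Xs) \<sigma> (map (app h) zs)"
    proof (rule tup_eqI'[OF XO ev_cells[OF PO Dh]])
      fix i assume i: "i < length ?Xs"
      have eq: "map (app (Farr U (projs V ?Xs ! i))) (map (app h) zs) = map (app ((\<pi> # rev \<chi>s) ! i)) zs"
        by (rule map_app_comp[OF Z D, symmetric]) (simp only: hp[OF _ i])
      have "act (projs V ?Xs ! i) (rd \<sigma>) (ev (Prod V ?Xs) \<sigma> (map (app h) zs)) = ev (?Xs ! i) \<sigma> (map (app ((\<pi> # rev \<chi>s) ! i)) zs)"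
        unfolding eq[symmetric] by (rule act_ev[OF ccone_nth[OF XO i] Dh])
      also have "\<dots> = (ev (ops P (length \<chi>s)) \<sigma> (map (app \<pi>) zs) #
        rev (medge (\<lambda>a b \<chi>. ev (ghom (ugraph A) a b) \<sigma> (map (app \<chi>) zs)) as \<chi>s)) ! i"
        unfolding nth[OF i] using i l by (auto simp: nth_Cons' rev_nth)
      finally show "act (projs V ?Xs ! i) (rd \<sigma>) (ev (Prod V ?Xs) \<sigma> (map (app h) zs)) = (ev (ops P (length \<chi>s)) \<sigma> (map (app \<pi>) zs) #
        rev (medge (\<lambda>a b \<chi>. ev (ghom (ugraph A) a b) \<sigma> (map (app \<chi>) zs)) as \<chi>s)) ! i" .
    qed (use l in simp)
    then show "ev (ghom (ugraph A) (hd as) (last as)) \<sigma> (map (\<lambda>(d, z). (d, gam A as d (gfun \<pi> d z) (map (\<lambda>\<chi>. gfun \<chi> d z) \<chi>s))) zs) =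
      gam A as (rd \<sigma>) (ev (ops P (length \<chi>s)) \<sigma> (map (app \<pi>) zs)) (medge (\<lambda>a b \<chi>. ev (ghom (ugraph A) a b) \<sigma> (map (app \<chi>) zs)) as \<chi>s)"
      unfolding eqz act_ev[OF v Dh, symmetric] by (simp add: gam_def)
  qed
  then show ?thesis using t st u a by (simp add: laws_def)
qed

end

section \<open>Hom globular sets\<close>

text \<open>The 0-dimensional source of a cell. The argument \<open>m\<close> is one less than the
  dimension of the cell, in agreement with \<open>gsrc\<close>.\<close>

fun bsrc :: "'u gset \<Rightarrow> nat \<Rightarrow> 'u \<Rightarrow> 'u" where
  "bsrc A 0 x = gsrc A 0 x"
| "bsrc A (Suc m) x = bsrc A m (gsrc A (Suc m) x)"

fun btgt :: "'u gset \<Rightarrow> nat \<Rightarrow> 'u \<Rightarrow> 'u" where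
  "btgt A 0 x = gtgt A 0 x"
| "btgt A (Suc m) x = btgt A m (gtgt A (Suc m) x)"

lemma bsrc_in: "is_gset n A \<Longrightarrow> x \<in> cells A (Suc m) \<Longrightarrow> bsrc A m x \<in> cells A 0"
  by (induction m arbitrary: x) (auto simp: gset_in)

lemma btgt_in: "is_gset n A \<Longrightarrow> x \<in> cells A (Suc m) \<Longrightarrow> btgt A m x \<in> cells A 0"
  by (induction m arbitrary: x) (auto simp: gset_in)

lemma bsrc_tgt: "is_gset n A \<Longrightarrow> x \<in> cells A (Suc (Suc m)) \<Longrightarrow> bsrc A m (gtgt A (Suc m) x) = bsrc A (Suc m) x"
  by (cases m) (auto simp: gset_globular)

lemma btgt_src: "is_gset n A \<Longrightarrow> x \<in> cells A (Suc (Suc m)) \<Longrightarrow> btgt A m (gsrc A (Suc m) x) = btgt A (Suc m) x"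
  by (cases m) (auto simp: gset_globular)

lemma gfun_bsrc: "f \<in> hom (gset_cat n) A B \<Longrightarrow> x \<in> cells A (Suc m) \<Longrightarrow> bsrc B m (gfun f (Suc m) x) = gfun f 0 (bsrc A m x)"
  by (induction m arbitrary: x) (auto simp: gfun_src gset_in[OF gset_homD(1)])

lemma gfun_btgt: "f \<in> hom (gset_cat n) A B \<Longrightarrow> x \<in> cells A (Suc m) \<Longrightarrow> btgt B m (gfun f (Suc m) x) = gfun f 0 (btgt A m x)"
  by (induction m arbitrary: x) (auto simp: gfun_tgt gset_in[OF gset_homD(1)])

text \<open>The hom object from \<open>a\<close> to \<open>b\<close> when an
  \<open>(n + 1)\<close>-globular set is regarded as a graph enriched in \<open>n\<close>-globular
  sets.\<close>

definition hset :: "'u gset \<Rightarrow> 'u \<Rightarrow> 'u \<Rightarrow> 'u gset" where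
  "hset A a b = GSet (\<lambda>m. {x \<in> cells A (Suc m). bsrc A m x = a \<and> btgt A m x = b})
     (\<lambda>m. \<lambda>x\<in>{x \<in> cells A (Suc (Suc m)). bsrc A (Suc m) x = a \<and> btgt A (Suc m) x = b}. gsrc A (Suc m) x)
     (\<lambda>m. \<lambda>x\<in>{x \<in> cells A (Suc (Suc m)). bsrc A (Suc m) x = a \<and> btgt A (Suc m) x = b}. gtgt A (Suc m) x)"

lemma cells_hset: "x \<in> cells (hset A a b) m \<longleftrightarrow> x \<in> cells A (Suc m) \<and> bsrc A m x = a \<and> btgt A m x = b"
  by (simp add: hset_def)

lemma hset_st: "x \<in> cells (hset A a b) (Suc m) \<Longrightarrow> gsrc (hset A a b) m x = gsrc A (Suc m) x"
  "x \<in> cells (hset A a b) (Suc m) \<Longrightarrow> gtgt (hset A a b) m x = gtgt A (Suc m) x"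
  by (simp_all add: hset_def)

lemma is_gset_hset:
  assumes A: "is_gset (Suc n) A"
  shows "is_gset n (hset A a b)"
proof -
  have st: "gsrc A (Suc m) x \<in> cells (hset A a b) m" "gtgt A (Suc m) x \<in> cells (hset A a b) m"
    if "x \<in> cells (hset A a b) (Suc m)" for m x
    using that gset_in[OF A] bsrc_tgt[OF A] btgt_src[OF A] by (auto simp: cells_hset)
  show ?thesis
  proof (rule is_gsetI)
    fix m x assume "x \<in> cells (hset A a b) m"
    then show "m \<le> n" using gset_dim[OF A] by (fastforce simp: cells_hset)
  next
    fix m x assume x: "x \<in> cells (hset A a b) (Suc (Suc m))"
    then show "gsrc (hset A a b) m (gsrc (hset A a b) (Suc m) x) = gsrc (hset A a b) m (gtgt (hset A a b) (Suc m) x)"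
      "gtgt (hset A a b) m (gsrc (hset A a b) (Suc m) x) = gtgt (hset A a b) m (gtgt (hset A a b) (Suc m) x)"
      using st[OF x] by (auto simp: hset_st cells_hset gset_globular[OF A])
  qed (simp_all add: hset_st st, simp_all add: hset_def)
qed

definition hmap :: "'u gset \<Rightarrow> 'u gset \<Rightarrow> 'u gmap \<Rightarrow> 'u \<Rightarrow> 'u \<Rightarrow> 'u gmap" where
  "hmap A B f a b = mk_gmap (hset A a b) (hset B (gfun f 0 a) (gfun f 0 b)) (\<lambda>d. gfun f (Suc d))"

lemma hset_map: "f \<in> hom (gset_cat n) A B \<Longrightarrow> x \<in> cells (hset A a b) d \<Longrightarrow>
    gfun f (Suc d) x \<in> cells (hset B (gfun f 0 a) (gfun f 0 b)) d"
  using gfun_in gfun_bsrc gfun_btgt by (fastforce simp: cells_hset)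

lemma hmap_hom:
  assumes f: "f \<in> hom (gset_cat (Suc n)) A B"
  shows "hmap A B f a b \<in> hom (gset_cat n) (hset A a b) (hset B (gfun f 0 a) (gfun f 0 b))"
proof -
  have h: "gfun f (Suc m) x \<in> cells (hset B (gfun f 0 a) (gfun f 0 b)) m" if "x \<in> cells (hset A a b) m" for m x
    using hset_map[OF f that] .
  show ?thesis unfolding hmap_def
    by (rule mk_gmap[OF is_gset_hset[OF gset_homD(1)[OF f]] is_gset_hset[OF gset_homD(2)[OF f]] h])
      (simp_all add: hset_st(1)[OF h] hset_st(2)[OF h] hset_st gfun_src[OF f] gfun_tgt[OF f] cells_hset)
qed

lemma gfun_hmap [simp]: "x \<in> cells (hset A a b) d \<Longrightarrow> gfun (hmap A B f a b) d x = gfun f (Suc d) x"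
  by (simp add: hmap_def)

definition sh :: "nat \<times> 'u \<Rightarrow> nat \<times> 'u" where
  "sh = (\<lambda>(d, x). (Suc d, x))"

lemma sh_simp [simp]: "sh (d, x) = (Suc d, x)" and inj_sh: "inj sh"
  by (auto simp: sh_def intro: injI)

context enriched begin

section \<open>Enriched categories as globular sets with operations\<close>

text \<open>
  The symbol \<open>(0, k, d, p)\<close> applies the \<open>d\<close>-cell \<open>p\<close> of \<open>P(k)\<close> to a string of \<open>k\<close> cells, given by its \<open>k + 1\<close>
  objects followed by the cells (so that \<open>k = 0\<close> needs no special treatment). The symbol \<open>(Suc j, k, d, p)\<close>
  is the operation \<open>(j, k, d, p)\<close> of a hom, whose two objects precede the arguments. Passing to a hom lowers
  dimensions by one.
\<close>

definition edges :: "nat \<Rightarrow> 'u list \<Rightarrow> 'u list \<Rightarrow> (nat \<times> 'u) list" where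
  "edges d as ys = map (Pair 0) as @ map (Pair (Suc d)) ys"

definition inner :: "'u \<Rightarrow> 'u \<Rightarrow> (nat \<times> 'u) list \<Rightarrow> (nat \<times> 'u) list" where
  "inner a b zs = (0, a) # (0, b) # map sh zs"

text \<open>The operad cell \<open>p\<close> belongs to the symbol and is not an argument. Thus the
  domain depends on \<open>T\<close> alone, and maps between globular sets leave \<open>p\<close> as
  it is.\<close>

fun eDm :: "'u gset \<Rightarrow> nat \<times> nat \<times> nat \<times> 'u \<Rightarrow> (nat \<times> 'u) list \<Rightarrow> bool" where
  "eDm T (0, k, d, p) xs \<longleftrightarrow> p \<in> cells (PU k) d \<and>
     (\<exists>as ys. set as \<subseteq> cells T 0 \<and> fits (hset T) d as ys \<and> length ys = k \<and> xs = edges d as ys)"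
| "eDm T (Suc j, k, d, p) xs \<longleftrightarrow> (\<exists>a\<in>cells T 0. \<exists>b\<in>cells T 0. \<exists>zs. Dm (hset T a b) (j, k, d, p) zs \<and> xs = inner a b zs)"

fun erd :: "nat \<times> nat \<times> nat \<times> 'u \<Rightarrow> nat" where
  "erd (0, k, d, p) = Suc d"
| "erd (Suc j, k, d, p) = Suc (rd (j, k, d, p))"

lemma map_app_edges: "map (app f) (edges d as ys) = edges d (map (gfun f 0) as) (map (gfun f (Suc d)) ys)"
  by (auto simp: edges_def)

lemma map_app_inner:
  assumes "\<And>d x. (d, x) \<in> set zs \<Longrightarrow> x \<in> cells (hset A a b) d"
  shows "map (app f) (inner a b zs) = inner (gfun f 0 a) (gfun f 0 b) (map (app (hmap A B f a b)) zs)"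
  using assms by (auto simp: inner_def)

lemma edges_eq: "length as = length as' \<Longrightarrow> edges d as ys = edges d as' ys' \<longleftrightarrow> as = as' \<and> ys = ys'"
  by (auto simp: edges_def dest: map_injective[OF _ injI])

lemma inner_eq: "inner a b zs = inner a' b' zs' \<longleftrightarrow> a = a' \<and> b = b' \<and> zs = zs'"
  by (auto simp: inner_def dest: map_injective[OF _ inj_sh])

lemma eDm_edges: "p \<in> cells (PU k) d \<Longrightarrow> set as \<subseteq> cells T 0 \<Longrightarrow> fits (hset T) d as ys \<Longrightarrow> length ys = k \<Longrightarrow>
    eDm T (0, k, d, p) (edges d as ys)"
  unfolding eDm.simps by blast

lemma eDm_inner: "a \<in> cells T 0 \<Longrightarrow> b \<in> cells T 0 \<Longrightarrow> Dm (hset T a b) (j, k, d, p) zs \<Longrightarrow>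
    eDm T (Suc j, k, d, p) (inner a b zs)"
  unfolding eDm.simps by blast

lemma eDm_map:
  assumes f: "f \<in> hom (gset_cat (Suc n)) A B" and D: "eDm A \<sigma> xs"
  shows "eDm B \<sigma> (map (app f) xs)"
proof -
  obtain j k d p where s: "\<sigma> = (j, k, d, p)" by (cases \<sigma>) auto
  show ?thesis
  proof (cases j)
    case 0
    then obtain as ys where p: "p \<in> cells (PU k) d" and as: "set as \<subseteq> cells A 0" and ys: "fits (hset A) d as ys"
      and xs: "length ys = k" "xs = edges d as ys" using D s by auto
    have "fits (hset B) d (map (gfun f 0) as) (map (gfun f (Suc d)) ys)"
      using hset_map[OF f] ys by (auto simp: along_def)
    moreover have "set (map (gfun f 0) as) \<subseteq> cells B 0" using as gfun_in[OF f] by auto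
    ultimately show ?thesis unfolding s 0 xs(2) map_app_edges using p xs(1) by (intro eDm_edges) auto
  next
    case (Suc i)
    then obtain a b zs where ab: "a \<in> cells A 0" "b \<in> cells A 0" and z: "Dm (hset A a b) (i, k, d, p) zs" "xs = inner a b zs"
      using D s by auto
    have c: "x \<in> cells (hset A a b) d" if "(d, x) \<in> set zs" for d x
      by (rule Dm_cells[OF is_gset_hset[OF gset_homD(1)[OF f]] z(1) that])
    have eq: "map (app f) xs = inner (gfun f 0 a) (gfun f 0 b) (map (app (hmap A B f a b)) zs)"
      unfolding z(2) by (rule map_app_inner[OF c])
    show ?thesis unfolding s Suc eq
      by (rule eDm_inner[OF gfun_in[OF f ab(1)] gfun_in[OF f ab(2)] Dm_map[OF hmap_hom[OF f] z(1)]])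
  qed
qed

lemma eDm_cells:
  assumes A: "is_gset (Suc n) A" and D: "eDm A \<sigma> xs" and x: "(d, x) \<in> set xs"
  shows "x \<in> cells A d"
proof -
  obtain j k d' p where s: "\<sigma> = (j, k, d', p)" by (cases \<sigma>) auto
  show ?thesis
  proof (cases j)
    case 0
    then obtain as ys where as: "set as \<subseteq> cells A 0" and ys: "fits (hset A) d' as ys"
      and xs: "xs = edges d' as ys" using D s by auto
    have "y \<in> cells A (Suc d')" if "y \<in> set ys" for y
      using alongD(3)[OF ys] that by (auto simp: in_set_conv_nth cells_hset)
    then show ?thesis using x as by (auto simp: xs edges_def)
  next
    case (Suc i)
    then obtain a b zs where ab: "a \<in> cells A 0" "b \<in> cells A 0" and z: "Dm (hset A a b) (i, k, d', p) zs" "xs = inner a b zs"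
      using D s by auto
    have c: "x \<in> cells (hset A a b) d" if "(d, x) \<in> set zs" for d x
      by (rule Dm_cells[OF is_gset_hset[OF A] z(1) that])
    then show ?thesis using x ab by (auto simp: z(2) inner_def cells_hset)
  qed
qed

lemma eDm_rd:
  assumes A: "is_gset (Suc n) A" and D: "eDm A \<sigma> xs"
  shows "erd \<sigma> \<le> Suc n"
proof -
  obtain j k d p where s: "\<sigma> = (j, k, d, p)" by (cases \<sigma>) auto
  show ?thesis
    using D s Dm_rd[OF is_gset_hset[OF A]] gset_dim[OF P_gset] by (cases j) auto
qed

text \<open>One map of the family already reveals the dimensions of the arguments and thereby the
  shape of the list. That end points match is an equation between 0-cells, which a jointly injective
  family detects. For operations of a hom, \<open>Dm_reflect\<close> is applied to the induced maps
  of homs.\<close>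

lemma eDm_reflect:
  assumes T: "is_gset (Suc n) T" and S: "S \<noteq> {}"
    and f: "\<And>f. f \<in> S \<Longrightarrow> f \<in> hom (gset_cat (Suc n)) T (gcod f)"
    and D: "\<And>f. f \<in> S \<Longrightarrow> eDm (gcod f) \<sigma> (map (app f) xs)"
    and sep: "\<And>d x y. x \<in> cells T d \<Longrightarrow> y \<in> cells T d \<Longrightarrow> (\<And>f. f \<in> S \<Longrightarrow> gfun f d x = gfun f d y) \<Longrightarrow> x = y"
    and xc: "\<And>d x. (d, x) \<in> set xs \<Longrightarrow> x \<in> cells T d"
  shows "eDm T \<sigma> xs"
proof -
  obtain j k d p where s: "\<sigma> = (j, k, d, p)" by (cases \<sigma>) auto
  obtain f0 where f0: "f0 \<in> S" using S by blast
  show ?thesis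
  proof (cases j)
    case 0
    obtain as0 ys0 where p: "p \<in> cells (PU k) d" and a0: "length as0 = Suc k" "length ys0 = k"
      "map (app f0) xs = edges d as0 ys0" using D[OF f0] s 0 alongD(1) by fastforce
    define as where "as = map snd (take (Suc k) xs)"
    define ys where "ys = map snd (drop (Suc k) xs)"
    have len: "length xs = Suc k + k" unfolding length_map[of "app f0" xs, symmetric] a0(3) using a0(1,2) by (simp add: edges_def)
    have fst: "map fst xs = map (\<lambda>_. 0) as0 @ map (\<lambda>_. Suc d) ys0"
      using arg_cong[OF a0(3), of "map fst"] by (simp add: edges_def o_def app_def split_beta)
    have "take (Suc k) xs = map (Pair 0) as"
    proof (rule nth_equalityI)
      fix i assume "i < length (take (Suc k) xs)"
      then have i: "i < Suc k" "i < length xs" using len by auto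
      have "fst (xs ! i) = 0" using arg_cong[OF fst, of "\<lambda>l. l ! i"] i a0 by (simp add: nth_append)
      then show "take (Suc k) xs ! i = map (Pair 0) as ! i" using i by (simp add: as_def prod_eq_iff)
    qed (simp add: as_def)
    moreover have "drop (Suc k) xs = map (Pair (Suc d)) ys"
    proof (rule nth_equalityI)
      fix i assume "i < length (drop (Suc k) xs)"
      then have i: "i < k" "Suc k + i < length xs" using len by auto
      have "fst (xs ! (Suc k + i)) = Suc d" using arg_cong[OF fst, of "\<lambda>l. l ! (Suc k + i)"] i a0 by (simp add: nth_append)
      then show "drop (Suc k) xs ! i = map (Pair (Suc d)) ys ! i" using i by (simp add: ys_def prod_eq_iff)
    qed (simp add: ys_def)
    ultimately have xs: "xs = edges d as ys" unfolding edges_def by (metis append_take_drop_id)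
    have la: "length as = Suc k" "length ys = k" using len by (auto simp: as_def ys_def)
    have asc: "set as \<subseteq> cells T 0" and ysc: "\<And>y. y \<in> set ys \<Longrightarrow> y \<in> cells T (Suc d)"
      using xc by (auto simp: xs edges_def)
    \<comment> \<open>A list of arguments determines its objects and its cells once the number of
      objects is known, and the symbol fixes this number to be \<open>k + 1\<close>.\<close>
    have fit: "fits (hset (gcod f)) d (map (gfun f 0) as) (map (gfun f (Suc d)) ys)" if fS: "f \<in> S" for f
    proof -
      obtain as' ys' where "fits (hset (gcod f)) d as' ys'" "length ys' = k" "edges d (map (gfun f 0) as) (map (gfun f (Suc d)) ys) = edges d as' ys'"
        using D[OF fS] s 0 unfolding xs map_app_edges by auto
      moreover have "length (map (gfun f 0) as) = length as'" using la alongD(1)[OF calculation(1)] calculation(2) by simp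
      ultimately show ?thesis by (simp add: edges_eq)
    qed
    have "fits (hset T) d as ys"
      unfolding along_def
    proof (intro conjI allI impI)
      show "length as = Suc (length ys)" using la by simp
      fix i assume i: "i < length ys"
      have y: "ys ! i \<in> cells T (Suc d)" using ysc i by simp
      have ai: "as ! i \<in> cells T 0" "as ! Suc i \<in> cells T 0" using asc la i by auto
      have *: "gfun f (Suc d) (ys ! i) \<in> cells (hset (gcod f) (gfun f 0 (as ! i)) (gfun f 0 (as ! Suc i))) d" if "f \<in> S" for f
        using alongD(3)[OF fit[OF that], of i] i la by simp
      have "bsrc T d (ys ! i) = as ! i"
        by (rule sep[OF bsrc_in[OF T y] ai(1)]) (use * gfun_bsrc[OF f y] in \<open>auto simp: cells_hset\<close>)
      moreover have "btgt T d (ys ! i) = as ! Suc i"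
        by (rule sep[OF btgt_in[OF T y] ai(2)]) (use * gfun_btgt[OF f y] in \<open>auto simp: cells_hset\<close>)
      ultimately show "ys ! i \<in> cells (hset T (as ! i) (as ! Suc i)) d" using y by (simp add: cells_hset)
    qed
    then show ?thesis unfolding s 0 xs by (rule eDm_edges[OF p asc _ la(2)])
  next
    case (Suc i)
    obtain a0 b0 zs0 where z0: "map (app f0) xs = inner a0 b0 zs0" using D[OF f0] s Suc by auto
    then obtain xa xb xr where xs1: "xs = xa # xb # xr" "app f0 xa = (0, a0)" "app f0 xb = (0, b0)" "map (app f0) xr = map sh zs0"
      unfolding inner_def by (auto simp: map_eq_Cons_conv)
    \<comment> \<open>The subtraction undoes \<open>sh\<close>: comparison with \<open>f0\<close>
      shows that all dimensions in \<open>xr\<close> are positive.\<close>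
    define a b zs where "a = snd xa" and "b = snd xb" and "zs = map (\<lambda>(d, x). (d - 1, x)) xr"
    have "fst xa = 0" "fst xb = 0" using xs1(2,3) by (auto simp: app_def split_beta)
    moreover have "xr = map sh zs"
    proof (rule nth_equalityI)
      fix i assume i: "i < length xr"
      then have "i < length zs0" using arg_cong[OF xs1(4), of length] by simp
      have "fst (app f0 (xr ! i)) = fst (sh (zs0 ! i))"
        using arg_cong[OF xs1(4), of "\<lambda>l. fst (l ! i)"] i \<open>i < length zs0\<close> by simp
      then have "fst (xr ! i) = Suc (fst (zs0 ! i))" by (simp add: app_def sh_def split_beta)
      then show "xr ! i = map sh zs ! i" using i by (simp add: zs_def sh_def split_beta prod_eq_iff)
    qed (simp add: zs_def)
    ultimately have xs: "xs = inner a b zs"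
      unfolding xs1(1) inner_def a_def b_def by (simp add: prod_eq_iff)
    have ab: "a \<in> cells T 0" "b \<in> cells T 0"
      using xc[of 0 a] xc[of 0 b] by (simp_all add: xs inner_def)
    have zc: "x \<in> cells T (Suc d)" if "(d, x) \<in> set zs" for d x
      using xc[of "Suc d" x] imageI[OF that, of sh] by (simp add: xs inner_def)
    have Df: "Dm (hset (gcod f) (gfun f 0 a) (gfun f 0 b)) (i, k, d, p) (map (\<lambda>(d, x). (d, gfun f (Suc d) x)) zs)" if "f \<in> S" for f
    proof -
      have "map (app f) xs = inner (gfun f 0 a) (gfun f 0 b) (map (\<lambda>(d, x). (d, gfun f (Suc d) x)) zs)"
        by (auto simp: xs inner_def)
      then show ?thesis using D[OF that] s Suc by (auto simp: inner_eq)
    qed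
    have zh: "x \<in> cells (hset T a b) d" if "(d, x) \<in> set zs" for d x
    proof -
      note y = zc[OF that]
      have *: "gfun f (Suc d) x \<in> cells (hset (gcod f) (gfun f 0 a) (gfun f 0 b)) d" if fS: "f \<in> S" for f
        using Dm_cells[OF is_gset_hset[OF gset_homD(2)[OF f[OF fS]]] Df[OF fS], of d "gfun f (Suc d) x"]
          imageI[OF \<open>(d, x) \<in> set zs\<close>, of "\<lambda>(d, x). (d, gfun f (Suc d) x)"] by simp
      have "bsrc T d x = a"
        by (rule sep[OF bsrc_in[OF T y] ab(1)]) (use * gfun_bsrc[OF f y] in \<open>auto simp: cells_hset\<close>)
      moreover have "btgt T d x = b"
        by (rule sep[OF btgt_in[OF T y] ab(2)]) (use * gfun_btgt[OF f y] in \<open>auto simp: cells_hset\<close>)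
      ultimately show ?thesis using y by (simp add: cells_hset)
    qed
    have "Dm (hset T a b) (i, k, d, p) zs"
    proof (rule Dm_reflect[OF is_gset_hset[OF T], of "(\<lambda>f. hmap T (gcod f) f a b) ` S"])
      show "(\<lambda>f. hmap T (gcod f) f a b) ` S \<noteq> {}" using S by simp
      fix g assume "g \<in> (\<lambda>f. hmap T (gcod f) f a b) ` S"
      then obtain f' where g: "f' \<in> S" "g = hmap T (gcod f') f' a b" by blast
      note hh = hmap_hom[OF f[OF g(1)], of a b]
      show "g \<in> hom (gset_cat n) (hset T a b) (gcod g)" using hh gset_homD(4)[OF hh] g by simp
      have eq: "map (app g) zs = map (\<lambda>(d, x). (d, gfun f' (Suc d) x)) zs" using zh by (auto simp: g(2))
      show "Dm (gcod g) (i, k, d, p) (map (app g) zs)"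
        unfolding eq using Df[OF g(1)] gset_homD(4)[OF hh] g(2) by simp
    next
      fix d x y assume x: "x \<in> cells (hset T a b) d" and y: "y \<in> cells (hset T a b) d"
        and eq: "\<And>g. g \<in> (\<lambda>f. hmap T (gcod f) f a b) ` S \<Longrightarrow> gfun g d x = gfun g d y"
      show "x = y"
      proof (rule sep)
        show "x \<in> cells T (Suc d)" "y \<in> cells T (Suc d)" using x y by (auto simp: cells_hset)
        fix f assume "f \<in> S"
        then show "gfun f (Suc d) x = gfun f (Suc d) y" using eq[of "hmap T (gcod f) f a b"] x y by simp
      qed
    qed (rule zh)
    then show ?thesis unfolding s Suc xs by (rule eDm_inner[OF ab])
  qed
qed


text \<open>Homs of different pairs of objects may share elements of \<open>'u\<close>. The tag
  keeps their cells apart and records where a cell starts and ends.\<close>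

definition enc :: "'u \<Rightarrow> 'u \<Rightarrow> 'u \<Rightarrow> 'u" where "enc a b x = enl [a, b, x]"

definition third :: "'u \<Rightarrow> 'u" where "third z = inv enl z ! 2"

lemma enc_eq [simp]: "enc a b x = enc a' b' x' \<longleftrightarrow> a = a' \<and> b = b' \<and> x = x'"
  by (simp add: enc_def)

lemma inv_enc [simp]: "inv enl (enc a b x) = [a, b, x]" "third (enc a b x) = x"
  by (simp_all add: enc_def third_def numeral_2_eq_2)

text \<open>The cells of positive dimension of an enriched category are those of its homs, tagged with the two objects.\<close>

definition acells :: "('u, 'o, 'm) vpcat \<Rightarrow> nat \<Rightarrow> 'u set" where
  "acells A m = (case m of 0 \<Rightarrow> gobjs (ugraph A) |
     Suc d \<Rightarrow> {enc a b x |a b x. a \<in> gobjs (ugraph A) \<and> b \<in> gobjs (ugraph A) \<and> x \<in> cells (gH A a b) d})"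

text \<open>The passage from enriched graphs to globular sets. Its inverse is \<open>hset\<close>,
  up to the isomorphisms \<open>kap\<close> and \<open>kap'\<close> that add and remove
  tags.\<close>

definition asmb :: "('u, 'o, 'm) vpcat \<Rightarrow> 'u gset" where
  "asmb A = GSet (acells A)
    (\<lambda>m. \<lambda>z\<in>acells A (Suc m). case m of 0 \<Rightarrow> inv enl z ! 0 | Suc d \<Rightarrow>
       enc (inv enl z ! 0) (inv enl z ! 1) (gsrc (gH A (inv enl z ! 0) (inv enl z ! 1)) d (third z)))
    (\<lambda>m. \<lambda>z\<in>acells A (Suc m). case m of 0 \<Rightarrow> inv enl z ! 1 | Suc d \<Rightarrow>
       enc (inv enl z ! 0) (inv enl z ! 1) (gtgt (gH A (inv enl z ! 0) (inv enl z ! 1)) d (third z)))"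

lemma cells_asmb: "cells (asmb A) 0 = gobjs (ugraph A)"
  "z \<in> cells (asmb A) (Suc d) \<longleftrightarrow> (\<exists>a b x. z = enc a b x \<and> a \<in> gobjs (ugraph A) \<and> b \<in> gobjs (ugraph A) \<and> x \<in> cells (gH A a b) d)"
  by (auto simp: asmb_def acells_def)

lemma asmb_st:
  assumes "a \<in> gobjs (ugraph A)" "b \<in> gobjs (ugraph A)"
  shows "x \<in> cells (gH A a b) 0 \<Longrightarrow> gsrc (asmb A) 0 (enc a b x) = a"
    "x \<in> cells (gH A a b) 0 \<Longrightarrow> gtgt (asmb A) 0 (enc a b x) = b"
    "x \<in> cells (gH A a b) (Suc d) \<Longrightarrow> gsrc (asmb A) (Suc d) (enc a b x) = enc a b (gsrc (gH A a b) d x)"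
    "x \<in> cells (gH A a b) (Suc d) \<Longrightarrow> gtgt (asmb A) (Suc d) (enc a b x) = enc a b (gtgt (gH A a b) d x)"
  using assms by (auto simp: asmb_def acells_def)

lemma gset_gH: "pre A \<Longrightarrow> a \<in> gobjs (ugraph A) \<Longrightarrow> b \<in> gobjs (ugraph A) \<Longrightarrow> is_gset n (gH A a b)"
  by (rule gset_U[OF ghom_Obj])

lemma is_gset_asmb:
  assumes A: "pre A"
  shows "is_gset (Suc n) (asmb A)"
proof (rule is_gsetI)
  fix m x assume x: "x \<in> cells (asmb A) m"
  show "m \<le> Suc n"
  proof (cases m)
    case (Suc d)
    then show ?thesis using x gset_dim[OF gset_gH[OF A]] by (fastforce simp: cells_asmb)
  qed simp
next
  fix m x assume x: "x \<in> cells (asmb A) (Suc m)"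
  then obtain a b y where y: "x = enc a b y" "a \<in> gobjs (ugraph A)" "b \<in> gobjs (ugraph A)" "y \<in> cells (gH A a b) m"
    by (auto simp: cells_asmb)
  show "gsrc (asmb A) m x \<in> cells (asmb A) m" "gtgt (asmb A) m x \<in> cells (asmb A) m"
    using y gset_in[OF gset_gH[OF A]] by (cases m; auto simp: asmb_st cells_asmb)+
next
  fix m x assume x: "x \<in> cells (asmb A) (Suc (Suc m))"
  then obtain a b y where y: "x = enc a b y" "a \<in> gobjs (ugraph A)" "b \<in> gobjs (ugraph A)" "y \<in> cells (gH A a b) (Suc m)"
    by (auto simp: cells_asmb)
  show "gsrc (asmb A) m (gsrc (asmb A) (Suc m) x) = gsrc (asmb A) m (gtgt (asmb A) (Suc m) x)"
    "gtgt (asmb A) m (gsrc (asmb A) (Suc m) x) = gtgt (asmb A) m (gtgt (asmb A) (Suc m) x)"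
    using y gset_in[OF gset_gH[OF A y(2,3)]] gset_globular[OF gset_gH[OF A y(2,3)]] by (cases m; simp add: asmb_st)+
qed (simp_all add: asmb_def)

lemma bsrc_enc:
  assumes A: "pre A" and ab: "a \<in> gobjs (ugraph A)" "b \<in> gobjs (ugraph A)"
  shows "x \<in> cells (gH A a b) m \<Longrightarrow> bsrc (asmb A) m (enc a b x) = a"
    "x \<in> cells (gH A a b) m \<Longrightarrow> btgt (asmb A) m (enc a b x) = b"
  by (induction m arbitrary: x) (auto simp: asmb_st ab gset_in[OF gset_gH[OF A ab]])

lemma hset_asmb:
  assumes A: "pre A" and ab: "a \<in> gobjs (ugraph A)" "b \<in> gobjs (ugraph A)"
  shows "z \<in> cells (hset (asmb A) a b) d \<longleftrightarrow> (\<exists>x\<in>cells (gH A a b) d. z = enc a b x)"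
  using ab bsrc_enc[OF A] by (auto simp: cells_hset cells_asmb)

definition kap :: "('u, 'o, 'm) vpcat \<Rightarrow> 'u \<Rightarrow> 'u \<Rightarrow> 'u gmap" where
  "kap A a b = mk_gmap (gH A a b) (hset (asmb A) a b) (\<lambda>d x. enc a b x)"

definition kap' :: "('u, 'o, 'm) vpcat \<Rightarrow> 'u \<Rightarrow> 'u \<Rightarrow> 'u gmap" where
  "kap' A a b = mk_gmap (hset (asmb A) a b) (gH A a b) (\<lambda>d. third)"

lemma kap:
  assumes A: "pre A" and ab: "a \<in> gobjs (ugraph A)" "b \<in> gobjs (ugraph A)"
  shows "kap A a b \<in> hom (gset_cat n) (gH A a b) (hset (asmb A) a b)"
    "kap' A a b \<in> hom (gset_cat n) (hset (asmb A) a b) (gH A a b)"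
proof -
  note g = gset_gH[OF A ab] and h = is_gset_hset[OF is_gset_asmb[OF A], of a b]
  note hs = hset_asmb[OF A ab]
  show "kap A a b \<in> hom (gset_cat n) (gH A a b) (hset (asmb A) a b)"
    unfolding kap_def
  proof (rule mk_gmap[OF g h])
    fix m x assume x: "x \<in> cells (gH A a b) (Suc m)"
    then have "enc a b x \<in> cells (hset (asmb A) a b) (Suc m)" using hs by auto
    then show "gsrc (hset (asmb A) a b) m (enc a b x) = enc a b (gsrc (gH A a b) m x)"
      "gtgt (hset (asmb A) a b) m (enc a b x) = enc a b (gtgt (gH A a b) m x)"
      using x by (simp_all add: hset_st asmb_st ab)
  qed (use hs in auto)
  show "kap' A a b \<in> hom (gset_cat n) (hset (asmb A) a b) (gH A a b)"
    unfolding kap'_def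
  proof (rule mk_gmap[OF h g])
    fix m z assume z: "z \<in> cells (hset (asmb A) a b) (Suc m)"
    then obtain x where "x \<in> cells (gH A a b) (Suc m)" "z = enc a b x" using hs by auto
    then show "gsrc (gH A a b) m (third z) = third (gsrc (hset (asmb A) a b) m z)"
      "gtgt (gH A a b) m (third z) = third (gtgt (hset (asmb A) a b) m z)"
      using z by (simp_all add: hset_st asmb_st ab)
  qed (use hs in auto)
qed

lemma gfun_kap [simp]: "x \<in> cells (gH A a b) d \<Longrightarrow> gfun (kap A a b) d x = enc a b x"
  "z \<in> cells (hset (asmb A) a b) d \<Longrightarrow> gfun (kap' A a b) d z = third z"
  by (simp_all add: kap_def kap'_def)

text \<open>Arguments are read off by position. In the first clause there are \<open>k + 1\<close>
  objects, so entry \<open>k\<close> is the last one and the cells follow it. In the second clause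
  \<open>d - 1\<close> undoes \<open>sh\<close>; in both, \<open>third\<close> removes tags.\<close>

fun eev :: "('u, 'o, 'm) vpcat \<Rightarrow> nat \<times> nat \<times> nat \<times> 'u \<Rightarrow> (nat \<times> 'u) list \<Rightarrow> 'u" where
  "eev A (0, k, d, p) xs = enc (snd (hd xs)) (snd (xs ! k))
     (gam A (map snd (take (Suc k) xs)) d p (map (third \<circ> snd) (drop (Suc k) xs)))"
| "eev A (Suc j, k, d, p) xs = enc (snd (xs ! 0)) (snd (xs ! 1))
     (ev (ghom (ugraph A) (snd (xs ! 0)) (snd (xs ! 1))) (j, k, d, p) (map (\<lambda>(d, x). (d - 1, third x)) (drop 2 xs)))"

lemma map_third_enc: "map third (medge enc as zs) = zs"
  by (auto simp: medge_def intro: nth_equalityI)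

lemma eev_edges:
  assumes "length as = Suc (length zs)"
  shows "eev A (0, length zs, d, p) (edges d as (medge enc as zs)) = enc (hd as) (last as) (gam A as d p zs)"
proof -
  have ne: "as \<noteq> []" using assms by auto
  have t: "take (Suc (length zs)) (edges d as ys) = map (Pair 0) as" "drop (Suc (length zs)) (edges d as ys) = map (Pair (Suc d)) ys" for ys
    using assms by (simp_all add: edges_def)
  have "snd (hd (edges d as ys)) = hd as" for ys using ne by (simp add: edges_def hd_map)
  moreover have "snd (edges d as ys ! length zs) = last as" for ys
    using assms ne by (simp add: edges_def nth_append last_conv_nth)
  moreover have "map (third \<circ> snd) (map (Pair (Suc d)) (medge enc as zs)) = zs"
    using map_third_enc[of as zs] by (simp add: o_def)
  ultimately show ?thesis by (simp add: t o_def del: map_map) (simp add: o_def)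
qed

lemma eev_inner:
  "eev A (Suc j, k, d, p) (inner a b (map (\<lambda>(d, x). (d, enc a b x)) zs)) = enc a b (ev (ghom (ugraph A) a b) (j, k, d, p) zs)"
proof -
  have "map (\<lambda>(d, x). (d - 1, third x)) (map sh (map (\<lambda>(d, x). (d, enc a b x)) zs)) = zs"
    by (auto intro!: map_idI)
  then show ?thesis by (simp add: inner_def numeral_2_eq_2 del: map_map)
qed

definition up :: "nat \<times> nat \<times> nat \<times> 'u \<Rightarrow> nat \<times> nat \<times> nat \<times> 'u" where
  "up \<sigma> = (Suc (fst \<sigma>), snd \<sigma>)"

lemma erd_up [simp]: "erd (up \<sigma>) = Suc (rd \<sigma>)"
  by (cases \<sigma>) (simp add: up_def)

lemma eDm_up: "eDm T (up \<sigma>) xs \<longleftrightarrow> (\<exists>a\<in>cells T 0. \<exists>b\<in>cells T 0. \<exists>zs. Dm (hset T a b) \<sigma> zs \<and> xs = inner a b zs)"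
  by (cases \<sigma>) (simp add: up_def)

lemma eev_up: "eev A (up \<sigma>) (inner a b (map (\<lambda>(d, x). (d, enc a b x)) zs)) = enc a b (ev (ghom (ugraph A) a b) \<sigma> zs)"
  by (cases \<sigma>) (simp only: up_def fst_conv snd_conv eev_inner)

lemma eDm_cases [consumes 1, case_names edges inner]:
  assumes "eDm T \<sigma> xs"
  obtains k d p as ys where "\<sigma> = (0, k, d, p)" "p \<in> cells (PU k) d" "set as \<subseteq> cells T 0" "fits (hset T) d as ys"
      "length ys = k" "xs = edges d as ys"
  | a b \<tau> zs where "\<sigma> = up \<tau>" "a \<in> cells T 0" "b \<in> cells T 0" "Dm (hset T a b) \<tau> zs" "xs = inner a b zs"
proof -
  obtain j k d p where s: "\<sigma> = (j, k, d, p)" by (cases \<sigma>) auto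
  show ?thesis
  proof (cases j)
    case 0
    then show ?thesis using assms s that(1) by auto
  next
    case (Suc i)
    then have "\<sigma> = up (i, k, d, p)" using s by (simp add: up_def)
    then show ?thesis using assms that(2) eDm_up by metis
  qed
qed

lemma hset_enc_args:
  assumes A: "pre A" and ab: "a \<in> gobjs (ugraph A)" "b \<in> gobjs (ugraph A)" and D: "Dm (hset (asmb A) a b) \<sigma> zs"
  shows "Dm (gH A a b) \<sigma> (map (app (kap' A a b)) zs)"
    "zs = map (\<lambda>(d, x). (d, enc a b x)) (map (app (kap' A a b)) zs)"
proof -
  show "Dm (gH A a b) \<sigma> (map (app (kap' A a b)) zs)" by (rule Dm_map[OF kap(2)[OF A ab] D])
  have "enc a b (gfun (kap' A a b) d z) = z" if "(d, z) \<in> set zs" for d z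
    using Dm_cells[OF is_gset_hset[OF is_gset_asmb[OF A]] D that] hset_asmb[OF A ab] by auto
  then show "zs = map (\<lambda>(d, x). (d, enc a b x)) (map (app (kap' A a b)) zs)"
    by (auto intro!: map_idI[symmetric])
qed

lemma fits_enc:
  assumes A: "pre A" and as: "set as \<subseteq> gobjs (ugraph A)" and ys: "fits (hset (asmb A)) d as ys"
  shows "fits (gH A) d as (map third ys)" "ys = medge enc as (map third ys)"
proof -
  have y: "\<exists>x\<in>cells (gH A (as ! i) (as ! Suc i)) d. ys ! i = enc (as ! i) (as ! Suc i) x" if "i < length ys" for i
    using alongD(3)[OF ys that] along_nth_in[OF ys that] as hset_asmb[OF A, of "as ! i" "as ! Suc i"] by blast
  show "fits (gH A) d as (map third ys)" unfolding along_def using alongD(1)[OF ys] y by force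
  show "ys = medge enc as (map third ys)"
    by (rule nth_equalityI) (use y in force)+
qed

text \<open>Over an assembled category all arguments carry tags; this form exposes the untagged
  string or list, on which \<open>eev_edges\<close> and \<open>eev_up\<close> compute.\<close>

lemma eDm_asmb_cases [consumes 2, case_names edges inner]:
  assumes A: "pre A" and D: "eDm (asmb A) \<sigma> xs"
  obtains k d p as zs where "\<sigma> = (0, k, d, p)" "p \<in> cells (PU k) d" "set as \<subseteq> gobjs (ugraph A)" "fits (gH A) d as zs"
      "length zs = k" "xs = edges d as (medge enc as zs)"
  | a b \<tau> zs where "\<sigma> = up \<tau>" "a \<in> gobjs (ugraph A)" "b \<in> gobjs (ugraph A)" "Dm (gH A a b) \<tau> zs"
      "xs = inner a b (map (\<lambda>(d, x). (d, enc a b x)) zs)"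
  using D
proof (cases rule: eDm_cases)
  case (edges k d p as ys)
  note as = edges(3)[unfolded cells_asmb]
  note F = fits_enc[OF A as edges(4)]
  show ?thesis by (rule that(1)[OF edges(1,2) as F(1)]) (use edges F(2) in auto)
next
  case (inner a b \<tau> zs)
  note ab = inner(2,3)[unfolded cells_asmb]
  note F = hset_enc_args[OF A ab inner(4)]
  show ?thesis by (rule that(2)[OF inner(1) ab F(1)]) (use inner(5) F(2) in metis)
qed

lemma eev_cells:
  assumes A: "pre A" and D: "eDm (asmb A) \<sigma> xs"
  shows "eev A \<sigma> xs \<in> cells (asmb A) (erd \<sigma>)"
  using A D
proof (cases rule: eDm_asmb_cases)
  case (edges k d p as zs)
  have e: "hd as \<in> gobjs (ugraph A)" "last as \<in> gobjs (ugraph A)" using along_ends[OF edges(4)] edges(3) by auto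
  have p: "p \<in> cells (PU (length zs)) d" using edges by simp
  have "eev A \<sigma> xs = enc (hd as) (last as) (gam A as d p zs)"
    unfolding edges(1,6) edges(5)[symmetric] by (rule eev_edges[OF alongD(1)[OF edges(4)]])
  then show ?thesis using gam_in[OF A edges(3,4) p] e edges(1) by (auto simp: cells_asmb)
next
  case (inner a b \<tau> zs)
  show ?thesis unfolding inner(5,1) eev_up using ev_cells[OF ghom_Obj[OF A inner(2,3)] inner(4)] inner(2,3)
    by (auto simp: cells_asmb)
qed

definition eU :: "(('u, 'o, 'm) vpcat, ('u, 'o, 'm) vpmap, 'u gset, 'u gmap) ftor" where
  "eU = \<lparr>Fobj = asmb, Farr = (\<lambda>F. mk_gmap (asmb (vdom F)) (asmb (vcod F)) (\<lambda>m z. case m of 0 \<Rightarrow> vfun F z |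
     Suc d \<Rightarrow> enc (vfun F (inv enl z ! 0)) (vfun F (inv enl z ! 1))
       (act (vhom F (inv enl z ! 0) (inv enl z ! 1)) d (third z))))\<rparr>"

lemma eU_obj [simp]: "Fobj eU = asmb"
  by (simp add: eU_def)

lemma eU_arr:
  "a \<in> gobjs (ugraph (vdom F)) \<Longrightarrow> gfun (Farr eU F) 0 a = vfun F a"
  "a \<in> gobjs (ugraph (vdom F)) \<Longrightarrow> b \<in> gobjs (ugraph (vdom F)) \<Longrightarrow> x \<in> cells (gH (vdom F) a b) d \<Longrightarrow>
    gfun (Farr eU F) (Suc d) (enc a b x) = enc (vfun F a) (vfun F b) (act (vhom F a b) d x)"
proof -
  show "gfun (Farr eU F) 0 a = vfun F a" if "a \<in> gobjs (ugraph (vdom F))"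
    using that by (simp add: eU_def cells_asmb)
  assume "a \<in> gobjs (ugraph (vdom F))" "b \<in> gobjs (ugraph (vdom F))" "x \<in> cells (gH (vdom F) a b) d"
  then have "enc a b x \<in> cells (asmb (vdom F)) (Suc d)" by (auto simp: cells_asmb)
  then show "gfun (Farr eU F) (Suc d) (enc a b x) = enc (vfun F a) (vfun F b) (act (vhom F a b) d x)"
    by (simp add: eU_def)
qed

lemma vp_homD:
  assumes "F \<in> hom (vp_cat V P) A B"
  shows "vdom F = A" "vcod F = B" "is_vpcat V P A" "is_vpcat V P B" "pre A" "pre B"
    "is_vgraph_map V (ugraph A) (ugraph B) (vfun F) (vhom F)" "hom_law F" "is_vpmap V P F"
  using assms by (auto simp: hom_vp_cat is_vpmap_iff vpcat_pre)

lemma eU_hom: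
  assumes F: "F \<in> hom (vp_cat V P) A B"
  shows "Farr eU F \<in> hom (gset_cat (Suc n)) (asmb A) (asmb B)"
proof -
  note D = vp_homD[OF F] and m = vgraph_mapD[OF vp_homD(7)[OF F]]
  define h where "h = (\<lambda>m z. case m of 0 \<Rightarrow> vfun F z |
     Suc d \<Rightarrow> enc (vfun F (inv enl z ! 0)) (vfun F (inv enl z ! 1))
       (act (vhom F (inv enl z ! 0) (inv enl z ! 1)) d (third z)))"
  have eq: "Farr eU F = mk_gmap (asmb A) (asmb B) h" using D(1,2) by (simp add: eU_def h_def)
  have h: "h 0 a = vfun F a" "h (Suc d) (enc a b x) = enc (vfun F a) (vfun F b) (act (vhom F a b) d x)" for a b x d
    by (simp_all add: h_def)
  show ?thesis unfolding eq
  proof (rule mk_gmap[OF is_gset_asmb[OF D(5)] is_gset_asmb[OF D(6)]])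
    fix k x assume x: "x \<in> cells (asmb A) k"
    show "h k x \<in> cells (asmb B) k"
    proof (cases k)
      case 0
      then show ?thesis using x m(1) by (simp add: cells_asmb h)
    next
      case (Suc d)
      then obtain a b y where "x = enc a b y" "a \<in> gobjs (ugraph A)" "b \<in> gobjs (ugraph A)" "y \<in> cells (gH A a b) d"
        using x by (auto simp: cells_asmb)
      then show ?thesis using m(1) act_in[OF m(2)] by (auto simp: Suc cells_asmb h)
    qed
  next
    fix k x assume x: "x \<in> cells (asmb A) (Suc k)"
    then obtain a b y where y: "x = enc a b y" and ab: "a \<in> gobjs (ugraph A)" "b \<in> gobjs (ugraph A)" and yc: "y \<in> cells (gH A a b) k"
      by (auto simp: cells_asmb)
    note fa = m(1)[OF ab(1)] m(1)[OF ab(2)] and ya = act_in[OF m(2)[OF ab] yc]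
    show "gsrc (asmb B) k (h (Suc k) x) = h k (gsrc (asmb A) k x)"
    proof (cases k)
      case 0
      then show ?thesis using yc ya ab fa by (simp add: y h asmb_st)
    next
      case (Suc d)
      then show ?thesis using yc ya ab fa gfun_src[OF U_hom[OF m(2)[OF ab]]] by (simp add: y h asmb_st)
    qed
    show "gtgt (asmb B) k (h (Suc k) x) = h k (gtgt (asmb A) k x)"
    proof (cases k)
      case 0
      then show ?thesis using yc ya ab fa by (simp add: y h asmb_st)
    next
      case (Suc d)
      then show ?thesis using yc ya ab fa gfun_tgt[OF U_hom[OF m(2)[OF ab]]] by (simp add: y h asmb_st)
    qed
  qed
qed

lemma asmb_gmap_eqI:
  assumes f: "f \<in> hom (gset_cat (Suc n)) (asmb A) T" and g: "g \<in> hom (gset_cat (Suc n)) (asmb A) T"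
    and "\<And>a. a \<in> gobjs (ugraph A) \<Longrightarrow> gfun f 0 a = gfun g 0 a"
    and "\<And>a b x d. a \<in> gobjs (ugraph A) \<Longrightarrow> b \<in> gobjs (ugraph A) \<Longrightarrow> x \<in> cells (gH A a b) d \<Longrightarrow>
      gfun f (Suc d) (enc a b x) = gfun g (Suc d) (enc a b x)"
  shows "f = g"
proof (rule gmap_eqI[OF f g])
  fix m x assume "x \<in> cells (asmb A) m"
  then show "gfun f m x = gfun g m x" using assms(3,4) by (cases m) (auto simp: cells_asmb)
qed

lemma eU_functor: "functor (vp_cat V P) (gset_cat (Suc n)) eU"
  unfolding functor_def
proof (intro conjI ballI allI impI)
  show "category (vp_cat V P :: (('u, 'o, 'm) vpcat, ('u, 'o, 'm) vpmap) cat)" by (rule category_vp_cat)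
  show "category (gset_cat (Suc n) :: ('u gset, 'u gmap) cat)" by (rule category_gset_cat)
next
  fix A :: "('u, 'o, 'm) vpcat" assume "A \<in> Obj (vp_cat V P)"
  then have A: "is_vpcat V P A" by (simp add: vp_cat_def)
  note p = vpcat_pre[OF A]
  show "Fobj eU A \<in> Obj (gset_cat (Suc n))" using is_gset_asmb[OF p] by simp
  have id: "Ident (vp_cat V P) A \<in> hom (vp_cat V P) A A"
    by (rule ident_hom[OF category_vp_cat]) (simp add: vp_cat_def A)
  have "Farr eU (Ident (vp_cat V P) A) = Ident (gset_cat (Suc n)) (asmb A)"
  proof (rule asmb_gmap_eqI[OF eU_hom[OF id] gset_ident_hom[OF is_gset_asmb[OF p]]])
    note d = vp_homD(1,2)[OF id]
    fix a assume a: "a \<in> gobjs (ugraph A)"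
    then show "gfun (Farr eU (Ident (vp_cat V P) A)) 0 a = gfun (Ident (gset_cat (Suc n)) (asmb A)) 0 a"
      using eU_arr(1)[of a "Ident (vp_cat V P) A"] by (simp add: d cells_asmb) (simp add: vp_cat_def)
    fix b x d assume b: "b \<in> gobjs (ugraph A)" and x: "x \<in> cells (gH A a b) d"
    have c: "enc a b x \<in> cells (asmb A) (Suc d)" using a b x by (auto simp: cells_asmb)
    show "gfun (Farr eU (Ident (vp_cat V P) A)) (Suc d) (enc a b x) = gfun (Ident (gset_cat (Suc n)) (asmb A)) (Suc d) (enc a b x)"
      using eU_arr(2)[of a "Ident (vp_cat V P) A" b x d] a b x c
      by (simp add: vp_homD(1,2)[OF id]) (simp add: vp_cat_def functor_ident[OF U ghom_Obj[OF p]])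
  qed
  then show "Farr eU (Ident (vp_cat V P) A) = Ident (gset_cat (Suc n)) (Fobj eU A)" by simp
next
  fix A B D :: "('u, 'o, 'm) vpcat" and F G assume "F \<in> hom (vp_cat V P) A B \<and> G \<in> hom (vp_cat V P) B D"
  then have F: "F \<in> hom (vp_cat V P) A B" and G: "G \<in> hom (vp_cat V P) B D" by auto
  note GF = comp_hom[OF category_vp_cat F G]
  note uF = eU_hom[OF F] and uG = eU_hom[OF G] and uGF = eU_hom[OF GF]
  note dF = vp_homD[OF F] and dG = vp_homD[OF G] and dGF = vp_homD[OF GF]
  note mF = vgraph_mapD[OF dF(7)] and mG = vgraph_mapD[OF dG(7)]
  show "Farr eU (Comp (vp_cat V P) G F) = Comp (gset_cat (Suc n)) (Farr eU G) (Farr eU F)"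
  proof (rule asmb_gmap_eqI[OF uGF gset_comp_hom[OF uF uG]])
    fix a assume a: "a \<in> gobjs (ugraph A)"
    show "gfun (Farr eU (Comp (vp_cat V P) G F)) 0 a = gfun (Comp (gset_cat (Suc n)) (Farr eU G) (Farr eU F)) 0 a"
      using eU_arr(1)[of a "Comp (vp_cat V P) G F"] eU_arr(1)[of a F] eU_arr(1)[of "vfun F a" G] a mF(1)[OF a]
      by (simp add: dF dG dGF gfun_comp[OF uF] cells_asmb) (simp add: vp_cat_def dF)
    fix b x d assume b: "b \<in> gobjs (ugraph A)" and x: "x \<in> cells (gH A a b) d"
    have c: "enc a b x \<in> cells (asmb A) (Suc d)" using a b x by (auto simp: cells_asmb)
    show "gfun (Farr eU (Comp (vp_cat V P) G F)) (Suc d) (enc a b x) =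
      gfun (Comp (gset_cat (Suc n)) (Farr eU G) (Farr eU F)) (Suc d) (enc a b x)"
      using eU_arr(2)[of a "Comp (vp_cat V P) G F" b x d] eU_arr(2)[of a F b x d]
        eU_arr(2)[of "vfun F a" G "vfun F b" "act (vhom F a b) d x" d] a b x c mF(1)[OF a] mF(1)[OF b] act_in[OF mF(2)[OF a b] x]
        act_comp[OF mF(2)[OF a b] mG(2)[OF mF(1)[OF a] mF(1)[OF b]] x]
      by (simp add: dF dG dGF gfun_comp[OF uF]) (simp add: vp_cat_def dF)
  qed
qed (use eU_hom in simp)


section \<open>Reading the data of the laws off a structure\<close>

definition ih :: "(nat \<times> nat \<times> nat \<times> 'u \<Rightarrow> (nat \<times> 'u) list \<Rightarrow> 'u) \<Rightarrow> 'u \<Rightarrow> 'u \<Rightarrow>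
    nat \<times> nat \<times> nat \<times> 'u \<Rightarrow> (nat \<times> 'u) list \<Rightarrow> 'u" where
  "ih e a b \<sigma> zs = e (up \<sigma>) (inner a b zs)"

definition ig :: "(nat \<times> nat \<times> nat \<times> 'u \<Rightarrow> (nat \<times> 'u) list \<Rightarrow> 'u) \<Rightarrow> 'u list \<Rightarrow> nat \<Rightarrow> 'u \<Rightarrow> 'u list \<Rightarrow> 'u" where
  "ig e as d p ys = e (0, length ys, d, p) (edges d as ys)"

lemma phom_edges:
  assumes "phom (Suc n) eDm erd T e B e' f" "eDm T (0, k, d, p) xs"
  shows "gfun f (Suc d) (e (0, k, d, p) xs) = e' (0, k, d, p) (map (app f) xs)"
  using assms unfolding phom_def by (metis erd.simps(1))

lemma fits_medge_enc:
  assumes A: "pre A" and as: "set as \<subseteq> gobjs (ugraph A)" and zs: "fits (gH A) d as zs"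
  shows "fits (hset (asmb A)) d as (medge enc as zs)"
  by (rule along_medge_id[OF zs]) (use as hset_asmb[OF A] in blast)

text \<open>The symbols with first component 0 express compatibility with composition. The other
  ones express that the component on each hom preserves the operations, which it does as an arrow of
  \<open>V\<close>.\<close>

lemma phom_eU:
  assumes F: "F \<in> hom (vp_cat V P) A B"
  shows "phom (Suc n) eDm erd (asmb A) (eev A) (asmb B) (eev B) (Farr eU F)"
  unfolding phom_def
proof (intro conjI allI impI eU_hom[OF F])
  note D = vp_homD[OF F] and m = vgraph_mapD[OF vp_homD(7)[OF F]]
  fix \<sigma> xs assume Dx: "eDm (asmb A) \<sigma> xs"
  from D(5) Dx show "gfun (Farr eU F) (erd \<sigma>) (eev A \<sigma> xs) = eev B \<sigma> (map (app (Farr eU F)) xs)"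
  proof (cases rule: eDm_asmb_cases)
    case (edges k d p as zs)
    note as = edges(3) and zs = edges(4)
    have e: "hd as \<in> gobjs (ugraph A)" "last as \<in> gobjs (ugraph A)" using along_ends[OF zs] as by auto
    have ne: "as \<noteq> []" using alongD(2)[OF zs] .
    have p: "p \<in> cells (PU (length zs)) d" using edges by simp
    let ?ws = "medge (\<lambda>a b. act (vhom F a b) d) as zs"
    have 1: "map (gfun (Farr eU F) 0) as = map (vfun F) as" using as eU_arr(1)[of _ F] D(1) by auto
    have 2: "map (gfun (Farr eU F) (Suc d)) (medge enc as zs) = medge enc (map (vfun F) as) ?ws"
      unfolding map_medge medge_map_medge[OF alongD(1)[OF zs]]
      by (rule medge_cong[OF zs]) (rule eU_arr(2)[of _ F, unfolded D(1), OF subsetD[OF as] subsetD[OF as]])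
    have "gfun (Farr eU F) (Suc d) (enc (hd as) (last as) (gam A as d p zs)) =
      enc (vfun F (hd as)) (vfun F (last as)) (act (vhom F (hd as) (last as)) d (gam A as d p zs))"
      using eU_arr(2)[of "hd as" F "last as"] e gam_in[OF D(5) as zs p] D(1) by simp
    also have "act (vhom F (hd as) (last as)) d (gam A as d p zs) = gam B (map (vfun F) as) d p ?ws"
      using D(8) as zs p unfolding hom_law_def D(1,2) by blast
    finally show ?thesis
      using eev_edges[OF alongD(1)[OF zs], of A d p] eev_edges[of "map (vfun F) as" ?ws B d p] alongD(1)[OF zs] ne edges(5)
      by (simp add: edges(1,6) map_app_edges 1 2 hd_map last_map)
  next
    case (inner a b \<tau> zs)
    note ab = inner(2,3)
    have 1: "map (app (Farr eU F)) xs = inner (vfun F a) (vfun F b)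
        (map (\<lambda>(d, x). (d, enc (vfun F a) (vfun F b) x)) (map (app (Farr U (vhom F a b))) zs))"
    proof -
      have "gfun (Farr eU F) (Suc d) (enc a b x) = enc (vfun F a) (vfun F b) (act (vhom F a b) d x)" if "(d, x) \<in> set zs" for d x
        using eU_arr(2)[of a F b x d] ab D(1) Dm_cells[OF gset_gH[OF D(5) ab] inner(4) that] by simp
      then show ?thesis using eU_arr(1)[of _ F] ab D(1) by (auto simp: inner(5) inner_def)
    qed
    show ?thesis unfolding 1 inner(1) eev_up unfolding inner(5) eev_up
      using eU_arr(2)[of a F b] ab D(1) ev_cells[OF ghom_Obj[OF D(5) ab] inner(4)] act_ev[OF m(2)[OF ab] inner(4)] by simp
  qed
qed

lemma eU_faithful:
  assumes F: "F \<in> hom (vp_cat V P) A B" and G: "G \<in> hom (vp_cat V P) A B" and eq: "Farr eU F = Farr eU G"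
  shows "F = G"
proof (rule vpmap_eqI[OF vp_homD(9)[OF F] vp_homD(9)[OF G]])
  note DF = vp_homD[OF F] and DG = vp_homD[OF G]
  show "vdom F = vdom G" "vcod F = vcod G" using DF DG by auto
  show v: "vfun F a = vfun G a" if "a \<in> gobjs (ugraph (vdom F))" for a
    using eU_arr(1)[of a F] eU_arr(1)[of a G] that eq DF DG by simp
  fix a b assume "a \<in> gobjs (ugraph (vdom F))" "b \<in> gobjs (ugraph (vdom F))"
  then have ab: "a \<in> gobjs (ugraph A)" "b \<in> gobjs (ugraph A)" using DF by auto
  have g: "vhom G a b \<in> hom V (ghom (ugraph A) a b) (ghom (ugraph B) (vfun F a) (vfun F b))"
    using vgraph_mapD(2)[OF DG(7) ab] v ab DF(1) by simp
  show "vhom F a b = vhom G a b"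
    by (rule arr_eqI[OF vgraph_mapD(2)[OF DF(7) ab] g])
      (use eU_arr(2)[of a F b] eU_arr(2)[of a G b] ab eq DF(1) DG(1) in simp)
qed

lemma ih_eev:
  assumes A: "pre A" and ab: "a \<in> gobjs (ugraph A)" "b \<in> gobjs (ugraph A)" and D: "Dm (hset (asmb A) a b) \<sigma> zs"
  shows "ih (eev A) a b \<sigma> zs \<in> cells (hset (asmb A) a b) (rd \<sigma>)"
proof -
  note F = hset_enc_args[OF A ab D]
  have "ih (eev A) a b \<sigma> zs = enc a b (ev (ghom (ugraph A) a b) \<sigma> (map (app (kap' A a b)) zs))"
    unfolding ih_def by (subst F(2)) (rule eev_up)
  then show ?thesis using ev_cells[OF ghom_Obj[OF A ab] F(1)] hset_asmb[OF A ab] by auto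
qed

lemma phom_kap:
  assumes A: "pre A" and ab: "a \<in> gobjs (ugraph A)" "b \<in> gobjs (ugraph A)"
  shows "phom n Dm rd (gH A a b) (ev (ghom (ugraph A) a b)) (hset (asmb A) a b) (ih (eev A) a b) (kap A a b)"
    "phom n Dm rd (hset (asmb A) a b) (ih (eev A) a b) (gH A a b) (ev (ghom (ugraph A) a b)) (kap' A a b)"
proof -
  note k = kap[OF A ab] and ec = ev_cells[OF ghom_Obj[OF A ab]]
  show 1: "phom n Dm rd (gH A a b) (ev (ghom (ugraph A) a b)) (hset (asmb A) a b) (ih (eev A) a b) (kap A a b)"
    unfolding phom_def
  proof (intro conjI allI impI k(1))
    fix \<sigma> zs assume D: "Dm (gH A a b) \<sigma> zs"
    have eq: "map (app (kap A a b)) zs = map (\<lambda>(d, x). (d, enc a b x)) zs"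
      using Dm_cells[OF gset_gH[OF A ab] D] by auto
    show "gfun (kap A a b) (rd \<sigma>) (ev (ghom (ugraph A) a b) \<sigma> zs) = ih (eev A) a b \<sigma> (map (app (kap A a b)) zs)"
      unfolding eq ih_def eev_up using ec[OF D] by simp
  qed
  show "phom n Dm rd (hset (asmb A) a b) (ih (eev A) a b) (gH A a b) (ev (ghom (ugraph A) a b)) (kap' A a b)"
    by (rule phom_inverse[OF 1 k(2) _ _ ec]) (use hset_asmb[OF A ab] in auto)
qed

lemma phom_hmap:
  assumes f: "phom (Suc n) eDm erd T e B e' f" and ab: "a \<in> cells T 0" "b \<in> cells T 0"
    and t: "\<And>\<sigma> zs. Dm (hset T a b) \<sigma> zs \<Longrightarrow> ih e a b \<sigma> zs \<in> cells (hset T a b) (rd \<sigma>)"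
  shows "phom n Dm rd (hset T a b) (ih e a b) (hset B (gfun f 0 a) (gfun f 0 b)) (ih e' (gfun f 0 a) (gfun f 0 b)) (hmap T B f a b)"
proof -
  have fh: "f \<in> hom (gset_cat (Suc n)) T B" using f by (simp add: phom_def)
  show ?thesis unfolding phom_def
  proof (intro conjI allI impI hmap_hom[OF fh])
    fix \<sigma> zs assume D: "Dm (hset T a b) \<sigma> zs"
    have D': "eDm T (up \<sigma>) (inner a b zs)" using ab D eDm_up by blast
    have eq: "map (app f) (inner a b zs) = inner (gfun f 0 a) (gfun f 0 b) (map (app (hmap T B f a b)) zs)"
      by (rule map_app_inner) (rule Dm_cells[OF is_gset_hset[OF gset_homD(1)[OF fh]] D])
    have "gfun f (erd (up \<sigma>)) (e (up \<sigma>) (inner a b zs)) = e' (up \<sigma>) (map (app f) (inner a b zs))"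
      using f D' unfolding phom_def by blast
    then show "gfun (hmap T B f a b) (rd \<sigma>) (ih e a b \<sigma> zs) = ih e' (gfun f 0 a) (gfun f 0 b) \<sigma> (map (app (hmap T B f a b)) zs)"
      unfolding eq gfun_hmap[OF t[OF D]] by (simp add: ih_def)
  qed
qed

text \<open>The map of homs induced by \<open>f\<close>, with the tags of the target removed.
  \<open>henc\<close> is its counterpart for maps out of an assembled category.\<close>

definition hdec :: "'u gset \<Rightarrow> ('u, 'o, 'm) vpcat \<Rightarrow> 'u gmap \<Rightarrow> 'u \<Rightarrow> 'u \<Rightarrow> 'u gmap" where
  "hdec T A f a b = Comp (gset_cat n) (kap' A (gfun f 0 a) (gfun f 0 b)) (hmap T (asmb A) f a b)"

definition henc :: "('u, 'o, 'm) vpcat \<Rightarrow> 'u gset \<Rightarrow> 'u gmap \<Rightarrow> 'u \<Rightarrow> 'u \<Rightarrow> 'u gmap" where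
  "henc A T f a b = Comp (gset_cat n) (hmap (asmb A) T f a b) (kap A a b)"

lemma hdec:
  assumes A: "pre A" and f: "f \<in> hom (gset_cat (Suc n)) T (asmb A)" and ab: "a \<in> cells T 0" "b \<in> cells T 0"
  shows "hdec T A f a b \<in> hom (gset_cat n) (hset T a b) (gH A (gfun f 0 a) (gfun f 0 b))"
    "x \<in> cells (hset T a b) d \<Longrightarrow> gfun f (Suc d) x = enc (gfun f 0 a) (gfun f 0 b) (gfun (hdec T A f a b) d x)"
proof -
  have o: "gfun f 0 a \<in> gobjs (ugraph A)" "gfun f 0 b \<in> gobjs (ugraph A)"
    using gfun_in[OF f ab(1)] gfun_in[OF f ab(2)] by (auto simp: cells_asmb)
  show "hdec T A f a b \<in> hom (gset_cat n) (hset T a b) (gH A (gfun f 0 a) (gfun f 0 b))"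
    unfolding hdec_def by (rule gset_comp_hom[OF hmap_hom[OF f] kap(2)[OF A o]])
  assume x: "x \<in> cells (hset T a b) d"
  have "gfun f (Suc d) x \<in> cells (hset (asmb A) (gfun f 0 a) (gfun f 0 b)) d" by (rule hset_map[OF f x])
  then show "gfun f (Suc d) x = enc (gfun f 0 a) (gfun f 0 b) (gfun (hdec T A f a b) d x)"
    using x hset_asmb[OF A o] by (auto simp: hdec_def gfun_comp[OF hmap_hom[OF f]])
qed

lemma henc:
  assumes A: "pre A" and f: "f \<in> hom (gset_cat (Suc n)) (asmb A) T" and ab: "a \<in> gobjs (ugraph A)" "b \<in> gobjs (ugraph A)"
  shows "henc A T f a b \<in> hom (gset_cat n) (gH A a b) (hset T (gfun f 0 a) (gfun f 0 b))"
    "x \<in> cells (gH A a b) d \<Longrightarrow> gfun (henc A T f a b) d x = gfun f (Suc d) (enc a b x)"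
proof -
  show "henc A T f a b \<in> hom (gset_cat n) (gH A a b) (hset T (gfun f 0 a) (gfun f 0 b))"
    unfolding henc_def by (rule gset_comp_hom[OF kap(1)[OF A ab] hmap_hom[OF f]])
  assume x: "x \<in> cells (gH A a b) d"
  then show "gfun (henc A T f a b) d x = gfun f (Suc d) (enc a b x)"
    using hset_asmb[OF A ab] by (auto simp: henc_def gfun_comp[OF kap(1)[OF A ab]])
qed

text \<open>Homomorphisms of structures into an enriched category take the form used in
  \<open>laws_sub\<close>; \<open>ihom_henc\<close> does this for homomorphisms out of one, as used
  in \<open>laws_quot\<close>.\<close>

lemma ihom_hdec:
  assumes A: "pre A" and f: "phom (Suc n) eDm erd T e (asmb A) (eev A) f"
    and t: "typed_law (cells T 0) (hset T) (ih e) (ig e)"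
  shows "ihom (cells T 0) (hset T) (ih e) (ig e) (gobjs (ugraph A)) (gH A) (\<lambda>a b. ev (ghom (ugraph A) a b)) (gam A)
    (gfun f 0) (hdec T A f)"
proof -
  have fh: "f \<in> hom (gset_cat (Suc n)) T (asmb A)" using f by (simp add: phom_def)
  have o: "gfun f 0 a \<in> gobjs (ugraph A)" if "a \<in> cells T 0" for a
    using gfun_in[OF fh that] by (simp add: cells_asmb)
  show ?thesis
    unfolding ihom_def
  proof (intro conjI ballI allI impI)
    show "gfun f 0 ` cells T 0 \<subseteq> gobjs (ugraph A)" using o by blast
    fix a b assume ab: "a \<in> cells T 0" "b \<in> cells T 0"
    show "phom n Dm rd (hset T a b) (ih e a b) (gH A (gfun f 0 a) (gfun f 0 b)) (ev (ghom (ugraph A) (gfun f 0 a) (gfun f 0 b))) (hdec T A f a b)"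
      unfolding hdec_def
      by (rule phom_comp[OF phom_hmap[OF f ab typed_lawD(2)[OF t ab]] phom_kap(2)[OF A o[OF ab(1)] o[OF ab(2)]] typed_lawD(2)[OF t ab]])
  next
    fix d as p ys assume "set as \<subseteq> cells T 0 \<and> fits (hset T) d as ys \<and> p \<in> cells (PU (length ys)) d"
    then have as: "set as \<subseteq> cells T 0" and ys: "fits (hset T) d as ys" and p: "p \<in> cells (PU (length ys)) d" by auto
    have e: "hd as \<in> cells T 0" "last as \<in> cells T 0" using along_ends[OF ys] as by auto
    have ne: "as \<noteq> []" using alongD(2)[OF ys] .
    let ?ws = "medge (\<lambda>a b. gfun (hdec T A f a b) d) as ys"
    have 1: "map (gfun f (Suc d)) ys = medge enc (map (gfun f 0) as) ?ws"
    proof -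
      have "map (gfun f (Suc d)) ys = medge (\<lambda>a b y. gfun f (Suc d) y) as ys" by (auto simp: medge_def intro: nth_equalityI)
      also have "\<dots> = medge enc (map (gfun f 0) as) ?ws"
        unfolding medge_map_medge[OF alongD(1)[OF ys]]
        by (rule medge_cong[OF ys]) (rule hdec(2)[OF A fh subsetD[OF as] subsetD[OF as]])
      finally show ?thesis .
    qed
    have "gfun f (Suc d) (ig e as d p ys) = eev A (0, length ys, d, p) (map (app f) (edges d as ys))"
      unfolding ig_def by (rule phom_edges[OF f eDm_edges[OF p as ys refl]])
    also have "\<dots> = enc (gfun f 0 (hd as)) (gfun f 0 (last as)) (gam A (map (gfun f 0) as) d p ?ws)"
      using eev_edges[of "map (gfun f 0) as" ?ws A d p] alongD(1)[OF ys] ne by (simp add: map_app_edges 1 hd_map last_map)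
    finally show "gfun (hdec T A f (hd as) (last as)) d (ig e as d p ys) = gam A (map (gfun f 0) as) d p ?ws"
      using hdec(2)[OF A fh e typed_lawD(3)[OF t as ys p]] by simp
  qed
qed

lemma ihom_henc:
  assumes A: "pre A" and f: "phom (Suc n) eDm erd (asmb A) (eev A) T e f"
  shows "ihom (gobjs (ugraph A)) (gH A) (\<lambda>a b. ev (ghom (ugraph A) a b)) (gam A) (cells T 0) (hset T) (ih e) (ig e)
    (gfun f 0) (henc A T f)"
proof -
  have fh: "f \<in> hom (gset_cat (Suc n)) (asmb A) T" using f by (simp add: phom_def)
  show ?thesis
    unfolding ihom_def
  proof (intro conjI ballI allI impI)
    show "gfun f 0 ` gobjs (ugraph A) \<subseteq> cells T 0" using gfun_in[OF fh] by (force simp: cells_asmb)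
    fix a b assume ab: "a \<in> gobjs (ugraph A)" "b \<in> gobjs (ugraph A)"
    have ab': "a \<in> cells (asmb A) 0" "b \<in> cells (asmb A) 0" using ab by (simp_all add: cells_asmb)
    show "phom n Dm rd (gH A a b) (ev (ghom (ugraph A) a b)) (hset T (gfun f 0 a) (gfun f 0 b)) (ih e (gfun f 0 a) (gfun f 0 b)) (henc A T f a b)"
      unfolding henc_def
      by (rule phom_comp[OF phom_kap(1)[OF A ab] phom_hmap[OF f ab' ih_eev[OF A ab]] ev_cells[OF ghom_Obj[OF A ab]]])
  next
    fix d as p ys assume "set as \<subseteq> gobjs (ugraph A) \<and> fits (gH A) d as ys \<and> p \<in> cells (PU (length ys)) d"
    then have as: "set as \<subseteq> gobjs (ugraph A)" and ys: "fits (gH A) d as ys" and p: "p \<in> cells (PU (length ys)) d" by auto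
    have e: "hd as \<in> gobjs (ugraph A)" "last as \<in> gobjs (ugraph A)" using along_ends[OF ys] as by auto
    have as': "set as \<subseteq> cells (asmb A) 0" using as by (simp add: cells_asmb)
    have p': "p \<in> cells (PU (length (medge enc as ys))) d" using p by simp
    have 1: "map (gfun f (Suc d)) (medge enc as ys) = medge (\<lambda>a b. gfun (henc A T f a b) d) as ys"
      unfolding map_medge by (rule medge_cong[OF ys]) (rule henc(2)[OF A fh subsetD[OF as] subsetD[OF as], symmetric])
    have "gfun (henc A T f (hd as) (last as)) d (gam A as d p ys) = gfun f (Suc d) (enc (hd as) (last as) (gam A as d p ys))"
      by (rule henc(2)[OF A fh e gam_in[OF A as ys p]])
    also have "\<dots> = gfun f (Suc d) (eev A (0, length ys, d, p) (edges d as (medge enc as ys)))"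
      unfolding eev_edges[OF alongD(1)[OF ys]] ..
    also have "\<dots> = e (0, length ys, d, p) (map (app f) (edges d as (medge enc as ys)))"
      using phom_edges[OF f eDm_edges[OF p' as' fits_medge_enc[OF A as ys] refl]] by simp
    finally show "gfun (henc A T f (hd as) (last as)) d (gam A as d p ys) =
      ig e (map (gfun f 0) as) d p (medge (\<lambda>a b. gfun (henc A T f a b) d) as ys)"
      by (simp add: map_app_edges 1 ig_def)
  qed
qed

text \<open>By the symbols with positive first component each \<open>\<psi> a b\<close> is a
  homomorphism between structures of objects of \<open>V\<close>, so it lifts by
  \<open>lift_arr\<close>. The symbols with first component 0 then give compatibility with
  composition.\<close>

lemma lift_vp:
  assumes A: "is_vpcat V P A" and B: "is_vpcat V P B" and f: "phom (Suc n) eDm erd (asmb A) (eev A) (asmb B) (eev B) f"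
  shows "\<exists>F\<in>hom (vp_cat V P) A B. Farr eU F = f"
proof -
  note pA = vpcat_pre[OF A] and pB = vpcat_pre[OF B]
  have fh: "f \<in> hom (gset_cat (Suc n)) (asmb A) (asmb B)" using f by (simp add: phom_def)
  note I = ihom_henc[OF pA f]
  let ?F = "gfun f 0"
  have o: "?F a \<in> gobjs (ugraph B)" if "a \<in> gobjs (ugraph A)" for a
    using ihomD(1)[OF I that] by (simp add: cells_asmb)
  define \<psi> where "\<psi> a b = Comp (gset_cat n) (kap' B (?F a) (?F b)) (henc A (asmb B) f a b)" for a b
  have \<psi>: "phom n Dm rd (gH A a b) (ev (ghom (ugraph A) a b)) (gH B (?F a) (?F b)) (ev (ghom (ugraph B) (?F a) (?F b))) (\<psi> a b)"
    if ab: "a \<in> gobjs (ugraph A)" "b \<in> gobjs (ugraph A)" for a b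
    unfolding \<psi>_def by (rule phom_comp[OF ihomD(2)[OF I ab] phom_kap(2)[OF pB o[OF ab(1)] o[OF ab(2)]] ev_cells[OF ghom_Obj[OF pA ab]]])
  have enc\<psi>: "gfun (henc A (asmb B) f a b) d x = enc (?F a) (?F b) (gfun (\<psi> a b) d x)"
    if ab: "a \<in> gobjs (ugraph A)" "b \<in> gobjs (ugraph A)" and x: "x \<in> cells (gH A a b) d" for a b d x
  proof -
    have "gfun (henc A (asmb B) f a b) d x \<in> cells (hset (asmb B) (?F a) (?F b)) d"
      by (rule gfun_in[OF ihomD(3)[OF I ab] x])
    then show ?thesis using hset_asmb[OF pB o[OF ab(1)] o[OF ab(2)]] by (auto simp: \<psi>_def gfun_comp[OF ihomD(3)[OF I ab] x])
  qed
  have "\<forall>a b. \<exists>v. a \<in> gobjs (ugraph A) \<and> b \<in> gobjs (ugraph A) \<longrightarrow>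
      v \<in> hom V (ghom (ugraph A) a b) (ghom (ugraph B) (?F a) (?F b)) \<and> Farr U v = \<psi> a b"
    using lift_arr[OF ghom_Obj[OF pA] ghom_Obj[OF pB] \<psi>] o by meson
  then obtain vh where vh: "\<And>a b. a \<in> gobjs (ugraph A) \<Longrightarrow> b \<in> gobjs (ugraph A) \<Longrightarrow>
      vh a b \<in> hom V (ghom (ugraph A) a b) (ghom (ugraph B) (?F a) (?F b))"
    "\<And>a b. a \<in> gobjs (ugraph A) \<Longrightarrow> b \<in> gobjs (ugraph A) \<Longrightarrow> Farr U (vh a b) = \<psi> a b" by metis
  define G where "G = VPMap A B (\<lambda>a\<in>gobjs (ugraph A). ?F a)
    (\<lambda>a b. if a \<in> gobjs (ugraph A) \<and> b \<in> gobjs (ugraph A) then vh a b else undefined)"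
  have G: "vdom G = A" "vcod G = B" "\<And>a. a \<in> gobjs (ugraph A) \<Longrightarrow> vfun G a = ?F a"
    "\<And>a b. a \<in> gobjs (ugraph A) \<Longrightarrow> b \<in> gobjs (ugraph A) \<Longrightarrow> vhom G a b = vh a b"
    by (simp_all add: G_def)
  have gm: "is_vgraph_map V (ugraph A) (ugraph B) (vfun G) (vhom G)"
    unfolding is_vgraph_map_def using o vh(1) by (auto simp: G_def)
  have "hom_law G"
    unfolding hom_law_def G(1,2)
  proof (intro allI impI, elim conjE)
    fix d as p ys assume as: "set as \<subseteq> gobjs (ugraph A)" and ys: "fits (gH A) d as ys" and p: "p \<in> cells (PU (length ys)) d"
    have e: "hd as \<in> gobjs (ugraph A)" "last as \<in> gobjs (ugraph A)" using along_ends[OF ys] as by auto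
    have ne: "as \<noteq> []" using alongD(2)[OF ys] .
    let ?ws = "medge (\<lambda>a b. gfun (\<psi> a b) d) as ys"
    have 1: "medge (\<lambda>a b. gfun (henc A (asmb B) f a b) d) as ys = medge enc (map ?F as) ?ws"
      unfolding medge_map_medge[OF alongD(1)[OF ys]]
      by (rule medge_cong[OF ys]) (rule enc\<psi>[OF subsetD[OF as] subsetD[OF as]])
    have "enc (?F (hd as)) (?F (last as)) (gfun (\<psi> (hd as) (last as)) d (gam A as d p ys)) =
      ig (eev B) (map ?F as) d p (medge (\<lambda>a b. gfun (henc A (asmb B) f a b) d) as ys)"
      using ihomD(5)[OF I as ys p] enc\<psi>[OF e gam_in[OF pA as ys p]] by simp
    also have "\<dots> = enc (?F (hd as)) (?F (last as)) (gam B (map ?F as) d p ?ws)"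
      unfolding 1 using eev_edges[of "map ?F as" ?ws B d p] alongD(1)[OF ys] ne by (simp add: ig_def hd_map last_map)
    finally have "gfun (\<psi> (hd as) (last as)) d (gam A as d p ys) = gam B (map ?F as) d p ?ws" by simp
    moreover have "map (vfun G) as = map ?F as" using as G(3) by auto
    moreover have "medge (\<lambda>a b. act (vhom G a b) d) as ys = ?ws"
      by (rule medge_cong[OF ys]) (use as G(4) vh(2) in \<open>metis subsetD\<close>)
    ultimately show "act (vhom G (hd as) (last as)) d (gam A as d p ys) =
      gam B (map (vfun G) as) d p (medge (\<lambda>a b. act (vhom G a b) d) as ys)"
      unfolding G(4)[OF e] vh(2)[OF e] by (simp only:)
  qed
  then have Gh: "G \<in> hom (vp_cat V P) A B" unfolding hom_vp_cat is_vpmap_iff using A B gm G by simp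
  have "Farr eU G = f"
  proof (rule asmb_gmap_eqI[OF eU_hom[OF Gh] fh])
    fix a assume a: "a \<in> gobjs (ugraph A)"
    then show "gfun (Farr eU G) 0 a = gfun f 0 a" using eU_arr(1)[of a G] G by simp
    fix b x d assume b: "b \<in> gobjs (ugraph A)" and x: "x \<in> cells (gH A a b) d"
    show "gfun (Farr eU G) (Suc d) (enc a b x) = gfun f (Suc d) (enc a b x)"
      using eU_arr(2)[of a G b x d] G a b x vh(2) enc\<psi>[OF a b x] henc(2)[OF pA fh a b x] by simp
  qed
  with Gh show ?thesis by blast
qed

text \<open>A globular set with operations that satisfy the laws, and whose homs underlie objects of \<open>V\<close>, underlies
  an enriched category: by the interchange law, its compositions lift to arrows of \<open>V\<close>.\<close>

lemma rep_build:
  assumes T: "is_gset (Suc n) T" and L: "laws (cells T 0) (hset T) (ih e) (ig e)"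
    and R: "\<And>a b. a \<in> cells T 0 \<Longrightarrow> b \<in> cells T 0 \<Longrightarrow> rep n V U Dm rd ev (hset T a b) (ih e a b)"
  shows "rep (Suc n) (vp_cat V P) eU eDm erd eev T e"
proof -
  let ?O = "cells T 0" and ?H = "hset T"
  have t: "typed_law ?O ?H (ih e) (ig e)" and st: "st_law ?O ?H (ig e)" and il: "inter_law ?O ?H (ih e) (ig e)"
    using L by (auto simp: laws_def)
  \<comment> \<open>Collected in one relation, so that the objects and isomorphisms can be chosen
    for all pairs at once.\<close>
  define R where "R a b N \<theta> \<theta>' \<longleftrightarrow> (a \<in> ?O \<and> b \<in> ?O \<longrightarrow> N \<in> Obj V \<and>
    phom n Dm rd (?H a b) (ih e a b) (Fobj U N) (ev N) \<theta> \<and> phom n Dm rd (Fobj U N) (ev N) (?H a b) (ih e a b) \<theta>' \<and>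
    (\<forall>m. \<forall>x\<in>cells (?H a b) m. gfun \<theta>' m (gfun \<theta> m x) = x) \<and> (\<forall>m. \<forall>y\<in>cells (Fobj U N) m. gfun \<theta> m (gfun \<theta>' m y) = y))"
    for a b N \<theta> \<theta>'
  have "\<exists>N \<theta> \<theta>'. R a b N \<theta> \<theta>'" for a b
  proof (cases "a \<in> ?O \<and> b \<in> ?O")
    case True
    then obtain N \<theta> \<theta>' where "N \<in> Obj V" "phom n Dm rd (?H a b) (ih e a b) (Fobj U N) (ev N) \<theta>"
      "phom n Dm rd (Fobj U N) (ev N) (?H a b) (ih e a b) \<theta>'"
      "\<And>m x. x \<in> cells (?H a b) m \<Longrightarrow> gfun \<theta>' m (gfun \<theta> m x) = x"
      "\<And>m y. y \<in> cells (Fobj U N) m \<Longrightarrow> gfun \<theta> m (gfun \<theta>' m y) = y"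
      using rep_iso[OF R typed_lawD(2)[OF t], of a b] by blast
    then have "R a b N \<theta> \<theta>'" unfolding R_def by blast
    then show ?thesis by blast
  qed (unfold R_def, blast)
  then obtain N \<theta> \<theta>' where "\<And>a b. R a b (N a b) (\<theta> a b) (\<theta>' a b)" by metis
  then have NO: "\<And>a b. a \<in> ?O \<Longrightarrow> b \<in> ?O \<Longrightarrow> N a b \<in> Obj V"
    and tp: "\<And>a b. a \<in> ?O \<Longrightarrow> b \<in> ?O \<Longrightarrow> phom n Dm rd (?H a b) (ih e a b) (Fobj U (N a b)) (ev (N a b)) (\<theta> a b)"
    and tp': "\<And>a b. a \<in> ?O \<Longrightarrow> b \<in> ?O \<Longrightarrow> phom n Dm rd (Fobj U (N a b)) (ev (N a b)) (?H a b) (ih e a b) (\<theta>' a b)"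
    and ti: "\<And>a b m x. a \<in> ?O \<Longrightarrow> b \<in> ?O \<Longrightarrow> x \<in> cells (?H a b) m \<Longrightarrow> gfun (\<theta>' a b) m (gfun (\<theta> a b) m x) = x"
    and ti': "\<And>a b m y. a \<in> ?O \<Longrightarrow> b \<in> ?O \<Longrightarrow> y \<in> cel (N a b) m \<Longrightarrow> gfun (\<theta> a b) m (gfun (\<theta>' a b) m y) = y"
    unfolding R_def by blast+
  have th: "\<theta> a b \<in> hom (gset_cat n) (?H a b) (Fobj U (N a b))" "\<theta>' a b \<in> hom (gset_cat n) (Fobj U (N a b)) (?H a b)"
    if "a \<in> ?O" "b \<in> ?O" for a b using tp[OF that] tp'[OF that] by (auto simp: phom_def)
  define B where "B = VGraph ?O (\<lambda>a b. if a \<in> ?O \<and> b \<in> ?O then N a b else undefined)"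
  have B: "gobjs B = ?O" "\<And>a b. a \<in> ?O \<Longrightarrow> b \<in> ?O \<Longrightarrow> ghom B a b = N a b" by (simp_all add: B_def)
  have vB: "is_vgraph V B" using NO by (simp add: is_vgraph_def B_def)
  define Xs where "Xs as = ops P (length as - 1) # rev (steps B as)" for as
  \<comment> \<open>The arrow \<open>v\<close> shall serve as the action over \<open>as\<close>: on
    cells it is the composition of \<open>T\<close>, transported along the isomorphisms of the
    homs.\<close>
  define S where "S as v \<longleftrightarrow> v \<in> hom V (Prod V (Xs as)) (N (hd as) (last as)) \<and>
      (\<forall>d ys p. fits (\<lambda>a b. Fobj U (N a b)) d as ys \<and> p \<in> cells (PU (length ys)) d \<longrightarrow>
      act v d (tup (Xs as) d (p # rev ys)) = gfun (\<theta> (hd as) (last as)) d (ig e as d p (medge (\<lambda>a b. gfun (\<theta>' a b) d) as ys)))"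
    for as v
  have "\<exists>v. S as v" if str: "as \<in> strings B" for as
  proof -
    have as: "set as \<subseteq> ?O" and ne: "as \<noteq> []" using str by (auto simp: strings_def B)
    have e: "hd as \<in> ?O" "last as \<in> ?O" using ne as by auto
    define k where "k = length as - 1"
    have lk: "length as = Suc k" using ne by (cases as) (auto simp: k_def)
    have ai: "as ! i \<in> ?O" "as ! Suc i \<in> ?O" if "i < k" for i using as lk that by auto
    have lX: "length (Xs as) = Suc k" using lk by (simp add: Xs_def)
    have X: "Xs as ! 0 = ops P k" "\<And>i. i < k \<Longrightarrow> Xs as ! (k - i) = N (as ! i) (as ! Suc i)"
      using lk ai by (auto simp: Xs_def nth_Cons' rev_nth steps_def B)
    have XO: "set (Xs as) \<subseteq> Obj V"
    proof -
      have "ghom B (as ! i) (as ! Suc i) \<in> Obj V" if "i < length as - 1" for i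
        using B(2) NO ai[of i] that lk by simp
      then show ?thesis using P_Obj by (auto simp: Xs_def steps_def)
    qed
    let ?Q = "Prod V (Xs as)"
    have Q: "?Q \<in> Obj V" by (rule Prod_Obj[OF XO])
    note gQ = gset_U[OF Q]
    define pr where "pr i = projs V (Xs as) ! i" for i
    have pr0: "pr 0 \<in> hom V ?Q (ops P k)" using ccone_nth[OF XO, of 0] X(1) lX by (simp add: pr_def)
    have "pr (k - i) \<in> hom V ?Q (N (as ! i) (as ! Suc i))" if "i < k" for i
      using ccone_nth[OF XO, of "k - i"] X(2)[OF that] lX by (simp add: pr_def)
    note pr = pr0 this
    \<comment> \<open>The generic string: the projections of the product, carried over to the homs
      of \<open>T\<close>. Edge \<open>i\<close> is found at projection \<open>k - i\<close>,
      because the homs stand in reverse order behind \<open>P(k)\<close>.\<close>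
    define \<chi>s where "\<chi>s = map (\<lambda>i. Comp (gset_cat n) (\<theta>' (as ! i) (as ! Suc i)) (Farr U (pr (k - i)))) [0..<k]"
    let ?\<pi> = "Farr U (pr 0)"
    have l\<chi>: "length \<chi>s = k" by (simp add: \<chi>s_def)
    have al: "along (\<lambda>a b \<chi>. \<chi> \<in> hom (gset_cat n) (Fobj U ?Q) (?H a b)) as \<chi>s"
      unfolding along_def using lk gset_comp_hom[OF U_hom[OF pr(2)] th(2)[OF ai]] by (simp add: \<chi>s_def)
    have pi: "?\<pi> \<in> hom (gset_cat n) (Fobj U ?Q) (PU (length \<chi>s))" using U_hom[OF pr(1)] l\<chi> by simp
    define g where "g = mk_gmap (Fobj U ?Q) (?H (hd as) (last as)) (\<lambda>d z. ig e as d (gfun ?\<pi> d z) (map (\<lambda>\<chi>. gfun \<chi> d z) \<chi>s))"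
    have g: "g \<in> hom (gset_cat n) (Fobj U ?Q) (?H (hd as) (last as))"
      unfolding g_def by (rule comp_gmap[OF t st as al gQ pi])
    \<comment> \<open>The interchange law for this generic string, with \<open>Z\<close> the product
      itself, says that the composition preserves the operations.\<close>
    have "phom n Dm rd (Fobj U ?Q) (ev ?Q) (?H (hd as) (last as)) (ih e (hd as) (last as)) g"
      unfolding phom_def
    proof (intro conjI allI impI g)
      fix \<sigma> zs assume D: "Dm (Fobj U ?Q) \<sigma> zs"
      have 1: "map (app g) zs = map (\<lambda>(d, z). (d, ig e as d (gfun ?\<pi> d z) (map (\<lambda>\<chi>. gfun \<chi> d z) \<chi>s))) zs"
        using Dm_cells[OF gQ D] by (auto simp: g_def)
      have 2: "medge (\<lambda>a b \<chi>. ih e a b \<sigma> (map (app \<chi>) zs)) as \<chi>s = map (\<lambda>\<chi>. gfun \<chi> (rd \<sigma>) (ev ?Q \<sigma> zs)) \<chi>s"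
      proof (rule nth_equalityI)
        fix i assume "i < length (medge (\<lambda>a b \<chi>. ih e a b \<sigma> (map (app \<chi>) zs)) as \<chi>s)"
        then have i: "i < k" using l\<chi> by simp
        have "phom n Dm rd (Fobj U ?Q) (ev ?Q) (?H (as ! i) (as ! Suc i)) (ih e (as ! i) (as ! Suc i)) (\<chi>s ! i)"
          using phom_comp[OF phom_arr[OF pr(2)[OF i]] tp'[OF ai[OF i]] ev_cells[OF Q]] i by (simp add: \<chi>s_def)
        then have "gfun (\<chi>s ! i) (rd \<sigma>) (ev ?Q \<sigma> zs) = ih e (as ! i) (as ! Suc i) \<sigma> (map (app (\<chi>s ! i)) zs)"
          using D unfolding phom_def by blast
        then show "medge (\<lambda>a b \<chi>. ih e a b \<sigma> (map (app \<chi>) zs)) as \<chi>s ! i = map (\<lambda>\<chi>. gfun \<chi> (rd \<sigma>) (ev ?Q \<sigma> zs)) \<chi>s ! i"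
          using i l\<chi> by simp
      qed simp
      have "ih e (hd as) (last as) \<sigma> (map (app g) zs) = ig e as (rd \<sigma>) (ev (ops P (length \<chi>s)) \<sigma> (map (app ?\<pi>) zs))
          (medge (\<lambda>a b \<chi>. ih e a b \<sigma> (map (app \<chi>) zs)) as \<chi>s)"
        unfolding 1 by (rule inter_lawD[OF il as al gQ pi D])
      also have "ev (ops P (length \<chi>s)) \<sigma> (map (app ?\<pi>) zs) = gfun ?\<pi> (rd \<sigma>) (ev ?Q \<sigma> zs)"
        using act_ev[OF pr(1) D] l\<chi> by simp
      finally show "gfun g (rd \<sigma>) (ev ?Q \<sigma> zs) = ih e (hd as) (last as) \<sigma> (map (app g) zs)"
        using ev_cells[OF Q D] by (simp add: g_def 2)
    qed
    from lift_arr[OF Q NO[OF e] phom_comp[OF this tp[OF e] ev_cells[OF Q]]]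
    obtain v where v: "v \<in> hom V ?Q (N (hd as) (last as))" "Farr U v = Comp (gset_cat n) (\<theta> (hd as) (last as)) g" by blast
    have "act v d (tup (Xs as) d (p # rev ys)) = gfun (\<theta> (hd as) (last as)) d (ig e as d p (medge (\<lambda>a b. gfun (\<theta>' a b) d) as ys))"
      if ys: "fits (\<lambda>a b. Fobj U (N a b)) d as ys" and p: "p \<in> cells (PU (length ys)) d" for d ys p
    proof -
      have ly: "length ys = k" using alongD(1)[OF ys] lk by simp
      have d: "d \<le> n" by (rule gset_dim[OF P_gset p])
      have la: "list_all2 (\<lambda>y X. y \<in> cel X d) (p # rev ys) (Xs as)"
      proof -
        have "along (\<lambda>a b y. y \<in> cel (ghom B a b) d) as ys"
          using alongD(3)[OF ys] ai ly lk B(2) by (simp add: along_def)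
        then show ?thesis using list_all2_steps[OF ne, of "\<lambda>y X. y \<in> cel X d" ys B] p lk ly by (simp add: Xs_def)
      qed
      note tc = tup(1)[OF XO d la]
      have 1: "gfun ?\<pi> d (tup (Xs as) d (p # rev ys)) = p"
        using tup_nth[OF XO d la, of 0] lX by (simp add: pr_def)
      have 2: "map (\<lambda>\<chi>. gfun \<chi> d (tup (Xs as) d (p # rev ys))) \<chi>s = medge (\<lambda>a b. gfun (\<theta>' a b) d) as ys"
      proof (rule nth_equalityI)
        fix i assume "i < length (map (\<lambda>\<chi>. gfun \<chi> d (tup (Xs as) d (p # rev ys))) \<chi>s)"
        then have i: "i < k" using l\<chi> by simp
        have "act (pr (k - i)) d (tup (Xs as) d (p # rev ys)) = ys ! i"
          using tup_nth[OF XO d la, of "k - i"] lX i ly by (simp add: pr_def nth_Cons' rev_nth)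
        then show "map (\<lambda>\<chi>. gfun \<chi> d (tup (Xs as) d (p # rev ys))) \<chi>s ! i = medge (\<lambda>a b. gfun (\<theta>' a b) d) as ys ! i"
          using i ly gfun_comp[OF U_hom[OF pr(2)[OF i]] tc] by (simp add: \<chi>s_def)
      qed (simp add: l\<chi> ly)
      show ?thesis unfolding v(2) gfun_comp[OF g tc] using tc 1 2 by (simp add: g_def)
    qed
    with v(1) show ?thesis unfolding S_def by blast
  qed
  then obtain v where "\<And>as. as \<in> strings B \<Longrightarrow> S as (v as)" by metis
  then have v: "\<And>as. as \<in> strings B \<Longrightarrow> v as \<in> hom V (Prod V (Xs as)) (N (hd as) (last as))"
    and va: "\<And>as d ys p. as \<in> strings B \<Longrightarrow> fits (\<lambda>a b. Fobj U (N a b)) d as ys \<Longrightarrow> p \<in> cells (PU (length ys)) d \<Longrightarrow>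
      act (v as) d (tup (Xs as) d (p # rev ys)) = gfun (\<theta> (hd as) (last as)) d (ig e as d p (medge (\<lambda>a b. gfun (\<theta>' a b) d) as ys))"
    unfolding S_def by blast+
  define A where "A = VPCat B (\<lambda>as. if as \<in> strings B then v as else undefined)"
  have A: "ugraph A = B" "\<And>as. as \<in> strings B \<Longrightarrow> vact A as = v as" by (simp_all add: A_def)
  have pA: "pre A"
    unfolding pre_def A(1)
  proof (intro conjI allI vB)
    fix as
    show "if as \<in> strings B then vact A as \<in> hom V (Prod V (ops P (length as - 1) # rev (steps B as))) (ghom B (hd as) (last as))
      else vact A as = undefined"
    proof (cases "as \<in> strings B")
      case True
      then have "hd as \<in> ?O" "last as \<in> ?O" by (auto simp: strings_def B)
      then show ?thesis using True v[OF True] B(2) A(2) by (simp add: Xs_def)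
    qed (simp add: A_def)
  qed
  have fit': "fits (gH A) d as ys \<longleftrightarrow> fits (\<lambda>a b. Fobj U (N a b)) d as ys" if "set as \<subseteq> ?O" for d as ys
    using that by (auto simp: along_def A(1) B(2) subset_iff)
  have gam: "gam A as d p ys = gfun (\<theta> (hd as) (last as)) d (ig e as d p (medge (\<lambda>a b. gfun (\<theta>' a b) d) as ys))"
    if as: "set as \<subseteq> ?O" and ys: "fits (gH A) d as ys" and p: "p \<in> cells (PU (length ys)) d" for d as ys p
  proof -
    have "as \<in> strings B" using as alongD(2)[OF ys] by (simp add: strings_def B)
    then show ?thesis using va[of as d ys p] ys p fit'[OF as] A by (simp add: gam_def Xs_def)
  qed
  have H: "gH A a b = Fobj U (N a b)" if "a \<in> ?O" "b \<in> ?O" for a b using that A(1) B(2) by simp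
  have G: "gam A as d p (medge (\<lambda>a b. gfun (\<theta> a b) d) as ys) = gfun (\<theta> (hd as) (last as)) d (ig e as d p ys)"
    if as: "set as \<subseteq> ?O" and ys: "fits ?H d as ys" and p: "p \<in> cells (PU (length ys)) d" for d as ys p
  proof -
    have "fits (gH A) d as (medge (\<lambda>a b. gfun (\<theta> a b) d) as ys)"
      unfolding fit'[OF as] by (rule along_medge_id[OF ys]) (rule gfun_in[OF th(1)[OF subsetD[OF as] subsetD[OF as]]])
    moreover have "medge (\<lambda>a b. gfun (\<theta>' a b) d) as (medge (\<lambda>a b. gfun (\<theta> a b) d) as ys) = ys"
      unfolding medge_medge_same by (rule medge_ident[OF ys]) (rule ti[OF subsetD[OF as] subsetD[OF as]])
    ultimately show ?thesis using gam[OF as] p by simp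
  qed
  have gO: "gobjs (ugraph A) = ?O" using A(1) B(1) by simp
  have ihA: "ihom ?O ?H (ih e) (ig e) ?O (gH A) (\<lambda>a b. ev (ghom (ugraph A) a b)) (gam A) (\<lambda>a. a) \<theta>"
    unfolding ihom_def using tp G by (auto simp: A(1) B(2))
  \<comment> \<open>An isomorphism is a quotient with a section, here \<open>\<theta>'\<close> over
    the identity on objects; so the laws pass from \<open>T\<close> to the new data.\<close>
  have LA: "laws ?O (gH A) (\<lambda>a b. ev (ghom (ugraph A) a b)) (gam A)"
    by (rule laws_quot[OF L ihA, of "\<lambda>a. a" \<theta>']) (use th(2) ti' H in auto)
  then have vA: "is_vpcat V P A" unfolding is_vpcat_iff gO using pA by (simp add: laws_def)
  \<comment> \<open>The isomorphism onto the assembled category: the identity on objects, and on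
    other cells \<open>\<theta>\<close> followed by tagging with the end points.\<close>
  define h where "h = (\<lambda>m x. case m of 0 \<Rightarrow> x | Suc d \<Rightarrow> enc (bsrc T d x) (btgt T d x) (gfun (\<theta> (bsrc T d x) (btgt T d x)) d x))"
  have h: "h 0 x = x" "x \<in> cells (?H a b) d \<Longrightarrow> h (Suc d) x = enc a b (gfun (\<theta> a b) d x)" for a b d x
    by (auto simp: h_def cells_hset)
  have hs: "\<exists>a\<in>?O. \<exists>b\<in>?O. x \<in> cells (?H a b) d" if "x \<in> cells T (Suc d)" for x d
    using bsrc_in[OF T that] btgt_in[OF T that] that by (auto simp: cells_hset)
  have hc: "h m x \<in> cells (asmb A) m" if x: "x \<in> cells T m" for m x
  proof (cases m)
    case 0
    then show ?thesis using x by (simp add: h cells_asmb gO)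
  next
    case (Suc d)
    then obtain a b where ab: "a \<in> ?O" "b \<in> ?O" "x \<in> cells (?H a b) d" using hs x by blast
    then show ?thesis using gfun_in[OF th(1)[OF ab(1,2)] ab(3)] H by (auto simp: Suc h cells_asmb gO)
  qed
  let ?\<Theta> = "mk_gmap T (asmb A) h"
  have \<Theta>: "?\<Theta> \<in> hom (gset_cat (Suc n)) T (asmb A)"
  proof (rule mk_gmap[OF T is_gset_asmb[OF pA] hc])
    fix m x assume x: "x \<in> cells T (Suc m)"
    obtain a b where ab: "a \<in> ?O" "b \<in> ?O" and xh: "x \<in> cells (?H a b) m" using hs[OF x] by blast
    have ab': "a \<in> gobjs (ugraph A)" "b \<in> gobjs (ugraph A)" using ab gO by auto
    have tx: "gfun (\<theta> a b) m x \<in> cells (gH A a b) m" using gfun_in[OF th(1)[OF ab] xh] H[OF ab] by simp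
    show "gsrc (asmb A) m (h (Suc m) x) = h m (gsrc T m x)" "gtgt (asmb A) m (h (Suc m) x) = h m (gtgt T m x)"
    proof -
      show "gsrc (asmb A) m (h (Suc m) x) = h m (gsrc T m x)"
      proof (cases m)
        case 0
        then show ?thesis using tx xh asmb_st(1)[OF ab'] by (simp add: h) (simp add: cells_hset)
      next
        case (Suc d)
        note hx = xh[unfolded Suc]
        have "gsrc T (Suc d) x \<in> cells (?H a b) d" using gset_in(1)[OF is_gset_hset[OF T] hx] hset_st(1)[OF hx] by simp
        then show ?thesis using tx hx asmb_st(3)[OF ab'] gfun_src[OF th(1)[OF ab] hx] hset_st(1)[OF hx] H[OF ab] by (simp add: Suc h)
      qed
      show "gtgt (asmb A) m (h (Suc m) x) = h m (gtgt T m x)"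
      proof (cases m)
        case 0
        then show ?thesis using tx xh asmb_st(2)[OF ab'] by (simp add: h) (simp add: cells_hset)
      next
        case (Suc d)
        note hx = xh[unfolded Suc]
        have "gtgt T (Suc d) x \<in> cells (?H a b) d" using gset_in(2)[OF is_gset_hset[OF T] hx] hset_st(2)[OF hx] by simp
        then show ?thesis using tx hx asmb_st(4)[OF ab'] gfun_tgt[OF th(1)[OF ab] hx] hset_st(2)[OF hx] H[OF ab] by (simp add: Suc h)
      qed
    qed
  qed
  have \<Theta>0: "gfun ?\<Theta> 0 a = a" if "a \<in> ?O" for a using that by (simp add: h)
  have \<Theta>S: "gfun ?\<Theta> (Suc d) x = enc a b (gfun (\<theta> a b) d x)" if "x \<in> cells (?H a b) d" for a b d x
    using that h(2)[OF that] by (simp add: cells_hset)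
  have ph: "phom (Suc n) eDm erd T e (asmb A) (eev A) ?\<Theta>"
    unfolding phom_def
  proof (intro conjI allI impI \<Theta>)
    fix \<sigma> xs assume "eDm T \<sigma> xs"
    then show "gfun ?\<Theta> (erd \<sigma>) (e \<sigma> xs) = eev A \<sigma> (map (app ?\<Theta>) xs)"
    proof (cases rule: eDm_cases)
      case (edges k d p as ys)
      note as = edges(3) and ys = edges(4)
      have p: "p \<in> cells (PU (length ys)) d" using edges by simp
      let ?ws = "medge (\<lambda>a b. gfun (\<theta> a b) d) as ys"
      have 1: "map (gfun ?\<Theta> 0) as = as" by (rule map_idI) (rule \<Theta>0[OF subsetD[OF as]])
      have "map (gfun ?\<Theta> (Suc d)) ys = medge (\<lambda>a b y. gfun ?\<Theta> (Suc d) y) as ys" by (auto simp: medge_def intro: nth_equalityI)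
      also have "\<dots> = medge enc as ?ws"
        unfolding medge_medge_same by (rule medge_cong[OF ys]) (rule \<Theta>S)
      finally have 2: "map (gfun ?\<Theta> (Suc d)) ys = medge enc as ?ws" .
      have "gfun ?\<Theta> (Suc d) (ig e as d p ys) = enc (hd as) (last as) (gam A as d p ?ws)"
        using \<Theta>S[OF typed_lawD(3)[OF t as ys p]] G[OF as ys p] by simp
      also have "\<dots> = eev A (0, length ys, d, p) (edges d as (medge enc as ?ws))"
        using eev_edges[of as ?ws A d p] alongD(1)[OF ys] by simp
      finally show ?thesis using edges(5) by (simp add: edges(1,6) map_app_edges 1 2 ig_def)
    next
      case (inner a b \<tau> zs)
      note ab = inner(2,3) and D = inner(4)
      have "map (app ?\<Theta>) xs = inner a b (map (\<lambda>(d, x). (d, enc a b x)) (map (app (\<theta> a b)) zs))"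
        using Dm_cells[OF is_gset_hset[OF T] D] \<Theta>S \<Theta>0 ab by (auto simp: inner(5) inner_def)
      then have "eev A \<sigma> (map (app ?\<Theta>) xs) = enc a b (ev (N a b) \<tau> (map (app (\<theta> a b)) zs))"
        unfolding inner(1) using eev_up[of A \<tau> a b "map (app (\<theta> a b)) zs"] ab A(1) B(2) by simp
      moreover have "gfun (\<theta> a b) (rd \<tau>) (ih e a b \<tau> zs) = ev (N a b) \<tau> (map (app (\<theta> a b)) zs)"
        using tp[OF ab] D unfolding phom_def by blast
      ultimately show ?thesis using \<Theta>S[OF typed_lawD(2)[OF t ab D]] by (simp add: inner(1,5) ih_def)
    qed
  qed
  have "bij_betw (gfun ?\<Theta> m) (cells T m) (cells (asmb A) m)" for m
  proof (cases m)
    case 0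
    have "bij_betw (\<lambda>x. x) ?O ?O" by (simp add: bij_betw_def)
    then show ?thesis unfolding 0 cells_asmb gO by (rule bij_betw_cong[THEN iffD1, rotated]) (simp only: \<Theta>0)
  next
    case (Suc d)
    show ?thesis
      unfolding Suc bij_betw_def
    proof (intro conjI inj_onI)
      fix x y assume x: "x \<in> cells T (Suc d)" and y: "y \<in> cells T (Suc d)" and eq: "gfun ?\<Theta> (Suc d) x = gfun ?\<Theta> (Suc d) y"
      obtain a b where ab: "a \<in> ?O" "b \<in> ?O" and xh: "x \<in> cells (?H a b) d" using hs[OF x] by blast
      obtain a' b' where ab': "a' \<in> ?O" "b' \<in> ?O" and yh: "y \<in> cells (?H a' b') d" using hs[OF y] by blast
      have "a' = a" "b' = b" "gfun (\<theta> a b) d x = gfun (\<theta> a b) d y" using eq \<Theta>S[OF xh] \<Theta>S[OF yh] by auto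
      then show "x = y" using ti[OF ab xh] ti[OF ab] yh by metis
    next
      show "gfun ?\<Theta> (Suc d) ` cells T (Suc d) = cells (asmb A) (Suc d)"
      proof
        show "gfun ?\<Theta> (Suc d) ` cells T (Suc d) \<subseteq> cells (asmb A) (Suc d)" using gfun_in[OF \<Theta>] by blast
        show "cells (asmb A) (Suc d) \<subseteq> gfun ?\<Theta> (Suc d) ` cells T (Suc d)"
        proof
          fix z assume "z \<in> cells (asmb A) (Suc d)"
          then obtain a b y where z: "z = enc a b y" "a \<in> ?O" "b \<in> ?O" "y \<in> cells (gH A a b) d"
            by (auto simp: cells_asmb gO)
          have y: "y \<in> cel (N a b) d" using z H by simp
          have "gfun (\<theta>' a b) d y \<in> cells (?H a b) d" by (rule gfun_in[OF th(2)[OF z(2,3)] y])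
          then have "gfun ?\<Theta> (Suc d) (gfun (\<theta>' a b) d y) = z" "gfun (\<theta>' a b) d y \<in> cells T (Suc d)"
            using \<Theta>S ti'[OF z(2,3) y] z(1) by (auto simp: cells_hset)
          then show "z \<in> gfun ?\<Theta> (Suc d) ` cells T (Suc d)" by blast
        qed
      qed
    qed
  qed
  then show ?thesis unfolding rep_def using ph vA by (auto simp: vp_cat_def)
qed

text \<open>A structure on \<open>T\<close> only guarantees the dimension of a result. That its end
  points are right is an equation between 0-cells, which may be tested under the separating
  homomorphisms; in an enriched category the end points are right.\<close>

lemma typed_law_sub:
  assumes T: "is_gset (Suc n) T" and e: "\<And>\<sigma> xs. eDm T \<sigma> xs \<Longrightarrow> e \<sigma> xs \<in> cells T (erd \<sigma>)"
    and sep: "\<And>m x y. x \<in> cells T m \<Longrightarrow> y \<in> cells T m \<Longrightarrow> x \<noteq> y \<Longrightarrow>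
         \<exists>M\<in>Obj (vp_cat V P). \<exists>f. phom (Suc n) eDm erd T e (asmb M) (eev M) f \<and> gfun f m x \<noteq> gfun f m y"
  shows "typed_law (cells T 0) (hset T) (ih e) (ig e)"
proof -
  have eq: "x = y" if "x \<in> cells T m" "y \<in> cells T m"
    "\<And>M f. is_vpcat V P M \<Longrightarrow> pre M \<Longrightarrow> phom (Suc n) eDm erd T e (asmb M) (eev M) f \<Longrightarrow>
      f \<in> hom (gset_cat (Suc n)) T (asmb M) \<Longrightarrow> gfun f m x = gfun f m y" for m x y
    using sep[OF that(1,2)] that(3) vpcat_pre unfolding vp_cat_def phom_def by fastforce
  show ?thesis
    unfolding typed_law_def
  proof (intro conjI ballI allI impI is_gset_hset[OF T])
    fix a b \<sigma> zs assume ab: "a \<in> cells T 0" "b \<in> cells T 0" and D: "Dm (hset T a b) \<sigma> zs"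
    have D': "eDm T (up \<sigma>) (inner a b zs)" using ab D eDm_up by blast
    have c: "ih e a b \<sigma> zs \<in> cells T (Suc (rd \<sigma>))" using e[OF D'] by (simp add: ih_def)
    have f: "\<exists>y. y \<in> cells (gH M (gfun f 0 a) (gfun f 0 b)) (rd \<sigma>) \<and> gfun f (Suc (rd \<sigma>)) (ih e a b \<sigma> zs) = enc (gfun f 0 a) (gfun f 0 b) y"
      "gfun f 0 a \<in> gobjs (ugraph M)" "gfun f 0 b \<in> gobjs (ugraph M)"
      if M: "pre M" and f: "phom (Suc n) eDm erd T e (asmb M) (eev M) f" and fh: "f \<in> hom (gset_cat (Suc n)) T (asmb M)" for M f
    proof -
      show o: "gfun f 0 a \<in> gobjs (ugraph M)" "gfun f 0 b \<in> gobjs (ugraph M)"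
        using gfun_in[OF fh ab(1)] gfun_in[OF fh ab(2)] by (auto simp: cells_asmb)
      note Df = Dm_map[OF hmap_hom[OF fh] D]
      have m: "map (app f) (inner a b zs) = inner (gfun f 0 a) (gfun f 0 b) (map (app (hmap T (asmb M) f a b)) zs)"
        by (rule map_app_inner) (rule Dm_cells[OF is_gset_hset[OF T] D])
      have "gfun f (erd (up \<sigma>)) (e (up \<sigma>) (inner a b zs)) = eev M (up \<sigma>) (map (app f) (inner a b zs))"
        using f D' unfolding phom_def by blast
      then have "gfun f (Suc (rd \<sigma>)) (ih e a b \<sigma> zs) = ih (eev M) (gfun f 0 a) (gfun f 0 b) \<sigma> (map (app (hmap T (asmb M) f a b)) zs)"
        unfolding m by (simp add: ih_def)
      then show "\<exists>y. y \<in> cells (gH M (gfun f 0 a) (gfun f 0 b)) (rd \<sigma>) \<and> gfun f (Suc (rd \<sigma>)) (ih e a b \<sigma> zs) = enc (gfun f 0 a) (gfun f 0 b) y"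
        using ih_eev[OF M o Df] hset_asmb[OF M o] by auto
    qed
    have "bsrc T (rd \<sigma>) (ih e a b \<sigma> zs) = a"
      by (rule eq[OF bsrc_in[OF T c] ab(1)]) (use f gfun_bsrc[OF _ c] bsrc_enc(1) in metis)
    moreover have "btgt T (rd \<sigma>) (ih e a b \<sigma> zs) = b"
      by (rule eq[OF btgt_in[OF T c] ab(2)]) (use f gfun_btgt[OF _ c] bsrc_enc(2) in metis)
    ultimately show "ih e a b \<sigma> zs \<in> cells (hset T a b) (rd \<sigma>)" using c by (simp add: cells_hset)
  next
    fix d as p ys assume "set as \<subseteq> cells T 0 \<and> fits (hset T) d as ys \<and> p \<in> cells (PU (length ys)) d"
    then have as: "set as \<subseteq> cells T 0" and ys: "fits (hset T) d as ys" and p: "p \<in> cells (PU (length ys)) d" by auto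
    have en: "hd as \<in> cells T 0" "last as \<in> cells T 0" using along_ends[OF ys] as by auto
    note D = eDm_edges[OF p as ys refl]
    have c: "ig e as d p ys \<in> cells T (Suc d)" using e[OF D] by (simp add: ig_def)
    have f: "\<exists>y. y \<in> cells (gH M (gfun f 0 (hd as)) (gfun f 0 (last as))) d \<and> gfun f (Suc d) (ig e as d p ys) = enc (gfun f 0 (hd as)) (gfun f 0 (last as)) y"
      "gfun f 0 (hd as) \<in> gobjs (ugraph M)" "gfun f 0 (last as) \<in> gobjs (ugraph M)"
      if M: "pre M" and f: "phom (Suc n) eDm erd T e (asmb M) (eev M) f" and fh: "f \<in> hom (gset_cat (Suc n)) T (asmb M)" for M f
    proof -
      show o: "gfun f 0 (hd as) \<in> gobjs (ugraph M)" "gfun f 0 (last as) \<in> gobjs (ugraph M)"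
        using gfun_in[OF fh en(1)] gfun_in[OF fh en(2)] by (auto simp: cells_asmb)
      have as': "set (map (gfun f 0) as) \<subseteq> gobjs (ugraph M)" using as gfun_in[OF fh] by (force simp: cells_asmb)
      have ys': "fits (hset (asmb M)) d (map (gfun f 0) as) (map (gfun f (Suc d)) ys)"
        using hset_map[OF fh] ys by (auto simp: along_def)
      note F = fits_enc[OF M as' ys']
      let ?ws = "map third (map (gfun f (Suc d)) ys)"
      have lw: "length (map (gfun f 0) as) = Suc (length ?ws)" using alongD(1)[OF ys] by simp
      have ne: "as \<noteq> []" using alongD(2)[OF ys] .
      have pw: "p \<in> cells (PU (length ?ws)) d" using p by simp
      have "gfun f (Suc d) (ig e as d p ys) = eev M (0, length ys, d, p) (map (app f) (edges d as ys))"
        unfolding ig_def by (rule phom_edges[OF f D])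
      also have "\<dots> = eev M (0, length ?ws, d, p) (edges d (map (gfun f 0) as) (medge enc (map (gfun f 0) as) ?ws))"
        unfolding map_app_edges F(2)[symmetric] by simp
      also have "\<dots> = enc (gfun f 0 (hd as)) (gfun f 0 (last as)) (gam M (map (gfun f 0) as) d p ?ws)"
        unfolding eev_edges[OF lw] using ne by (simp add: hd_map last_map)
      finally show "\<exists>y. y \<in> cells (gH M (gfun f 0 (hd as)) (gfun f 0 (last as))) d \<and> gfun f (Suc d) (ig e as d p ys) = enc (gfun f 0 (hd as)) (gfun f 0 (last as)) y"
        using gam_in[OF M as' F(1) pw] ne by (auto simp: hd_map last_map)
    qed
    have "bsrc T d (ig e as d p ys) = hd as"
      by (rule eq[OF bsrc_in[OF T c] en(1)]) (use f gfun_bsrc[OF _ c] bsrc_enc(1) in metis)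
    moreover have "btgt T d (ig e as d p ys) = last as"
      by (rule eq[OF btgt_in[OF T c] en(2)]) (use f gfun_btgt[OF _ c] bsrc_enc(2) in metis)
    ultimately show "ig e as d p ys \<in> cells (hset T (hd as) (last as)) d" using c by (simp add: cells_hset)
  qed
qed

text \<open>The separating homomorphisms induce separating homomorphisms on homs. From these
  \<open>laws_sub\<close> derives the laws, and the closure property \<open>rep_sub\<close> of
  \<open>V\<close> shows that the homs come from \<open>V\<close>; \<open>rep_build\<close> combines
  the two.\<close>

lemma rep_sub_vp:
  assumes T: "is_gset (Suc n) T" and e: "\<And>\<sigma> xs. eDm T \<sigma> xs \<Longrightarrow> e \<sigma> xs \<in> cells T (erd \<sigma>)"
    and sep: "\<And>m x y. x \<in> cells T m \<Longrightarrow> y \<in> cells T m \<Longrightarrow> x \<noteq> y \<Longrightarrow>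
         \<exists>M\<in>Obj (vp_cat V P). \<exists>f. phom (Suc n) eDm erd T e (asmb M) (eev M) f \<and> gfun f m x \<noteq> gfun f m y"
  shows "rep (Suc n) (vp_cat V P) eU eDm erd eev T e"
proof -
  note t = typed_law_sub[OF T e sep]
  \<comment> \<open>The images of \<open>x\<close> and \<open>y\<close> carry the same tags, since
    the two cells have the same end points. If the images differ, they differ inside the
    hom.\<close>
  have hsep: "\<exists>M f. is_vpcat V P M \<and> phom (Suc n) eDm erd T e (asmb M) (eev M) f \<and> gfun (hdec T M f a b) d x \<noteq> gfun (hdec T M f a b) d y"
    if ab: "a \<in> cells T 0" "b \<in> cells T 0" and x: "x \<in> cells (hset T a b) d" and y: "y \<in> cells (hset T a b) d" and ne: "x \<noteq> y" for a b d x y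
  proof -
    obtain M f where M: "is_vpcat V P M" and f: "phom (Suc n) eDm erd T e (asmb M) (eev M) f" and fn: "gfun f (Suc d) x \<noteq> gfun f (Suc d) y"
      using sep[of x "Suc d" y] x y ne by (auto simp: cells_hset vp_cat_def)
    have fh: "f \<in> hom (gset_cat (Suc n)) T (asmb M)" using f by (simp add: phom_def)
    show ?thesis using M f fn hdec(2)[OF vpcat_pre[OF M] fh ab x] hdec(2)[OF vpcat_pre[OF M] fh ab y] by auto
  qed
  have "laws (cells T 0) (hset T) (ih e) (ig e)"
  proof (rule laws_sub[OF t])
    fix a b d x y assume ab: "a \<in> cells T 0" "b \<in> cells T 0" and x: "x \<in> cells (hset T a b) d" and y: "y \<in> cells (hset T a b) d"
      and eq: "\<And>Ob' H' h' g' F \<phi>. laws Ob' H' h' g' \<Longrightarrow> ihom (cells T 0) (hset T) (ih e) (ig e) Ob' H' h' g' F \<phi> \<Longrightarrow>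
         gfun (\<phi> a b) d x = gfun (\<phi> a b) d y"
    show "x = y"
    proof (rule ccontr)
      assume "x \<noteq> y"
      then obtain M f where M: "is_vpcat V P M" and f: "phom (Suc n) eDm erd T e (asmb M) (eev M) f"
        and fn: "gfun (hdec T M f a b) d x \<noteq> gfun (hdec T M f a b) d y" using hsep[OF ab x y] by blast
      from eq[OF laws_vpcat[OF M] ihom_hdec[OF vpcat_pre[OF M] f t]] fn show False by blast
    qed
  qed
  moreover have "rep n V U Dm rd ev (hset T a b) (ih e a b)" if ab: "a \<in> cells T 0" "b \<in> cells T 0" for a b
  proof (rule rep_sub[OF is_gset_hset[OF T] typed_lawD(2)[OF t ab]])
    fix d x y assume "x \<in> cells (hset T a b) d" "y \<in> cells (hset T a b) d" "x \<noteq> y"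
    then obtain M f where M: "is_vpcat V P M" and f: "phom (Suc n) eDm erd T e (asmb M) (eev M) f"
      and fn: "gfun (hdec T M f a b) d x \<noteq> gfun (hdec T M f a b) d y" using hsep[OF ab] by blast
    note I = ihom_hdec[OF vpcat_pre[OF M] f t]
    show "\<exists>M\<in>Obj V. \<exists>f. phom n Dm rd (hset T a b) (ih e a b) (Fobj U M) (ev M) f \<and> gfun f d x \<noteq> gfun f d y"
      using ihomD(2)[OF I ab] fn ghom_Obj[OF vpcat_pre[OF M] ihomD(1)[OF I ab(1)] ihomD(1)[OF I ab(2)]] by blast
  qed
  ultimately show ?thesis by (rule rep_build[OF T])
qed

text \<open>The section splits \<open>q\<close> on objects and on each hom. So the homs of
  \<open>T\<close> come from \<open>V\<close> by \<open>rep_quot\<close>, and the laws descend from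
  \<open>M\<close> by \<open>laws_quot\<close>.\<close>

lemma rep_quot_vp:
  assumes M: "is_vpcat V P M" and q: "phom (Suc n) eDm erd (asmb M) (eev M) T e q"
    and s: "s \<in> hom (gset_cat (Suc n)) T (asmb M)" and qs: "\<And>m x. x \<in> cells T m \<Longrightarrow> gfun q m (gfun s m x) = x"
  shows "rep (Suc n) (vp_cat V P) eU eDm erd eev T e"
proof -
  note pM = vpcat_pre[OF M] and T = gset_homD(1)[OF s]
  have qh: "q \<in> hom (gset_cat (Suc n)) (asmb M) T" using q by (simp add: phom_def)
  note I = ihom_henc[OF pM q]
  have so: "gfun s 0 a \<in> gobjs (ugraph M)" if "a \<in> cells T 0" for a
    using gfun_in[OF s that] by (simp add: cells_asmb)
  have sec: "gfun (henc M T q (gfun s 0 a) (gfun s 0 b)) d (gfun (hdec T M s a b) d x) = x"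
    if ab: "a \<in> cells T 0" "b \<in> cells T 0" and x: "x \<in> cells (hset T a b) d" for a b d x
  proof -
    note hd = hdec[OF pM s ab]
    have "gfun (henc M T q (gfun s 0 a) (gfun s 0 b)) d (gfun (hdec T M s a b) d x) = gfun q (Suc d) (gfun s (Suc d) x)"
      using henc(2)[OF pM qh so[OF ab(1)] so[OF ab(2)] gfun_in[OF hd(1) x]] hd(2)[OF x] by simp
    then show ?thesis using qs x by (simp add: cells_hset)
  qed
  have "laws (cells T 0) (hset T) (ih e) (ig e)"
    by (rule laws_quot[OF laws_vpcat[OF M] I, of "gfun s 0" "hdec T M s"])
      (simp_all add: so qs hdec(1)[OF pM s] sec)
  moreover have "rep n V U Dm rd ev (hset T a b) (ih e a b)" if ab: "a \<in> cells T 0" "b \<in> cells T 0" for a b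
  proof (rule rep_quot[OF ghom_Obj[OF pM so[OF ab(1)] so[OF ab(2)]] _ hdec(1)[OF pM s ab] sec[OF ab]])
    show "phom n Dm rd (gH M (gfun s 0 a) (gfun s 0 b)) (ev (ghom (ugraph M) (gfun s 0 a) (gfun s 0 b)))
      (hset T a b) (ih e a b) (henc M T q (gfun s 0 a) (gfun s 0 b))"
      using ihomD(2)[OF I so[OF ab(1)] so[OF ab(2)]] qs ab by simp
  qed
  ultimately show ?thesis by (rule rep_build[OF T])
qed

text \<open>The induction step: everything assumed of \<open>V\<close> holds again one dimension
  higher, for the same codes.\<close>

theorem coded_opcat_vp_cat: "coded_opcat (Suc n) (vp_cat V P) eU eDm erd eev enl es"
proof unfold_locales
  fix M T e q s
  assume "M \<in> Obj (vp_cat V P)" "phom (Suc n) eDm erd (Fobj eU M) (eev M) T e q"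
    "s \<in> hom (gset_cat (Suc n)) T (Fobj eU M)" "\<And>m x. x \<in> cells T m \<Longrightarrow> gfun q m (gfun s m x) = x"
  then show "rep (Suc n) (vp_cat V P) eU eDm erd eev T e"
    using rep_quot_vp[of M T e q s] by (simp add: vp_cat_def)
next
  fix A B f \<sigma> xs assume "f \<in> hom (gset_cat (Suc n)) A B" "eDm A \<sigma> xs"
  then show "eDm B \<sigma> (map (app f) xs)" by (rule eDm_map)
next
  fix T :: "'u gset" and S \<sigma> xs
  assume "is_gset (Suc n) T" "S \<noteq> {}" "\<And>f. f \<in> S \<Longrightarrow> f \<in> hom (gset_cat (Suc n)) T (gcod f)"
    "\<And>f. f \<in> S \<Longrightarrow> eDm (gcod f) \<sigma> (map (app f) xs)"
    "\<And>d x y. x \<in> cells T d \<Longrightarrow> y \<in> cells T d \<Longrightarrow> (\<And>f. f \<in> S \<Longrightarrow> gfun f d x = gfun f d y) \<Longrightarrow> x = y"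
    "\<And>d x. (d, x) \<in> set xs \<Longrightarrow> x \<in> cells T d"
  then show "eDm T \<sigma> xs" by (rule eDm_reflect)
next
  fix X :: "('u, 'o, 'm) vpcat" and \<sigma> xs assume "X \<in> Obj (vp_cat V P)" "eDm (Fobj eU X) \<sigma> xs"
  then show "eev X \<sigma> xs \<in> cells (Fobj eU X) (erd \<sigma>)"
    using eev_cells[of X] vpcat_pre[of X] by (simp add: vp_cat_def)
next
  fix X Y f assume "X \<in> Obj (vp_cat V P)" "Y \<in> Obj (vp_cat V P)"
    "phom (Suc n) eDm erd (Fobj eU X) (eev X) (Fobj eU Y) (eev Y) f"
  then show "\<exists>g\<in>hom (vp_cat V P) X Y. Farr eU g = f" using lift_vp[of X Y f] by (simp add: vp_cat_def)
next
  fix T e assume a: "is_gset (Suc n) T" "\<And>\<sigma> xs. eDm T \<sigma> xs \<Longrightarrow> e \<sigma> xs \<in> cells T (erd \<sigma>)"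
    "\<And>m x y. x \<in> cells T m \<Longrightarrow> y \<in> cells T m \<Longrightarrow> x \<noteq> y \<Longrightarrow>
         \<exists>M\<in>Obj (vp_cat V P). \<exists>f. phom (Suc n) eDm erd T e (Fobj eU M) (eev M) f \<and> gfun f m x \<noteq> gfun f m y"
  show "rep (Suc n) (vp_cat V P) eU eDm erd eev T e"
    by (rule rep_sub_vp[OF a(1,2)]) (use a(3) in \<open>simp_all\<close>)
qed (auto intro: eU_functor eDm_cells eDm_rd eU_faithful phom_eU inj_enl inj_es simp: phom_eU)

end

section \<open>Sets and copies of categories\<close>

definition set_gset :: "'u set \<Rightarrow> 'u gset" where
  "set_gset A = GSet (\<lambda>m. if m = 0 then A else {}) (\<lambda>_ _. undefined) (\<lambda>_ _. undefined)"

definition set_gmap :: "'u setmap \<Rightarrow> 'u gmap" where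
  "set_gmap f = GMap (set_gset (sdom f)) (set_gset (scod f)) (\<lambda>m. if m = 0 then sfun f else (\<lambda>_. undefined))"

lemma cells_set_gset [simp]: "cells (set_gset A) m = (if m = 0 then A else {})"
  by (simp add: set_gset_def)

lemma is_gset_set_gset: "is_gset 0 (set_gset A)"
  by (auto simp: is_gset_def set_gset_def)

lemma is_gset_0:
  assumes "is_gset 0 T"
  shows "T = set_gset (cells T 0)"
proof (rule gset.expand, intro conjI)
  have e: "cells T m = {}" if "0 < m" for m using assms that by (auto simp: is_gset_def)
  then show "cells T = cells (set_gset (cells T 0))" by (intro ext) simp
  have "gsrc T m \<in> {} \<rightarrow>\<^sub>E cells T m" "gtgt T m \<in> {} \<rightarrow>\<^sub>E cells T m" for m
    using assms e[of "Suc m"] unfolding is_gset_def by auto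
  then show "gsrc T = gsrc (set_gset (cells T 0))" "gtgt T = gtgt (set_gset (cells T 0))"
    by (auto simp: set_gset_def fun_eq_iff)
qed

lemma hom_set_cat: "f \<in> hom set_cat A B \<longleftrightarrow> sfun f \<in> A \<rightarrow>\<^sub>E B \<and> sdom f = A \<and> scod f = B"
  by (auto simp: hom_def set_cat_def)

lemma category_set_cat: "category set_cat"
proof -
  have "\<And>A B f. f \<in> hom set_cat A B \<Longrightarrow> Comp set_cat f (Ident set_cat A) = f \<and> Comp set_cat (Ident set_cat B) f = f"
    unfolding hom_set_cat by (auto simp: set_cat_def intro!: setmap.expand extensionalityI[where A = "sdom _"])
      (auto simp: fun_eq_iff PiE_def extensional_def)
  moreover have "\<And>A B D f g. f \<in> hom set_cat A B \<Longrightarrow> g \<in> hom set_cat B D \<Longrightarrow> Comp set_cat g f \<in> hom set_cat A D"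
    unfolding hom_set_cat by (auto simp: set_cat_def)
  moreover have "\<And>A B D E f g h. f \<in> hom set_cat A B \<Longrightarrow> g \<in> hom set_cat B D \<Longrightarrow> h \<in> hom set_cat D E \<Longrightarrow>
      Comp set_cat h (Comp set_cat g f) = Comp set_cat (Comp set_cat h g) f"
    unfolding hom_set_cat by (auto simp: set_cat_def fun_eq_iff)
  moreover have "\<And>A. Ident set_cat A \<in> hom set_cat A A"
    unfolding hom_set_cat by (auto simp: set_cat_def)
  ultimately show ?thesis unfolding category_def by (auto simp: set_cat_def)
qed

lemma set_gmap_hom: "f \<in> hom set_cat A B \<Longrightarrow> set_gmap f \<in> hom (gset_cat 0) (set_gset A) (set_gset B)"
  unfolding hom_set_cat gset_hom_iff is_gmap_def by (auto simp: set_gmap_def is_gset_set_gset)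

lemma set_functor: "functor set_cat (gset_cat 0) \<lparr>Fobj = set_gset, Farr = set_gmap\<rparr>"
  unfolding functor_def
  by (auto simp: category_set_cat category_gset_cat is_gset_set_gset set_gmap_hom)
    (auto simp: set_gmap_def set_cat_def gset_cat_def hom_def fun_eq_iff)

text \<open>The induction starts without operations: no argument list lies in a domain. A structure
  is then a mere 0-globular set, which is the same thing as a set, so both closure properties hold
  trivially.\<close>

lemma coded_opcat_set_cat:
  assumes "inj enl" "inj es"
  shows "coded_opcat 0 set_cat \<lparr>Fobj = set_gset, Farr = set_gmap\<rparr> (\<lambda>_ _ _. False) (\<lambda>_. 0) (\<lambda>_ _ _. undefined) enl es"
proof -
  have lift: "\<exists>g\<in>hom set_cat A B. set_gmap g = f" if f: "f \<in> hom (gset_cat 0) (set_gset A) (set_gset B)" for A B and f :: "'a gmap"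
  proof -
    have 0: "gfun f m \<in> cells (set_gset A) m \<rightarrow>\<^sub>E cells (set_gset B) m" for m
      using f unfolding gset_hom_iff is_gmap_def by metis
    let ?g = "SetMap A B (gfun f 0)"
    have g: "?g \<in> hom set_cat A B" using 0[of 0] by (simp add: hom_set_cat)
    moreover have "set_gmap ?g = f"
    proof (rule gmap_eqI[OF set_gmap_hom[OF g] f])
      fix m x assume "x \<in> cells (set_gset A) m"
      then show "gfun (set_gmap ?g) m x = gfun f m x" by (auto simp: set_gmap_def split: if_splits)
    qed
    ultimately show ?thesis by blast
  qed
  have rep: "rep 0 set_cat \<lparr>Fobj = set_gset, Farr = set_gmap\<rparr> (\<lambda>_ _ _. False) (\<lambda>_. 0) (\<lambda>_ _ _. undefined) T e"
    if T: "is_gset 0 T" for T :: "'a gset" and e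
  proof -
    have "phom 0 (\<lambda>_ _ _. False) (\<lambda>_. 0) T e (set_gset (cells T 0)) (\<lambda>_ _. undefined) (Ident (gset_cat 0) T)"
      using gset_ident_hom[OF T] is_gset_0[OF T, symmetric] by (simp add: phom_def)
    moreover have "bij_betw (gfun (Ident (gset_cat 0) T) m) (cells T m) (cells (set_gset (cells T 0)) m)" for m
      using is_gset_0[OF T, symmetric] by (simp add: bij_betw_def inj_on_def cong: image_cong)
    ultimately show ?thesis unfolding rep_def
      by (intro bexI[of _ "cells T 0"] exI[of _ "Ident (gset_cat 0) T"] conjI allI) (simp_all add: set_cat_def)
  qed
  show ?thesis
  proof (unfold_locales, goal_cases)
    \<comment> \<open>The numbered cases are faithfulness, fullness and the two closure
      properties.\<close>
    case (7 X Y f g)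
    then show ?case by (auto simp: set_gmap_def hom_set_cat fun_eq_iff intro!: setmap.expand split: if_splits)
  next
    case (9 X Y f)
    then show ?case using lift[of f X Y] by (simp add: phom_def)
  next
    case (10 T e)
    then show ?case using rep by blast
  next
    case (11 M T e q s)
    then show ?case using rep gset_homD(1) by blast
  qed (use assms set_functor set_gmap_hom in \<open>auto simp: phom_def\<close>)
qed

section \<open>Transport along the tagging constructors\<close>

lemma copy_simps:
  assumes i: "inj i" and j: "inj j"
  shows "Obj (copy_cat i j V) = i ` Obj V" "Arr (copy_cat i j V) = j ` Arr V"
    "Dom (copy_cat i j V) (j f) = i (Dom V f)" "Cod (copy_cat i j V) (j f) = i (Cod V f)"
    "Ident (copy_cat i j V) (i X) = j (Ident V X)" "Comp (copy_cat i j V) (j g) (j f) = j (Comp V g f)"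
  by (simp_all add: copy_cat_def inv_f_f[OF i] inv_f_f[OF j])

lemma hom_copy:
  assumes i: "inj i" and j: "inj j"
  shows "hom (copy_cat i j V) (i X) (i Y) = j ` hom V X Y"
    "f \<in> hom (copy_cat i j V) A B \<Longrightarrow> category V \<Longrightarrow> \<exists>X\<in>Obj V. \<exists>Y\<in>Obj V. A = i X \<and> B = i Y \<and> f \<in> j ` hom V X Y"
  unfolding hom_def by (auto simp: copy_simps[OF assms] inj_eq[OF i] category_def)

lemma category_copy:
  assumes i: "inj i" and j: "inj j" and V: "category V"
  shows "category (copy_cat i j V)"
  unfolding category_def
proof (intro conjI ballI allI impI)
  fix f assume "f \<in> Arr (copy_cat i j V)"
  then show "Dom (copy_cat i j V) f \<in> Obj (copy_cat i j V)" "Cod (copy_cat i j V) f \<in> Obj (copy_cat i j V)"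
    using V by (auto simp: copy_simps[OF i j] category_def)
next
  fix X assume "X \<in> Obj (copy_cat i j V)"
  then show "Ident (copy_cat i j V) X \<in> hom (copy_cat i j V) X X"
    using ident_hom[OF V] by (auto simp: copy_simps[OF i j] hom_copy[OF i j])
next
  fix X Y Z f g assume a: "f \<in> hom (copy_cat i j V) X Y \<and> g \<in> hom (copy_cat i j V) Y Z"
  then obtain x y f' where 1: "X = i x" "Y = i y" "f = j f'" "f' \<in> hom V x y" using hom_copy(2)[OF i j _ V] by blast
  obtain y' z g' where 2: "Y = i y'" "Z = i z" "g = j g'" "g' \<in> hom V y' z" using a hom_copy(2)[OF i j _ V] by blast
  have "y' = y" using 1(2) 2(1) inj_eq[OF i] by metis
  then show "Comp (copy_cat i j V) g f \<in> hom (copy_cat i j V) X Z"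
    using 1 2 comp_hom[OF V] by (auto simp: copy_simps[OF i j] hom_copy[OF i j])
next
  fix X Y f assume "f \<in> hom (copy_cat i j V) X Y"
  then obtain x y f' where 1: "X = i x" "Y = i y" "f = j f'" "f' \<in> hom V x y" using hom_copy(2)[OF i j _ V] by blast
  then show "Comp (copy_cat i j V) f (Ident (copy_cat i j V) X) = f" "Comp (copy_cat i j V) (Ident (copy_cat i j V) Y) f = f"
    using comp_ident[OF V 1(4)] by (auto simp: copy_simps[OF i j])
next
  fix W X Y Z f g h
  assume a: "f \<in> hom (copy_cat i j V) W X \<and> g \<in> hom (copy_cat i j V) X Y \<and> h \<in> hom (copy_cat i j V) Y Z"
  obtain w x f' where 1: "W = i w" "X = i x" "f = j f'" "f' \<in> hom V w x" using a hom_copy(2)[OF i j _ V] by blast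
  obtain x' y g' where 2: "X = i x'" "Y = i y" "g = j g'" "g' \<in> hom V x' y" using a hom_copy(2)[OF i j _ V] by blast
  obtain y' z h' where 3: "Y = i y'" "Z = i z" "h = j h'" "h' \<in> hom V y' z" using a hom_copy(2)[OF i j _ V] by blast
  have "x' = x" "y' = y" using 1(2) 2(1,2) 3(1) inj_eq[OF i] by metis+
  then show "Comp (copy_cat i j V) h (Comp (copy_cat i j V) g f) = Comp (copy_cat i j V) (Comp (copy_cat i j V) h g) f"
    using 1 2 3 comp_assoc[OF V, of f' w x g' y h' z] by (simp add: copy_simps[OF i j])
qed

text \<open>A tagged object keeps its globular set and its operations, so the notion of structure
  and the codes stay the same and only \<open>V\<close> is renamed.\<close>

lemma coded_opcat_copy:
  assumes "coded_opcat n V U Dm rd ev enl es" and i: "inj i" and j: "inj j"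
  shows "coded_opcat n (copy_cat i j V) \<lparr>Fobj = Fobj U \<circ> inv i, Farr = Farr U \<circ> inv j\<rparr> Dm rd (ev \<circ> inv i) enl es"
proof -
  interpret coded_opcat n V U Dm rd ev enl es by fact
  let ?V = "copy_cat i j V" and ?U = "\<lparr>Fobj = Fobj U \<circ> inv i, Farr = Farr U \<circ> inv j\<rparr>" and ?ev = "ev \<circ> inv i"
  note cs = copy_simps[OF i j] and hc = hom_copy(2)[OF i j _ V]
  have [simp]: "inv i (i x) = x" "inv j (j f) = f" for x f using inv_f_f[OF i] inv_f_f[OF j] by auto
  have rep: "rep n ?V ?U Dm rd ?ev T e" if "rep n V U Dm rd ev T e" for T e
    using that unfolding rep_def by (auto simp: cs)
  show ?thesis
  proof (unfold_locales, goal_cases)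
    case 1
    show ?case
      unfolding functor_def
    proof (intro conjI ballI allI impI)
      fix X Y f assume "f \<in> hom ?V X Y"
      then obtain x y f' where 1: "X = i x" "Y = i y" "f = j f'" "f' \<in> hom V x y" using hc by blast
      then show "Farr ?U f \<in> hom (gset_cat n) (Fobj ?U X) (Fobj ?U Y)" using U_hom by simp
    next
      fix X Y Z f g assume a: "f \<in> hom ?V X Y \<and> g \<in> hom ?V Y Z"
      then obtain x y f' where 1: "X = i x" "Y = i y" "f = j f'" "f' \<in> hom V x y" using hc by blast
      obtain y' z g' where 2: "Y = i y'" "Z = i z" "g = j g'" "g' \<in> hom V y' z" using a hc by blast
      have "y' = y" using 1(2) 2(1) inj_eq[OF i] by metis
      then show "Farr ?U (Comp ?V g f) = Comp (gset_cat n) (Farr ?U g) (Farr ?U f)"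
        using 1 2 functor_comp[OF U, of f' x y g' z] by (simp add: cs)
    qed (use category_copy[OF i j V] category_gset_cat gset_U functor_ident[OF U] in \<open>auto simp: cs\<close>)
  next
    case (2 A B f \<sigma> xs)
    then show ?case by (rule Dm_map)
  next
    case (3 A \<sigma> xs d x)
    then show ?case by (rule Dm_cells)
  next
    case (4 T S \<sigma> xs)
    then show ?case by (rule Dm_reflect)
  next
    case (5 A \<sigma> xs)
    then show ?case by (rule Dm_rd)
  next
    case (6 X \<sigma> xs)
    then show ?case using ev_cells by (auto simp: cs)
  next
    case (7 X Y f g)
    obtain x y f' where f: "X = i x" "Y = i y" "f = j f'" "f' \<in> hom V x y" using hc[OF 7(1)] by blast
    then obtain g' where g: "g = j g'" "g' \<in> hom V x y" using 7(2) by (auto simp: hom_copy(1)[OF i j])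
    show ?case using faithful[OF f(4) g(2)] 7(3) f g by simp
  next
    case (8 X Y f)
    then obtain x y f' where "X = i x" "Y = i y" "f = j f'" "f' \<in> hom V x y" using hc by blast
    then show ?case using phom_arr by simp
  next
    case (9 X Y f)
    then obtain x y where "X = i x" "Y = i y" "x \<in> Obj V" "y \<in> Obj V" by (auto simp: cs)
    then show ?case using lift_arr[of x y f] 9(3) by (auto simp: hom_copy(1)[OF i j])
  next
    case (10 T e)
    then show ?case by (intro rep rep_sub) (auto simp: cs)
  next
    case (11 M T e q s)
    then obtain m where "M = i m" "m \<in> Obj V" by (auto simp: cs)
    then show ?case using rep_quot[of m T e q s] 11 rep by simp
  qed (rule inj_enl inj_es)+
qed

text \<open>An infinite type is equinumerous with its square, so pairs can be coded in it, and lists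
  by repeated pairing.\<close>

lemma inj_list_code:
  assumes "infinite (UNIV :: 'u set)"
  shows "\<exists>enl :: 'u list \<Rightarrow> 'u. inj enl"
proof -
  have "\<exists>f :: 'u \<times> 'u \<Rightarrow> 'u. inj_on f (UNIV \<times> UNIV) \<and> f ` (UNIV \<times> UNIV) \<subseteq> UNIV"
    using card_of_ordLeq[THEN iffD2, OF ordIso_imp_ordLeq[OF card_of_Times_same_infinite[OF assms]]] .
  then obtain pr :: "'u \<times> 'u \<Rightarrow> 'u" where pr: "inj pr" by auto
  obtain nat_c :: "nat \<Rightarrow> 'u" where nc: "inj nat_c"
    using assms infinite_countable_subset by blast
  define c where "c = rec_list (nat_c 0) (\<lambda>x _ r. pr (x, r))"
  have c: "c [] = nat_c 0" "c (x # xs) = pr (x, c xs)" for x xs by (simp_all add: c_def)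
  have "c xs = c ys \<Longrightarrow> length xs = length ys \<Longrightarrow> xs = ys" for xs ys
  proof (induction xs arbitrary: ys)
    case (Cons x xs)
    then obtain y zs where "ys = y # zs" by (cases ys) auto
    then show ?case using Cons pr by (auto simp: c inj_eq)
  qed simp
  \<comment> \<open>A pair may happen to have the code \<open>nat_c 0\<close> of the empty list, so
    \<open>c\<close> is only known to be injective on lists of equal length. Recording the length in
    front repairs this.\<close>
  then have "inj (\<lambda>xs. pr (nat_c (length xs), c xs))"
    by (intro injI) (simp add: inj_eq[OF pr] inj_eq[OF nc])
  then show ?thesis by blast
qed

theorem theorem4p3:
  fixes P :: "nat \<Rightarrow> ('u nobj, 'u narr) operad"
  assumes "infinite (UNIV :: 'u set)"
    and "iterative_operadic_theory P"
  shows "\<forall>n. \<exists>Q. monad (gset_cat n :: ('u gset, 'u gmap) cat) Q \<and>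
    equivalent_cats (algebras (gset_cat n) Q) (ncat P n)"
proof
  fix n
  obtain enl :: "'u list \<Rightarrow> 'u" where enl: "inj enl" using inj_list_code[OF assms(1)] by blast
  define nc where "nc k = enl (replicate k undefined)" for k
  \<comment> \<open>A symbol becomes a list of four entries, its three numbers being coded as
    numerals inside \<open>'u\<close>.\<close>
  define es where "es = (\<lambda>(j, k, d, p). enl [nc j, nc k, nc d, p])"
  have "inj nc" unfolding nc_def by (rule injI) (metis enl injD length_replicate)
  then have es: "inj es" unfolding es_def by (auto intro!: injI dest: injD[OF enl] simp: inj_eq)
  \<comment> \<open>The codes do not depend on \<open>n\<close>; the functor, the domains, the
    result dimensions and the operations are rebuilt at each step of the induction.\<close>
  have "\<exists>U Dm rd ev. coded_opcat n (ncat P n) U Dm rd ev enl es"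
  proof (induction n)
    case 0
    show ?case using coded_opcat_copy[OF coded_opcat_set_cat[OF enl es], of SetObj SetArr] by (auto simp: inj_def)
  next
    case (Suc n)
    then obtain U Dm rd ev where c: "coded_opcat n (ncat P n) U Dm rd ev enl es" by blast
    interpret enriched n "ncat P n" U Dm rd ev enl es "P n"
      using c assms(2) by (auto simp: enriched_def enriched_axioms_def iterative_operadic_theory_def)
    show ?case using coded_opcat_copy[OF coded_opcat_vp_cat, of CatObj CatArr] by (auto simp: inj_def)
  qed
  then obtain U Dm rd ev where "coded_opcat n (ncat P n) U Dm rd ev enl es" by blast
  then show "\<exists>Q. monad (gset_cat n :: ('u gset, 'u gmap) cat) Q \<and> equivalent_cats (algebras (gset_cat n) Q) (ncat P n)"
    by (rule coded_opcat.monadic_gset)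
qed

end
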